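(* Let $N,k\ge1$ be integers, write $z=(x,y)\in\mathbb{R}^{N}\times\mathbb{R}^k$, and let $\Delta_{\mathcal{G}}=\Delta_x+|x|^2\Delta_y$. Let $0<\gamma<1$, $p_1,p_2>1$, and let $u_0\in L^1(\mathbb{R}^{N+k})$ satisfy $\int_{\mathbb{R}^{N+k}}u_0(z)\,dz>0$. If $$p_1\le 1+\frac{2(2-\gamma)}{N+2k-2+2\gamma}\quad\text{or}\quad p_2\le 1+\frac{2}{N+2k}\quad\text{or}\quad p_1<\frac1\gamma,$$ then the problem $$u_t-\Delta_{\mathcal{G}}u=\int_0^t(t-s)^{-\gamma}|u(s)|^{p_1-1}u(s)\,ds+|u(t)|^{p_2-1}u(t)\ \text{ in }\mathbb{R}^{N+k}\times(0,\infty),\qquad u(z,0)=u_0(z),$$ admits no global nonnegative weak solution.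
   Context: For $T>0$, a function $u$ is a weak solution on $[0,T]$ if $u$, $\int_0^t(t-s)^{-\gamma}|u|^{p_1-1}u(s)\,ds$, $|u|^{p_2-1}u\in L^1_{\mathrm{loc}}(\mathbb{R}^{N+k}\times(0,T))$ and for every compactly supported $\varphi\in C^{2,1}(\mathbb{R}^{N+k}\times[0,T])$ with $\varphi(\cdot,T)=0$, $$-\int_{\mathbb{R}^{N+k}}u_0\varphi(z,0)\,dz=\int_0^T\!\!\int_{\mathbb{R}^{N+k}}\Big(\int_0^t(t-s)^{-\gamma}|u|^{p_1-1}u(z,s)\,ds\Big)\varphi\,dz\,dt+\int_0^T\!\!\int_{\mathbb{R}^{N+k}}|u|^{p_2-1}u\,\varphi\,dz\,dt+\int_0^T\!\!\int_{\mathbb{R}^{N+k}}u\,\Delta_{\mathcal{G}}\varphi\,dz\,dt+\int_0^T\!\!\int_{\mathbb{R}^{N+k}}u\,\varphi_t\,dz\,dt.$$ A global weak solution is a weak solution on $[0,T]$ for every $T>0$. *)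

theory Defs
  imports "HOL-Analysis.Analysis"
begin

text \<open>Space variable z = (x,y) with x in 'x (dimension N = DIM('x)) and y in 'y
 (dimension k = DIM('y)); functions of (z,t) are written curried: u z t.\<close>

definition dz :: "'z::real_normed_vector \<Rightarrow> ('z \<Rightarrow> real \<Rightarrow> real) \<Rightarrow> 'z \<Rightarrow> real \<Rightarrow> real" where
  "dz v \<phi> z t = deriv (\<lambda>h. \<phi> (z + h *\<^sub>R v) t) 0"

definition grushin :: "(('x::euclidean_space \<times> 'y::euclidean_space) \<Rightarrow> real \<Rightarrow> real)
    \<Rightarrow> ('x \<times> 'y) \<Rightarrow> real \<Rightarrow> real" where
  "grushin \<phi> z t =
     (\<Sum>b\<in>(Basis::'x set). dz (b, 0::'y) (dz (b, 0::'y) \<phi>) z t)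
     + (norm (fst z))\<^sup>2 * (\<Sum>c\<in>(Basis::'y set). dz (0::'x, c) (dz (0::'x, c) \<phi>) z t)"

definition C21 :: "real \<Rightarrow> ('z::euclidean_space \<Rightarrow> real \<Rightarrow> real) \<Rightarrow> bool" where
  "C21 T \<phi> \<longleftrightarrow>
     continuous_on (UNIV \<times> {0..T}) (\<lambda>w. \<phi> (fst w) (snd w)) \<and>
     (\<exists>\<psi>. continuous_on (UNIV \<times> {0..T}) (\<lambda>w. \<psi> (fst w) (snd w)) \<and>
          (\<forall>z. \<forall>t\<in>{0..T}. ((\<lambda>s. \<phi> z s) has_real_derivative \<psi> z t) (at t within {0..T}))) \<and>
     (\<forall>b\<in>Basis.
        continuous_on (UNIV \<times> {0..T}) (\<lambda>w. dz b \<phi> (fst w) (snd w)) \<and>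
        (\<forall>z. \<forall>t\<in>{0..T}. ((\<lambda>h. \<phi> (z + h *\<^sub>R b) t) has_real_derivative dz b \<phi> z t) (at 0))) \<and>
     (\<forall>b\<in>Basis. \<forall>c\<in>Basis.
        continuous_on (UNIV \<times> {0..T}) (\<lambda>w. dz c (dz b \<phi>) (fst w) (snd w)) \<and>
        (\<forall>z. \<forall>t\<in>{0..T}. ((\<lambda>h. dz b \<phi> (z + h *\<^sub>R c) t) has_real_derivative dz c (dz b \<phi>) z t) (at 0)))"

definition compact_supp :: "real \<Rightarrow> ('z::euclidean_space \<Rightarrow> real \<Rightarrow> real) \<Rightarrow> bool" where
  "compact_supp T \<phi> \<longleftrightarrow> compact (closure {w. snd w \<in> {0..T} \<and> \<phi> (fst w) (snd w) \<noteq> 0})"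

definition locL1 :: "real \<Rightarrow> ('z::euclidean_space \<Rightarrow> real \<Rightarrow> real) \<Rightarrow> bool" where
  "locL1 T f \<longleftrightarrow> (\<forall>K. compact K \<and> K \<subseteq> UNIV \<times> {0<..<T} \<longrightarrow>
                       set_integrable lborel K (\<lambda>w. f (fst w) (snd w)))"

definition memterm :: "real \<Rightarrow> real \<Rightarrow> ('z::euclidean_space \<Rightarrow> real \<Rightarrow> real) \<Rightarrow> 'z \<Rightarrow> real \<Rightarrow> real" where
  "memterm \<gamma> p u z t =
     set_lebesgue_integral lborel {0<..<t} (\<lambda>s. (t - s) powr (-\<gamma>) * (\<bar>u z s\<bar> powr (p - 1) * u z s))"

definition weak_solution ::
  "real \<Rightarrow> real \<Rightarrow> real \<Rightarrow> (('x::euclidean_space \<times> 'y::euclidean_space) \<Rightarrow> real) \<Rightarrow> real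
     \<Rightarrow> (('x \<times> 'y) \<Rightarrow> real \<Rightarrow> real) \<Rightarrow> bool" where
  "weak_solution \<gamma> p1 p2 u0 T u \<longleftrightarrow>
     locL1 T u \<and> locL1 T (memterm \<gamma> p1 u) \<and> locL1 T (\<lambda>z t. \<bar>u z t\<bar> powr (p2 - 1) * u z t) \<and>
     (\<forall>\<phi>. C21 T \<phi> \<and> compact_supp T \<phi> \<and> (\<forall>z. \<phi> z T = 0) \<longrightarrow>
        - (LINT z|lborel. u0 z * \<phi> z 0) =
          set_lebesgue_integral lborel (UNIV \<times> {0<..<T})
             (\<lambda>w. memterm \<gamma> p1 u (fst w) (snd w) * \<phi> (fst w) (snd w))
        + set_lebesgue_integral lborel (UNIV \<times> {0<..<T})
             (\<lambda>w. \<bar>u (fst w) (snd w)\<bar> powr (p2 - 1) * u (fst w) (snd w) * \<phi> (fst w) (snd w))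
        + set_lebesgue_integral lborel (UNIV \<times> {0<..<T})
             (\<lambda>w. u (fst w) (snd w) * grushin \<phi> (fst w) (snd w))
        + set_lebesgue_integral lborel (UNIV \<times> {0<..<T})
             (\<lambda>w. u (fst w) (snd w) * deriv (\<lambda>s. \<phi> (fst w) s) (snd w)))"

definition global_weak_solution ::
  "real \<Rightarrow> real \<Rightarrow> real \<Rightarrow> (('x::euclidean_space \<times> 'y::euclidean_space) \<Rightarrow> real)
     \<Rightarrow> (('x \<times> 'y) \<Rightarrow> real \<Rightarrow> real) \<Rightarrow> bool" where
  "global_weak_solution \<gamma> p1 p2 u0 u \<longleftrightarrow> (\<forall>T>0. weak_solution \<gamma> p1 p2 u0 T u)"

end

(* Test the weak formulation with (1 - t/T)^q times a cutoff of |x|^2/T^e and |y|^2/T^(2e). Writing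
   X for the weighted integral of u^p, Hoelder's inequality bounds X by a power of T times X^(1/p);
   under the hypotheses on the exponents X stays bounded and then tends to 0 as T grows, so u = 0
   almost everywhere, which contradicts the positive integral of u0. For the memory term, integration
   of the time factor against (t - s)^(-gamma) contributes the extra power T^(1 - gamma); the case
   p1 < 1/gamma is obtained with e small.

   Integrals of nonintegrable functions are 0, so two regularity facts have to come first. The solution
   and both nonlinear terms are integrable up to t = 0 on bounded sets, by test functions constant in
   time near t = 0. The integral of u^p1 over (0,T) is finite for almost every z: away from x = 0 a
   Gaussian with frozen coefficients is a supersolution of the adjoint equation up to a bounded error,
   so u is bounded by a potential |z|^(-b) t^(-a) of integrable data with a p1 < 1, and Jensen's
   inequality applies. *)
theory Submission
  imports Defs
begin

section \<open>Products of radial profiles as test functions\<close>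

text \<open>Balance of powers of \<open>T\<close>: the support of the test function has measure of
  order \<open>T powr (1 + e * (N/2 + k))\<close>, the adjoint operator costs
  \<open>T powr (- e)\<close> and the memory term gains \<open>T powr (1 - \<gamma>)\<close>. A
  bounded weighted integral thus asks for
  \<open>1 + e * (N/2 + k) \<le> (\<alpha> + e) * p / (p - 1)\<close>, with
  \<open>\<alpha> = 0\<close> for \<open>p2\<close> and \<open>\<alpha> = 1 - \<gamma>\<close> for
  \<open>p1\<close>. At \<open>e = 1\<close> these are the two Fujita-type bounds, equality
  included; as \<open>e\<close> tends to 0 the version for \<open>p1\<close> becomes
  \<open>1 \<le> (1 - \<gamma>) * p1 / (p1 - 1)\<close>, which is strict exactly when
  \<open>p1 < 1 / \<gamma>\<close>. The obstacle is the default value inside \<open>memterm\<close>: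
  if the time integral diverged, the memory term would silently vanish and its lower bound by the
  power \<open>p1\<close> would be lost. The weak formulation controls the values of
  \<open>memterm\<close>, not its integrand, so finiteness must come from an upper bound on
  \<open>u\<close> that uses nothing but integrability of the data and of the nonlinear terms. Since
  almost every \<open>z\<close> is enough, the set \<open>x = 0\<close>, where the operator
  degenerates, can be avoided.\<close>

definition profile :: "real \<Rightarrow> (real \<Rightarrow> real \<Rightarrow> real) \<Rightarrow> (real \<Rightarrow> real \<Rightarrow> real) \<Rightarrow>
    (real \<Rightarrow> real \<Rightarrow> real) \<Rightarrow> (real \<Rightarrow> real \<Rightarrow> real) \<Rightarrow> bool" where
  "profile T f f1 f2 f' \<longleftrightarrow>
     continuous_on (UNIV \<times> {0..T}) (\<lambda>w. f (fst w) (snd w)) \<and>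
     continuous_on (UNIV \<times> {0..T}) (\<lambda>w. f1 (fst w) (snd w)) \<and>
     continuous_on (UNIV \<times> {0..T}) (\<lambda>w. f2 (fst w) (snd w)) \<and>
     continuous_on (UNIV \<times> {0..T}) (\<lambda>w. f' (fst w) (snd w)) \<and>
     (\<forall>r t. ((\<lambda>r. f r t) has_real_derivative f1 r t) (at r)) \<and>
     (\<forall>r t. ((\<lambda>r. f1 r t) has_real_derivative f2 r t) (at r)) \<and>
     (\<forall>r. \<forall>t\<in>{0..T}. ((\<lambda>t. f r t) has_real_derivative f' r t) (at t within {0..T}))"

lemma profile_mult:
  assumes "profile T f f1 f2 f'" "profile T g g1 g2 g'"
  shows "profile T (\<lambda>r t. f r t * g r t) (\<lambda>r t. f1 r t * g r t + f r t * g1 r t)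
    (\<lambda>r t. f2 r t * g r t + 2 * f1 r t * g1 r t + f r t * g2 r t)
    (\<lambda>r t. f' r t * g r t + f r t * g' r t)"
  using assms unfolding profile_def
  by (auto intro!: continuous_intros derivative_eq_intros)

lemma profile_time:
  assumes "continuous_on {0..T} \<eta>'"
    and "\<And>t. t \<in> {0..T} \<Longrightarrow> (\<eta> has_real_derivative \<eta>' t) (at t within {0..T})"
  shows "profile T (\<lambda>r t. \<eta> t) (\<lambda>r t. 0) (\<lambda>r t. 0) (\<lambda>r t. \<eta>' t)"
proof -
  have "continuous_on {0..T} \<eta>"
    using DERIV_continuous[OF assms(2)] by (auto simp: continuous_on_eq_continuous_within)
  then have "continuous_on (UNIV \<times> {0..T}) (\<lambda>w::real \<times> real. \<eta> (snd w))"
    "continuous_on (UNIV \<times> {0..T}) (\<lambda>w::real \<times> real. \<eta>' (snd w))"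
    using assms(1) by (auto intro: continuous_on_compose2[OF _ continuous_on_snd[OF continuous_on_id]])
  then show ?thesis using assms(2) unfolding profile_def by auto
qed

lemma profile_space:
  assumes "\<And>r. (h has_real_derivative h1 r) (at r)" "\<And>r. (h1 has_real_derivative h2 r) (at r)"
    and "continuous_on UNIV h2"
  shows "profile T (\<lambda>r t. h r) (\<lambda>r t. h1 r) (\<lambda>r t. h2 r) (\<lambda>r t. 0)"
proof -
  have "continuous_on UNIV h" "continuous_on UNIV h1"
    using assms(1,2) by (auto simp: continuous_on_eq_continuous_within intro: DERIV_continuous)
  then have "continuous_on (UNIV \<times> {0..T}) (\<lambda>w::real \<times> real. h (fst w))"
    "continuous_on (UNIV \<times> {0..T}) (\<lambda>w::real \<times> real. h1 (fst w))"
    "continuous_on (UNIV \<times> {0..T}) (\<lambda>w::real \<times> real. h2 (fst w))"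
    using assms(3) by (auto intro: continuous_on_compose2[OF _ continuous_on_fst[OF continuous_on_id]])
  then show ?thesis using assms(1,2) unfolding profile_def by auto
qed

lemma deriv_radial:
  fixes x a v :: "'a::real_inner"
  assumes "\<And>r. (F has_real_derivative F1 r) (at r)"
  shows "((\<lambda>h. F ((norm (x + h *\<^sub>R v - a))\<^sup>2)) has_real_derivative
     F1 ((norm (x - a))\<^sup>2) * (2 * ((x - a) \<bullet> v))) (at 0)"
proof -
  have *: "((\<lambda>h. (x + h *\<^sub>R v - a) \<bullet> (x + h *\<^sub>R v - a)) has_real_derivative 2 * ((x - a) \<bullet> v)) (at 0)"
  proof -
    have "(\<lambda>h. (x + h *\<^sub>R v - a) \<bullet> (x + h *\<^sub>R v - a)) =
      (\<lambda>h. (x - a) \<bullet> (x - a) + h * (2 * ((x - a) \<bullet> v)) + h * h * (v \<bullet> v))"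
      by (auto simp: algebra_simps inner_commute)
    then show ?thesis by (auto intro!: derivative_eq_intros)
  qed
  have "((\<lambda>h. F ((x + h *\<^sub>R v - a) \<bullet> (x + h *\<^sub>R v - a))) has_real_derivative
     F1 ((x + 0 *\<^sub>R v - a) \<bullet> (x + 0 *\<^sub>R v - a)) * (2 * ((x - a) \<bullet> v))) (at 0)"
    by (rule DERIV_chain2[OF assms *])
  then show ?thesis by (simp add: power2_norm_eq_inner)
qed

text \<open>Profiles are functions of squared distances, so nothing singular happens at the pole
  \<open>(a, c)\<close>. The two blocks of variables are kept apart because the operator weighs and
  scales them differently.\<close>

definition radial2 :: "'x::euclidean_space \<Rightarrow> 'y::euclidean_space \<Rightarrow> (real \<Rightarrow> real \<Rightarrow> real) \<Rightarrow>
   (real \<Rightarrow> real \<Rightarrow> real) \<Rightarrow> 'x \<times> 'y \<Rightarrow> real \<Rightarrow> real" where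
  "radial2 a c f g z t = f ((norm (fst z - a))\<^sup>2) t * g ((norm (snd z - c))\<^sup>2) t"

definition drad where
  "drad a c f f1 g g1 v z t =
     2 * ((fst z - a) \<bullet> fst v) * radial2 a c f1 g z t + 2 * ((snd z - c) \<bullet> snd v) * radial2 a c f g1 z t"

lemma deriv_radial2:
  fixes z v :: "'x::euclidean_space \<times> 'y::euclidean_space"
  assumes "profile T f f1 f2 f'" "profile T g g1 g2 g'"
  shows "((\<lambda>h. radial2 a c f g (z + h *\<^sub>R v) t) has_real_derivative drad a c f f1 g g1 v z t) (at 0)"
    and "((\<lambda>h. radial2 a c f1 g (z + h *\<^sub>R v) t) has_real_derivative drad a c f1 f2 g g1 v z t) (at 0)"
    and "((\<lambda>h. radial2 a c f g1 (z + h *\<^sub>R v) t) has_real_derivative drad a c f f1 g1 g2 v z t) (at 0)"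
proof -
  have A: "((\<lambda>h. radial2 a c f g (z + h *\<^sub>R v) t) has_real_derivative drad a c f f1 g g1 v z t) (at 0)"
    if "\<And>r. ((\<lambda>r. f r t) has_real_derivative f1 r t) (at r)" "\<And>r. ((\<lambda>r. g r t) has_real_derivative g1 r t) (at r)"
    for f g f1 g1 :: "real \<Rightarrow> real \<Rightarrow> real"
    using DERIV_mult[OF deriv_radial[OF that(1), of "fst z" "fst v" a] deriv_radial[OF that(2), of "snd z" "snd v" c]]
    by (simp add: radial2_def drad_def algebra_simps)
  show "((\<lambda>h. radial2 a c f g (z + h *\<^sub>R v) t) has_real_derivative drad a c f f1 g g1 v z t) (at 0)"
    "((\<lambda>h. radial2 a c f1 g (z + h *\<^sub>R v) t) has_real_derivative drad a c f1 f2 g g1 v z t) (at 0)"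
    "((\<lambda>h. radial2 a c f g1 (z + h *\<^sub>R v) t) has_real_derivative drad a c f f1 g1 g2 v z t) (at 0)"
    using assms unfolding profile_def by (auto intro!: A)
qed

definition ddrad where
  "ddrad a c f f1 f2 g g1 g2 v w z t =
     2 * (fst w \<bullet> fst v) * radial2 a c f1 g z t
   + 2 * ((fst z - a) \<bullet> fst v) * drad a c f1 f2 g g1 w z t
   + 2 * (snd w \<bullet> snd v) * radial2 a c f g1 z t
   + 2 * ((snd z - c) \<bullet> snd v) * drad a c f f1 g1 g2 w z t"

lemma deriv_drad:
  fixes z v :: "'x::euclidean_space \<times> 'y::euclidean_space"
  assumes "profile T f f1 f2 f'" "profile T g g1 g2 g'"
  shows "((\<lambda>h. drad a c f f1 g g1 v (z + h *\<^sub>R w) t) has_real_derivative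
      ddrad a c f f1 f2 g g1 g2 v w z t) (at 0)"
  unfolding drad_def[of a c f f1 g g1]
  by (auto intro!: derivative_eq_intros deriv_radial2[OF assms] simp: ddrad_def algebra_simps inner_add_left)

lemma continuous_on_radial2:
  fixes a :: "'x::euclidean_space" and c :: "'y::euclidean_space"
  assumes "continuous_on (UNIV \<times> {0..T}) (\<lambda>w. f (fst w) (snd w))"
    "continuous_on (UNIV \<times> {0..T}) (\<lambda>w. g (fst w) (snd w))"
  shows "continuous_on (UNIV \<times> {0..T}) (\<lambda>w. radial2 a c f g (fst w) (snd w))"
proof -
  have "continuous_on (UNIV \<times> {0..T}) (\<lambda>w::('x\<times>'y)\<times>real. ((norm (fst (fst w) - a))\<^sup>2, snd w))"
    "continuous_on (UNIV \<times> {0..T}) (\<lambda>w::('x\<times>'y)\<times>real. ((norm (snd (fst w) - c))\<^sup>2, snd w))"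
    by (intro continuous_intros)+
  from continuous_on_compose2[OF assms(1) this(1)] continuous_on_compose2[OF assms(2) this(2)]
  have 1: "continuous_on (UNIV \<times> {0..T}) (\<lambda>w::('x\<times>'y)\<times>real. f ((norm (fst (fst w) - a))\<^sup>2) (snd w))"
    and 2: "continuous_on (UNIV \<times> {0..T}) (\<lambda>w::('x\<times>'y)\<times>real. g ((norm (snd (fst w) - c))\<^sup>2) (snd w))"
    by (auto simp: image_subset_iff)
  show ?thesis unfolding radial2_def by (intro continuous_intros 1 2)
qed

text \<open>These are equalities of functions, at every real \<open>t\<close>, so that
  \<open>dz\<close> can be iterated inside \<open>C21\<close> and \<open>grushin\<close>. For this
  reason \<open>profile\<close> asks for the derivatives in \<open>r\<close> at all
  \<open>t\<close>, but for the time derivative only within \<open>{0..T}\<close>.\<close>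

lemma dz_radial2:
  fixes a :: "'x::euclidean_space" and c :: "'y::euclidean_space"
  assumes "profile T f f1 f2 f'" "profile T g g1 g2 g'"
  shows "dz v (radial2 a c f g) = drad a c f f1 g g1 v"
    and "dz w (drad a c f f1 g g1 v) = ddrad a c f f1 f2 g g1 g2 v w"
  unfolding dz_def
  by (intro ext DERIV_imp_deriv deriv_radial2(1)[OF assms] deriv_drad[OF assms])+

lemma deriv_time_within_radial2:
  assumes f: "profile T f f1 f2 f'" and g: "profile T g g1 g2 g'" and t: "t \<in> {0..T}"
  shows "((\<lambda>s. radial2 a c f g z s) has_real_derivative (radial2 a c f' g z t + radial2 a c f g' z t)) (at t within {0..T})"
proof -
  have "(f r has_real_derivative f' r t) (at t within {0..T})" "(g r has_real_derivative g' r t) (at t within {0..T})" for r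
    using t f g unfolding profile_def by auto
  from DERIV_mult[OF this] show ?thesis by (simp add: radial2_def mult.commute add.commute)
qed

lemma C21_radial2:
  fixes a :: "'x::euclidean_space" and c :: "'y::euclidean_space"
  assumes f: "profile T f f1 f2 f'" and g: "profile T g g1 g2 g'"
  shows "C21 T (radial2 a c f g)"
proof -
  have D: "((\<lambda>s. radial2 a c f g z s) has_real_derivative (radial2 a c f' g z t + radial2 a c f g' z t)) (at t within {0..T})"
    if "t \<in> {0..T}" for z t
    using deriv_time_within_radial2[OF f g that] .
  have C: "continuous_on (UNIV \<times> {0..T}) (\<lambda>w. radial2 a c F G (fst w) (snd w))"
    if "F \<in> {f,f1,f2,f'}" "G \<in> {g,g1,g2,g'}" for F G
    using that f g unfolding profile_def by (auto intro!: continuous_on_radial2)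
  have Cd: "continuous_on (UNIV \<times> {0..T}) (\<lambda>w. drad a c F F1 G G1 v (fst w) (snd w))"
    if "F \<in> {f,f1,f2,f'}" "G \<in> {g,g1,g2,g'}" "F1 \<in> {f,f1,f2,f'}" "G1 \<in> {g,g1,g2,g'}" for F G F1 G1 v
    unfolding drad_def using that by (intro continuous_intros C) auto
  have Cdd: "continuous_on (UNIV \<times> {0..T}) (\<lambda>w. ddrad a c f f1 f2 g g1 g2 v u (fst w) (snd w))" for v u
    unfolding ddrad_def by (intro continuous_intros C Cd) auto
  show ?thesis unfolding C21_def dz_radial2[OF f g]
    using C[of f g] Cd[of f g f1 g1] Cdd deriv_radial2(1)[OF f g] deriv_drad[OF f g] D
    by (intro conjI ballI allI exI[of _ "\<lambda>z t. radial2 a c f' g z t + radial2 a c f g' z t"] continuous_on_add C) auto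
qed

lemma sum_Basis_sq: "(\<Sum>b\<in>Basis. (x \<bullet> b) * (x \<bullet> b)) = (norm x)\<^sup>2" for x :: "'a::euclidean_space"
  by (metis (no_types) euclidean_inner power2_norm_eq_inner)

text \<open>On a function \<open>F\<close> of \<open>r = |x - a|^2\<close> the Laplacian in
  \<open>n\<close> variables acts as \<open>4 r F'' + 2 n F'\<close>. The weight, the square of
  \<open>norm (fst z)\<close>, is not centred at \<open>a\<close>; this mismatch is what the
  Gaussian kernel has to cope with later.\<close>

lemma grushin_radial2:
  fixes a :: "'x::euclidean_space" and c :: "'y::euclidean_space"
  assumes f: "profile T f f1 f2 f'" and g: "profile T g g1 g2 g'"
  defines "P \<equiv> \<lambda>z. (norm (fst z - a))\<^sup>2" and "Q \<equiv> \<lambda>z. (norm (snd z - c))\<^sup>2"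
  shows "grushin (radial2 a c f g) z t =
    (4 * P z * f2 (P z) t + 2 * real DIM('x) * f1 (P z) t) * g (Q z) t
    + (norm (fst z))\<^sup>2 * (f (P z) t * (4 * Q z * g2 (Q z) t + 2 * real DIM('y) * g1 (Q z) t))"
proof -
  have 1: "(\<Sum>b\<in>(Basis::'x set). ddrad a c f f1 f2 g g1 g2 (b,0) (b,0) z t) =
    (4 * P z * f2 (P z) t + 2 * real DIM('x) * f1 (P z) t) * g (Q z) t"
  proof -
    have "(\<Sum>b\<in>(Basis::'x set). ddrad a c f f1 f2 g g1 g2 (b,0) (b,0) z t) =
      (\<Sum>b\<in>(Basis::'x set). 4 * f2 (P z) t * g (Q z) t * (((fst z - a) \<bullet> b) * ((fst z - a) \<bullet> b)) + 2 * f1 (P z) t * g (Q z) t)"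
      by (intro sum.cong) (auto simp: ddrad_def drad_def radial2_def P_def Q_def)
    also have "\<dots> = 4 * f2 (P z) t * g (Q z) t * P z + real DIM('x) * (2 * f1 (P z) t * g (Q z) t)"
      by (simp add: sum.distrib sum_distrib_left[symmetric] sum_Basis_sq P_def)
    finally show ?thesis by (simp add: algebra_simps)
  qed
  have 2: "(\<Sum>b\<in>(Basis::'y set). ddrad a c f f1 f2 g g1 g2 (0,b) (0,b) z t) =
    f (P z) t * (4 * Q z * g2 (Q z) t + 2 * real DIM('y) * g1 (Q z) t)"
  proof -
    have "(\<Sum>b\<in>(Basis::'y set). ddrad a c f f1 f2 g g1 g2 (0,b) (0,b) z t) =
      (\<Sum>b\<in>(Basis::'y set). 4 * f (P z) t * g2 (Q z) t * (((snd z - c) \<bullet> b) * ((snd z - c) \<bullet> b)) + 2 * f (P z) t * g1 (Q z) t)"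
      by (intro sum.cong) (auto simp: ddrad_def drad_def radial2_def P_def Q_def)
    also have "\<dots> = 4 * f (P z) t * g2 (Q z) t * Q z + real DIM('y) * (2 * f (P z) t * g1 (Q z) t)"
      by (simp add: sum.distrib sum_distrib_left[symmetric] sum_Basis_sq Q_def)
    finally show ?thesis by (simp add: algebra_simps)
  qed
  show ?thesis unfolding grushin_def dz_radial2[OF f g] 1 2 ..
qed

lemma deriv_time_radial2:
  assumes f: "profile T f f1 f2 f'" and g: "profile T g g1 g2 g'" and t: "0 < t" "t < T"
  shows "deriv (radial2 a c f g z) t = radial2 a c f' g z t + radial2 a c f g' z t"
proof -
  have "((\<lambda>s. radial2 a c f g z s) has_real_derivative (radial2 a c f' g z t + radial2 a c f g' z t)) (at t within {0..T})"
    by (rule deriv_time_within_radial2[OF f g]) (use t in auto)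
  then have "((\<lambda>s. radial2 a c f g z s) has_real_derivative (radial2 a c f' g z t + radial2 a c f g' z t)) (at t)"
    using t by (simp add: at_within_Icc_at)
  then show ?thesis by (rule DERIV_imp_deriv)
qed

lemma compact_supp_radial2:
  fixes a :: "'x::euclidean_space" and c :: "'y::euclidean_space"
  assumes "\<And>r t. r > \<rho> \<Longrightarrow> f r t = 0" "\<And>r t. r > \<rho> \<Longrightarrow> g r t = 0"
  shows "compact_supp T (radial2 a c f g)"
proof -
  have "{w. snd w \<in> {0..T} \<and> radial2 a c f g (fst w) (snd w) \<noteq> 0} \<subseteq>
     (cball a (sqrt \<rho>) \<times> cball c (sqrt \<rho>)) \<times> {0..T}"
  proof
    fix w assume w: "w \<in> {w. snd w \<in> {0..T} \<and> radial2 a c f g (fst w) (snd w) \<noteq> 0}"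
    then have "(norm (fst (fst w) - a))\<^sup>2 \<le> \<rho>" "(norm (snd (fst w) - c))\<^sup>2 \<le> \<rho>"
      using assms unfolding radial2_def by (force simp: not_less[symmetric])+
    then have "norm (fst (fst w) - a) \<le> sqrt \<rho>" "norm (snd (fst w) - c) \<le> sqrt \<rho>"
      by (auto intro: real_le_rsqrt)
    then show "w \<in> (cball a (sqrt \<rho>) \<times> cball c (sqrt \<rho>)) \<times> {0..T}"
      using w by (auto simp: mem_Times_iff dist_norm norm_minus_commute)
  qed
  then have "bounded {w. snd w \<in> {0..T} \<and> radial2 a c f g (fst w) (snd w) \<noteq> 0}"
    by (rule bounded_subset[rotated]) (intro bounded_Times bounded_cball bounded_closed_interval)
  then show ?thesis unfolding compact_supp_def by (simp add: compact_closure)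
qed

section \<open>Polynomial cutoffs whose derivatives are controlled by powers of their base\<close>

definition pos :: "real \<Rightarrow> real" where "pos r = max 0 r"

text \<open>With exponent at least 2 the difference quotient at the kink is at most
  \<open>\<bar>h\<bar> ^ (n - 1)\<close> and tends to 0. Powers of positive parts therefore yield
  twice differentiable cutoffs with fully explicit derivatives.\<close>

lemma pos_pow_deriv [derivative_intros]:
  assumes "n \<ge> 2" "(g has_real_derivative g') (at r within S)"
  shows "((\<lambda>r. pos (g r) ^ n) has_real_derivative real n * pos (g r) ^ (n - 1) * g') (at r within S)"
proof -
  have "((\<lambda>r. pos r ^ n) has_real_derivative real n * pos r ^ (n - 1)) (at r)" for r
  proof -
    consider "r > 0" | "r < 0" | "r = 0" by linarith
    then show ?thesis
    proof cases
      case 1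
      have "((\<lambda>r. r ^ n) has_real_derivative real n * pos r ^ (n - 1)) (at r)"
        using 1 by (auto intro!: derivative_eq_intros simp: pos_def)
      then show ?thesis
        by (rule has_field_derivative_transform_within_open[of _ _ _ "{0<..}"]) (use 1 in \<open>auto simp: pos_def\<close>)
    next
      case 2
      have "((\<lambda>r. 0) has_real_derivative real n * pos r ^ (n - 1)) (at r)"
        using 2 assms by (auto intro!: derivative_eq_intros simp: pos_def)
      then show ?thesis
        by (rule has_field_derivative_transform_within_open[of _ _ _ "{..<0}"]) (use 2 assms in \<open>auto simp: pos_def\<close>)
    next
      case 3
      have "((\<lambda>h. pos h ^ n / h) \<longlongrightarrow> 0) (at 0)"
      proof (rule Lim_null_comparison)
        show "\<forall>\<^sub>F h in at 0. norm (pos h ^ n / h) \<le> \<bar>h\<bar> ^ (n - 1)"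
        proof (rule always_eventually, rule allI)
          fix h :: real
          obtain k where k: "n = Suc k" using assms by (cases n) auto
          show "norm (pos h ^ n / h) \<le> \<bar>h\<bar> ^ (n - 1)"
            by (cases "h \<le> 0") (auto simp: k pos_def max_def)
        qed
        have "((\<lambda>h::real. \<bar>h\<bar> ^ (n - 1)) \<longlongrightarrow> \<bar>0\<bar> ^ (n - 1)) (at 0)" by (intro tendsto_intros)
        moreover have "\<bar>0::real\<bar> ^ (n - 1) = 0" using assms by (auto simp: power_0_left)
        ultimately show "((\<lambda>h::real. \<bar>h\<bar> ^ (n - 1)) \<longlongrightarrow> 0) (at 0)" by metis
      qed
      moreover obtain m where "n = Suc (Suc m)" using assms(1) by (metis Suc_le_D numeral_2_eq_2 Suc_le_mono)
      ultimately show ?thesis using 3 by (auto simp: has_field_derivative_iff pos_def)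
    qed
  qed
  from DERIV_chain2[OF this assms(2)] show ?thesis by simp
qed

lemma continuous_on_pos [continuous_intros]:
  "continuous_on A f \<Longrightarrow> continuous_on A (\<lambda>x. pos (f x))"
  unfolding pos_def by (intro continuous_intros)

text \<open>Equal to 1 up to \<open>r = 1\<close> and to 0 from \<open>r = 2\<close> on. The cube
  makes the inner positive part twice continuously differentiable; a power \<open>l \<ge> 3\<close>
  does the same for the outer one. The base stays visible because a cutoff differentiated twice
  still carries \<open>cbase ^ (l - 2)\<close>, which for large \<open>l\<close> is at most the
  \<open>1/p\<close>-th power of the cutoff.\<close>

definition cbase :: "real \<Rightarrow> real" where "cbase r = pos (1 - pos (r - 1) ^ 3)"
definition cut0 :: "nat \<Rightarrow> real \<Rightarrow> real" where "cut0 l r = cbase r ^ l"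
definition cut1 :: "nat \<Rightarrow> real \<Rightarrow> real" where
  "cut1 l r = - 3 * real l * cbase r ^ (l - 1) * pos (r - 1) ^ 2"
definition cut2 :: "nat \<Rightarrow> real \<Rightarrow> real" where
  "cut2 l r = 9 * real l * real (l - 1) * cbase r ^ (l - 2) * pos (r - 1) ^ 4
     - 6 * real l * cbase r ^ (l - 1) * pos (r - 1)"

lemma cut_deriv:
  assumes "l \<ge> 3"
  shows "(cut0 l has_real_derivative cut1 l r) (at r)" "(cut1 l has_real_derivative cut2 l r) (at r)"
    "continuous_on A (cut0 l)" "continuous_on A (cut1 l)" "continuous_on A (cut2 l)"
proof -
  have d: "((\<lambda>r. cbase r ^ n) has_real_derivative real n * cbase r ^ (n - 1) * (- 3 * pos (r - 1) ^ 2)) (at r)"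
    if "n \<ge> 2" for n
    using pos_pow_deriv[OF that DERIV_diff[OF DERIV_const pos_pow_deriv[OF _ DERIV_diff[OF DERIV_ident DERIV_const]]], of 3 1 1 r UNIV]
    by (simp add: cbase_def)
  show "(cut0 l has_real_derivative cut1 l r) (at r)"
    unfolding cut0_def[abs_def] cut1_def
    using d[of l] assms by (simp add: algebra_simps)
  have "l - 1 - 1 = l - 2" by simp
  moreover have "((\<lambda>r. - 3 * real l * (cbase r ^ (l - 1) * pos (r - 1) ^ 2)) has_real_derivative
      - 3 * real l * (real (l - 1) * cbase r ^ (l - 1 - 1) * (- 3 * pos (r - 1) ^ 2) * pos (r - 1) ^ 2
        + 2 * pos (r - 1) ^ (2 - 1) * (1 - 0) * cbase r ^ (l - 1))) (at r)"
    using DERIV_cmult[OF DERIV_mult[OF d[of "l - 1"] pos_pow_deriv[OF _ DERIV_diff[OF DERIV_ident DERIV_const], of 2]], of "- 3 * real l"] assms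
    by simp
  ultimately show "(cut1 l has_real_derivative cut2 l r) (at r)"
    unfolding cut1_def[abs_def] cut2_def
    by (simp add: algebra_simps power2_eq_square power4_eq_xxxx)
qed (auto simp: cut0_def[abs_def] cut1_def[abs_def] cut2_def[abs_def] cbase_def intro!: continuous_intros)

lemma cbase_bounds: "0 \<le> cbase r" "cbase r \<le> 1" "r \<le> 1 \<Longrightarrow> cbase r = 1" "r \<ge> 2 \<Longrightarrow> cbase r = 0"
proof -
  show "0 \<le> cbase r" "cbase r \<le> 1" "r \<le> 1 \<Longrightarrow> cbase r = 1" by (auto simp: cbase_def pos_def)
  assume "r \<ge> 2"
  then have "1 ^ 3 \<le> pos (r - 1) ^ 3" by (intro power_mono) (auto simp: pos_def)
  then show "cbase r = 0" by (auto simp: cbase_def pos_def)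
qed

text \<open>The constant is \<open>9 + 6\<close>: the two terms of \<open>cut2\<close> are at most
  \<open>9 * l^2\<close> and \<open>6 * l^2\<close> times \<open>cbase r ^ (l - 2)\<close>, since
  \<open>pos (r - 1) \<le> 1\<close> wherever the base does not vanish.\<close>

lemma cut_bounds:
  assumes "l \<ge> 3"
  shows "0 \<le> cut0 l r" "cut0 l r \<le> 1" "r \<le> 1 \<Longrightarrow> cut0 l r = 1" "r \<ge> 2 \<Longrightarrow> cut0 l r = 0"
    "\<bar>cut1 l r\<bar> \<le> 15 * real l ^ 2 * cbase r ^ (l - 2)" "\<bar>cut2 l r\<bar> \<le> 15 * real l ^ 2 * cbase r ^ (l - 2)"
    "r \<le> 1 \<Longrightarrow> cut1 l r = 0" "r \<le> 1 \<Longrightarrow> cut2 l r = 0" "r \<ge> 2 \<Longrightarrow> cut1 l r = 0" "r \<ge> 2 \<Longrightarrow> cut2 l r = 0"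
proof -
  have l: "l - 1 = Suc (l - 2)" "l \<noteq> 0" using assms by auto
  show "0 \<le> cut0 l r" "cut0 l r \<le> 1" "r \<le> 1 \<Longrightarrow> cut0 l r = 1" "r \<ge> 2 \<Longrightarrow> cut0 l r = 0"
    using cbase_bounds[of r] assms by (auto simp: cut0_def power_le_one)
  show "r \<le> 1 \<Longrightarrow> cut1 l r = 0" "r \<le> 1 \<Longrightarrow> cut2 l r = 0" by (auto simp: cut1_def cut2_def pos_def)
  show z: "r \<ge> 2 \<Longrightarrow> cut1 l r = 0" "r \<ge> 2 \<Longrightarrow> cut2 l r = 0"
    using cbase_bounds(4)[of r] assms by (auto simp: cut1_def cut2_def power_0_left)
  have b: "cbase r ^ (l - 1) \<le> cbase r ^ (l - 2)" "0 \<le> cbase r ^ (l - 2)" "0 \<le> cbase r ^ (l - 1)"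
    using cbase_bounds[of r] assms by (auto intro!: power_decreasing)
  have ll: "real l \<le> real l ^ 2" using assms by (simp add: power2_eq_square)
  have l1: "real l * real (l - 1) \<le> real l ^ 2" by (auto simp: power2_eq_square intro!: mult_left_mono)
  show "\<bar>cut1 l r\<bar> \<le> 15 * real l ^ 2 * cbase r ^ (l - 2)"
  proof (cases "r \<ge> 2")
    case False
    then have p: "0 \<le> pos (r - 1)" "pos (r - 1) \<le> 1" by (auto simp: pos_def)
    have "\<bar>cut1 l r\<bar> = 3 * real l * cbase r ^ (l - 1) * pos (r - 1) ^ 2"
      using b by (simp add: cut1_def abs_mult)
    also have "\<dots> \<le> 3 * real l ^ 2 * cbase r ^ (l - 2) * 1"
      using b ll p by (intro mult_mono mult_nonneg_nonneg power_le_one) auto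
    also have "\<dots> \<le> 15 * real l ^ 2 * cbase r ^ (l - 2)" using b by (auto intro!: mult_right_mono)
    finally show ?thesis .
  qed (use z b in auto)
  show "\<bar>cut2 l r\<bar> \<le> 15 * real l ^ 2 * cbase r ^ (l - 2)"
  proof (cases "r \<ge> 2")
    case False
    then have p: "0 \<le> pos (r - 1)" "pos (r - 1) \<le> 1" by (auto simp: pos_def)
    have "\<bar>cut2 l r\<bar> \<le> \<bar>9 * real l * real (l - 1) * cbase r ^ (l - 2) * pos (r - 1) ^ 4\<bar>
        + \<bar>6 * real l * cbase r ^ (l - 1) * pos (r - 1)\<bar>"
      unfolding cut2_def by (rule abs_triangle_ineq4)
    also have "\<dots> = 9 * (real l * real (l - 1)) * cbase r ^ (l - 2) * pos (r - 1) ^ 4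
        + 6 * real l * cbase r ^ (l - 1) * pos (r - 1)"
      using b p by (simp add: abs_mult)
    also have "\<dots> \<le> 9 * real l ^ 2 * cbase r ^ (l - 2) * 1 + 6 * real l ^ 2 * cbase r ^ (l - 2) * 1"
      using b ll l1 p by (intro add_mono mult_mono mult_nonneg_nonneg power_le_one) auto
    finally show ?thesis by simp
  qed (use z b in auto)
qed

lemma profile_cut:
  assumes "l \<ge> 3"
  shows "profile T (\<lambda>r t. cut0 l (r / A)) (\<lambda>r t. cut1 l (r / A) / A) (\<lambda>r t. cut2 l (r / A) / A^2) (\<lambda>r t. 0)"
proof (rule profile_space)
  have d: "((\<lambda>r. r / A) has_real_derivative 1 / A) (at r)" for r
    by (cases "A = 0") (auto intro!: derivative_eq_intros)
  show "((\<lambda>r. cut0 l (r / A)) has_real_derivative cut1 l (r / A) / A) (at r)" for r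
    using DERIV_chain2[OF cut_deriv(1)[OF assms] d] by simp
  show "((\<lambda>r. cut1 l (r / A) / A) has_real_derivative cut2 l (r / A) / A^2) (at r)" for r
    using DERIV_cdivide[OF DERIV_chain2[OF cut_deriv(2)[OF assms] d], of A] by (simp add: power2_eq_square)
  show "continuous_on UNIV (\<lambda>r. cut2 l (r / A) / A^2)"
    unfolding divide_inverse
    by (intro continuous_intros continuous_on_compose2[OF cut_deriv(5)[OF assms, of UNIV]]) auto
qed

text \<open>Derivatives in \<open>r\<close> vanish on the open ray where the function does. For the
  time derivative, uniqueness within \<open>{0..T}\<close> is used, and this requires
  \<open>T > 0\<close>.\<close>

lemma profile_supp:
  assumes f: "profile T f f1 f2 f'" and T: "T > 0" and 0: "\<And>r t. r > \<rho> \<Longrightarrow> f r t = 0" and r: "r > \<rho>"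
  shows "f1 r t = 0" "f2 r t = 0" "t \<in> {0..T} \<Longrightarrow> f' r t = 0"
proof -
  have z: "F1 r = 0" if "\<And>r. (F has_real_derivative F1 r) (at r)" "\<And>r. r > \<rho> \<Longrightarrow> F r = 0" "r > \<rho>"
    for F F1 :: "real \<Rightarrow> real" and r
  proof -
    have "((\<lambda>_. 0) has_real_derivative F1 r) (at r)"
      by (rule has_field_derivative_transform_within_open[OF that(1), of "{\<rho><..}"]) (use that in auto)
    then show ?thesis using DERIV_unique[OF _ DERIV_const] by metis
  qed
  have f1: "f1 r t = 0" if "r > \<rho>" for r t
    by (rule z[of "\<lambda>r. f r t" "\<lambda>r. f1 r t"]) (use f 0 that in \<open>auto simp: profile_def\<close>)
  then show "f1 r t = 0" using r .
  show "f2 r t = 0"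
    by (rule z[of "\<lambda>r. f1 r t" "\<lambda>r. f2 r t"]) (use f f1 r in \<open>auto simp: profile_def\<close>)
  assume t: "t \<in> {0..T}"
  have "((\<lambda>t. f r t) has_real_derivative f' r t) (at t within {0..T})" using f t by (auto simp: profile_def)
  moreover have "((\<lambda>t. f r t) has_real_derivative 0) (at t within {0..T})" using 0[OF r] by simp
  moreover have "at t within {0..T} \<noteq> bot" using t T by (simp add: trivial_limit_within islimpt_Icc)
  ultimately show "f' r t = 0" using has_field_derivative_unique by blast
qed

definition Lrad where
  "Lrad a c f f1 f2 g g1 g2 (z::'x::euclidean_space \<times> 'y::euclidean_space) (t::real) =
    (4 * (norm (fst z - a))\<^sup>2 * f2 ((norm (fst z - a))\<^sup>2) t + 2 * real DIM('x) * f1 ((norm (fst z - a))\<^sup>2) t)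
       * g ((norm (snd z - c))\<^sup>2) t
    + (norm (fst z))\<^sup>2 * (f ((norm (fst z - a))\<^sup>2) t
       * (4 * (norm (snd z - c))\<^sup>2 * g2 ((norm (snd z - c))\<^sup>2) t + 2 * real DIM('y) * g1 ((norm (snd z - c))\<^sup>2) t))"

text \<open>At the ends of the time interval only one-sided derivatives are available and
  \<open>deriv\<close> is undetermined; the closed formula is continuous on the whole slab over
  \<open>{0..T}\<close>.\<close>

definition Trad where
  "Trad a c f f' g g' z t = radial2 a c f' g z t + radial2 a c f g' z t"

definition Om :: "real \<Rightarrow> ('z \<times> real) set" where "Om T = UNIV \<times> {0<..<T}"

text \<open>Indexed by the squared radius, the variable in which profiles are supported.\<close>

definition Kb :: "'x::euclidean_space \<Rightarrow> 'y::euclidean_space \<Rightarrow> real \<Rightarrow> ('x \<times> 'y) set" where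
  "Kb a c \<rho> = cball a (sqrt \<rho>) \<times> cball c (sqrt \<rho>)"

lemma mem_Kb: "z \<in> Kb a c \<rho> \<longleftrightarrow> (norm (fst z - a))\<^sup>2 \<le> \<rho> \<and> (norm (snd z - c))\<^sup>2 \<le> \<rho>"
proof -
  have "r \<le> sqrt \<rho> \<longleftrightarrow> r\<^sup>2 \<le> \<rho>" if "r \<ge> 0" for r
    using that by (metis real_sqrt_le_iff real_sqrt_abs abs_of_nonneg)
  then show ?thesis by (auto simp: Kb_def mem_Times_iff dist_norm norm_minus_commute)
qed

lemma compact_Kb [simp]: "compact (Kb a c \<rho>)"
  unfolding Kb_def by (intro compact_Times compact_cball)

lemma Om_sets [measurable]: "Om T \<in> sets (borel :: ('z::euclidean_space \<times> real) measure)"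
proof -
  have "open (Om T :: ('z \<times> real) set)" unfolding Om_def by (intro open_Times) auto
  then show ?thesis by (rule borel_open)
qed

lemma Kb_sets [measurable]: "Kb a c \<rho> \<in> sets borel" by (simp add: borel_compact)

lemma Kb_Ioo_sets [measurable]: "Kb a c \<rho> \<times> {s<..<t::real} \<in> sets borel"
  using borel_Times[of "Kb a c \<rho>" "{s<..<t::real}"] by auto

lemma continuous_on_Lrad:
  fixes a :: "'x::euclidean_space" and c :: "'y::euclidean_space"
  assumes f: "profile T f f1 f2 f'" and g: "profile T g g1 g2 g'"
  shows "continuous_on (UNIV \<times> {0..T}) (\<lambda>w. Lrad a c f f1 f2 g g1 g2 (fst w) (snd w))"
    "continuous_on (UNIV \<times> {0..T}) (\<lambda>w. Trad a c f f' g g' (fst w) (snd w))"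
    "continuous_on (UNIV \<times> {0..T}) (\<lambda>w. radial2 a c f g (fst w) (snd w))"
proof -
  have C: "continuous_on (UNIV \<times> {0..T}) (\<lambda>w. radial2 a c F G (fst w) (snd w))"
    if "F \<in> {f,f1,f2,f'}" "G \<in> {g,g1,g2,g'}" for F G
    using that f g unfolding profile_def by (auto intro!: continuous_on_radial2)
  have L: "Lrad a c f f1 f2 g g1 g2 z t = 4 * (norm (fst z - a))\<^sup>2 * radial2 a c f2 g z t
     + 2 * real DIM('x) * radial2 a c f1 g z t + (norm (fst z))\<^sup>2 * (4 * (norm (snd z - c))\<^sup>2 * radial2 a c f g2 z t
     + 2 * real DIM('y) * radial2 a c f g1 z t)" for z :: "'x \<times> 'y" and t
    unfolding Lrad_def radial2_def by (simp add: algebra_simps)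
  show "continuous_on (UNIV \<times> {0..T}) (\<lambda>w. Lrad a c f f1 f2 g g1 g2 (fst w) (snd w))"
    unfolding L by (intro continuous_intros C) auto
  show "continuous_on (UNIV \<times> {0..T}) (\<lambda>w. Trad a c f f' g g' (fst w) (snd w))"
    "continuous_on (UNIV \<times> {0..T}) (\<lambda>w. radial2 a c f g (fst w) (snd w))"
    unfolding Trad_def by (intro continuous_intros C; auto)+
qed

lemma supp_rad:
  fixes a :: "'x::euclidean_space" and c :: "'y::euclidean_space"
  assumes f: "profile T f f1 f2 f'" and g: "profile T g g1 g2 g'" and T: "T > 0"
    and f0: "\<And>r t. r > \<rho> \<Longrightarrow> f r t = 0" and g0: "\<And>r t. r > \<rho> \<Longrightarrow> g r t = 0" and z: "z \<notin> Kb a c \<rho>"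
  shows "radial2 a c f g z t = 0" "Lrad a c f f1 f2 g g1 g2 z t = 0" "t \<in> {0..T} \<Longrightarrow> Trad a c f f' g g' z t = 0"
proof -
  from z consider (1) "(norm (fst z - a))\<^sup>2 > \<rho>" | (2) "(norm (snd z - c))\<^sup>2 > \<rho>" by (auto simp: mem_Kb)
  then have "radial2 a c f g z t = 0 \<and> Lrad a c f f1 f2 g g1 g2 z t = 0 \<and> (t \<in> {0..T} \<longrightarrow> Trad a c f f' g g' z t = 0)"
  proof cases
    case 1
    note P = profile_supp[OF f T _ 1, OF f0] f0[OF 1]
    show ?thesis unfolding radial2_def Lrad_def Trad_def by (simp add: P)
  next
    case 2
    note P = profile_supp[OF g T _ 2, OF g0] g0[OF 2]
    show ?thesis unfolding radial2_def Lrad_def Trad_def by (simp add: P)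
  qed
  then show "radial2 a c f g z t = 0" "Lrad a c f f1 f2 g g1 g2 z t = 0" "t \<in> {0..T} \<Longrightarrow> Trad a c f f' g g' z t = 0"
    by auto
qed

lemma continuous_bounded_slab:
  assumes "continuous_on (UNIV \<times> {0..T}) F" "compact K"
  shows "\<exists>C\<ge>0. \<forall>z\<in>K. \<forall>t\<in>{0..T::real}. \<bar>F (z,t) :: real\<bar> \<le> C"
proof -
  have "bounded (F ` (K \<times> {0..T}))"
    by (intro compact_imp_bounded compact_continuous_image continuous_on_subset[OF assms(1)] compact_Times assms) auto
  then obtain C where C: "\<forall>v\<in>F ` (K \<times> {0..T}). norm v \<le> C" unfolding bounded_iff by blast
  have "\<bar>F (z,t)\<bar> \<le> \<bar>C\<bar>" if "z \<in> K" "t \<in> {0..T}" for z t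
  proof -
    have "norm (F (z,t)) \<le> C" using that C by blast
    then show ?thesis by simp
  qed
  then show ?thesis by (intro exI[of _ "\<bar>C\<bar>"]) simp
qed

lemma measurable_slab:
  fixes F :: "'z::euclidean_space \<times> real \<Rightarrow> real"
  assumes "continuous_on (UNIV \<times> {0..T}) F"
  shows "(\<lambda>w. indicator (Om T) w * F w) \<in> borel_measurable borel"
proof -
  have "continuous_on (Om T) F" by (rule continuous_on_subset[OF assms]) (auto simp: Om_def)
  from borel_measurable_continuous_on_indicator[OF Om_sets this] show ?thesis by simp
qed

text \<open>Integrability up to \<open>t = 0\<close>, which \<open>locL1\<close> does not give
  because its compact sets stay away from both ends of the time interval. As an extended integral it
  is free of default values; it is meant for nonnegative \<open>H\<close>.\<close>

definition loc0 :: "('x::euclidean_space \<times> 'y::euclidean_space) set \<Rightarrow> real \<Rightarrow> (('x \<times> 'y) \<times> real \<Rightarrow> real) \<Rightarrow> bool" where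
  "loc0 K T H \<longleftrightarrow> (\<integral>\<^sup>+w. ennreal (H w) * indicator (K \<times> {0<..<T}) w \<partial>lborel) < \<infinity>"

text \<open>The continuous factor is bounded on the compact set that carries it, so
  \<open>loc0\<close> is all that has to be known about \<open>H\<close>.\<close>

lemma integrable_Om:
  fixes F :: "('x::euclidean_space \<times> 'y::euclidean_space) \<times> real \<Rightarrow> real"
  assumes H[measurable]: "H \<in> borel_measurable borel" and Hn: "\<And>w. H w \<ge> 0" and fin: "loc0 K T H"
    and F: "continuous_on (UNIV \<times> {0..T}) F" and K: "compact K" and F0: "\<And>z t. z \<notin> K \<Longrightarrow> t \<in> {0..T} \<Longrightarrow> F (z,t) = 0"
  shows "set_integrable lborel (Om T) (\<lambda>w. H w * F w)"
proof -
  note [measurable] = measurable_slab[OF F]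
  have [measurable]: "K \<times> {0<..<T} \<in> sets borel"
    using borel_Times[of K "{0<..<T::real}"] borel_compact[OF K] by auto
  obtain C where C: "C \<ge> 0" "\<And>z t. z \<in> K \<Longrightarrow> t \<in> {0..T} \<Longrightarrow> \<bar>F (z,t)\<bar> \<le> C"
    using continuous_bounded_slab[OF F K] by blast
  have "integrable lborel (\<lambda>w. H w * (indicator (Om T) w * F w))"
  proof (rule integrableI_bounded)
    have "(\<integral>\<^sup>+w. ennreal (norm (H w * (indicator (Om T) w * F w))) \<partial>lborel)
        \<le> (\<integral>\<^sup>+w. ennreal C * (ennreal (H w) * indicator (K \<times> {0<..<T}) w) \<partial>lborel)"
    proof (rule nn_integral_mono)
      fix w :: "('x \<times> 'y) \<times> real"
      obtain z t where w: "w = (z,t)" by (cases w)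
      show "ennreal (norm (H w * (indicator (Om T) w * F w))) \<le> ennreal C * (ennreal (H w) * indicator (K \<times> {0<..<T}) w)"
      proof (cases "t \<in> {0<..<T} \<and> z \<in> K")
        case True
        then have "\<bar>F w\<bar> \<le> C" using C(2)[of z t] w by auto
        then have "norm (H w * (indicator (Om T) w * F w)) \<le> C * H w"
          using True Hn[of w] w mult_right_mono[of "\<bar>F w\<bar>" C "H w"] by (auto simp: Om_def abs_mult mult.commute)
        then have "ennreal (norm (H w * (indicator (Om T) w * F w))) \<le> ennreal C * ennreal (H w)"
          using C(1) Hn by (simp add: ennreal_mult[symmetric] ennreal_leI)
        then show ?thesis using True w by simp
      next
        case False
        then show ?thesis using F0[of z t] w by (auto simp: Om_def indicator_def)
      qed
    qed
    also have "\<dots> = ennreal C * (\<integral>\<^sup>+w. (ennreal (H w) * indicator (K \<times> {0<..<T}) w) \<partial>lborel)"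
      by (rule nn_integral_cmult) measurable
    also have "\<dots> < \<infinity>" using fin by (simp add: loc0_def ennreal_mult_less_top)
    finally show "(\<integral>\<^sup>+w. ennreal (norm (H w * (indicator (Om T) w * F w))) \<partial>lborel) < \<infinity>" .
  qed measurable
  then show ?thesis unfolding set_integrable_def by (simp add: mult_ac)
qed

text \<open>Only integrability on compact sets is given, so measurability is recovered as a
  pointwise limit: the boxes \<open>K n\<close> exhaust the half space \<open>t > 0\<close>, and
  each restriction is measurable because it is integrable.\<close>

lemma locL1_measurable:
  fixes f :: "'z::euclidean_space \<Rightarrow> real \<Rightarrow> real"
  assumes "\<And>T. T > 0 \<Longrightarrow> locL1 T f"
  shows "(\<lambda>w. if snd w > 0 then f (fst w) (snd w) else 0) \<in> borel_measurable borel"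
proof -
  define K where "K n = cball (0::'z) (real n) \<times> {inverse (real (Suc n))..real n}" for n
  define g where "g n w = indicat_real (K n) w * f (fst w) (snd w)" for n w
  have "g n \<in> borel_measurable borel" for n
  proof -
    have "compact (K n)" unfolding K_def by (intro compact_Times) auto
    moreover have "K n \<subseteq> UNIV \<times> {0<..<real n + 1}"
    proof
      fix w assume "w \<in> K n"
      moreover have "0 < inverse (real (Suc n))" by simp
      ultimately have "0 < snd w" "snd w < real n + 1"
        unfolding K_def mem_Times_iff atLeastAtMost_iff by linarith+
      then show "w \<in> UNIV \<times> {0<..<real n + 1}" by (simp add: mem_Times_iff)
    qed
    ultimately have "set_integrable lborel (K n) (\<lambda>w. f (fst w) (snd w))"
      using assms[of "real n + 1"] unfolding locL1_def by auto
    then have "(\<lambda>w. indicat_real (K n) w *\<^sub>R f (fst w) (snd w)) \<in> borel_measurable lborel"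
      unfolding set_integrable_def by (rule borel_measurable_integrable)
    then show ?thesis by (simp add: g_def[abs_def])
  qed
  moreover have "(\<lambda>n. g n w) \<longlonglongrightarrow> (if snd w > 0 then f (fst w) (snd w) else 0)" for w
  proof (cases "snd w > 0")
    case True
    obtain n0 where n0: "inverse (real (Suc n0)) < snd w" using reals_Archimedean[OF True] by blast
    obtain n1 where n1: "norm (fst w) + snd w < real n1" using reals_Archimedean2 by blast
    have "\<forall>\<^sub>F n in sequentially. g n w = f (fst w) (snd w)"
      using eventually_ge_at_top[of "max n0 n1"]
    proof eventually_elim
      case (elim n)
      have "inverse (real (Suc n)) \<le> inverse (real (Suc n0))" using elim by (intro le_imp_inverse_le) auto
      moreover have "real n1 \<le> real n" using elim by simp
      moreover have "0 \<le> norm (fst w)" by simp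
      ultimately have "norm (fst w) \<le> real n" "inverse (real (Suc n)) \<le> snd w" "snd w \<le> real n"
        using n0 n1 True by linarith+
      then have "w \<in> K n" by (simp add: K_def mem_Times_iff)
      then show ?case by (simp add: g_def)
    qed
    then show ?thesis using True by (simp add: tendsto_eventually)
  next
    case False
    have "g n w = 0" for n
    proof -
      have "0 < inverse (real (Suc n))" by simp
      then have "w \<notin> K n" using False unfolding K_def mem_Times_iff atLeastAtMost_iff by linarith
      then show ?thesis by (simp add: g_def)
    qed
    then show ?thesis using False by simp
  qed
  ultimately show ?thesis by (rule borel_measurable_LIMSEQ_real[rotated])
qed

text \<open>Vanishes for \<open>t \<le> \<epsilon>\<close>: the weak identity gives no integrability near \<open>t = 0\<close>, so test functions must
  be kept constant in time there.\<close>

definition ramp :: "real \<Rightarrow> real \<Rightarrow> real" where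
  "ramp \<epsilon> t = pos (t - \<epsilon>) ^ 2 / (pos (t - \<epsilon>) ^ 2 + \<epsilon> ^ 2)"
definition ramp' :: "real \<Rightarrow> real \<Rightarrow> real" where
  "ramp' \<epsilon> t = 2 * pos (t - \<epsilon>) * \<epsilon> ^ 2 / (pos (t - \<epsilon>) ^ 2 + \<epsilon> ^ 2) ^ 2"

lemma pos_nonneg [simp]: "0 \<le> pos r" by (simp add: pos_def)

lemma ramp_deriv:
  assumes "\<epsilon> > 0"
  shows "(ramp \<epsilon> has_real_derivative ramp' \<epsilon> t) (at t within S)" "continuous_on A (ramp' \<epsilon>)"
proof -
  have nz: "pos (t - \<epsilon>) ^ 2 + \<epsilon> ^ 2 \<noteq> 0" for t
    using assms by (metis add_nonneg_eq_0_iff power2_less_eq_zero_iff zero_le_power2 power_eq_0_iff less_irrefl)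
  have p: "((\<lambda>t. pos (t - \<epsilon>) ^ 2) has_real_derivative 2 * pos (t - \<epsilon>)) (at t within S)"
    using pos_pow_deriv[OF _ DERIV_diff[OF DERIV_ident DERIV_const], of 2 "\<epsilon>" t S] by simp
  show "(ramp \<epsilon> has_real_derivative ramp' \<epsilon> t) (at t within S)"
    unfolding ramp_def[abs_def] ramp'_def
    by (rule DERIV_cong[OF DERIV_divide[OF p DERIV_add[OF p DERIV_const] nz]])
       (simp add: field_simps power2_eq_square)
  show "continuous_on A (ramp' \<epsilon>)"
    unfolding ramp'_def[abs_def] using nz by (intro continuous_intros) auto
qed

lemma ramp_bounds:
  assumes "\<epsilon> > 0"
  shows "0 \<le> ramp \<epsilon> t" "ramp \<epsilon> t \<le> 1" "t \<le> \<epsilon> \<Longrightarrow> ramp \<epsilon> t = 0" "0 \<le> ramp' \<epsilon> t" "t \<le> \<epsilon> \<Longrightarrow> ramp' \<epsilon> t = 0"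
    "t \<ge> 2 * \<epsilon> \<Longrightarrow> ramp \<epsilon> t \<ge> 1/2" "s \<le> t \<Longrightarrow> ramp \<epsilon> s \<le> ramp \<epsilon> t"
proof -
  have d: "pos (t - \<epsilon>) ^ 2 + \<epsilon> ^ 2 > 0" for t using assms by (simp add: add_nonneg_pos)
  show "0 \<le> ramp \<epsilon> t" "ramp \<epsilon> t \<le> 1" "t \<le> \<epsilon> \<Longrightarrow> ramp \<epsilon> t = 0" "0 \<le> ramp' \<epsilon> t" "t \<le> \<epsilon> \<Longrightarrow> ramp' \<epsilon> t = 0"
    using d[of t] by (auto simp: ramp_def ramp'_def field_simps) (auto simp: pos_def)
  \<comment> \<open>The map \<open>x / (x + \<epsilon>^2)\<close> is increasing. This gives
    monotonicity in time and, through its value at \<open>x = \<epsilon>^2\<close>, the lower bound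
    \<open>1/2\<close>.\<close>
  have m: "x / (x + \<epsilon>^2) \<le> y / (y + \<epsilon>^2)" if "0 \<le> x" "x \<le> y" for x y
  proof -
    have "x + \<epsilon>^2 > 0" "y + \<epsilon>^2 > 0" using that assms by (auto intro: add_nonneg_pos)
    then show ?thesis using that assms by (simp add: field_simps mult_right_mono)
  qed
  show "s \<le> t \<Longrightarrow> ramp \<epsilon> s \<le> ramp \<epsilon> t"
    unfolding ramp_def by (rule m) (auto intro!: power_mono simp: pos_def)
  assume "t \<ge> 2 * \<epsilon>"
  then have "\<epsilon>^2 \<le> pos (t - \<epsilon>)^2" using assms by (intro power_mono) (auto simp: pos_def)
  from m[OF _ this] show "ramp \<epsilon> t \<ge> 1/2" unfolding ramp_def using assms by simp
qed

section \<open>Integrability of nonnegative solutions up to time zero\<close>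

locale nonneg_solution =
  fixes \<gamma> p1 p2 :: real and u0 :: "('x::euclidean_space \<times> 'y::euclidean_space) \<Rightarrow> real"
    and u :: "'x \<times> 'y \<Rightarrow> real \<Rightarrow> real"
  assumes gam: "0 < \<gamma>" "\<gamma> < 1" and p1: "p1 > 1" and p2: "p2 > 1" and u0: "integrable lborel u0"
    and u_nn: "\<And>z t. t > 0 \<Longrightarrow> u z t \<ge> 0"
    and sol: "\<And>T. T > 0 \<Longrightarrow> weak_solution \<gamma> p1 p2 u0 T u"
begin

text \<open>Extension by 0 to \<open>t \<le> 0\<close>, where nothing is known about
  \<open>u\<close>, makes \<open>U\<close>, \<open>M\<close> and \<open>V\<close> Borel functions on
  the whole space.\<close>

definition U :: "('x \<times> 'y) \<times> real \<Rightarrow> real" where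
  "U w = (if snd w > 0 then u (fst w) (snd w) else 0)"

definition M :: "('x \<times> 'y) \<times> real \<Rightarrow> real" where
  "M w = (if snd w > 0 then memterm \<gamma> p1 u (fst w) (snd w) else 0)"

definition V :: "('x \<times> 'y) \<times> real \<Rightarrow> real" where
  "V w = (if snd w > 0 then \<bar>u (fst w) (snd w)\<bar> powr (p2 - 1) * u (fst w) (snd w) else 0)"

lemma V_eq: "V w = U w powr p2"
proof (cases "snd w > 0 \<and> u (fst w) (snd w) \<noteq> 0")
  case True
  then have "u (fst w) (snd w) > 0" using u_nn[of "snd w" "fst w"] by auto
  then show ?thesis using True p2 by (simp add: V_def U_def powr_mult_base mult.commute)
qed (auto simp: V_def U_def)

lemma U_nonneg: "U w \<ge> 0" using u_nn by (simp add: U_def)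
lemma V_nonneg: "V w \<ge> 0" by (simp add: V_eq)

lemma M_nonneg: "M w \<ge> 0"
proof -
  have "0 \<le> indicator {0<..<snd w} s *\<^sub>R ((snd w - s) powr - \<gamma> * (\<bar>u (fst w) s\<bar> powr (p1 - 1) * u (fst w) s))" for s
    using u_nn[of s "fst w"] by (cases "s \<in> {0<..<snd w}") auto
  then show ?thesis unfolding M_def memterm_def set_lebesgue_integral_def by simp
qed

lemma U_meas [measurable]: "U \<in> borel_measurable borel"
  and M_meas [measurable]: "M \<in> borel_measurable borel"
  and V_meas [measurable]: "V \<in> borel_measurable borel"
  unfolding U_def[abs_def] M_def[abs_def] V_def[abs_def]
  by (rule locL1_measurable, use sol in \<open>auto simp: weak_solution_def\<close>)+

text \<open>The solution is global: a compact set in \<open>t > 0\<close> lies in the open slab of a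
  longer horizon, so integrability reaches the final time of any fixed slab.\<close>

lemma UMV_set_integrable:
  assumes "compact K" "K \<subseteq> UNIV \<times> {0<..}"
  shows "set_integrable lborel K U" "set_integrable lborel K M" "set_integrable lborel K V"
proof -
  have "bounded (snd ` K)" using assms(1) by (intro compact_imp_bounded compact_continuous_image continuous_intros)
  then obtain B where B: "\<And>w. w \<in> K \<Longrightarrow> \<bar>snd w\<bar> \<le> B" unfolding bounded_iff by auto
  define T where "T = \<bar>B\<bar> + 1"
  have "T > 0" "compact K \<and> K \<subseteq> UNIV \<times> {0<..<T}"
    using assms B by (force simp: T_def mem_Times_iff)+
  then have "set_integrable lborel K (\<lambda>w. u (fst w) (snd w))"
    "set_integrable lborel K (\<lambda>w. memterm \<gamma> p1 u (fst w) (snd w))"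
    "set_integrable lborel K (\<lambda>w. \<bar>u (fst w) (snd w)\<bar> powr (p2 - 1) * u (fst w) (snd w))"
    using sol[of T] by (auto simp: weak_solution_def locL1_def)
  moreover have "snd w > 0" if "w \<in> K" for w using that assms(2) by auto
  ultimately show "set_integrable lborel K U" "set_integrable lborel K M" "set_integrable lborel K V"
    unfolding U_def[abs_def] M_def[abs_def] V_def[abs_def]
    by (simp_all cong: set_integrable_cong)
qed

text \<open>Only the integrands are rewritten. Each of the four integrals may still be the default
  value 0 of a divergent one, so they cannot yet be merged or compared.\<close>

lemma weak:
  assumes f: "profile T f f1 f2 f'" and g: "profile T g g1 g2 g'" and T: "T > 0"
    and f0: "\<And>r t. r > \<rho> \<Longrightarrow> f r t = 0" and g0: "\<And>r t. r > \<rho> \<Longrightarrow> g r t = 0" and fT: "\<And>r. f r T = 0"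
  shows "- (LINT z|lborel. u0 z * radial2 a c f g z 0) =
     set_lebesgue_integral lborel (Om T) (\<lambda>w. M w * radial2 a c f g (fst w) (snd w))
   + set_lebesgue_integral lborel (Om T) (\<lambda>w. V w * radial2 a c f g (fst w) (snd w))
   + set_lebesgue_integral lborel (Om T) (\<lambda>w. U w * Lrad a c f f1 f2 g g1 g2 (fst w) (snd w))
   + set_lebesgue_integral lborel (Om T) (\<lambda>w. U w * Trad a c f f' g g' (fst w) (snd w))"
proof -
  have OmT: "Om T \<in> sets (lborel :: (('x \<times> 'y) \<times> real) measure)" by simp
  have "C21 T (radial2 a c f g)" "compact_supp T (radial2 a c f g)" "\<forall>z. radial2 a c f g z T = 0"
    using C21_radial2[OF f g] compact_supp_radial2[of \<rho> f g] f0 g0 fT by (auto simp: radial2_def)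
  then have "- (LINT z|lborel. u0 z * radial2 a c f g z 0) =
          set_lebesgue_integral lborel (UNIV \<times> {0<..<T})
             (\<lambda>w. memterm \<gamma> p1 u (fst w) (snd w) * radial2 a c f g (fst w) (snd w))
        + set_lebesgue_integral lborel (UNIV \<times> {0<..<T})
             (\<lambda>w. \<bar>u (fst w) (snd w)\<bar> powr (p2 - 1) * u (fst w) (snd w) * radial2 a c f g (fst w) (snd w))
        + set_lebesgue_integral lborel (UNIV \<times> {0<..<T})
             (\<lambda>w. u (fst w) (snd w) * grushin (radial2 a c f g) (fst w) (snd w))
        + set_lebesgue_integral lborel (UNIV \<times> {0<..<T})
             (\<lambda>w. u (fst w) (snd w) * deriv (\<lambda>s. radial2 a c f g (fst w) s) (snd w))"
    using sol[OF T] unfolding weak_solution_def by blast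
  also have "\<dots> = set_lebesgue_integral lborel (Om T) (\<lambda>w. M w * radial2 a c f g (fst w) (snd w))
   + set_lebesgue_integral lborel (Om T) (\<lambda>w. V w * radial2 a c f g (fst w) (snd w))
   + set_lebesgue_integral lborel (Om T) (\<lambda>w. U w * Lrad a c f f1 f2 g g1 g2 (fst w) (snd w))
   + set_lebesgue_integral lborel (Om T) (\<lambda>w. U w * Trad a c f f' g g' (fst w) (snd w))"
    unfolding Om_def[symmetric] Lrad_def[abs_def] grushin_radial2[OF f g]
    by (intro arg_cong2[of _ _ _ _ "(+)"] set_lebesgue_integral_cong[OF OmT])
       (auto simp: Om_def U_def V_def M_def Trad_def deriv_time_radial2[OF f g])
  finally show ?thesis .
qed

end

lemma nn_integral_Fatou_bound:
  assumes "\<And>n::nat. f n \<in> borel_measurable M" "AE x in M. (\<lambda>n. f n x) \<longlonglongrightarrow> g x"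
    and "\<forall>\<^sub>F n in sequentially. (\<integral>\<^sup>+x. f n x \<partial>M) \<le> (C::ennreal)"
  shows "(\<integral>\<^sup>+x. g x \<partial>M) \<le> C"
proof -
  have "(\<integral>\<^sup>+x. g x \<partial>M) = (\<integral>\<^sup>+x. liminf (\<lambda>n. f n x) \<partial>M)"
    by (rule nn_integral_cong_AE) (use assms(2) in \<open>auto elim!: eventually_mono dest: lim_imp_Liminf[rotated]\<close>)
  also have "\<dots> \<le> liminf (\<lambda>n. \<integral>\<^sup>+x. f n x \<partial>M)" by (rule nn_integral_liminf[OF assms(1)])
  also have "\<dots> \<le> limsup (\<lambda>n. \<integral>\<^sup>+x. f n x \<partial>M)" by (rule Liminf_le_Limsup) simp
  also have "\<dots> \<le> C" by (rule Limsup_bounded[OF assms(3)])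
  finally show ?thesis .
qed

lemma measurable_fst_snd_borel [measurable (raw)]:
  fixes F :: "'a \<Rightarrow> 'b::second_countable_topology \<times> 'c::second_countable_topology"
  assumes "F \<in> measurable N borel"
  shows "(\<lambda>w. fst (F w)) \<in> measurable N borel" "(\<lambda>w. snd (F w)) \<in> measurable N borel"
  by (rule measurable_compose[OF assms] borel_measurable_continuous_onI continuous_intros)+

text \<open>The constant \<open>C\<close> is the same for every \<open>\<epsilon>\<close>, and at
  each point the indicator of \<open>{2*\<epsilon><..<T}\<close> eventually agrees with that of
  \<open>{0<..<T}\<close>; Fatou's lemma keeps the bound.\<close>

lemma nn_integral_time_Fatou:
  fixes H :: "'z::euclidean_space \<times> real \<Rightarrow> real"
  assumes [measurable]: "H \<in> borel_measurable borel" and K: "K \<in> sets borel" and T: "T > 0"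
    and main: "\<And>\<epsilon>. \<epsilon> \<in> {0<..<T} \<Longrightarrow> (\<integral>\<^sup>+w. ennreal (H w) * indicator (K \<times> {2*\<epsilon><..<T}) w \<partial>lborel) \<le> C"
  shows "(\<integral>\<^sup>+w. ennreal (H w) * indicator (K \<times> {0<..<T}) w \<partial>lborel) \<le> C"
proof (rule nn_integral_Fatou_bound)
  define \<epsilon> where "\<epsilon> n = T / real (n + 2)" for n
  have eps: "\<epsilon> n \<in> {0<..<T}" for n using T by (auto simp: \<epsilon>_def field_simps intro: add_pos_nonneg)
  have [measurable]: "K \<times> {s<..<t::real} \<in> sets borel" for s t
    using borel_Times[OF K, of "{s<..<t}"] by auto
  show "(\<lambda>w. ennreal (H w) * indicator (K \<times> {2*\<epsilon> n<..<T}) w) \<in> borel_measurable lborel" for n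
    by measurable
  show "\<forall>\<^sub>F n in sequentially. (\<integral>\<^sup>+w. ennreal (H w) * indicator (K \<times> {2*\<epsilon> n<..<T}) w \<partial>lborel) \<le> C"
    using main[OF eps] by simp
  show "AE w in lborel. (\<lambda>n. ennreal (H w) * indicator (K \<times> {2*\<epsilon> n<..<T}) w) \<longlonglongrightarrow> ennreal (H w) * indicator (K \<times> {0<..<T}) w"
  proof (rule AE_I2)
    fix w :: "'z \<times> real"
    have lim: "(\<lambda>n. 2 * \<epsilon> n) \<longlonglongrightarrow> 0"
      using LIMSEQ_ignore_initial_segment[OF lim_const_over_n[of "2*T"], of 2] by (simp add: \<epsilon>_def)
    have "\<forall>\<^sub>F n in sequentially. snd w > 0 \<longrightarrow> 2 * \<epsilon> n < snd w"
    proof (cases "snd w > 0")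
      case True
      from order_tendstoD(2)[OF lim True] show ?thesis by (auto elim: eventually_mono)
    qed simp
    then have "\<forall>\<^sub>F n in sequentially. ennreal (H w) * indicator (K \<times> {2*\<epsilon> n<..<T}) w = ennreal (H w) * indicator (K \<times> {0<..<T}) w"
    proof eventually_elim
      case (elim n)
      have "0 < \<epsilon> n" using eps[of n] by simp
      then have "w \<in> K \<times> {2*\<epsilon> n<..<T} \<longleftrightarrow> w \<in> K \<times> {0<..<T}" using elim by (auto simp: mem_Times_iff)
      then show ?case by (simp add: indicator_def)
    qed
    then show "(\<lambda>n. ennreal (H w) * indicator (K \<times> {2*\<epsilon> n<..<T}) w) \<longlonglongrightarrow> ennreal (H w) * indicator (K \<times> {0<..<T}) w"
      by (rule tendsto_eventually)
  qed
qed

text \<open>Dichotomy. If \<open>H * \<psi>\<close> is integrable on the slab, its integral bounds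
  all cut versions. If it is not, no cut version is integrable either, because
  \<open>\<eta> \<ge> 1/2\<close> on the first half of the time interval and \<open>H\<close> is
  integrable on the second; the Bochner integrals are then all 0. Either way the bound is uniform in
  \<open>\<epsilon>\<close>.\<close>

lemma time_cut_integral_bounded:
  fixes H :: "'z::euclidean_space \<times> real \<Rightarrow> real"
  assumes H: "\<And>w. H w \<ge> 0" "H \<in> borel_measurable borel" and psi: "\<psi> \<in> borel_measurable borel" "\<And>z. 0 \<le> \<psi> z" "\<And>z. \<psi> z \<le> C0"
    and K: "\<And>z. z \<notin> K \<Longrightarrow> \<psi> z = 0" and HK: "set_integrable lborel (K \<times> {T/2..T}) H"
    and eta: "\<And>\<epsilon> t. \<epsilon> \<in> E \<Longrightarrow> t \<in> {0<..<T} \<Longrightarrow> 0 \<le> \<eta> \<epsilon> t \<and> \<eta> \<epsilon> t \<le> (1::real)"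
      "\<And>\<epsilon> t. \<epsilon> \<in> E \<Longrightarrow> t \<in> {0<..<T/2} \<Longrightarrow> 1/2 \<le> \<eta> \<epsilon> t"
  shows "\<exists>C. \<forall>\<epsilon>\<in>E. set_lebesgue_integral lborel (Om T) (\<lambda>w. H w * (\<psi> (fst w) * \<eta> \<epsilon> (snd w))) \<le> C"
proof (cases "integrable lborel (\<lambda>w. indicator (Om T) w * (H w * \<psi> (fst w)))")
  case True
  have "set_lebesgue_integral lborel (Om T) (\<lambda>w. H w * (\<psi> (fst w) * \<eta> \<epsilon> (snd w))) \<le>
      (LINT w|lborel. indicator (Om T) w * (H w * \<psi> (fst w)))" if e: "\<epsilon> \<in> E" for \<epsilon>
    unfolding set_lebesgue_integral_def real_scaleR_def
  proof (rule integral_mono_AE'[OF True])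
    have "indicat_real (Om T) w * (H w * (\<psi> (fst w) * \<eta> \<epsilon> (snd w))) \<le> indicat_real (Om T) w * (H w * \<psi> (fst w))" for w
      using eta(1)[OF e, of "snd w"] H(1)[of w] psi(2)[of "fst w"]
      by (cases "w \<in> Om T") (auto simp: Om_def mem_Times_iff intro!: mult_left_mono mult_left_le)
    then show "AE w in lborel. indicat_real (Om T) w * (H w * (\<psi> (fst w) * \<eta> \<epsilon> (snd w))) \<le> indicat_real (Om T) w * (H w * \<psi> (fst w))"
      by simp
    show "AE w in lborel. 0 \<le> indicat_real (Om T) w * (H w * \<psi> (fst w))"
      using H(1) psi(2) by simp
  qed
  then show ?thesis by blast
next
  case False
  have "set_lebesgue_integral lborel (Om T) (\<lambda>w. H w * (\<psi> (fst w) * \<eta> \<epsilon> (snd w))) \<le> 0" if e: "\<epsilon> \<in> E" for \<epsilon>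
  proof -
    have "\<not> integrable lborel (\<lambda>w. indicat_real (Om T) w * (H w * (\<psi> (fst w) * \<eta> \<epsilon> (snd w))))"
    proof
      assume I: "integrable lborel (\<lambda>w. indicat_real (Om T) w * (H w * (\<psi> (fst w) * \<eta> \<epsilon> (snd w))))"
      have J: "integrable lborel (\<lambda>w. 2 * (indicat_real (Om T) w * (H w * (\<psi> (fst w) * \<eta> \<epsilon> (snd w))))
          + C0 * (indicat_real (K \<times> {T/2..T}) w *\<^sub>R H w))"
        using I HK unfolding set_integrable_def by (intro Bochner_Integration.integrable_add integrable_mult_right)
      have "integrable lborel (\<lambda>w. indicator (Om T) w * (H w * \<psi> (fst w)))"
      proof (rule Bochner_Integration.integrable_bound[OF J])
        note [measurable] = H(2) psi(1)
        show "(\<lambda>w. indicator (Om T) w * (H w * \<psi> (fst w))) \<in> borel_measurable lborel"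
          by measurable
        have "norm (indicator (Om T) w * (H w * \<psi> (fst w))) \<le>
           2 * (indicat_real (Om T) w * (H w * (\<psi> (fst w) * \<eta> \<epsilon> (snd w)))) + C0 * (indicat_real (K \<times> {T/2..T}) w *\<^sub>R H w)" for w
        proof -
          have hp: "0 \<le> H w * \<psi> (fst w)" using H(1) psi(2) by simp
          have C0: "0 \<le> C0 * H w" using H(1)[of w] psi(2,3)[of "fst w"] by (meson mult_nonneg_nonneg order_trans)
          consider "w \<notin> Om T" | "w \<in> Om T" "snd w < T/2" | "w \<in> Om T" "snd w \<ge> T/2" by linarith
          then show ?thesis
          proof cases
            case 2
            then have "H w * \<psi> (fst w) * (1/2) \<le> H w * \<psi> (fst w) * \<eta> \<epsilon> (snd w)"
              using eta(2)[OF e, of "snd w"] hp by (intro mult_left_mono) (auto simp: Om_def)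
            then show ?thesis using 2 hp C0 by (simp add: indicator_def mult_ac)
          next
            case 3
            have e0: "0 \<le> H w * \<psi> (fst w) * \<eta> \<epsilon> (snd w)"
              using eta(1)[OF e, of "snd w"] hp 3 mult_nonneg_nonneg[OF hp, of "\<eta> \<epsilon> (snd w)"] by (auto simp: Om_def)
            have "H w * \<psi> (fst w) \<le> C0 * (indicat_real (K \<times> {T/2..T}) w *\<^sub>R H w)"
            proof (cases "fst w \<in> K")
              case True
              then have "w \<in> K \<times> {T/2..T}" using 3 by (auto simp: Om_def mem_Times_iff)
              then show ?thesis using mult_left_mono[OF psi(3)[of "fst w"] H(1)[of w]] by (simp add: mult.commute)
            next
              case False
              then show ?thesis using K C0 by (simp add: indicator_def mem_Times_iff)
            qed
            then show ?thesis using 3 hp e0 by (simp add: mult_ac)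
          qed (use C0 in \<open>auto simp: indicator_def\<close>)
        qed
        from order_trans[OF this abs_ge_self]
        show "AE w in lborel. norm (indicator (Om T) w * (H w * \<psi> (fst w))) \<le> norm (2 * (indicat_real (Om T) w * (H w * (\<psi> (fst w) * \<eta> \<epsilon> (snd w)))) + C0 * (indicat_real (K \<times> {T/2..T}) w *\<^sub>R H w))"
          by (intro AE_I2) (simp only: real_norm_def)
      qed
      with False show False by simp
    qed
    then show ?thesis unfolding set_lebesgue_integral_def real_scaleR_def
      by (simp add: not_integrable_integral_eq)
  qed
  then show ?thesis by blast
qed

context nonneg_solution
begin

text \<open>From time \<open>\<epsilon>\<close> on, local integrability suffices. The extra
  indicator changes nothing when the test factor vanishes before \<open>\<epsilon>\<close>.\<close>

lemma loc0_restrict: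
  assumes "H \<in> {U,M,V}" "compact K" "\<epsilon> > 0"
  shows "loc0 K T (\<lambda>w. H w * indicator {\<epsilon>..} (snd w))"
proof -
  have [measurable]: "K \<times> {0<..<T} \<in> sets borel" "K \<times> {\<epsilon>..T} \<in> sets borel"
    using borel_Times[of K "{0<..<T::real}"] borel_Times[of K "{\<epsilon>..T}"] borel_compact[OF assms(2)] by auto
  have "compact (K \<times> {\<epsilon>..T})" "K \<times> {\<epsilon>..T} \<subseteq> UNIV \<times> {0<..}"
    using assms(3) by (auto intro: compact_Times[OF assms(2) compact_Icc])
  from UMV_set_integrable[OF this] assms(1) have "set_integrable lborel (K \<times> {\<epsilon>..T}) H" by blast
  then have "(\<integral>\<^sup>+w. ennreal (norm (indicator (K \<times> {\<epsilon>..T}) w *\<^sub>R H w)) \<partial>lborel) < \<infinity>"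
    unfolding set_integrable_def integrable_iff_bounded by blast
  moreover have "(\<integral>\<^sup>+w. ennreal (H w * indicator {\<epsilon>..} (snd w)) * indicator (K \<times> {0<..<T}) w \<partial>lborel) \<le>
     (\<integral>\<^sup>+w. ennreal (norm (indicator (K \<times> {\<epsilon>..T}) w *\<^sub>R H w)) \<partial>lborel)"
  proof (rule nn_integral_mono)
    fix w :: "('x \<times> 'y) \<times> real"
    show "ennreal (H w * indicator {\<epsilon>..} (snd w)) * indicator (K \<times> {0<..<T}) w \<le> ennreal (norm (indicator (K \<times> {\<epsilon>..T}) w *\<^sub>R H w))"
    proof (cases "w \<in> K \<times> {0<..<T} \<and> snd w \<ge> \<epsilon>")
      case True
      then have "w \<in> K \<times> {\<epsilon>..T}" by (auto simp: mem_Times_iff)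
      then show ?thesis using True by (simp add: ennreal_leI)
    next
      case False
      then have "indicator {\<epsilon>..} (snd w) = (0::real) \<or> indicator (K \<times> {0<..<T}) w = (0::ennreal)"
        by (cases "w \<in> K \<times> {0<..<T}") simp_all
      then show ?thesis by auto
    qed
  qed
  ultimately show ?thesis unfolding loc0_def by (rule le_less_trans[rotated])
qed

text \<open>If the term with the Grushin operator is not integrable, its Bochner integral is \<open>0\<close> and the
  identity still bounds the time-derivative term. If it is integrable, the factor \<open>4 * B - r\<close> keeps the
  operator away from \<open>0\<close> on the inner box, so integrability passes to \<open>U\<close>.\<close>

lemma loc0_U:
  assumes B: "B > 0" and T: "T > 0"
  shows "loc0 (Kb 0 0 B) T U"
proof -
  define K where "K = Kb (0::'x) (0::'y) B"
  define K2 where "K2 = Kb (0::'x) (0::'y) (2*B)"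
  \<comment> \<open>The doubled horizon keeps the time cutoff at least \<open>1/2\<close> on
    \<open>(0, T)\<close>.\<close>
  define T1 where "T1 = 2 * T"
  \<comment> \<open>Equal to 1 up to \<open>\<epsilon>\<close>, nonincreasing, 0 at
    \<open>T1\<close>, and of slope at most \<open>- 1 / (2 * T1)\<close> from
    \<open>2 * \<epsilon>\<close> on, so that the resulting bounds do not depend on
    \<open>\<epsilon>\<close>.\<close>
  define \<eta> where "\<eta> \<epsilon> t = 1 - t * ramp \<epsilon> t / (T1 * ramp \<epsilon> T1)" for \<epsilon> t
  define \<eta>' where "\<eta>' \<epsilon> t = - (ramp \<epsilon> t + t * ramp' \<epsilon> t) / (T1 * ramp \<epsilon> T1)" for \<epsilon> t
  define f where "f \<epsilon> r t = (4 * B - r) * cut0 3 (r / B) * \<eta> \<epsilon> t" for \<epsilon> r t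
  define f1 where "f1 \<epsilon> r t = (-1 * cut0 3 (r / B) + (4 * B - r) * (cut1 3 (r / B) / B)) * \<eta> \<epsilon> t + (4 * B - r) * cut0 3 (r / B) * 0" for \<epsilon> r t
  define f2 where "f2 \<epsilon> r t = (0 * cut0 3 (r / B) + 2 * (-1) * (cut1 3 (r / B) / B) + (4 * B - r) * (cut2 3 (r / B) / B^2)) * \<eta> \<epsilon> t
     + 2 * (-1 * cut0 3 (r / B) + (4 * B - r) * (cut1 3 (r / B) / B)) * 0 + (4 * B - r) * cut0 3 (r / B) * 0" for \<epsilon> r t
  define f' where "f' \<epsilon> r t = (0 * cut0 3 (r / B) + (4 * B - r) * 0) * \<eta> \<epsilon> t + (4 * B - r) * cut0 3 (r / B) * \<eta>' \<epsilon> t" for \<epsilon> r t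
  define g where "g r t = cut0 3 (r / B)" for r t :: real
  define g1 where "g1 r t = cut1 3 (r / B) / B" for r t :: real
  define g2 where "g2 r t = cut2 3 (r / B) / B^2" for r t :: real
  define \<psi> where "\<psi> z = (4 * B - (norm (fst z))^2) * cut0 3 ((norm (fst z))^2 / B) * cut0 3 ((norm (snd z))^2 / B)" for z :: "'x \<times> 'y"
  have T1: "T1 > 0" using T by (simp add: T1_def)
  have rT: "ramp \<epsilon> T1 \<ge> 1/2" if "\<epsilon> \<in> {0<..<T}" for \<epsilon> using that ramp_bounds(6)[of \<epsilon> T1] by (simp add: T1_def)
  have eta: "((\<lambda>t. \<eta> \<epsilon> t) has_real_derivative \<eta>' \<epsilon> t) (at t within {0..T1})" if "\<epsilon> \<in> {0<..<T}" for \<epsilon> t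
  proof -
    have "((\<lambda>t. 1 - t * ramp \<epsilon> t / (T1 * ramp \<epsilon> T1)) has_real_derivative 
       0 - (1 * ramp \<epsilon> t + ramp' \<epsilon> t * t) / (T1 * ramp \<epsilon> T1)) (at t within {0..T1})"
      using that by (intro DERIV_diff DERIV_const DERIV_cdivide DERIV_mult DERIV_ident ramp_deriv) auto
    then show ?thesis unfolding \<eta>_def[abs_def] \<eta>'_def
      by (rule DERIV_cong) (simp only: diff_0 minus_divide_left mult_1 mult.commute[of t])
  qed
  have etab: "\<eta> \<epsilon> t \<le> 1" "0 \<le> \<eta> \<epsilon> t" "t \<le> T \<Longrightarrow> 1/2 \<le> \<eta> \<epsilon> t" "\<eta> \<epsilon> T1 = 0" "\<eta>' \<epsilon> t \<le> 0" "t \<le> \<epsilon> \<Longrightarrow> \<eta>' \<epsilon> t = 0"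
    "t \<ge> 2 * \<epsilon> \<Longrightarrow> \<eta>' \<epsilon> t \<le> - 1 / (2 * T1)"
    if e: "\<epsilon> \<in> {0<..<T}" and t: "t \<in> {0..T1}" for \<epsilon> t
  proof -
    have e0: "\<epsilon> > 0" using e by simp
    note rb = ramp_bounds[OF e0] and rT = rT[OF e]
    have r0: "ramp \<epsilon> T1 \<noteq> 0" and d: "T1 * ramp \<epsilon> T1 > 0" using T1 rT by auto
    show "\<eta> \<epsilon> t \<le> 1" using d t rb(1)[of t] by (simp add: \<eta>_def)
    have m: "ramp \<epsilon> t \<le> ramp \<epsilon> T1" using t by (intro rb(7)) auto
    have "t * ramp \<epsilon> t \<le> T1 * ramp \<epsilon> T1" using t m rb(1) T1 by (intro mult_mono) auto
    then show "0 \<le> \<eta> \<epsilon> t" using d by (simp add: \<eta>_def)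
    show "\<eta> \<epsilon> T1 = 0" using r0 T1 by (simp add: \<eta>_def)
    show "\<eta>' \<epsilon> t \<le> 0" 
    proof -
      have "0 \<le> ramp \<epsilon> t + t * ramp' \<epsilon> t" using rb(1,4)[of t] t by simp
      then show ?thesis unfolding \<eta>'_def by (intro divide_nonpos_pos[OF _ d]) simp
    qed
    show "t \<le> \<epsilon> \<Longrightarrow> \<eta>' \<epsilon> t = 0" using rb(3,5)[of t] by (simp add: \<eta>'_def)
    show "1/2 \<le> \<eta> \<epsilon> t" if "t \<le> T"
    proof -
      have "t * ramp \<epsilon> t \<le> (T1/2) * ramp \<epsilon> T1" using t m rb(1) T1 that by (intro mult_mono) (auto simp: T1_def)
      then have "t * ramp \<epsilon> t / (T1 * ramp \<epsilon> T1) \<le> (T1/2) * ramp \<epsilon> T1 / (T1 * ramp \<epsilon> T1)" using d by (intro divide_right_mono) auto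
      also have "\<dots> = 1/2" using r0 T1 by simp
      finally show ?thesis by (simp add: \<eta>_def)
    qed
    show "\<eta>' \<epsilon> t \<le> - 1 / (2 * T1)" if "t \<ge> 2 * \<epsilon>"
    proof -
      have "1/2 \<le> ramp \<epsilon> t + t * ramp' \<epsilon> t" using rb(4,6)[of t] that t by (simp add: add_increasing2)
      moreover have "T1 * ramp \<epsilon> T1 \<le> T1" using rb(2)[of T1] T1 by simp
      ultimately have "(1/2) / T1 \<le> (ramp \<epsilon> t + t * ramp' \<epsilon> t) / (T1 * ramp \<epsilon> T1)" using d by (intro frac_le) auto
      then show ?thesis unfolding \<eta>'_def minus_divide_left[symmetric] by simp
    qed
  qed
  have lin: "profile T1 (\<lambda>r t. 4 * B - r) (\<lambda>r t. -1) (\<lambda>r t. 0) (\<lambda>r t. 0)"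
    by (rule profile_space) (auto intro!: derivative_eq_intros)
  have f: "profile T1 (f \<epsilon>) (f1 \<epsilon>) (f2 \<epsilon>) (f' \<epsilon>)" if "\<epsilon> \<in> {0<..<T}" for \<epsilon>
  proof -
    have "continuous_on {0..T1} (\<eta>' \<epsilon>)"
      unfolding \<eta>'_def[abs_def] using that rT[OF that] T1
      by (intro continuous_intros ramp_deriv(2)) (auto intro!: DERIV_continuous_on ramp_deriv(1))
    from profile_mult[OF profile_mult[OF lin profile_cut] profile_time[OF this eta]] that
    show ?thesis unfolding f_def[abs_def] f1_def[abs_def] f2_def[abs_def] f'_def[abs_def] by simp
  qed
  have g: "profile T1 g g1 g2 (\<lambda>r t. 0)"
    unfolding g_def[abs_def] g1_def[abs_def] g2_def[abs_def] by (rule profile_cut) simp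
  have supp: "f \<epsilon> r t = 0" "g r t = 0" if "r > 2 * B" for \<epsilon> r t
  proof -
    have "r / B \<ge> 2" using that B by (simp add: le_divide_eq)
    then have "cut0 3 (r / B) = 0" by (intro cut_bounds) auto
    then show "f \<epsilon> r t = 0" "g r t = 0" by (simp_all add: f_def g_def)
  qed
  have fT: "f \<epsilon> r T1 = 0" if "\<epsilon> \<in> {0<..<T}" for \<epsilon> r using etab(4)[OF that, of 0] T1 by (simp add: f_def)
  have rad: "radial2 0 0 (f \<epsilon>) g z t = \<psi> z * \<eta> \<epsilon> t" for \<epsilon> z t by (simp add: radial2_def f_def g_def \<psi>_def)
  have trad: "Trad 0 0 (f \<epsilon>) (f' \<epsilon>) g (\<lambda>r t. 0) z t = \<psi> z * \<eta>' \<epsilon> t" for \<epsilon> z t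
    by (simp add: Trad_def radial2_def f'_def g_def \<psi>_def)
  have psi0: "\<psi> z = 0" if "z \<notin> K2" for z
    using that supp(2)[of "(norm (fst z))^2"] supp(2)[of "(norm (snd z))^2"] B
    by (auto simp: K2_def mem_Kb \<psi>_def g_def not_le)
  have psin: "0 \<le> \<psi> z \<and> \<psi> z \<le> 4 * B" for z
  proof (cases "z \<in> K2")
    case True
    then have r: "(norm (fst z))^2 \<le> 2 * B" by (simp add: K2_def mem_Kb)
    have "\<psi> z \<le> (4 * B) * 1 * 1" unfolding \<psi>_def using r B by (intro mult_mono mult_nonneg_nonneg cut_bounds) auto
    moreover have "0 \<le> \<psi> z" unfolding \<psi>_def using r B by (intro mult_nonneg_nonneg cut_bounds) auto
    ultimately show ?thesis by simp
  qed (use psi0 B in auto)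
  have psiK: "\<psi> z \<ge> 3 * B" if "z \<in> K" for z
    using that B by (simp add: K_def mem_Kb \<psi>_def cut_bounds(3))
  have "continuous_on UNIV \<psi>"
  proof -
    have "continuous_on UNIV (\<lambda>z::'x \<times> 'y. (norm (fst z))^2 / B)" "continuous_on UNIV (\<lambda>z::'x \<times> 'y. (norm (snd z))^2 / B)"
      using B by (intro continuous_intros; simp)+
    from continuous_on_compose2[OF cut_deriv(3)[of 3 UNIV] this(1)] continuous_on_compose2[OF cut_deriv(3)[of 3 UNIV] this(2)]
    show ?thesis unfolding \<psi>_def[abs_def] by (auto intro!: continuous_intros)
  qed
  then have psim: "\<psi> \<in> borel_measurable borel" by (rule borel_measurable_continuous_onI)
  \<comment> \<open>On the inner box all cutoffs equal 1, so only the linear factor in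
    \<open>|x|^2\<close> is differentiated: the operator yields exactly
    \<open>- 2 * DIM('x) * \<eta>\<close>.\<close>
  have lrad: "\<bar>Lrad 0 0 (f \<epsilon>) (f1 \<epsilon>) (f2 \<epsilon>) g g1 g2 z t\<bar> \<ge> 1" if "\<epsilon> \<in> {0<..<T}" "z \<in> K" "t \<in> {0..T}" for \<epsilon> z t
  proof -
    have r: "(norm (fst z))^2 / B \<le> 1" "(norm (snd z))^2 / B \<le> 1" using that B by (auto simp: K_def mem_Kb)
    have "Lrad 0 0 (f \<epsilon>) (f1 \<epsilon>) (f2 \<epsilon>) g g1 g2 z t = - (2 * real DIM('x) * \<eta> \<epsilon> t)"
      using cut_bounds(3,7,8)[of 3, OF _ r(1)] cut_bounds(3,7,8)[of 3, OF _ r(2)]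
      by (simp add: Lrad_def f_def f1_def f2_def g_def g1_def g2_def)
    moreover have "1 * (1/2) \<le> real DIM('x) * \<eta> \<epsilon> t"
      using etab(3)[OF that(1), of t] that(3) T by (intro mult_mono) (auto simp: T1_def Suc_le_eq)
    ultimately show ?thesis by simp
  qed
  have weak': "- (LINT z|lborel. u0 z * (\<psi> z * \<eta> \<epsilon> 0)) =
     set_lebesgue_integral lborel (Om T1) (\<lambda>w. M w * (\<psi> (fst w) * \<eta> \<epsilon> (snd w)))
   + set_lebesgue_integral lborel (Om T1) (\<lambda>w. V w * (\<psi> (fst w) * \<eta> \<epsilon> (snd w)))
   + set_lebesgue_integral lborel (Om T1) (\<lambda>w. U w * Lrad 0 0 (f \<epsilon>) (f1 \<epsilon>) (f2 \<epsilon>) g g1 g2 (fst w) (snd w))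
   + set_lebesgue_integral lborel (Om T1) (\<lambda>w. U w * (\<psi> (fst w) * \<eta>' \<epsilon> (snd w)))" if "\<epsilon> \<in> {0<..<T}" for \<epsilon>
    using weak[OF f[OF that] g T1 supp(1) supp(2) fT[OF that], where a=0 and c=0] unfolding rad trad .
  show ?thesis
  proof (cases "\<exists>\<epsilon>\<in>{0<..<T}. set_integrable lborel (Om T1) (\<lambda>w. U w * Lrad 0 0 (f \<epsilon>) (f1 \<epsilon>) (f2 \<epsilon>) g g1 g2 (fst w) (snd w))")
    case True
    then obtain \<epsilon> where e: "\<epsilon> \<in> {0<..<T}" and "integrable lborel (\<lambda>w. indicator (Om T1) w *\<^sub>R (U w * Lrad 0 0 (f \<epsilon>) (f1 \<epsilon>) (f2 \<epsilon>) g g1 g2 (fst w) (snd w)))"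
      unfolding set_integrable_def by blast
    then have "(\<integral>\<^sup>+w. ennreal (norm (indicator (Om T1) w *\<^sub>R (U w * Lrad 0 0 (f \<epsilon>) (f1 \<epsilon>) (f2 \<epsilon>) g g1 g2 (fst w) (snd w)))) \<partial>lborel) < \<infinity>"
      unfolding integrable_iff_bounded by blast
    moreover have "(\<integral>\<^sup>+w. ennreal (U w) * indicator (K \<times> {0<..<T}) w \<partial>lborel) \<le>
       (\<integral>\<^sup>+w. ennreal (norm (indicator (Om T1) w *\<^sub>R (U w * Lrad 0 0 (f \<epsilon>) (f1 \<epsilon>) (f2 \<epsilon>) g g1 g2 (fst w) (snd w)))) \<partial>lborel)"
    proof (rule nn_integral_mono)
      fix w :: "('x \<times> 'y) \<times> real"
      show "ennreal (U w) * indicator (K \<times> {0<..<T}) w \<le> ennreal (norm (indicator (Om T1) w *\<^sub>R (U w * Lrad 0 0 (f \<epsilon>) (f1 \<epsilon>) (f2 \<epsilon>) g g1 g2 (fst w) (snd w))))"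
      proof (cases "w \<in> K \<times> {0<..<T}")
        case True
        then have "w \<in> Om T1" using T by (auto simp: Om_def T1_def)
        moreover have "U w * 1 \<le> U w * \<bar>Lrad 0 0 (f \<epsilon>) (f1 \<epsilon>) (f2 \<epsilon>) g g1 g2 (fst w) (snd w)\<bar>"
          using lrad[OF e, of "fst w" "snd w"] True U_nonneg by (intro mult_left_mono) (auto simp: mem_Times_iff)
        ultimately show ?thesis using True U_nonneg[of w] by (simp add: abs_mult ennreal_leI)
      qed simp
    qed
    ultimately show ?thesis unfolding loc0_def K_def by (rule le_less_trans[rotated])
  next
    case False
    \<comment> \<open>The operator term now diverges for every \<open>\<epsilon>\<close> and drops
      out of the identity, which then expresses the time-derivative term through \<open>u0\<close>,
      \<open>M\<close> and \<open>V\<close>. The last two contributions are bounded uniformly in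
      \<open>\<epsilon>\<close>, convergent or not.\<close>
    have HK: "set_integrable lborel (K2 \<times> {T1/2..T1}) M" "set_integrable lborel (K2 \<times> {T1/2..T1}) V"
    proof -
      have "compact (K2 \<times> {T1/2..T1})" "K2 \<times> {T1/2..T1} \<subseteq> UNIV \<times> {0<..}"
        using T1 unfolding K2_def by (auto intro: compact_Times[OF compact_Kb compact_Icc])
      from UMV_set_integrable[OF this] show "set_integrable lborel (K2 \<times> {T1/2..T1}) M" "set_integrable lborel (K2 \<times> {T1/2..T1}) V" by auto
    qed
    have eb: "0 \<le> \<eta> \<epsilon> t \<and> \<eta> \<epsilon> t \<le> 1" if "\<epsilon> \<in> {0<..<T}" "t \<in> {0<..<T1}" for \<epsilon> t using etab(1,2)[of \<epsilon> t] that by auto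
    have eb2: "1/2 \<le> \<eta> \<epsilon> t" if "\<epsilon> \<in> {0<..<T}" "t \<in> {0<..<T1/2}" for \<epsilon> t using etab(3)[of \<epsilon> t] that by (auto simp: T1_def)
    have "\<exists>C. \<forall>\<epsilon>\<in>{0<..<T}. set_lebesgue_integral lborel (Om T1) (\<lambda>w. M w * (\<psi> (fst w) * \<eta> \<epsilon> (snd w))) \<le> C"
      by (rule time_cut_integral_bounded[OF M_nonneg M_meas psim _ _ psi0 HK(1) eb eb2, of "4 * B"]) (simp_all add: psin)
    then obtain C1 where C1: "\<And>\<epsilon>. \<epsilon> \<in> {0<..<T} \<Longrightarrow> set_lebesgue_integral lborel (Om T1) (\<lambda>w. M w * (\<psi> (fst w) * \<eta> \<epsilon> (snd w))) \<le> C1" by blast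
    have "\<exists>C. \<forall>\<epsilon>\<in>{0<..<T}. set_lebesgue_integral lborel (Om T1) (\<lambda>w. V w * (\<psi> (fst w) * \<eta> \<epsilon> (snd w))) \<le> C"
      by (rule time_cut_integral_bounded[OF V_nonneg V_meas psim _ _ psi0 HK(2) eb eb2, of "4 * B"]) (simp_all add: psin)
    then obtain C2 where C2: "\<And>\<epsilon>. \<epsilon> \<in> {0<..<T} \<Longrightarrow> set_lebesgue_integral lborel (Om T1) (\<lambda>w. V w * (\<psi> (fst w) * \<eta> \<epsilon> (snd w))) \<le> C2" by blast
    define D where "D = C1 + C2 + (LINT z|lborel. u0 z * \<psi> z)"
    have main: "(\<integral>\<^sup>+w. ennreal (U w) * indicator (K \<times> {2*\<epsilon><..<T}) w \<partial>lborel) \<le> ennreal (2 * T1 / (3 * B)) * ennreal D"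
      if e: "\<epsilon> \<in> {0<..<T}" for \<epsilon>
    proof -
      have "\<not> set_integrable lborel (Om T1) (\<lambda>w. U w * Lrad 0 0 (f \<epsilon>) (f1 \<epsilon>) (f2 \<epsilon>) g g1 g2 (fst w) (snd w))"
        using False e by blast
      then have z: "set_lebesgue_integral lborel (Om T1) (\<lambda>w. U w * Lrad 0 0 (f \<epsilon>) (f1 \<epsilon>) (f2 \<epsilon>) g g1 g2 (fst w) (snd w)) = 0"
        unfolding set_integrable_def set_lebesgue_integral_def by (rule not_integrable_integral_eq)
      have e0: "\<eta> \<epsilon> 0 = 1" by (simp add: \<eta>_def)
      have le: "- set_lebesgue_integral lborel (Om T1) (\<lambda>w. U w * (\<psi> (fst w) * \<eta>' \<epsilon> (snd w))) \<le> D"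
        using weak'[OF e] C1[OF e] C2[OF e] unfolding z e0 D_def by simp
      have cF: "continuous_on (UNIV \<times> {0..T1}) (\<lambda>w. \<psi> (fst w) * \<eta>' \<epsilon> (snd w))"
        using continuous_on_Lrad(2)[OF f[OF e] g, of "0::'x" "0::'y"] unfolding trad .
      have "set_integrable lborel (Om T1) (\<lambda>w. U w * indicator {\<epsilon>..} (snd w) * (\<psi> (fst w) * \<eta>' \<epsilon> (snd w)))"
        by (rule integrable_Om[OF _ _ loc0_restrict[of U K2 \<epsilon>] cF]) (use e psi0 U_nonneg in \<open>auto simp: K2_def\<close>)
      moreover have "U w * indicator {\<epsilon>..} (snd w) * (\<psi> (fst w) * \<eta>' \<epsilon> (snd w)) = U w * (\<psi> (fst w) * \<eta>' \<epsilon> (snd w))" if "w \<in> Om T1" for w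
        using that etab(6)[OF e, of "snd w"] by (auto simp: Om_def indicator_def)
      ultimately have I: "set_integrable lborel (Om T1) (\<lambda>w. U w * (\<psi> (fst w) * \<eta>' \<epsilon> (snd w)))"
        by (simp cong: set_integrable_cong)
      have nn: "0 \<le> - (indicator (Om T1) w *\<^sub>R (U w * (\<psi> (fst w) * \<eta>' \<epsilon> (snd w))))" for w
        using U_nonneg[of w] psin[of "fst w"] etab(5)[OF e, of "snd w"]
        by (cases "w \<in> Om T1") (auto simp: Om_def mult_nonneg_nonpos)
      have "(\<integral>\<^sup>+w. ennreal (- (indicator (Om T1) w *\<^sub>R (U w * (\<psi> (fst w) * \<eta>' \<epsilon> (snd w))))) \<partial>lborel) =
         ennreal (LINT w|lborel. - (indicator (Om T1) w *\<^sub>R (U w * (\<psi> (fst w) * \<eta>' \<epsilon> (snd w)))))"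
        by (rule nn_integral_eq_integral) (use I nn in \<open>simp_all add: set_integrable_def\<close>)
      also have "\<dots> \<le> ennreal D" using le by (intro ennreal_leI) (simp add: set_lebesgue_integral_def)
      finally have nD: "(\<integral>\<^sup>+w. ennreal (- (indicator (Om T1) w *\<^sub>R (U w * (\<psi> (fst w) * \<eta>' \<epsilon> (snd w))))) \<partial>lborel) \<le> ennreal D" .
      have "(\<integral>\<^sup>+w. ennreal (U w) * indicator (K \<times> {2*\<epsilon><..<T}) w \<partial>lborel) \<le>
         (\<integral>\<^sup>+w. ennreal (2 * T1 / (3 * B)) * ennreal (- (indicator (Om T1) w *\<^sub>R (U w * (\<psi> (fst w) * \<eta>' \<epsilon> (snd w))))) \<partial>lborel)"
      proof (rule nn_integral_mono)
        fix w :: "('x \<times> 'y) \<times> real"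
        show "ennreal (U w) * indicator (K \<times> {2*\<epsilon><..<T}) w \<le> ennreal (2 * T1 / (3 * B)) * ennreal (- (indicator (Om T1) w *\<^sub>R (U w * (\<psi> (fst w) * \<eta>' \<epsilon> (snd w)))))"
        proof (cases "w \<in> K \<times> {2*\<epsilon><..<T}")
          case True
          then have t: "w \<in> Om T1" "fst w \<in> K" "2 * \<epsilon> \<le> snd w" "snd w \<in> {0..T1}" using T e by (auto simp: Om_def T1_def)
          have "(3 * B) * (1 / (2 * T1)) \<le> \<psi> (fst w) * - \<eta>' \<epsilon> (snd w)"
            using psiK[OF t(2)] etab(7)[OF e t(4) t(3)] B T1 psin[of "fst w"] by (intro mult_mono) auto
          then have "1 \<le> (2 * T1 / (3 * B)) * (\<psi> (fst w) * - \<eta>' \<epsilon> (snd w))"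
            using B T1 by (simp add: field_simps)
          then have "U w * 1 \<le> U w * ((2 * T1 / (3 * B)) * (\<psi> (fst w) * - \<eta>' \<epsilon> (snd w)))"
            by (intro mult_left_mono U_nonneg)
          then have "U w \<le> (2 * T1 / (3 * B)) * (- (indicator (Om T1) w *\<^sub>R (U w * (\<psi> (fst w) * \<eta>' \<epsilon> (snd w)))))"
            using t(1) by (simp add: mult_ac)
          then have "ennreal (U w) \<le> ennreal (2 * T1 / (3 * B)) * ennreal (- (indicator (Om T1) w *\<^sub>R (U w * (\<psi> (fst w) * \<eta>' \<epsilon> (snd w)))))"
            using B T1 by (subst ennreal_mult[symmetric]) (use nn in \<open>auto intro!: ennreal_leI simp: nn\<close>)
          then show ?thesis using True by simp
        qed simp
      qed
      also have "\<dots> = ennreal (2 * T1 / (3 * B)) * (\<integral>\<^sup>+w. ennreal (- (indicator (Om T1) w *\<^sub>R (U w * (\<psi> (fst w) * \<eta>' \<epsilon> (snd w))))) \<partial>lborel)"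
        by (rule nn_integral_cmult) (use I in \<open>auto simp: set_integrable_def dest!: borel_measurable_integrable\<close>)
      also have "\<dots> \<le> ennreal (2 * T1 / (3 * B)) * ennreal D" by (intro mult_left_mono nD) simp
      finally show ?thesis .
    qed
    have "(\<integral>\<^sup>+w. ennreal (U w) * indicator (K \<times> {0<..<T}) w \<partial>lborel) \<le> ennreal (2 * T1 / (3 * B)) * ennreal D"
      unfolding K_def by (rule nn_integral_time_Fatou[OF U_meas _ T main[unfolded K_def]]) auto
    also have "\<dots> < \<infinity>" by (simp add: ennreal_mult_less_top)
    finally show ?thesis unfolding loc0_def K_def .
  qed
qed

end

lemma integrable_Om_iff_loc0:
  assumes [measurable]: "H \<in> borel_measurable borel" and "\<And>w. 0 \<le> H w" "loc0 K T H" and K: "compact K"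
  shows "set_integrable lborel (K \<times> {0<..<T}) H"
  unfolding set_integrable_def
proof (rule integrableI_bounded)
  have [measurable]: "K \<times> {0<..<T} \<in> sets borel"
    using borel_Times[of K "{0<..<T::real}"] borel_compact[OF K] by auto
  show "(\<lambda>x. indicat_real (K \<times> {0<..<T}) x *\<^sub>R H x) \<in> borel_measurable lborel" by measurable
  have "(\<integral>\<^sup>+x. ennreal (norm (indicat_real (K \<times> {0<..<T}) x *\<^sub>R H x)) \<partial>lborel) = (\<integral>\<^sup>+w. ennreal (H w) * indicator (K \<times> {0<..<T}) w \<partial>lborel)"
    by (rule nn_integral_cong) (auto simp: indicator_def assms(2))
  then show "(\<integral>\<^sup>+x. ennreal (norm (indicat_real (K \<times> {0<..<T}) x *\<^sub>R H x)) \<partial>lborel) < \<infinity>"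
    using assms(3) by (simp add: loc0_def)
qed

context nonneg_solution
begin

text \<open>The time cutoff vanishes up to \<open>\<epsilon>\<close>, so every integral converges
  and \<open>u0\<close> disappears. Its derivative is large, of order \<open>1 / \<epsilon>\<close>,
  only with the positive sign, which is the favourable one. The lower bound \<open>- 2 / T1\<close>
  is enough to control the nonlinear terms by the integral of \<open>U\<close>, uniformly in
  \<open>\<epsilon>\<close>.\<close>

lemma loc0_MV:
  assumes B: "B > 0" and T: "T > 0"
  shows "loc0 (Kb 0 0 B) T (\<lambda>w. M w + V w)"
proof -
  define K where "K = Kb (0::'x) (0::'y) B"
  define K2 where "K2 = Kb (0::'x) (0::'y) (2*B)"
  define T1 where "T1 = 2 * T"
  define \<kappa> where "\<kappa> \<epsilon> t = ramp \<epsilon> t * (1 - t / T1)^2" for \<epsilon> t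
  define \<kappa>' where "\<kappa>' \<epsilon> t = ramp' \<epsilon> t * (1 - t / T1)^2 - ramp \<epsilon> t * (2 * (1 - t / T1) / T1)" for \<epsilon> t
  define g where "g r t = cut0 3 (r / B)" for r t :: real
  define g1 where "g1 r t = cut1 3 (r / B) / B" for r t :: real
  define g2 where "g2 r t = cut2 3 (r / B) / B^2" for r t :: real
  define f where "f \<epsilon> r t = g r t * \<kappa> \<epsilon> t" for \<epsilon> r t
  define f1 where "f1 \<epsilon> r t = g1 r t * \<kappa> \<epsilon> t + g r t * 0" for \<epsilon> r t
  define f2 where "f2 \<epsilon> r t = g2 r t * \<kappa> \<epsilon> t + 2 * g1 r t * 0 + g r t * 0" for \<epsilon> r t
  define f' where "f' \<epsilon> r t = 0 * \<kappa> \<epsilon> t + g r t * \<kappa>' \<epsilon> t" for \<epsilon> r t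
  define \<psi> where "\<psi> z = g ((norm (fst z))^2) 0 * g ((norm (snd z))^2) 0" for z :: "'x \<times> 'y"
  define L where "L z = Lrad 0 0 g g1 g2 g g1 g2 z 0" for z :: "'x \<times> 'y"
  have T1: "T1 > 0" using T by (simp add: T1_def)
  have kap: "((\<lambda>t. \<kappa> \<epsilon> t) has_real_derivative \<kappa>' \<epsilon> t) (at t within {0..T1})" if "\<epsilon> > 0" for \<epsilon> t
  proof -
    have "((\<lambda>t. 1 - t / T1) has_real_derivative 0 - 1 / T1) (at t within {0..T1})"
      by (intro DERIV_diff DERIV_const DERIV_cdivide DERIV_ident)
    from DERIV_mult[OF ramp_deriv(1)[OF that] DERIV_power[OF this, of 2]] show ?thesis
      unfolding \<kappa>_def[abs_def] \<kappa>'_def by (rule DERIV_cong) (simp add: algebra_simps diff_divide_distrib)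
  qed
  have g: "profile T1 g g1 g2 (\<lambda>r t. 0)"
    unfolding g_def[abs_def] g1_def[abs_def] g2_def[abs_def] by (rule profile_cut) simp
  have f: "profile T1 (f \<epsilon>) (f1 \<epsilon>) (f2 \<epsilon>) (f' \<epsilon>)" if "\<epsilon> > 0" for \<epsilon>
  proof -
    have "continuous_on {0..T1} (\<kappa>' \<epsilon>)"
      unfolding \<kappa>'_def[abs_def] using that T1
      by (intro continuous_intros ramp_deriv(2)) (auto intro!: DERIV_continuous_on ramp_deriv(1))
    from profile_mult[OF g profile_time[OF this kap]] that
    show ?thesis unfolding f_def[abs_def] f1_def[abs_def] f2_def[abs_def] f'_def[abs_def] by simp
  qed
  have supp: "f \<epsilon> r t = 0" "g r t = 0" if "r > 2 * B" for \<epsilon> r t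
  proof -
    have "r / B \<ge> 2" using that B by (simp add: le_divide_eq)
    then have "cut0 3 (r / B) = 0" by (intro cut_bounds) auto
    then show "f \<epsilon> r t = 0" "g r t = 0" by (simp_all add: f_def g_def)
  qed
  have gb: "0 \<le> g r t" "g r t \<le> 1" for r t by (simp_all add: g_def cut_bounds)
  have fT: "f \<epsilon> r T1 = 0" for \<epsilon> r using T1 by (simp add: f_def \<kappa>_def)
  have rad: "radial2 0 0 (f \<epsilon>) g z t = \<psi> z * \<kappa> \<epsilon> t" for \<epsilon> z t by (simp add: radial2_def f_def g_def \<psi>_def)
  have trad: "Trad 0 0 (f \<epsilon>) (f' \<epsilon>) g (\<lambda>r t. 0) z t = \<psi> z * \<kappa>' \<epsilon> t" for \<epsilon> z t
    by (simp add: Trad_def radial2_def f'_def g_def \<psi>_def)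
  have lrad: "Lrad 0 0 (f \<epsilon>) (f1 \<epsilon>) (f2 \<epsilon>) g g1 g2 z t = L z * \<kappa> \<epsilon> t" for \<epsilon> z t
    by (simp add: Lrad_def L_def f_def f1_def f2_def g_def g1_def g2_def algebra_simps)
  have psi0: "\<psi> z = 0" "L z = 0" if "z \<notin> K2" for z
    using supp_rad(1,2)[OF g g T1 supp(2) supp(2), where z=z and a="0::'x" and c="0::'y" and t=0] that by (simp_all add: K2_def \<psi>_def L_def radial2_def)
  have psin: "0 \<le> \<psi> z" "\<psi> z \<le> 1" for z
    using gb by (auto simp: \<psi>_def intro: mult_le_one)
  have psiK: "\<psi> z = 1" if "z \<in> K" for z
    using that B by (simp add: K_def mem_Kb \<psi>_def g_def cut_bounds(3))
  obtain CL where CL: "CL \<ge> 0" "\<And>z. \<bar>L z\<bar> \<le> CL"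
  proof -
    obtain CL where "CL \<ge> 0" "\<And>z. z \<in> K2 \<Longrightarrow> \<bar>L z\<bar> \<le> CL"
      using continuous_bounded_slab[OF continuous_on_Lrad(1)[OF g g, of "0::'x" "0::'y"], of K2] T1 unfolding K2_def L_def by force
    then show ?thesis using psi0(2) that by (metis abs_zero)
  qed
  have kb: "0 \<le> \<kappa> \<epsilon> t" "\<kappa> \<epsilon> t \<le> 1" "t \<le> \<epsilon> \<Longrightarrow> \<kappa> \<epsilon> t = 0" "\<kappa>' \<epsilon> t \<ge> - (2 / T1)" "2 * \<epsilon> \<le> t \<Longrightarrow> t \<le> T \<Longrightarrow> \<kappa> \<epsilon> t \<ge> 1/8"
    if e: "\<epsilon> > 0" and t: "t \<in> {0..T1}" for \<epsilon> t
  proof -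
    note rb = ramp_bounds[OF e, of t]
    have u: "0 \<le> 1 - t / T1" "1 - t / T1 \<le> 1" using t T1 by auto
    show "0 \<le> \<kappa> \<epsilon> t" using rb by (simp add: \<kappa>_def)
    have "ramp \<epsilon> t * (1 - t / T1)^2 \<le> 1 * 1^2" using rb u by (intro mult_mono power_mono) auto
    then show "\<kappa> \<epsilon> t \<le> 1" by (simp add: \<kappa>_def)
    show "t \<le> \<epsilon> \<Longrightarrow> \<kappa> \<epsilon> t = 0" using rb by (simp add: \<kappa>_def)
    have "ramp \<epsilon> t * (2 * (1 - t / T1) / T1) \<le> 1 * (2 * 1 / T1)"
      using rb u T1 by (intro mult_mono divide_right_mono divide_nonneg_nonneg mult_nonneg_nonneg) auto
    moreover have "0 \<le> ramp' \<epsilon> t * (1 - t / T1)^2" using rb by simp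
    ultimately show "\<kappa>' \<epsilon> t \<ge> - (2 / T1)" by (simp add: \<kappa>'_def)
    assume "2 * \<epsilon> \<le> t" "t \<le> T"
    then have "1/2 * (1/2)^2 \<le> ramp \<epsilon> t * (1 - t / T1)^2"
      using rb T1 T by (intro mult_mono power_mono) (auto simp: T1_def field_simps)
    then show "\<kappa> \<epsilon> t \<ge> 1/8" by (simp add: \<kappa>_def power2_eq_square)
  qed
  have lU: "loc0 K2 T1 U" using loc0_U[of "2*B" T1] B T1 by (simp add: K2_def)
  define D where "D = (CL + 2 / T1) * (LINT w|lborel. indicator (K2 \<times> {0<..<T1}) w *\<^sub>R U w)"
  have main: "(\<integral>\<^sup>+w. ennreal (M w + V w) * indicator (K \<times> {2*\<epsilon><..<T}) w \<partial>lborel) \<le> ennreal 8 * ennreal D"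
    if "\<epsilon> \<in> {0<..<T}" for \<epsilon>
  proof -
    have e: "\<epsilon> > 0" using that by simp
    have cF: "continuous_on (UNIV \<times> {0..T1}) (\<lambda>w. \<psi> (fst w) * \<kappa> \<epsilon> (snd w))"
      "continuous_on (UNIV \<times> {0..T1}) (\<lambda>w. \<psi> (fst w) * \<kappa>' \<epsilon> (snd w))"
      "continuous_on (UNIV \<times> {0..T1}) (\<lambda>w. L (fst w) * \<kappa> \<epsilon> (snd w))"
      using continuous_on_Lrad[OF f[OF e] g, of "0::'x" "0::'y"] unfolding rad trad lrad by auto
    have IM: "set_integrable lborel (Om T1) (\<lambda>w. H w * (\<psi> (fst w) * \<kappa> \<epsilon> (snd w)))" if H: "H \<in> {M, V}" for H
    proof -
      have Hm [measurable]: "H \<in> borel_measurable borel" and Hn: "\<And>w. 0 \<le> H w" using H M_nonneg V_nonneg by auto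
      have "set_integrable lborel (Om T1) (\<lambda>w. H w * indicator {\<epsilon>..} (snd w) * (\<psi> (fst w) * \<kappa> \<epsilon> (snd w)))"
        by (rule integrable_Om[OF _ _ loc0_restrict[of H K2 \<epsilon>] cF(1)]) (use e psi0 Hn H in \<open>auto simp: K2_def\<close>)
      moreover have "H w * indicator {\<epsilon>..} (snd w) * (\<psi> (fst w) * \<kappa> \<epsilon> (snd w)) = H w * (\<psi> (fst w) * \<kappa> \<epsilon> (snd w))" if "w \<in> Om T1" for w
        using that kb(3)[OF e, of "snd w"] by (auto simp: Om_def indicator_def)
      ultimately show ?thesis by (simp cong: set_integrable_cong)
    qed
    have I3: "set_integrable lborel (Om T1) (\<lambda>w. U w * (L (fst w) * \<kappa> \<epsilon> (snd w)))"
      by (rule integrable_Om[OF U_meas U_nonneg lU cF(3)]) (use psi0 in \<open>auto simp: K2_def\<close>)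
    have I4: "set_integrable lborel (Om T1) (\<lambda>w. U w * (\<psi> (fst w) * \<kappa>' \<epsilon> (snd w)))"
      by (rule integrable_Om[OF U_meas U_nonneg lU cF(2)]) (use psi0 in \<open>auto simp: K2_def\<close>)
    have IU: "integrable lborel (\<lambda>w. (CL + 2 / T1) * (indicator (K2 \<times> {0<..<T1}) w *\<^sub>R U w))"
      using integrable_Om_iff_loc0[OF U_meas U_nonneg lU] unfolding set_integrable_def K2_def by simp
    have w: "0 = set_lebesgue_integral lborel (Om T1) (\<lambda>w. M w * (\<psi> (fst w) * \<kappa> \<epsilon> (snd w)))
   + set_lebesgue_integral lborel (Om T1) (\<lambda>w. V w * (\<psi> (fst w) * \<kappa> \<epsilon> (snd w)))
   + set_lebesgue_integral lborel (Om T1) (\<lambda>w. U w * (L (fst w) * \<kappa> \<epsilon> (snd w)))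
   + set_lebesgue_integral lborel (Om T1) (\<lambda>w. U w * (\<psi> (fst w) * \<kappa>' \<epsilon> (snd w)))"
      using weak[OF f[OF e] g T1 supp(1) supp(2) fT, where a=0 and c=0] kb(3)[OF e, of 0] e T1 unfolding rad trad lrad by simp
    have "set_lebesgue_integral lborel (Om T1) (\<lambda>w. M w * (\<psi> (fst w) * \<kappa> \<epsilon> (snd w)))
       + set_lebesgue_integral lborel (Om T1) (\<lambda>w. V w * (\<psi> (fst w) * \<kappa> \<epsilon> (snd w)))
       = - (LINT w|lborel. indicator (Om T1) w *\<^sub>R (U w * (L (fst w) * \<kappa> \<epsilon> (snd w))) + indicator (Om T1) w *\<^sub>R (U w * (\<psi> (fst w) * \<kappa>' \<epsilon> (snd w))))"
      using w I3 I4 unfolding set_lebesgue_integral_def set_integrable_def by simp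
    also have "\<dots> \<le> D"
    proof -
      have "- D \<le> (LINT w|lborel. indicator (Om T1) w *\<^sub>R (U w * (L (fst w) * \<kappa> \<epsilon> (snd w))) + indicator (Om T1) w *\<^sub>R (U w * (\<psi> (fst w) * \<kappa>' \<epsilon> (snd w))))"
        unfolding D_def integral_mult_right_zero[symmetric] integral_minus[symmetric]
      proof (rule integral_mono)
        fix w :: "('x \<times> 'y) \<times> real"
        show "- ((CL + 2 / T1) * (indicat_real (K2 \<times> {0<..<T1}) w *\<^sub>R U w))
         \<le> indicat_real (Om T1) w *\<^sub>R (U w * (L (fst w) * \<kappa> \<epsilon> (snd w))) + indicat_real (Om T1) w *\<^sub>R (U w * (\<psi> (fst w) * \<kappa>' \<epsilon> (snd w)))"
        proof (cases "w \<in> K2 \<times> {0<..<T1}")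
          case True
          then have t: "w \<in> Om T1" "snd w \<in> {0..T1}" by (auto simp: Om_def)
          have "\<bar>L (fst w) * \<kappa> \<epsilon> (snd w)\<bar> \<le> CL * 1" unfolding abs_mult
            using CL kb(1,2)[OF e t(2)] by (intro mult_mono) auto
          then have 1: "- CL \<le> L (fst w) * \<kappa> \<epsilon> (snd w)" by linarith
          have "1 * - (2 / T1) \<le> \<psi> (fst w) * \<kappa>' \<epsilon> (snd w)"
          proof (cases "\<kappa>' \<epsilon> (snd w) \<ge> 0")
            case True
            then show ?thesis using psin[of "fst w"] T1 by (auto intro: order_trans[of _ 0])
          next
            case False
            then have "1 * \<kappa>' \<epsilon> (snd w) \<le> \<psi> (fst w) * \<kappa>' \<epsilon> (snd w)"
              using psin[of "fst w"] by (intro mult_right_mono_neg) auto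
            then show ?thesis using kb(4)[OF e t(2)] by simp
          qed
          with 1 have "U w * - (CL + 2 / T1) \<le> U w * (L (fst w) * \<kappa> \<epsilon> (snd w) + \<psi> (fst w) * \<kappa>' \<epsilon> (snd w))"
            by (intro mult_left_mono U_nonneg) simp
          then show ?thesis using True t by (simp add: algebra_simps)
        next
          case False
          then show ?thesis using psi0 by (cases "w \<in> Om T1") (auto simp: Om_def indicator_def mem_Times_iff)
        qed
      qed (use IU I3 I4 in \<open>auto simp: set_integrable_def\<close>)
      then show ?thesis by simp
    qed
    finally have le: "set_lebesgue_integral lborel (Om T1) (\<lambda>w. M w * (\<psi> (fst w) * \<kappa> \<epsilon> (snd w)))
       + set_lebesgue_integral lborel (Om T1) (\<lambda>w. V w * (\<psi> (fst w) * \<kappa> \<epsilon> (snd w))) \<le> D" .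
    define G where "G w = indicator (Om T1) w *\<^sub>R (M w * (\<psi> (fst w) * \<kappa> \<epsilon> (snd w))) + indicator (Om T1) w *\<^sub>R (V w * (\<psi> (fst w) * \<kappa> \<epsilon> (snd w)))" for w
    have Gi: "integrable lborel G" "(LINT w|lborel. G w) \<le> D"
      using le IM[of M] IM[of V] unfolding G_def[abs_def] set_integrable_def set_lebesgue_integral_def by auto
    have Gn: "0 \<le> G w" for w
      using kb(1)[OF e, of "snd w"] psin[of "fst w"] M_nonneg[of w] V_nonneg[of w]
      by (cases "w \<in> Om T1") (auto simp: G_def Om_def)
    have "(\<integral>\<^sup>+w. ennreal (M w + V w) * indicator (K \<times> {2*\<epsilon><..<T}) w \<partial>lborel) \<le> (\<integral>\<^sup>+w. ennreal 8 * ennreal (G w) \<partial>lborel)"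
    proof (rule nn_integral_mono)
      fix w :: "('x \<times> 'y) \<times> real"
      show "ennreal (M w + V w) * indicator (K \<times> {2*\<epsilon><..<T}) w \<le> ennreal 8 * ennreal (G w)"
      proof (cases "w \<in> K \<times> {2*\<epsilon><..<T}")
        case True
        then have t: "w \<in> Om T1" "fst w \<in> K" "2 * \<epsilon> \<le> snd w" "snd w \<in> {0..T1}" "snd w \<le> T" using T e by (auto simp: Om_def T1_def)
        have "(M w + V w) * 1 \<le> (M w + V w) * (8 * \<kappa> \<epsilon> (snd w))"
          using kb(5)[OF e t(4) t(3) t(5)] M_nonneg[of w] V_nonneg[of w] by (intro mult_left_mono) auto
        then have "M w + V w \<le> 8 * G w" using t psiK[OF t(2)] by (simp add: G_def algebra_simps)
        then have "ennreal (M w + V w) \<le> ennreal (8 * G w)" by (rule ennreal_leI)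
        then show ?thesis using True Gn by (simp add: ennreal_mult)
      qed simp
    qed
    also have "\<dots> = ennreal 8 * (\<integral>\<^sup>+w. ennreal (G w) \<partial>lborel)"
      by (rule nn_integral_cmult) (use Gi(1) in \<open>auto dest!: borel_measurable_integrable\<close>)
    also have "(\<integral>\<^sup>+w. ennreal (G w) \<partial>lborel) = ennreal (LINT w|lborel. G w)"
      by (rule nn_integral_eq_integral[OF Gi(1)]) (use Gn in auto)
    also have "ennreal 8 * \<dots> \<le> ennreal 8 * ennreal D" by (intro mult_left_mono ennreal_leI Gi) simp
    finally show ?thesis .
  qed
  have "(\<integral>\<^sup>+w. ennreal (M w + V w) * indicator (K \<times> {0<..<T}) w \<partial>lborel) \<le> ennreal 8 * ennreal D"
    unfolding K_def by (rule nn_integral_time_Fatou[OF _ _ T main[unfolded K_def]]) auto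
  also have "\<dots> < \<infinity>" by (simp add: ennreal_mult_less_top)
  finally show ?thesis unfolding loc0_def K_def .
qed

lemma loc0_bounded:
  assumes "bounded K" "T > 0"
  shows "loc0 K T U" "loc0 K T M" "loc0 K T V" "loc0 K T (\<lambda>w. M w + V w)"
proof -
  obtain b where b: "\<And>z. z \<in> K \<Longrightarrow> norm z \<le> b" using assms(1) unfolding bounded_iff by blast
  define B where "B = b^2 + 1"
  have B: "B > 0" by (simp add: B_def add_nonneg_pos)
  have "z \<in> Kb 0 0 B" if "z \<in> K" for z
  proof -
    have "norm (fst z) \<le> b" "norm (snd z) \<le> b"
      using b[OF that] norm_fst_le[of "fst z" "snd z"] norm_snd_le[of "snd z" "fst z"] by simp_all
    then have "(norm (fst z))^2 \<le> b^2" "(norm (snd z))^2 \<le> b^2" by (auto intro: power_mono)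
    then show ?thesis by (simp add: mem_Kb B_def)
  qed
  then have KK: "indicator (K \<times> {0<..<T}) w \<le> (indicator (Kb 0 0 B \<times> {0<..<T}) w :: ennreal)" for w
    by (auto simp: indicator_def)
  have mono: "loc0 K T H" if "loc0 (Kb 0 0 B) T H'" "\<And>w. H w \<le> H' w" for H H'
    using that(1) unfolding loc0_def
    by (rule le_less_trans[rotated]) (intro nn_integral_mono mult_mono ennreal_leI that(2) KK; simp)
  show "loc0 K T U" "loc0 K T M" "loc0 K T V" "loc0 K T (\<lambda>w. M w + V w)"
    using mono[OF loc0_U[OF B assms(2)]] mono[OF loc0_MV[OF B assms(2)]] M_nonneg V_nonneg by auto
qed

end

section \<open>Nonexistence by rescaled cutoffs\<close>

text \<open>The weights of the two exponents are estimated by 1. The free \<open>\<delta>\<close>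
  serves either to absorb the power term into the left side (\<open>\<delta> = 1/2\<close>) or to
  show integrability of a product (\<open>\<delta> = 1\<close>).\<close>

lemma Young_scaled:
  fixes x y p \<delta> :: real
  assumes p: "p > 1" and x: "x \<ge> 0" and y: "y \<ge> 0" and d: "\<delta> > 0"
  shows "x * y \<le> \<delta> * x powr p + \<delta> powr (- 1 / (p - 1)) * y powr (p / (p - 1))"
proof -
  define q where "q = p / (p - 1)"
  have q: "q > 1" "1 / p + 1 / q = 1" using p by (auto simp: q_def field_simps)
  have "x * y = (\<delta> powr (1/p) * x) * (\<delta> powr (- 1/p) * y)"
    using d by (simp add: powr_minus field_simps)
  also have "\<dots> \<le> (\<delta> powr (1/p) * x) powr p / p + (\<delta> powr (- 1/p) * y) powr q / q"
    by (rule Youngs_inequality) (use p q x y in auto)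
  also have "\<dots> \<le> (\<delta> powr (1/p) * x) powr p + (\<delta> powr (- 1/p) * y) powr q"
    using p q by (intro add_mono divide_le_eq_1[THEN iffD2] mult_left_le) (auto simp: divide_le_eq mult_le_cancel_left1)
  also have "(\<delta> powr (1/p) * x) powr p = \<delta> * x powr p"
    using d x p by (simp add: powr_mult powr_powr)
  also have "(\<delta> powr (- 1/p) * y) powr q = \<delta> powr (- 1 / (p - 1)) * y powr q"
    using d y p by (simp add: powr_mult powr_powr q_def)
  finally show ?thesis unfolding q_def .
qed

text \<open>With \<open>q = p / (p - 1)\<close>, the growth \<open>n powr (a * q)\<close> of the
  measure of \<open>D n\<close> exactly offsets the factor \<open>n powr (- a)\<close> raised to the
  power \<open>q\<close>. Young's inequality therefore bounds the integrals uniformly, and Fatou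
  makes \<open>U powr p\<close> integrable. Because the offset is exact, Young alone gives no decay;
  decay comes from the integrability just gained, by splitting according to the size of
  \<open>U\<close>.\<close>

lemma AE_zero_of_test_inequality:
  fixes U :: "'a \<Rightarrow> real" and W :: "nat \<Rightarrow> 'a \<Rightarrow> real"
  assumes Um [measurable]: "U \<in> borel_measurable M" and U0: "\<And>x. U x \<ge> 0"
    and Wm [measurable]: "\<And>n. W n \<in> borel_measurable M" and W0: "\<And>n x. 0 \<le> W n x" "\<And>n x. W n x \<le> 1"
    and WD: "\<And>n x. x \<notin> D n \<Longrightarrow> W n x = 0" and Dm [measurable]: "\<And>n. D n \<in> sets M"
    and K: "K \<ge> 0" and C: "C \<ge> 0" and p: "p > 1" and a: "a > 0"
    and D: "\<And>n. n \<ge> 1 \<Longrightarrow> emeasure M (D n) \<le> ennreal (K * real n powr (a * (p / (p - 1))))"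
    and W1: "AE x in M. U x \<noteq> 0 \<longrightarrow> (\<lambda>n. W n x) \<longlonglongrightarrow> 1"
    and int: "\<forall>\<^sub>F n in sequentially. integrable M (\<lambda>x. U x powr p * W n x)"
    and ineq: "\<forall>\<^sub>F n in sequentially. (LINT x|M. U x powr p * W n x) \<le>
        C * real n powr (- a) * (LINT x|M. U x * W n x powr (1 / p))"
  shows "AE x in M. U x = 0"
proof -
  define q where "q = p / (p - 1)"
  have q: "q > 1" using p by (simp add: q_def)
  have ID: "integrable M (indicat_real (D n))" "(LINT x|M. indicat_real (D n) x) \<le> K * real n powr (a * q)" if "n \<ge> 1" for n
  proof -
    have "emeasure M (D n) < \<infinity>" using D[OF that] by (rule le_less_trans) simp
    then show "integrable M (indicat_real (D n))" using Dm by simp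
    show "(LINT x|M. indicat_real (D n) x) \<le> K * real n powr (a * q)"
      using D[OF that] K by (simp add: measure_def q_def enn2real_leI)
  qed
  have Wp: "(U x * W n x powr (1/p)) powr p = U x powr p * W n x" for n x
    using U0[of x] W0[of n x] p by (simp add: powr_mult powr_powr)
  have IU: "integrable M (\<lambda>x. U x * W n x powr (1 / p))" if i: "integrable M (\<lambda>x. U x powr p * W n x)" and n: "n \<ge> 1" for n
  proof (rule Bochner_Integration.integrable_bound)
    show "integrable M (\<lambda>x. U x powr p * W n x + indicat_real (D n) x)" using i ID[OF n] by auto
    have "U x * W n x powr (1 / p) \<le> U x powr p * W n x + indicat_real (D n) x" for x
    proof (cases "x \<in> D n")
      case True
      have "(U x * W n x powr (1 / p)) * 1 \<le> U x powr p * W n x + 1"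
        using Young_scaled[OF p, of "U x * W n x powr (1 / p)" 1 1] U0[of x] by (simp add: Wp)
      then show ?thesis using True by simp
    qed (use WD p in auto)
    then show "AE x in M. norm (U x * W n x powr (1 / p)) \<le> norm (U x powr p * W n x + indicat_real (D n) x)"
      using U0 W0 by (auto intro!: AE_I2 simp: order_trans[OF _ abs_ge_self])
  qed measurable
  obtain B where B: "B \<ge> 0" "\<forall>\<^sub>F n in sequentially. (LINT x|M. U x powr p * W n x) \<le> B"
  proof
    \<comment> \<open>The factor 2 undoes the absorption of half of the left side. Powers of
      \<open>n\<close> from the Young term and from the measure of \<open>D n\<close> cancel, so
      \<open>B\<close> is independent of \<open>n\<close>.\<close>
    define B where "B = 2 * ((1/2) powr (- 1 / (p - 1)) * C powr q * K)"
    show "B \<ge> 0" using K by (simp add: B_def)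
    show "\<forall>\<^sub>F n in sequentially. (LINT x|M. U x powr p * W n x) \<le> B"
      using int ineq eventually_ge_at_top[of 1]
    proof eventually_elim
      case (elim n)
      have n: "real n > 0" using elim by simp
      define y where "y = (1/2::real) powr (- 1 / (p - 1)) * (C * real n powr (- a)) powr q"
      have yq: "y = (1/2) powr (- 1 / (p - 1)) * C powr q * real n powr (- (a * q))"
        using C n by (simp add: y_def powr_mult powr_powr)
      have y0: "y \<ge> 0" by (simp add: y_def)
      have "C * real n powr (- a) * (LINT x|M. U x * W n x powr (1 / p)) = (LINT x|M. U x * W n x powr (1 / p) * (C * real n powr (- a)))"
        by (subst integral_mult_left_zero) (rule mult.commute)
      also have "\<dots> \<le> (LINT x|M. (1/2) * (U x powr p * W n x) + y * indicat_real (D n) x)"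
      proof (rule integral_mono)
        show "U x * W n x powr (1 / p) * (C * real n powr (- a)) \<le> (1/2) * (U x powr p * W n x) + y * indicat_real (D n) x" for x
        proof (cases "x \<in> D n")
          case True
          then show ?thesis
            using Young_scaled[OF p, of "U x * W n x powr (1 / p)" "C * real n powr (- a)" "1/2"] U0[of x] C
            by (simp add: Wp y_def q_def)
        qed (use WD p in auto)
      qed (use elim IU[of n] ID[of n] in auto)
      also have "\<dots> = (1/2) * (LINT x|M. U x powr p * W n x) + y * (LINT x|M. indicat_real (D n) x)"
        using elim IU[of n] ID[of n] by simp
      also have "y * (LINT x|M. indicat_real (D n) x) \<le> y * (K * real n powr (a * q))"
        using ID(2)[of n] elim y0 by (intro mult_left_mono) auto
      also have "y * (K * real n powr (a * q)) = B / 2"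
        using n by (simp add: yq B_def powr_minus field_simps)
      finally show ?case using elim by linarith
    qed
  qed
  have IUp: "integrable M (\<lambda>x. U x powr p)"
  proof (rule integrableI_bounded)
    have "(\<integral>\<^sup>+x. ennreal (U x powr p) \<partial>M) \<le> ennreal B"
    proof (rule nn_integral_Fatou_bound)
      show "(\<lambda>x. ennreal (U x powr p * W n x)) \<in> borel_measurable M" for n by measurable
      show "AE x in M. (\<lambda>n. ennreal (U x powr p * W n x)) \<longlonglongrightarrow> ennreal (U x powr p)"
        using W1
      proof eventually_elim
        case (elim x)
        show ?case
        proof (cases "U x = 0")
          case False
          with elim have "(\<lambda>n. U x powr p * W n x) \<longlonglongrightarrow> U x powr p * 1" by (intro tendsto_intros) auto
          then show ?thesis by (intro tendsto_ennrealI) simp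
        qed simp
      qed
      show "\<forall>\<^sub>F n in sequentially. (\<integral>\<^sup>+x. ennreal (U x powr p * W n x) \<partial>M) \<le> ennreal B"
        using int B(2)
      proof eventually_elim
        case (elim n)
        have "(\<integral>\<^sup>+x. ennreal (U x powr p * W n x) \<partial>M) = ennreal (LINT x|M. U x powr p * W n x)"
          using elim W0 by (intro nn_integral_eq_integral) auto
        then show ?case using elim by (simp add: ennreal_leI)
      qed
    qed
    then show "(\<integral>\<^sup>+x. ennreal (norm (U x powr p)) \<partial>M) < \<infinity>" by (simp add: le_less_trans)
  qed measurable
  have lim: "(\<lambda>n. LINT x|M. U x powr p * W n x) \<longlonglongrightarrow> (LINT x|M. U x powr p)"
  proof (rule integral_dominated_convergence[where w="\<lambda>x. U x powr p"])
    show "AE x in M. (\<lambda>n. U x powr p * W n x) \<longlonglongrightarrow> U x powr p"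
      using W1
    proof eventually_elim
      case (elim x)
      show ?case
      proof (cases "U x = 0")
        case False
        with elim have "(\<lambda>n. U x powr p * W n x) \<longlonglongrightarrow> U x powr p * 1" by (intro tendsto_intros) auto
        then show ?thesis by simp
      qed simp
    qed
    show "AE x in M. norm (U x powr p * W n x) \<le> U x powr p" for n
      using W0 by (auto intro!: AE_I2 mult_left_le simp: abs_mult)
  qed (use IUp in auto)
  \<comment> \<open>Where \<open>U \<le> \<mu> * n powr (- a / (p - 1))\<close>, the integrand is at
    most \<open>C * \<mu> * n powr (- (a * q))\<close>, which contributes at most
    \<open>C * \<mu> * K\<close> over \<open>D n\<close>. Elsewhere
    \<open>n powr (- a) \<le> (U / \<mu>) powr (p - 1)\<close>, so the integrand is dominated by a
    fixed multiple of \<open>U powr p\<close>.\<close>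
  have small: "(LINT x|M. U x powr p) \<le> C * \<mu> * K" if mu: "\<mu> > 0" for \<mu>
  proof -
    \<comment> \<open>The minimum combines two properties: its first entry tends to 0 pointwise, its
      second is an integrable majorant.\<close>
    define G where "G n x = min (C * real n powr (- a) * U x) (C * \<mu> powr (1 - p) * U x powr p)" for n x
    have Gd: "norm (G n x) \<le> C * \<mu> powr (1 - p) * U x powr p" for n x
      using C U0[of x] by (auto simp: G_def min_def)
    have Gi: "integrable M (G n)" for n
      by (rule Bochner_Integration.integrable_bound[OF integrable_mult_right[OF IUp, of "C * \<mu> powr (1 - p)"]])
         (use Gd in \<open>auto simp: G_def[abs_def] intro!: AE_I2 order_trans[OF _ abs_ge_self]\<close>)
    have G0: "(\<lambda>n. LINT x|M. G n x) \<longlonglongrightarrow> (LINT x|M. 0)"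
    proof (rule integral_dominated_convergence[where w="\<lambda>x. C * \<mu> powr (1 - p) * U x powr p"])
      show "AE x in M. (\<lambda>n. G n x) \<longlonglongrightarrow> 0"
      proof (rule AE_I2)
        fix x
        have "(\<lambda>n. real n powr (- a)) \<longlonglongrightarrow> 0"
          using tendsto_neg_powr[OF _ filterlim_real_sequentially, of "- a"] a by simp
        then have "(\<lambda>n. C * real n powr (- a) * U x) \<longlonglongrightarrow> C * 0 * U x" by (intro tendsto_intros)
        then have "(\<lambda>n. G n x) \<longlonglongrightarrow> min (C * 0 * U x) (C * \<mu> powr (1 - p) * U x powr p)"
          unfolding G_def by (intro tendsto_min) auto
        then show "(\<lambda>n. G n x) \<longlonglongrightarrow> 0" using C by simp
      qed
    qed (use Gd Gi IUp in auto)
    have "\<forall>\<^sub>F n in sequentially. (LINT x|M. U x powr p * W n x) \<le> (LINT x|M. G n x) + C * \<mu> * K"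
      using int ineq eventually_ge_at_top[of 1]
    proof eventually_elim
      case (elim n)
      have n: "real n > 0" using elim by simp
      define y where "y = C * \<mu> * real n powr (- (a * q))"
      have y0: "y \<ge> 0" using C mu by (simp add: y_def)
      have "C * real n powr (- a) * (LINT x|M. U x * W n x powr (1 / p)) = (LINT x|M. C * real n powr (- a) * (U x * W n x powr (1 / p)))"
        by simp
      also have "\<dots> \<le> (LINT x|M. G n x + y * indicat_real (D n) x)"
      proof (rule integral_mono)
        fix x
        show "C * real n powr (- a) * (U x * W n x powr (1 / p)) \<le> G n x + y * indicat_real (D n) x"
        proof (cases "x \<in> D n")
          case True
          have "W n x powr (1/p) \<le> 1 powr (1/p)" using W0 p by (intro powr_mono2) auto
          then have le: "C * real n powr (- a) * (U x * W n x powr (1 / p)) \<le> C * real n powr (- a) * U x"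
            using C U0[of x] by (intro mult_left_mono) (auto simp: mult_left_le)
          show ?thesis
          proof (cases "U x \<le> \<mu> * real n powr (- a / (p - 1))")
            case t: True
            have "C * real n powr (- a) * U x \<le> C * real n powr (- a) * (\<mu> * real n powr (- a / (p - 1)))"
              using t C by (intro mult_left_mono) auto
            also have "\<dots> = C * \<mu> * (real n powr (- a) * real n powr (- a / (p - 1)))" by simp
            also have "real n powr (- a) * real n powr (- a / (p - 1)) = real n powr (- (a * q))"
              unfolding powr_add[symmetric] using p by (intro arg_cong[where f="\<lambda>z. real n powr z"]) (simp add: q_def field_simps)
            finally have "C * real n powr (- a) * U x \<le> y" by (simp add: y_def)
            moreover have "0 \<le> G n x" using C U0[of x] by (auto simp: G_def)
            ultimately show ?thesis using le True by simp
          next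
            case f: False
            have Ux: "U x > 0" using f mu by (meson less_le_trans mult_nonneg_nonneg not_le powr_ge_zero less_imp_le order_trans U0 antisym_conv2)
            have "real n powr (- a / (p - 1)) \<le> U x / \<mu>" using f mu by (simp add: field_simps)
            then have "(real n powr (- a / (p - 1))) powr (p - 1) \<le> (U x / \<mu>) powr (p - 1)"
              using p by (intro powr_mono2) auto
            then have "real n powr (- a) \<le> (U x / \<mu>) powr (p - 1)" using p by (simp add: powr_powr)
            then have "C * (real n powr (- a) * U x) \<le> C * ((U x / \<mu>) powr (p - 1) * U x)"
              using C Ux by (intro mult_left_mono mult_right_mono) auto
            also have "(U x / \<mu>) powr (p - 1) * U x = \<mu> powr (1 - p) * U x powr p"
              using Ux mu p by (simp add: powr_divide powr_diff field_simps)
            finally have "G n x = C * real n powr (- a) * U x" by (simp add: G_def mult_ac)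
            then show ?thesis using le True y0 by simp
          qed
        next
          case False
          moreover have "0 \<le> G n x" using C U0[of x] by (auto simp: G_def)
          ultimately show ?thesis using WD p by simp
        qed
      qed (use elim IU[of n] ID[of n] Gi in auto)
      also have "\<dots> = (LINT x|M. G n x) + y * (LINT x|M. indicat_real (D n) x)"
        using elim ID[of n] Gi by simp
      also have "y * (LINT x|M. indicat_real (D n) x) \<le> y * (K * real n powr (a * q))"
        using ID(2)[of n] elim y0 by (intro mult_left_mono) auto
      also have "y * (K * real n powr (a * q)) = C * \<mu> * K"
        using n by (simp add: y_def powr_minus field_simps)
      finally show ?case using elim by linarith
    qed
    from tendsto_le[OF _ tendsto_add[OF G0 tendsto_const] lim this] show ?thesis by simp
  qed
  have "(LINT x|M. U x powr p) \<le> 0"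
  proof (rule field_le_epsilon)
    fix e :: real assume e: "e > 0"
    \<comment> \<open>The choice \<open>\<mu> = e / (C * K + 1)\<close> keeps the bound below
      \<open>e\<close> also when \<open>C * K\<close> is 0.\<close>
    define x where "x = C * K"
    have "x \<ge> 0" using C K by (simp add: x_def)
    then have "e * (x / (x + 1)) \<le> e * 1" using e by (intro mult_left_mono) auto
    then have "C * (e / (C * K + 1)) * K \<le> e" by (simp add: x_def mult_ac)
    then show "(LINT x|M. U x powr p) \<le> 0 + e"
      using small[of "e / (C * K + 1)"] C K e by (simp add: add_nonneg_pos)
  qed
  moreover have "0 \<le> (LINT x|M. U x powr p)" by simp
  ultimately have "(LINT x|M. U x powr p) = 0" by linarith
  then have "AE x in M. U x powr p = 0" using integral_nonneg_eq_0_iff_AE[OF IUp] by simp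
  then show ?thesis by simp
qed

lemma pred_Ioo [measurable (raw)]:
  fixes f g h :: "'a \<Rightarrow> real"
  assumes [measurable]: "f \<in> borel_measurable N" "g \<in> borel_measurable N" "h \<in> borel_measurable N"
  shows "Measurable.pred N (\<lambda>x. h x \<in> {f x<..<g x})"
  unfolding greaterThanLessThan_iff by measurable

lemma nn_integral_powr_Ioo:
  assumes a: "0 \<le> a" "a < 1" and st: "s < t"
  shows "(\<integral>\<^sup>+r. ennreal ((r - s) powr - a) * indicator {s<..<t} r \<partial>lborel) = ennreal ((t - s) powr (1 - a) / (1 - a))"
proof -
  have hi: "((\<lambda>x::real. x powr - a) has_integral ((t - s) powr (1 - a) / (1 - a))) {0..t - s}"
    using has_integral_powr_from_0[of "- a" "t - s"] a st by simp
  have "(\<integral>\<^sup>+x. ennreal (x powr - a) * indicator {0..t - s} x \<partial>lborel) = ennreal ((t - s) powr (1 - a) / (1 - a))"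
    by (rule nn_integral_has_integral_lebesgue'[OF _ hi, unfolded nn_integral_completion]) auto
  moreover have "(\<integral>\<^sup>+r. ennreal ((r - s) powr - a) * indicator {s<..<t} r \<partial>lborel)
      = (\<integral>\<^sup>+x. ennreal (x powr - a) * indicator {0<..<t - s} x \<partial>lborel)"
    by (subst nn_integral_real_affine[where c=1 and t=s]) (auto simp: indicator_def intro!: nn_integral_cong)
  moreover have "(\<integral>\<^sup>+x. ennreal (x powr - a) * indicator {0<..<t - s} x \<partial>lborel) = (\<integral>\<^sup>+x. ennreal (x powr - a) * indicator {0..t - s} x \<partial>lborel)"
    by (rule nn_integral_cong_AE) (use AE_lborel_singleton[of 0] AE_lborel_singleton[of "t - s"] in \<open>eventually_elim, auto simp: indicator_def\<close>)
  ultimately show ?thesis by simp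
qed

text \<open>Only the first half of \<open>(s, T)\<close> is used: there \<open>t - s\<close> is at
  most \<open>h\<close> and \<open>1 - t / T\<close> is at least \<open>v / 2\<close>. Together with
  the length \<open>h\<close> of that interval this produces \<open>T powr (1 - \<gamma>)\<close>
  and raises the exponent of \<open>1 - s / T\<close> from \<open>q\<close> to
  \<open>q + (1 - \<gamma>)\<close>.\<close>

lemma nn_integral_powr_lower:
  assumes \<gamma>: "0 < \<gamma>" "\<gamma> < 1" and s: "0 < s" "s < T"
  shows "ennreal (2 powr (\<gamma> - 1 - real q) * T powr (1 - \<gamma>) * (1 - s / T) powr (real q + (1 - \<gamma>)))
    \<le> (\<integral>\<^sup>+t. ennreal ((t - s) powr - \<gamma> * (1 - t / T) ^ q) * indicator {s<..<T} t \<partial>lborel)"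
proof -
  define h where "h = (T - s) / 2"
  define v where "v = 1 - s / T"
  have T: "T > 0" and h: "h > 0" and v: "v > 0" using s by (auto simp: h_def v_def)
  have Tv: "T - s = T * v" using T by (simp add: v_def field_simps)
  have "ennreal (h powr - \<gamma> * (v / 2) ^ q) * emeasure lborel {s<..<s + h}
      = (\<integral>\<^sup>+t. ennreal (h powr - \<gamma> * (v / 2) ^ q) * indicator {s<..<s + h} t \<partial>lborel)"
    by (simp add: nn_integral_cmult_indicator)
  also have "\<dots> \<le> (\<integral>\<^sup>+t. ennreal ((t - s) powr - \<gamma> * (1 - t / T) ^ q) * indicator {s<..<T} t \<partial>lborel)"
  proof (rule nn_integral_mono)
    fix t :: real
    show "ennreal (h powr - \<gamma> * (v / 2) ^ q) * indicator {s<..<s + h} t \<le> ennreal ((t - s) powr - \<gamma> * (1 - t / T) ^ q) * indicator {s<..<T} t"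
    proof (cases "t \<in> {s<..<s + h}")
      case True
      then have t: "t \<in> {s<..<T}" using s by (auto simp: h_def field_simps)
      have "h powr - \<gamma> \<le> (t - s) powr - \<gamma>" using True \<gamma> by (intro powr_mono2') auto
      moreover have "v / 2 \<le> 1 - t / T"
      proof -
        have "t \<le> (s + T) / 2" using True by (simp add: h_def field_simps)
        then have "t / T \<le> ((s + T) / 2) / T" using T by (intro divide_right_mono) auto
        also have "\<dots> = 1 - v / 2" using T by (simp add: v_def field_simps)
        finally show ?thesis by simp
      qed
      ultimately have "h powr - \<gamma> * (v / 2) ^ q \<le> (t - s) powr - \<gamma> * (1 - t / T) ^ q"
        using v by (intro mult_mono power_mono) auto
      then show ?thesis using True t by (simp add: ennreal_leI)
    qed simp
  qed
  also have "ennreal (h powr - \<gamma> * (v / 2) ^ q) * emeasure lborel {s<..<s + h} = ennreal (h powr - \<gamma> * (v / 2) ^ q * h)"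
  proof -
    have "emeasure lborel {s<..<s + h} = ennreal h" using h by simp
    then show ?thesis using h v by (simp add: ennreal_mult[symmetric] del: emeasure_lborel_Ioo)
  qed
  also have "h powr - \<gamma> * (v / 2) ^ q * h = h powr (1 - \<gamma>) * (v / 2) powr real q"
    using h v by (simp add: powr_diff powr_minus powr_realpow field_simps)
  also have "h powr (1 - \<gamma>) = T powr (1 - \<gamma>) * v powr (1 - \<gamma>) * 2 powr (\<gamma> - 1)"
    unfolding h_def Tv using T v by (simp add: powr_mult powr_divide powr_diff field_simps)
  also have "(v / 2) powr real q = v powr real q * 2 powr (- real q)"
    using v by (simp add: powr_divide powr_minus field_simps)
  also have "T powr (1 - \<gamma>) * v powr (1 - \<gamma>) * 2 powr (\<gamma> - 1) * (v powr real q * 2 powr (- real q)) =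
      2 powr (\<gamma> - 1 - real q) * T powr (1 - \<gamma>) * v powr (real q + (1 - \<gamma>))"
  proof -
    have "2 powr (\<gamma> - 1 - real q) = 2 powr (\<gamma> - 1) * 2 powr (- real q)" by (simp add: powr_add[symmetric])
    moreover have "v powr (real q + (1 - \<gamma>)) = v powr real q * v powr (1 - \<gamma>)" by (rule powr_add)
    ultimately show ?thesis by simp
  qed
  finally show ?thesis by (simp add: v_def)
qed

lemma nn_integral_lborel_Pair:
  fixes F :: "'a::euclidean_space \<times> 'b::euclidean_space \<Rightarrow> ennreal"
  assumes "F \<in> borel_measurable borel"
  shows "(\<integral>\<^sup>+w. F w \<partial>lborel) = (\<integral>\<^sup>+z. \<integral>\<^sup>+t. F (z, t) \<partial>lborel \<partial>lborel)"
proof -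
  have "F \<in> borel_measurable (lborel \<Otimes>\<^sub>M lborel)" using assms by (simp add: lborel_prod)
  from lborel.nn_integral_fst[OF this] show ?thesis by (simp add: lborel_prod)
qed

lemma measurable_section:
  fixes F :: "'a::euclidean_space \<times> 'b::euclidean_space \<Rightarrow> 'c::topological_space"
  assumes "F \<in> borel_measurable borel"
  shows "(\<lambda>t. F (z, t)) \<in> borel_measurable borel"
  by (rule measurable_compose[OF _ assms]) (auto intro!: borel_measurable_continuous_onI continuous_intros)

section \<open>Lower bound for the memory term by a weighted integral of the power
  \<open>p1\<close>\<close>

context nonneg_solution
begin

text \<open>Tonelli moves the time weight under the singular kernel, where
  \<open>nn_integral_powr_lower\<close> estimates it. The exchange concerns the extended integral
  \<open>N\<close>, which agrees with the Bochner integral in \<open>memterm\<close> only where it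
  is finite; \<open>fin\<close> guarantees this at almost every time.\<close>

lemma memory_section:
  assumes T: "T > 0" and fin: "(\<integral>\<^sup>+s. ennreal (U (z,s) powr p1) * indicator {0<..<T} s \<partial>lborel) < \<infinity>"
  shows "ennreal (2 powr (\<gamma> - 1 - real q) * T powr (1 - \<gamma>)) *
      (\<integral>\<^sup>+s. ennreal (U (z,s) powr p1 * (1 - s / T) powr (real q + (1 - \<gamma>))) * indicator {0<..<T} s \<partial>lborel)
    \<le> (\<integral>\<^sup>+t. ennreal (M (z,t) * (1 - t / T) ^ q) * indicator {0<..<T} t \<partial>lborel)"
proof -
  define h where "h s = U (z,s) powr p1" for s
  have Us [measurable]: "(\<lambda>s. U (z,s)) \<in> borel_measurable borel" by (rule measurable_section[OF U_meas])
  then have hm [measurable]: "h \<in> borel_measurable borel" unfolding h_def by measurable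
  have h0: "h s \<ge> 0" for s by (simp add: h_def)
  define N where "N t = (\<integral>\<^sup>+s. ennreal ((t - s) powr - \<gamma> * h s) * indicator {0<..<t} s \<partial>lborel)" for t
  have swap: "(\<integral>\<^sup>+t. N t * (ennreal (k t) * indicator {0<..<T} t) \<partial>lborel) =
      (\<integral>\<^sup>+s. ennreal (h s) * indicator {0<..<T} s * (\<integral>\<^sup>+t. ennreal ((t - s) powr - \<gamma> * k t) * indicator {s<..<T} t \<partial>lborel) \<partial>lborel)"
    if [measurable]: "k \<in> borel_measurable borel" and k: "\<And>t. t \<in> {0<..<T} \<Longrightarrow> k t \<ge> 0" for k
  proof -
    have "(\<integral>\<^sup>+t. N t * (ennreal (k t) * indicator {0<..<T} t) \<partial>lborel) =
      (\<integral>\<^sup>+t. (\<integral>\<^sup>+s. ennreal ((t - s) powr - \<gamma> * h s) * indicator {0<..<t} s * (ennreal (k t) * indicator {0<..<T} t) \<partial>lborel) \<partial>lborel)"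
      unfolding N_def by (intro nn_integral_cong nn_integral_multc[symmetric]) measurable
    also have "\<dots> = (\<integral>\<^sup>+t. (\<integral>\<^sup>+s. ennreal (h s) * indicator {0<..<T} s * (ennreal ((t - s) powr - \<gamma> * k t) * indicator {s<..<T} t) \<partial>lborel) \<partial>lborel)"
    proof (intro nn_integral_cong)
      fix t s :: real
      show "ennreal ((t - s) powr - \<gamma> * h s) * indicator {0<..<t} s * (ennreal (k t) * indicator {0<..<T} t) =
         ennreal (h s) * indicator {0<..<T} s * (ennreal ((t - s) powr - \<gamma> * k t) * indicator {s<..<T} t)"
      proof (cases "0 < s \<and> s < t \<and> t < T")
        case True
        then show ?thesis using h0[of s] k[of t] by (simp add: ennreal_mult mult_ac)
      qed (auto simp: indicator_def)
    qed
    also have "\<dots> = (\<integral>\<^sup>+s. (\<integral>\<^sup>+t. ennreal (h s) * indicator {0<..<T} s * (ennreal ((t - s) powr - \<gamma> * k t) * indicator {s<..<T} t) \<partial>lborel) \<partial>lborel)"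
      by (rule lborel_pair.Fubini') measurable
    also have "\<dots> = (\<integral>\<^sup>+s. ennreal (h s) * indicator {0<..<T} s * (\<integral>\<^sup>+t. ennreal ((t - s) powr - \<gamma> * k t) * indicator {s<..<T} t \<partial>lborel) \<partial>lborel)"
      by (intro nn_integral_cong nn_integral_cmult) measurable
    finally show ?thesis .
  qed
  have Nm [measurable]: "N \<in> borel_measurable borel"
    unfolding N_def by measurable
  have "(\<integral>\<^sup>+t. N t * (ennreal 1 * indicator {0<..<T} t) \<partial>lborel) = (\<integral>\<^sup>+s. ennreal (h s) * indicator {0<..<T} s * (\<integral>\<^sup>+t. ennreal ((t - s) powr - \<gamma> * 1) * indicator {s<..<T} t \<partial>lborel) \<partial>lborel)"
    by (rule swap) auto
  also have "\<dots> \<le> (\<integral>\<^sup>+s. ennreal (T powr (1 - \<gamma>) / (1 - \<gamma>)) * (ennreal (h s) * indicator {0<..<T} s) \<partial>lborel)"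
  proof (rule nn_integral_mono)
    fix s :: real
    show "ennreal (h s) * indicator {0<..<T} s * (\<integral>\<^sup>+t. ennreal ((t - s) powr - \<gamma> * 1) * indicator {s<..<T} t \<partial>lborel) \<le> ennreal (T powr (1 - \<gamma>) / (1 - \<gamma>)) * (ennreal (h s) * indicator {0<..<T} s)"
    proof (cases "s \<in> {0<..<T}")
      case True
      have "(T - s) powr (1 - \<gamma>) \<le> T powr (1 - \<gamma>)" using True gam by (intro powr_mono2) auto
      then have "(\<integral>\<^sup>+t. ennreal ((t - s) powr - \<gamma> * 1) * indicator {s<..<T} t \<partial>lborel) \<le> ennreal (T powr (1 - \<gamma>) / (1 - \<gamma>))"
        using nn_integral_powr_Ioo[of \<gamma> s T] True gam by (simp add: divide_right_mono ennreal_leI)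
      then show ?thesis by (subst mult.commute) (rule mult_right_mono, auto)
    qed simp
  qed
  also have "\<dots> = ennreal (T powr (1 - \<gamma>) / (1 - \<gamma>)) * (\<integral>\<^sup>+s. (ennreal (h s) * indicator {0<..<T} s) \<partial>lborel)"
    by (rule nn_integral_cmult) measurable
  also have "\<dots> < \<infinity>" using fin by (simp add: ennreal_mult_less_top h_def)
  finally have "(\<integral>\<^sup>+t. N t * indicator {0<..<T} t \<partial>lborel) < \<infinity>" by simp
  \<comment> \<open>Finiteness of \<open>N\<close> comes from the exchange with weight 1: its
    integral over \<open>(0, T)\<close> is at most a constant times that of \<open>h\<close>,
    because the kernel is integrable in \<open>t\<close>.\<close>
  then have "AE t in lborel. N t * indicator {0<..<T} t \<noteq> \<infinity>" by (intro nn_integral_PInf_AE) auto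
  then have MN: "AE t in lborel. N t * (ennreal ((1 - t / T) ^ q) * indicator {0<..<T} t) = ennreal (M (z,t) * (1 - t / T) ^ q) * indicator {0<..<T} t"
  proof eventually_elim
    case (elim t)
    show ?case
    proof (cases "t \<in> {0<..<T}")
      case True
      have "M (z,t) = (LINT s|lborel. (t - s) powr - \<gamma> * h s * indicator {0<..<t} s)"
      proof -
        have eq: "indicator {0<..<t} s *\<^sub>R ((t - s) powr - \<gamma> * (\<bar>u z s\<bar> powr (p1 - 1) * u z s)) = (t - s) powr - \<gamma> * h s * indicator {0<..<t} s" for s
        proof -
          have "\<bar>u z s\<bar> powr (p1 - 1) * u z s = h s" if "s > 0"
          proof (cases "u z s = 0")
            case False
            then have "u z s > 0" using u_nn[OF that, of z] by simp
            then show ?thesis using that p1 by (simp add: h_def U_def powr_mult_base mult.commute)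
          qed (use that in \<open>simp add: h_def U_def\<close>)
          then show ?thesis by (simp add: indicator_def)
        qed
        have "M (z,t) = memterm \<gamma> p1 u z t" using True by (simp add: M_def)
        then show ?thesis unfolding memterm_def set_lebesgue_integral_def eq .
      qed
      also have "\<dots> = enn2real (\<integral>\<^sup>+s. ennreal ((t - s) powr - \<gamma> * h s * indicator {0<..<t} s) \<partial>lborel)"
        by (rule integral_eq_nn_integral) (use h0 in auto)
      also have "(\<integral>\<^sup>+s. ennreal ((t - s) powr - \<gamma> * h s * indicator {0<..<t} s) \<partial>lborel) = N t"
        unfolding N_def by (intro nn_integral_cong) (auto simp: indicator_def)
      finally have "ennreal (M (z,t)) = N t" using elim True by (simp add: less_top)
      then show ?thesis using True M_nonneg[of "(z,t)"] by (simp add: ennreal_mult)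
    qed simp
  qed
  have "ennreal (2 powr (\<gamma> - 1 - real q) * T powr (1 - \<gamma>)) *
      (\<integral>\<^sup>+s. ennreal (h s * (1 - s / T) powr (real q + (1 - \<gamma>))) * indicator {0<..<T} s \<partial>lborel) =
      (\<integral>\<^sup>+s. ennreal (2 powr (\<gamma> - 1 - real q) * T powr (1 - \<gamma>)) * (ennreal (h s * (1 - s / T) powr (real q + (1 - \<gamma>))) * indicator {0<..<T} s) \<partial>lborel)"
    by (rule nn_integral_cmult[symmetric]) measurable
  also have "\<dots> \<le> (\<integral>\<^sup>+s. ennreal (h s) * indicator {0<..<T} s * (\<integral>\<^sup>+t. ennreal ((t - s) powr - \<gamma> * (1 - t / T) ^ q) * indicator {s<..<T} t \<partial>lborel) \<partial>lborel)"
  proof (rule nn_integral_mono)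
    fix s :: real
    show "ennreal (2 powr (\<gamma> - 1 - real q) * T powr (1 - \<gamma>)) * (ennreal (h s * (1 - s / T) powr (real q + (1 - \<gamma>))) * indicator {0<..<T} s)
      \<le> ennreal (h s) * indicator {0<..<T} s * (\<integral>\<^sup>+t. ennreal ((t - s) powr - \<gamma> * (1 - t / T) ^ q) * indicator {s<..<T} t \<partial>lborel)"
    proof (cases "s \<in> {0<..<T}")
      case True
      then have "ennreal (h s) * ennreal (2 powr (\<gamma> - 1 - real q) * T powr (1 - \<gamma>) * (1 - s / T) powr (real q + (1 - \<gamma>)))
         \<le> ennreal (h s) * (\<integral>\<^sup>+t. ennreal ((t - s) powr - \<gamma> * (1 - t / T) ^ q) * indicator {s<..<T} t \<partial>lborel)"
        by (intro mult_left_mono nn_integral_powr_lower gam) auto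
      then show ?thesis using True h0[of s] by (simp add: ennreal_mult mult_ac)
    qed simp
  qed
  also have "\<dots> = (\<integral>\<^sup>+t. N t * (ennreal ((1 - t / T) ^ q) * indicator {0<..<T} t) \<partial>lborel)"
    by (rule swap[symmetric]) auto
  also have "\<dots> = (\<integral>\<^sup>+t. ennreal (M (z,t) * (1 - t / T) ^ q) * indicator {0<..<T} t \<partial>lborel)"
    by (rule nn_integral_cong_AE[OF MN])
  finally show ?thesis by (simp add: h_def)
qed

text \<open>The section estimate is multiplied by the spatial factor and integrated in
  \<open>z\<close>, so finiteness at almost every \<open>z\<close> is enough.\<close>

lemma memory_lower:
  assumes T: "T > 0" and fin: "AE z in lborel. (\<integral>\<^sup>+s. ennreal (U (z,s) powr p1) * indicator {0<..<T} s \<partial>lborel) < \<infinity>"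
    and psi [measurable]: "\<psi> \<in> borel_measurable borel" and psi0: "\<And>z. 0 \<le> \<psi> z"
  shows "ennreal (2 powr (\<gamma> - 1 - real q) * T powr (1 - \<gamma>)) *
      (\<integral>\<^sup>+w. ennreal (U w powr p1 * (\<psi> (fst w) * (1 - snd w / T) powr (real q + (1 - \<gamma>)))) * indicator (Om T) w \<partial>lborel)
    \<le> (\<integral>\<^sup>+w. ennreal (M w * (\<psi> (fst w) * (1 - snd w / T) ^ q)) * indicator (Om T) w \<partial>lborel)"
proof -
  have ind: "indicator (Om T) (z,t) = (indicator {0<..<T} t :: ennreal)" for z :: "'x \<times> 'y" and t by (auto simp: Om_def indicator_def)
  have Us [measurable]: "(\<lambda>s. U (z,s)) \<in> borel_measurable borel" "(\<lambda>s. M (z,s)) \<in> borel_measurable borel" for z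
    by (rule measurable_section[OF U_meas] measurable_section[OF M_meas])+
  have "(\<integral>\<^sup>+w. ennreal (U w powr p1 * (\<psi> (fst w) * (1 - snd w / T) powr (real q + (1 - \<gamma>)))) * indicator (Om T) w \<partial>lborel)
     = (\<integral>\<^sup>+z. \<integral>\<^sup>+t. ennreal (\<psi> z) * (ennreal (U (z,t) powr p1 * (1 - t / T) powr (real q + (1 - \<gamma>))) * indicator {0<..<T} t) \<partial>lborel \<partial>lborel)"
    by (subst nn_integral_lborel_Pair, measurable) (auto simp: ind ennreal_mult psi0 mult_ac intro!: nn_integral_cong)
  also have "\<dots> = (\<integral>\<^sup>+z. ennreal (\<psi> z) * (\<integral>\<^sup>+t. ennreal (U (z,t) powr p1 * (1 - t / T) powr (real q + (1 - \<gamma>))) * indicator {0<..<T} t \<partial>lborel) \<partial>lborel)"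
    by (intro nn_integral_cong nn_integral_cmult) measurable
  finally have L: "(\<integral>\<^sup>+w. ennreal (U w powr p1 * (\<psi> (fst w) * (1 - snd w / T) powr (real q + (1 - \<gamma>)))) * indicator (Om T) w \<partial>lborel) = \<dots>" .
  have "(\<integral>\<^sup>+w. ennreal (M w * (\<psi> (fst w) * (1 - snd w / T) ^ q)) * indicator (Om T) w \<partial>lborel)
     = (\<integral>\<^sup>+z. \<integral>\<^sup>+t. ennreal (\<psi> z) * (ennreal (M (z,t) * (1 - t / T) ^ q) * indicator {0<..<T} t) \<partial>lborel \<partial>lborel)"
    by (subst nn_integral_lborel_Pair, measurable) (auto simp: ind ennreal_mult' psi0 M_nonneg mult_ac intro!: nn_integral_cong)
  also have "\<dots> = (\<integral>\<^sup>+z. ennreal (\<psi> z) * (\<integral>\<^sup>+t. ennreal (M (z,t) * (1 - t / T) ^ q) * indicator {0<..<T} t \<partial>lborel) \<partial>lborel)"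
    by (intro nn_integral_cong nn_integral_cmult) measurable
  finally have R: "(\<integral>\<^sup>+w. ennreal (M w * (\<psi> (fst w) * (1 - snd w / T) ^ q)) * indicator (Om T) w \<partial>lborel) = \<dots>" .
  have "ennreal (2 powr (\<gamma> - 1 - real q) * T powr (1 - \<gamma>)) * (\<integral>\<^sup>+z. ennreal (\<psi> z) * (\<integral>\<^sup>+t. ennreal (U (z,t) powr p1 * (1 - t / T) powr (real q + (1 - \<gamma>))) * indicator {0<..<T} t \<partial>lborel) \<partial>lborel)
    = (\<integral>\<^sup>+z. ennreal (2 powr (\<gamma> - 1 - real q) * T powr (1 - \<gamma>)) * (ennreal (\<psi> z) * (\<integral>\<^sup>+t. ennreal (U (z,t) powr p1 * (1 - t / T) powr (real q + (1 - \<gamma>))) * indicator {0<..<T} t \<partial>lborel)) \<partial>lborel)"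
  proof (rule nn_integral_cmult[symmetric])
    have "(\<lambda>w. ennreal (U w powr p1 * (1 - snd w / T) powr (real q + (1 - \<gamma>))) * indicator {0<..<T} (snd w)) \<in> borel_measurable (lborel \<Otimes>\<^sub>M lborel)"
      unfolding lborel_prod by measurable
    from lborel.borel_measurable_nn_integral_fst[OF this]
    show "(\<lambda>z. ennreal (\<psi> z) * (\<integral>\<^sup>+t. ennreal (U (z,t) powr p1 * (1 - t / T) powr (real q + (1 - \<gamma>))) * indicator {0<..<T} t \<partial>lborel)) \<in> borel_measurable lborel"
      by (auto intro!: borel_measurable_times)
  qed
  also have "\<dots> \<le> (\<integral>\<^sup>+z. ennreal (\<psi> z) * (\<integral>\<^sup>+t. ennreal (M (z,t) * (1 - t / T) ^ q) * indicator {0<..<T} t \<partial>lborel) \<partial>lborel)"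
  proof (rule nn_integral_mono_AE, use fin in eventually_elim)
    case (elim z)
    from mult_left_mono[OF memory_section[OF T elim, of q], of "ennreal (\<psi> z)"]
    show ?case by (simp add: mult_ac)
  qed
  finally show ?thesis unfolding L R .
qed

text \<open>All terms are now integrable on bounded sets up to \<open>t = 0\<close>: the identity no
  longer hides divergent integrals, and the two terms in \<open>U\<close> may be merged.\<close>

lemma weak_up_to_zero:
  assumes f: "profile T f f1 f2 f'" and g: "profile T g g1 g2 g'" and T: "T > 0"
    and f0: "\<And>r t. r > \<rho> \<Longrightarrow> f r t = 0" and g0: "\<And>r t. r > \<rho> \<Longrightarrow> g r t = 0" and fT: "\<And>r. f r T = 0"
  shows "set_integrable lborel (Om T) (\<lambda>w. M w * radial2 a c f g (fst w) (snd w))" (is ?A)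
   and "set_integrable lborel (Om T) (\<lambda>w. V w * radial2 a c f g (fst w) (snd w))" (is ?B)
   and "set_integrable lborel (Om T) (\<lambda>w. U w * (Lrad a c f f1 f2 g g1 g2 (fst w) (snd w) + Trad a c f f' g g' (fst w) (snd w)))" (is ?C)
   and "(LINT z|lborel. u0 z * radial2 a c f g z 0)
     + set_lebesgue_integral lborel (Om T) (\<lambda>w. M w * radial2 a c f g (fst w) (snd w))
     + set_lebesgue_integral lborel (Om T) (\<lambda>w. V w * radial2 a c f g (fst w) (snd w)) =
     - set_lebesgue_integral lborel (Om T) (\<lambda>w. U w * (Lrad a c f f1 f2 g g1 g2 (fst w) (snd w) + Trad a c f f' g g' (fst w) (snd w)))"
proof -
  have b: "bounded (Kb a c \<rho>)" by (simp add: compact_imp_bounded)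
  note l = loc0_bounded[OF b T]
  note c = continuous_on_Lrad[OF f g, of a c]
  note s = supp_rad[OF f g T f0 g0, where a=a and c=c and \<rho>=\<rho>]
  show ?A ?B
    using s by (auto intro!: integrable_Om[OF M_meas M_nonneg l(2) c(3)] integrable_Om[OF V_meas V_nonneg l(3) c(3)])
  have L: "set_integrable lborel (Om T) (\<lambda>w. U w * Lrad a c f f1 f2 g g1 g2 (fst w) (snd w))"
    using s by (auto intro!: integrable_Om[OF U_meas U_nonneg l(1) c(1)])
  have Tr: "set_integrable lborel (Om T) (\<lambda>w. U w * Trad a c f f' g g' (fst w) (snd w))"
    using s by (auto intro!: integrable_Om[OF U_meas U_nonneg l(1) c(2)])
  from set_integral_add[OF L Tr] show ?C by (simp add: distrib_left)
  show "(LINT z|lborel. u0 z * radial2 a c f g z 0)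
     + set_lebesgue_integral lborel (Om T) (\<lambda>w. M w * radial2 a c f g (fst w) (snd w))
     + set_lebesgue_integral lborel (Om T) (\<lambda>w. V w * radial2 a c f g (fst w) (snd w)) =
     - set_lebesgue_integral lborel (Om T) (\<lambda>w. U w * (Lrad a c f f1 f2 g g1 g2 (fst w) (snd w) + Trad a c f f' g g' (fst w) (snd w)))"
    using weak[OF f g T f0 g0 fT, where a=a and c=c and \<rho>=\<rho>] set_integral_add(2)[OF L Tr] by (simp add: distrib_left)
qed

end

text \<open>Kept without its exponent, because the estimates compare the powers \<open>l\<close>,
  \<open>l - 2\<close> and \<open>l / p\<close> of one and the same base.\<close>

definition scaled_cut :: "real \<Rightarrow> real \<Rightarrow> ('x::euclidean_space \<times> 'y::euclidean_space) \<Rightarrow> real" where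
  "scaled_cut A B z = cbase ((norm (fst z))\<^sup>2 / A) * cbase ((norm (snd z))\<^sup>2 / B)"

lemma scaled_cut_bounds: "0 \<le> scaled_cut A B z" "scaled_cut A B z \<le> 1"
  unfolding scaled_cut_def by (auto intro: mult_le_one simp: cbase_bounds)

lemma scaled_cut_zero:
  assumes "A > 0" "B > 0" "z \<notin> cball 0 (sqrt (2 * A)) \<times> cball 0 (sqrt (2 * B))"
  shows "scaled_cut A B z = 0"
proof -
  have *: "cbase ((norm v)\<^sup>2 / A) = 0" if "A > 0" "\<not> norm v \<le> sqrt (2 * A)" for A and v :: "'c::real_normed_vector"
  proof (rule cbase_bounds(4))
    have "sqrt (2 * A) ^ 2 \<le> (norm v)\<^sup>2" using that by (intro power_mono) auto
    then show "2 \<le> (norm v)\<^sup>2 / A" using that by (simp add: field_simps)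
  qed
  have "\<not> norm (fst z) \<le> sqrt (2 * A) \<or> \<not> norm (snd z) \<le> sqrt (2 * B)"
    using assms(3) by (auto simp: mem_Times_iff)
  then show ?thesis using *[OF assms(1)] *[OF assms(2)] by (auto simp: scaled_cut_def)
qed

lemma continuous_on_scaled_cut:
  assumes "A > 0" "B > 0"
  shows "continuous_on S (scaled_cut A B)"
proof -
  have c: "continuous_on UNIV cbase" unfolding cbase_def[abs_def] by (intro continuous_intros)
  show ?thesis unfolding scaled_cut_def[abs_def] using assms
    by (intro continuous_intros continuous_on_compose2[OF c]) auto
qed

text \<open>On the support \<open>|x|^2\<close> is at most \<open>2 * A\<close>, so the degenerate
  part costs \<open>A / B\<close> rather than \<open>1 / B\<close>. With \<open>B = A^2\<close> both
  parts are of order \<open>1 / A\<close>; this is the origin of the scales \<open>T powr e\<close>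
  and \<open>T powr (2 * e)\<close>.\<close>

lemma Lrad_cut_bound:
  fixes z :: "'x::euclidean_space \<times> 'y::euclidean_space"
  assumes l: "l \<ge> 3" and A: "A > 0" and B: "B > 0"
  shows "\<bar>Lrad 0 0 (\<lambda>r t. cut0 l (r / A)) (\<lambda>r t. cut1 l (r / A) / A) (\<lambda>r t. cut2 l (r / A) / A^2)
      (\<lambda>r t. cut0 l (r / B)) (\<lambda>r t. cut1 l (r / B) / B) (\<lambda>r t. cut2 l (r / B) / B^2) z t\<bar>
    \<le> 15 * real l ^ 2 * ((8 + 2 * real DIM('x)) / A + 2 * (8 + 2 * real DIM('y)) * (A / B)) * scaled_cut A B z ^ (l - 2)"
proof -
  define k where "k = 15 * real l ^ 2"
  define X where "X = (norm (fst z))\<^sup>2"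
  define Y where "Y = (norm (snd z))\<^sup>2"
  have k: "k \<ge> 0" by (simp add: k_def)
  have XY: "X \<ge> 0" "Y \<ge> 0" by (auto simp: X_def Y_def)
  \<comment> \<open>Where the derivatives do not vanish, \<open>X / A\<close> is below 2, so the
    factor \<open>4 * X / A\<close> contributes at most 8.\<close>
  have one: "\<bar>4 * X * (cut2 l (X / A) / A^2) + 2 * n * (cut1 l (X / A) / A)\<bar> \<le> k * ((8 + 2 * n) / A) * cbase (X / A) ^ (l - 2)"
    if "X \<ge> 0" "A > 0" "n \<ge> 0" for X A n :: real
  proof (cases "X / A \<ge> 2")
    case True
    then show ?thesis using cut_bounds(9,10)[OF l True] k that by (simp add: cbase_bounds)
  next
    case False
    then have "X / A \<le> 2" by simp
    then have "\<bar>4 * (X / A) * (cut2 l (X / A))\<bar> \<le> (4 * 2) * (k * cbase (X / A) ^ (l - 2))"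
      using cut_bounds(6)[OF l, of "X / A"] that unfolding abs_mult by (intro mult_mono) (auto simp: k_def)
    moreover have "\<bar>2 * n * cut1 l (X / A)\<bar> \<le> 2 * n * (k * cbase (X / A) ^ (l - 2))"
      using cut_bounds(5)[OF l, of "X / A"] that unfolding abs_mult by (intro mult_mono) (auto simp: k_def)
    ultimately have "\<bar>4 * (X / A) * cut2 l (X / A)\<bar> + \<bar>2 * n * cut1 l (X / A)\<bar> \<le> (4 * 2) * (k * cbase (X / A) ^ (l - 2)) + 2 * n * (k * cbase (X / A) ^ (l - 2))"
      by (rule add_mono)
    with abs_triangle_ineq have "\<bar>4 * (X / A) * cut2 l (X / A) + 2 * n * cut1 l (X / A)\<bar> \<le> (4 * 2) * (k * cbase (X / A) ^ (l - 2)) + 2 * n * (k * cbase (X / A) ^ (l - 2))"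
      by (rule order_trans)
    also have "\<dots> = (8 + 2 * n) * (k * cbase (X / A) ^ (l - 2))" by (simp add: distrib_right)
    finally have "\<bar>4 * (X / A) * cut2 l (X / A) + 2 * n * cut1 l (X / A)\<bar> / A \<le> (8 + 2 * n) * (k * cbase (X / A) ^ (l - 2)) / A"
      using that by (intro divide_right_mono) auto
    moreover have "\<bar>4 * X * (cut2 l (X / A) / A^2) + 2 * n * (cut1 l (X / A) / A)\<bar> = \<bar>4 * (X / A) * cut2 l (X / A) + 2 * n * cut1 l (X / A)\<bar> / A"
    proof -
      have "4 * X * (cut2 l (X / A) / A^2) + 2 * n * (cut1 l (X / A) / A) = (4 * (X / A) * cut2 l (X / A) + 2 * n * cut1 l (X / A)) / A"
        using that by (simp add: field_simps power2_eq_square)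
      then show ?thesis using that by simp
    qed
    ultimately show ?thesis by (simp add: mult_ac)
  qed
  have c0: "0 \<le> cut0 l r" "cut0 l r \<le> cbase r ^ (l - 2)" for r
    using l cbase_bounds[of r] by (auto simp: cut0_def intro!: power_decreasing)
  have xc: "X * cut0 l (X / A) \<le> 2 * A * cbase (X / A) ^ (l - 2)"
  proof (cases "X / A \<ge> 2")
    case True
    then show ?thesis using cut_bounds(4)[OF l True] A cbase_bounds(1)[of "X / A"] by simp
  next
    case False
    then have "X \<le> 2 * A" using A by (simp add: field_simps)
    then show ?thesis using c0[of "X / A"] XY A by (intro mult_mono) auto
  qed
  have "\<bar>(4 * X * (cut2 l (X / A) / A^2) + 2 * real DIM('x) * (cut1 l (X / A) / A)) * cut0 l (Y / B)\<bar> \<le>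
      (k * ((8 + 2 * real DIM('x)) / A) * cbase (X / A) ^ (l - 2)) * cbase (Y / B) ^ (l - 2)"
    unfolding abs_mult[of _ "cut0 l (Y / B)"] using one[of X A "real DIM('x)"] c0[of "Y / B"] XY A k
    by (intro mult_mono) (auto simp: cbase_bounds)
  moreover have "\<bar>(X * cut0 l (X / A)) * (4 * Y * (cut2 l (Y / B) / B^2) + 2 * real DIM('y) * (cut1 l (Y / B) / B))\<bar> \<le>
      (2 * A * cbase (X / A) ^ (l - 2)) * (k * ((8 + 2 * real DIM('y)) / B) * cbase (Y / B) ^ (l - 2))"
    unfolding abs_mult[of "X * cut0 l (X / A)"] using one[of Y B "real DIM('y)"] xc c0[of "X / A"] XY A B k
    by (intro mult_mono) (auto simp: cbase_bounds)
  ultimately have "\<bar>(4 * X * (cut2 l (X / A) / A^2) + 2 * real DIM('x) * (cut1 l (X / A) / A)) * cut0 l (Y / B)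
      + X * (cut0 l (X / A) * (4 * Y * (cut2 l (Y / B) / B^2) + 2 * real DIM('y) * (cut1 l (Y / B) / B)))\<bar>
    \<le> (k * ((8 + 2 * real DIM('x)) / A) * cbase (X / A) ^ (l - 2)) * cbase (Y / B) ^ (l - 2)
     + (2 * A * cbase (X / A) ^ (l - 2)) * (k * ((8 + 2 * real DIM('y)) / B) * cbase (Y / B) ^ (l - 2))"
    by (simp only: mult.assoc[of X, symmetric] abs_triangle_ineq[THEN order_trans] add_mono)
  also have "\<dots> = k * ((8 + 2 * real DIM('x)) / A + 2 * (8 + 2 * real DIM('y)) * (A / B)) * scaled_cut A B z ^ (l - 2)"
    by (simp add: scaled_cut_def X_def Y_def power_mult_distrib algebra_simps add_divide_distrib)
  finally show ?thesis unfolding Lrad_def k_def X_def Y_def by simp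
qed

context nonneg_solution
begin

text \<open>Differentiation lowers the cutoff to the power \<open>l - 2\<close> and the time factor
  to the power \<open>q - 1\<close>. For bases between 0 and 1, the conditions on \<open>l\<close>
  and \<open>q\<close> bound these by the \<open>1/p\<close>-th power of the weight, in which
  \<open>\<alpha>\<close> is the shift of the time exponent caused by the memory term. The time
  derivative costs \<open>1 / T\<close>, at most \<open>T powr (- e)\<close> because
  \<open>e \<le> 1\<close> and \<open>T \<ge> 1\<close>.\<close>

lemma test_inequality:
  assumes l: "l \<ge> 3" "real l / p \<le> real (l - 2)" and q: "(real q + \<alpha>) / p \<le> real q - 1" and p: "p > 1" and \<alpha>: "\<alpha> \<ge> 0"
    and e: "0 < e" "e \<le> 1"
  defines "\<psi> \<equiv> \<lambda>T z. scaled_cut (T powr e) (T powr (2 * e)) z ^ l"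
  shows "\<exists>C\<ge>0. \<forall>T\<ge>1. set_integrable lborel (Om T) (\<lambda>w. M w * (\<psi> T (fst w) * (1 - snd w / T) ^ q)) \<and>
     set_integrable lborel (Om T) (\<lambda>w. V w * (\<psi> T (fst w) * (1 - snd w / T) ^ q)) \<and>
     (LINT z|lborel. u0 z * \<psi> T z)
     + set_lebesgue_integral lborel (Om T) (\<lambda>w. M w * (\<psi> T (fst w) * (1 - snd w / T) ^ q))
     + set_lebesgue_integral lborel (Om T) (\<lambda>w. V w * (\<psi> T (fst w) * (1 - snd w / T) ^ q))
     \<le> C * T powr (- e) * set_lebesgue_integral lborel (Om T) (\<lambda>w. U w * (\<psi> T (fst w) * (1 - snd w / T) powr (real q + \<alpha>)) powr (1 / p))"
proof -
  define C0 where "C0 = 15 * real l ^ 2 * ((8 + 2 * real DIM('x)) + 2 * (8 + 2 * real DIM('y)))"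
  have C0: "C0 \<ge> 0" by (simp add: C0_def)
  have q1: "q \<ge> 1"
  proof -
    have "0 \<le> (real q + \<alpha>) / p" using \<alpha> p by simp
    then show ?thesis using q by linarith
  qed
  show ?thesis
  proof (intro exI[of _ "C0 + real q"] conjI allI impI)
    show "0 \<le> C0 + real q" using C0 by simp
    fix T :: real assume T1: "T \<ge> 1"
    then have T: "T > 0" by simp
    define A where "A = T powr e"
    define B where "B = T powr (2 * e)"
    have A: "A > 0" and B: "B > 0" using T by (auto simp: A_def B_def)
    define v where "v t = 1 - t / T" for t
    define g where "g r t = cut0 l (r / B)" for r t :: real
    define g1 where "g1 r t = cut1 l (r / B) / B" for r t :: real
    define g2 where "g2 r t = cut2 l (r / B) / B^2" for r t :: real
    define h where "h r t = cut0 l (r / A)" for r t :: real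
    define h1 where "h1 r t = cut1 l (r / A) / A" for r t :: real
    define h2 where "h2 r t = cut2 l (r / A) / A^2" for r t :: real
    define \<eta>' where "\<eta>' t = real q * v t ^ (q - 1) * (- 1 / T)" for t
    have g: "profile T g g1 g2 (\<lambda>r t. 0)" and h: "profile T h h1 h2 (\<lambda>r t. 0)"
      unfolding g_def[abs_def] g1_def[abs_def] g2_def[abs_def] h_def[abs_def] h1_def[abs_def] h2_def[abs_def]
      using profile_cut[OF l(1)] by auto
    have dv: "((\<lambda>t. v t ^ q) has_real_derivative \<eta>' t) (at t within S)" for t S
    proof -
      have "((\<lambda>t. 1 - t / T) has_real_derivative 0 - 1 / T) (at t within S)"
        by (intro DERIV_diff DERIV_const DERIV_cdivide DERIV_ident)
      from DERIV_power[OF this, of q] show ?thesis by (simp add: v_def[abs_def] \<eta>'_def)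
    qed
    have vc: "continuous_on S v" for S unfolding v_def[abs_def] divide_inverse by (intro continuous_intros)
    have time: "profile T (\<lambda>r t. v t ^ q) (\<lambda>r t. 0) (\<lambda>r t. 0) (\<lambda>r t. \<eta>' t)"
      by (rule profile_time[OF _ dv]) (unfold \<eta>'_def[abs_def], intro continuous_intros vc)
    note f = profile_mult[OF h time]
    define f where "f r t = h r t * v t ^ q" for r t
    define f1 where "f1 r t = h1 r t * v t ^ q + h r t * 0" for r t
    define f2 where "f2 r t = h2 r t * v t ^ q + 2 * h1 r t * 0 + h r t * 0" for r t
    define f' where "f' r t = 0 * v t ^ q + h r t * \<eta>' t" for r t
    have f: "profile T f f1 f2 f'"
      using f unfolding f_def[abs_def] f1_def[abs_def] f2_def[abs_def] f'_def[abs_def] .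
    define \<rho> where "\<rho> = 2 * A + 2 * B"
    have supp: "f r t = 0" "g r t = 0" if "r > \<rho>" for r t
    proof -
      have "r / A \<ge> 2" "r / B \<ge> 2" using that A B by (auto simp: le_divide_eq \<rho>_def)
      then have "cut0 l (r / A) = 0" "cut0 l (r / B) = 0" using l by (auto intro!: cut_bounds)
      then show "f r t = 0" "g r t = 0" by (simp_all add: f_def h_def g_def)
    qed
    have psi: "\<psi> T z = h ((norm (fst z))\<^sup>2) 0 * g ((norm (snd z))\<^sup>2) 0" for z
      by (simp add: \<psi>_def h_def g_def cut0_def scaled_cut_def A_def B_def power_mult_distrib)
    have rad: "radial2 0 0 f g z t = \<psi> T z * v t ^ q" for z t by (simp add: radial2_def psi f_def h_def g_def)
    have fT: "f r T = 0" for r using T q1 by (simp add: f_def v_def)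
    define E where "E w = Lrad 0 0 f f1 f2 g g1 g2 (fst w) (snd w) + Trad 0 0 f f' g (\<lambda>r t. 0) (fst w) (snd w)" for w :: "('x \<times> 'y) \<times> real"
    note wt = weak_up_to_zero[OF f g T supp(1) supp(2) fT, where a="0::'x" and c="0::'y" and \<rho>=\<rho>, unfolded rad, folded E_def]
    define R where "R w = (\<psi> T (fst w) * (1 - snd w / T) powr (real q + \<alpha>)) powr (1 / p)" for w
    have Eb: "\<bar>E w\<bar> \<le> (C0 + real q) * T powr (- e) * R w" if w: "w \<in> Om T" for w
    proof -
      define cb where "cb = scaled_cut A B (fst w)"
      define vt where "vt = v (snd w)"
      have cb: "0 \<le> cb" "cb \<le> 1" by (auto simp: cb_def scaled_cut_bounds)
      have vt: "0 < vt" "vt < 1" using w T by (auto simp: vt_def v_def Om_def field_simps)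
      have cl: "cb ^ l = cb powr real l" using cb l by (cases "cb = 0") (auto simp: powr_realpow)
      have Rw: "R w = cb powr (real l / p) * vt powr ((real q + \<alpha>) / p)"
      proof -
        have "R w = (cb ^ l * vt powr (real q + \<alpha>)) powr (1 / p)"
          by (simp add: R_def \<psi>_def cb_def vt_def v_def A_def B_def)
        then show ?thesis unfolding cl using cb vt by (simp add: powr_mult powr_powr)
      qed
      have cbl: "cb ^ (l - 2) \<le> cb powr (real l / p)"
      proof (cases "cb = 0")
        case False
        then have "cb ^ (l - 2) = cb powr real (l - 2)" using cb by (simp add: powr_realpow)
        also have "\<dots> \<le> cb powr (real l / p)" using cb False l by (intro powr_mono') auto
        finally show ?thesis .
      qed (use l in \<open>auto simp: power_0_left\<close>)
      have vq: "vt ^ (q - 1) \<le> vt powr ((real q + \<alpha>) / p)"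
      proof -
        have "vt ^ (q - 1) = vt powr real (q - 1)" using vt by (simp add: powr_realpow)
        also have "\<dots> \<le> vt powr ((real q + \<alpha>) / p)" using vt q q1 by (intro powr_mono') auto
        finally show ?thesis .
      qed
      have prod: "cb ^ (l - 2) * vt ^ (q - 1) \<le> R w" unfolding Rw using cbl vq cb vt by (intro mult_mono) auto
      have "\<bar>Lrad 0 0 f f1 f2 g g1 g2 (fst w) (snd w)\<bar> = \<bar>Lrad 0 0 h h1 h2 g g1 g2 (fst w) (snd w)\<bar> * vt ^ q"
      proof -
        have "Lrad 0 0 f f1 f2 g g1 g2 (fst w) (snd w) = Lrad 0 0 h h1 h2 g g1 g2 (fst w) (snd w) * vt ^ q"
          unfolding Lrad_def f_def f1_def f2_def vt_def by (simp add: algebra_simps)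
        then show ?thesis using vt by (simp add: abs_mult)
      qed
      also have "\<dots> \<le> (C0 * T powr (- e) * cb ^ (l - 2)) * vt ^ (q - 1)"
      proof (rule mult_mono)
        have a: "(8 + 2 * real DIM('x)) / A = (8 + 2 * real DIM('x)) * T powr (- e)"
          by (simp add: A_def powr_minus_divide)
        have b: "A / B = T powr (- e)" unfolding A_def B_def powr_diff[symmetric] by simp
        have "15 * real l ^ 2 * ((8 + 2 * real DIM('x)) / A + 2 * (8 + 2 * real DIM('y)) * (A / B)) = C0 * T powr (- e)"
          unfolding a b C0_def by (simp only: distrib_right mult.assoc)
        then show "\<bar>Lrad 0 0 h h1 h2 g g1 g2 (fst w) (snd w)\<bar> \<le> C0 * T powr (- e) * cb ^ (l - 2)"
          using Lrad_cut_bound[OF l(1) A B, of "fst w" "snd w"]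
          unfolding h_def[abs_def] h1_def[abs_def] h2_def[abs_def] g_def[abs_def] g1_def[abs_def] g2_def[abs_def] cb_def by simp
        show "vt ^ q \<le> vt ^ (q - 1)" using vt by (intro power_decreasing) auto
      qed (use C0 vt cb in auto)
      also have "\<dots> = C0 * T powr (- e) * (cb ^ (l - 2) * vt ^ (q - 1))" by simp
      also have "\<dots> \<le> C0 * T powr (- e) * R w" using prod C0 by (intro mult_left_mono) auto
      finally have 1: "\<bar>Lrad 0 0 f f1 f2 g g1 g2 (fst w) (snd w)\<bar> \<le> C0 * T powr (- e) * R w" .
      have "\<bar>Trad 0 0 f f' g (\<lambda>r t. 0) (fst w) (snd w)\<bar> = (real q * (1 / T)) * (cb ^ l * vt ^ (q - 1))"
      proof -
        have "Trad 0 0 f f' g (\<lambda>r t. 0) (fst w) (snd w) = - ((real q * (1 / T)) * (\<psi> T (fst w) * vt ^ (q - 1)))"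
          by (simp add: Trad_def radial2_def psi f'_def \<eta>'_def vt_def h_def g_def)
        then show ?thesis using T vt cb by (simp add: \<psi>_def cb_def A_def B_def abs_mult)
      qed
      also have "\<dots> \<le> (real q * T powr (- e)) * R w"
      proof (intro mult_mono)
        have "T powr (- 1) \<le> T powr (- e)" using T1 e by (intro powr_mono) auto
        then show "1 / T \<le> T powr (- e)" using T by (simp add: powr_minus_divide)
        have "cb ^ l * vt ^ (q - 1) \<le> cb ^ (l - 2) * vt ^ (q - 1)" using cb vt by (intro mult_right_mono power_decreasing) auto
        then show "cb ^ l * vt ^ (q - 1) \<le> R w" using prod by linarith
      qed (use T cb vt in auto)
      finally have "\<bar>Trad 0 0 f f' g (\<lambda>r t. 0) (fst w) (snd w)\<bar> \<le> real q * T powr (- e) * R w" .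
      with 1 show ?thesis unfolding E_def by (simp add: algebra_simps)
    qed
    have RI: "set_integrable lborel (Om T) (\<lambda>w. U w * R w)"
    proof -
      define K where "K = cball (0::'x) (sqrt (2 * A)) \<times> cball (0::'y) (sqrt (2 * B))"
      have K: "compact K" unfolding K_def by (intro compact_Times) auto
      have cS: "continuous_on UNIV (scaled_cut A B :: 'x \<times> 'y \<Rightarrow> real)" by (rule continuous_on_scaled_cut[OF A B])
      have Rc: "continuous_on (UNIV \<times> {0..T}) R"
        unfolding R_def[abs_def] \<psi>_def A_def[symmetric] B_def[symmetric] using \<alpha> p q1 T
        by (intro continuous_on_powr' continuous_intros continuous_on_compose2[OF cS])
           (auto simp: scaled_cut_bounds)
      have "R (z,t) = 0" if "z \<notin> K" for z t
        using scaled_cut_zero[OF A B, of z] that l by (simp add: R_def \<psi>_def K_def A_def B_def)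
      then show ?thesis
        using integrable_Om[OF U_meas U_nonneg loc0_bounded(1)[OF compact_imp_bounded[OF K] T] Rc K] by auto
    qed
    show "set_integrable lborel (Om T) (\<lambda>w. M w * (\<psi> T (fst w) * (1 - snd w / T) ^ q))"
      "set_integrable lborel (Om T) (\<lambda>w. V w * (\<psi> T (fst w) * (1 - snd w / T) ^ q))"
      using wt(1,2) by (auto simp: v_def)
    have "- set_lebesgue_integral lborel (Om T) (\<lambda>w. U w * E w) \<le> set_lebesgue_integral lborel (Om T) (\<lambda>w. (C0 + real q) * T powr (- e) * (U w * R w))"
      unfolding set_lebesgue_integral_def integral_minus[symmetric]
    proof (rule integral_mono)
      show "- (indicator (Om T) w *\<^sub>R (U w * E w)) \<le> indicator (Om T) w *\<^sub>R ((C0 + real q) * T powr (- e) * (U w * R w))" for w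
      proof (cases "w \<in> Om T")
        case True
        have "U w * - E w \<le> U w * ((C0 + real q) * T powr (- e) * R w)"
          using Eb[OF True] by (intro mult_left_mono U_nonneg) linarith
        then show ?thesis using True by (simp add: mult_ac)
      qed simp
      show "integrable lborel (\<lambda>w. - (indicator (Om T) w *\<^sub>R (U w * E w)))"
        using wt(3) unfolding set_integrable_def by simp
      show "integrable lborel (\<lambda>w. indicator (Om T) w *\<^sub>R ((C0 + real q) * T powr (- e) * (U w * R w)))"
        using set_integrable_mult_right[OF RI, of "(C0 + real q) * T powr (- e)"] unfolding set_integrable_def .
    qed
    also have "\<dots> = (C0 + real q) * T powr (- e) * set_lebesgue_integral lborel (Om T) (\<lambda>w. U w * R w)"
      by (rule set_integral_mult_right)
    finally show "(LINT z|lborel. u0 z * \<psi> T z)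
     + set_lebesgue_integral lborel (Om T) (\<lambda>w. M w * (\<psi> T (fst w) * (1 - snd w / T) ^ q))
     + set_lebesgue_integral lborel (Om T) (\<lambda>w. V w * (\<psi> T (fst w) * (1 - snd w / T) ^ q))
     \<le> (C0 + real q) * T powr (- e) * set_lebesgue_integral lborel (Om T) (\<lambda>w. U w * (\<psi> T (fst w) * (1 - snd w / T) powr (real q + \<alpha>)) powr (1 / p))"
      using wt(4) by (simp add: v_def R_def)
  qed
qed

end

lemma scaled_cut_tendsto:
  assumes "e > 0"
  shows "\<forall>\<^sub>F n in sequentially. scaled_cut (real n powr e) (real n powr (2 * e)) z = 1"
proof -
  have *: "filterlim (\<lambda>n. real n powr b) at_top sequentially" if "b > 0" for b
  proof (rule filterlim_at_top_mono[OF filterlim_compose[OF exp_at_top filterlim_tendsto_pos_mult_at_top[OF tendsto_const that filterlim_compose[OF ln_at_top filterlim_real_sequentially]]]])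
    show "\<forall>\<^sub>F n in sequentially. exp (b * ln (real n)) \<le> real n powr b"
      using eventually_gt_at_top[of 0] by eventually_elim (simp add: powr_def)
  qed
  have "\<forall>\<^sub>F n in sequentially. (norm (fst z))\<^sup>2 \<le> real n powr e"
    using *[OF assms] by (simp add: filterlim_at_top)
  moreover have "\<forall>\<^sub>F n in sequentially. (norm (snd z))\<^sup>2 \<le> real n powr (2 * e)"
    using *[of "2 * e"] assms by (simp add: filterlim_at_top)
  moreover have "\<forall>\<^sub>F n in sequentially. n \<ge> (1::nat)" by (rule eventually_ge_at_top)
  ultimately show ?thesis
  proof eventually_elim
    case (elim n)
    then have "(norm (fst z))\<^sup>2 / real n powr e \<le> 1" "(norm (snd z))\<^sup>2 / real n powr (2 * e) \<le> 1"
      by (auto simp: divide_le_eq_1)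
    then show ?case by (simp add: scaled_cut_def cbase_bounds(3))
  qed
qed

lemma emeasure_parabolic_box:
  assumes "A > 0" "B > 0" "T > 0"
  shows "emeasure lborel ((cball (0::'x::euclidean_space) (sqrt (2 * A)) \<times> cball (0::'y::euclidean_space) (sqrt (2 * B))) \<times> {0<..<T})
    = ennreal (unit_ball_vol (real DIM('x)) * sqrt (2 * A) ^ DIM('x) * (unit_ball_vol (real DIM('y)) * sqrt (2 * B) ^ DIM('y)) * T)"
proof -
  have P: "emeasure lborel (X \<times> Y) = emeasure lborel X * emeasure lborel Y"
    if "X \<in> sets borel" "Y \<in> sets borel" for X :: "'c::euclidean_space set" and Y :: "'d::euclidean_space set"
    using lborel.emeasure_pair_measure_Times[of X lborel Y] that by (simp add: lborel_prod)
  have "cball (0::'x) (sqrt (2 * A)) \<times> cball (0::'y) (sqrt (2 * B)) \<in> sets borel" by (auto intro!: borel_Times)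
  then show ?thesis using assms
    by (simp add: P emeasure_cball ennreal_mult mult_ac)
qed

context nonneg_solution
begin

text \<open>One argument for both nonlinearities: \<open>\<alpha> = 0\<close> with
  \<open>p2\<close>, and \<open>\<alpha> = 1 - \<gamma>\<close> with \<open>p1\<close>. By
  \<open>key\<close> the nonlinear terms dominate \<open>T powr \<alpha>\<close> times the weighted
  integral of \<open>U powr p\<close>; dividing by this power turns the cost
  \<open>T powr (- e)\<close> into \<open>T powr (- (\<alpha> + e))\<close>, and \<open>expo\<close>
  compares it with the volume of the support.\<close>

lemma nonexistence_from_lower_bound:
  assumes p: "p > 1" and \<alpha>: "\<alpha> \<ge> 0" and e: "0 < e" "e \<le> 1" and u0pos: "(LINT z|lborel. u0 z) > 0"
    and expo: "1 + e * (real DIM('x) / 2 + real DIM('y)) \<le> (\<alpha> + e) * (p / (p - 1))"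
    and key: "\<And>q. \<exists>c>0. \<forall>T\<ge>1. \<forall>\<psi>. \<psi> \<in> borel_measurable borel \<and> (\<forall>z. 0 \<le> \<psi> z) \<and>
        set_integrable lborel (Om T) (\<lambda>w. M w * (\<psi> (fst w) * (1 - snd w / T) ^ q)) \<and>
        set_integrable lborel (Om T) (\<lambda>w. V w * (\<psi> (fst w) * (1 - snd w / T) ^ q)) \<longrightarrow>
        set_integrable lborel (Om T) (\<lambda>w. U w powr p * (\<psi> (fst w) * (1 - snd w / T) powr (real q + \<alpha>))) \<and>
        c * T powr \<alpha> * set_lebesgue_integral lborel (Om T) (\<lambda>w. U w powr p * (\<psi> (fst w) * (1 - snd w / T) powr (real q + \<alpha>)))
        \<le> set_lebesgue_integral lborel (Om T) (\<lambda>w. M w * (\<psi> (fst w) * (1 - snd w / T) ^ q)) +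
          set_lebesgue_integral lborel (Om T) (\<lambda>w. V w * (\<psi> (fst w) * (1 - snd w / T) ^ q))"
  shows False
proof -
  \<comment> \<open>Since \<open>p > 1\<close>, the inequalities required of \<open>l\<close> and
    \<open>q\<close> hold for all sufficiently large values.\<close>
  obtain l :: nat where l: "l \<ge> 3" "real l / p \<le> real (l - 2)"
  proof -
    obtain m :: nat where m: "2 * p / (p - 1) < real m" using reals_Archimedean2 by blast
    have "2 * p / (p - 1) \<le> real (m + 3)" using m by simp
    then have "2 * p \<le> real (m + 3) * (p - 1)" using p by (simp add: field_simps)
    then have "real (m + 3) / p \<le> real (m + 3) - 2" using p by (simp add: field_simps)
    then have "real (m + 3) / p \<le> real (m + 3 - 2)" by (subst of_nat_diff) auto
    then show ?thesis by (intro that[of "m + 3"]) auto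
  qed
  obtain q :: nat where q: "(real q + \<alpha>) / p \<le> real q - 1"
  proof -
    obtain m :: nat where m: "(p + \<alpha>) / (p - 1) < real m" using reals_Archimedean2 by blast
    then have "p + \<alpha> \<le> real m * (p - 1)" using p by (simp add: field_simps)
    then have "(real m + \<alpha>) / p \<le> real m - 1" using p by (simp add: field_simps)
    then show ?thesis by (rule that)
  qed
  have ql: "real q + \<alpha> > 0"
  proof -
    have "0 \<le> (real q + \<alpha>) / p" using \<alpha> p by simp
    then show ?thesis using q \<alpha> by linarith
  qed
  define \<psi> where "\<psi> T z = scaled_cut (T powr e) (T powr (2 * e)) z ^ l" for T and z :: "'x \<times> 'y"
  obtain C1 where C1: "C1 \<ge> 0" and ti: "\<And>T. T \<ge> 1 \<Longrightarrow> set_integrable lborel (Om T) (\<lambda>w. M w * (\<psi> T (fst w) * (1 - snd w / T) ^ q)) \<and>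
     set_integrable lborel (Om T) (\<lambda>w. V w * (\<psi> T (fst w) * (1 - snd w / T) ^ q)) \<and>
     (LINT z|lborel. u0 z * \<psi> T z)
     + set_lebesgue_integral lborel (Om T) (\<lambda>w. M w * (\<psi> T (fst w) * (1 - snd w / T) ^ q))
     + set_lebesgue_integral lborel (Om T) (\<lambda>w. V w * (\<psi> T (fst w) * (1 - snd w / T) ^ q))
     \<le> C1 * T powr (- e) * set_lebesgue_integral lborel (Om T) (\<lambda>w. U w * (\<psi> T (fst w) * (1 - snd w / T) powr (real q + \<alpha>)) powr (1 / p))"
    using test_inequality[OF l q p \<alpha> e] unfolding \<psi>_def by blast
  obtain c where c: "c > 0" and ck: "\<And>T \<psi>. T \<ge> 1 \<Longrightarrow> \<psi> \<in> borel_measurable borel \<Longrightarrow> (\<forall>z. 0 \<le> \<psi> z) \<Longrightarrow>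
        set_integrable lborel (Om T) (\<lambda>w. M w * (\<psi> (fst w) * (1 - snd w / T) ^ q)) \<Longrightarrow>
        set_integrable lborel (Om T) (\<lambda>w. V w * (\<psi> (fst w) * (1 - snd w / T) ^ q)) \<Longrightarrow>
        set_integrable lborel (Om T) (\<lambda>w. U w powr p * (\<psi> (fst w) * (1 - snd w / T) powr (real q + \<alpha>))) \<and>
        c * T powr \<alpha> * set_lebesgue_integral lborel (Om T) (\<lambda>w. U w powr p * (\<psi> (fst w) * (1 - snd w / T) powr (real q + \<alpha>)))
        \<le> set_lebesgue_integral lborel (Om T) (\<lambda>w. M w * (\<psi> (fst w) * (1 - snd w / T) ^ q)) +
          set_lebesgue_integral lborel (Om T) (\<lambda>w. V w * (\<psi> (fst w) * (1 - snd w / T) ^ q))"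
    using key[of q] by blast
  have psib: "0 \<le> \<psi> T z" "\<psi> T z \<le> 1" for T z
    unfolding \<psi>_def using scaled_cut_bounds[of "T powr e" "T powr (2 * e)" z] by (auto intro: power_le_one)
  have psim [measurable]: "\<psi> T \<in> borel_measurable borel" if "T > 0" for T
    unfolding \<psi>_def[abs_def] using that
    by (intro borel_measurable_power borel_measurable_continuous_onI continuous_on_scaled_cut) auto
  have psi1: "\<forall>\<^sub>F n in sequentially. \<psi> (real n) z = 1" for z
    using scaled_cut_tendsto[OF e(1), of z] by (auto simp: \<psi>_def elim: eventually_mono)
  \<comment> \<open>At \<open>n = 0\<close> the scales degenerate; the weight 0 there keeps the
    bounds valid for every \<open>n\<close>.\<close>
  define W where "W n w = (if n = 0 then 0 else indicator (Om (real n)) w * (\<psi> (real n) (fst w) * (1 - snd w / real n) powr (real q + \<alpha>)))" for n w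
  define D where "D n = (cball (0::'x) (sqrt (2 * real n powr e)) \<times> cball (0::'y) (sqrt (2 * real n powr (2*e)))) \<times> {0<..<real n}" for n
  have W0: "0 \<le> W n w" "W n w \<le> 1" for n w
  proof -
    show "0 \<le> W n w" by (simp add: W_def psib)
    show "W n w \<le> 1"
    proof (cases "n \<noteq> 0 \<and> w \<in> Om (real n)")
      case True
      then have "0 \<le> 1 - snd w / real n" "1 - snd w / real n \<le> 1" by (auto simp: Om_def)
      then have "(1 - snd w / real n) powr (real q + \<alpha>) \<le> 1 powr (real q + \<alpha>)" using ql by (intro powr_mono2) auto
      then show ?thesis using True psib[of "real n" "fst w"] by (simp add: W_def mult_le_one)
    qed (auto simp: W_def)
  qed
  have Wm: "W n \<in> borel_measurable lborel" for n
  proof (cases "n = 0")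
    case False
    then have [measurable]: "\<psi> (real n) \<in> borel_measurable borel" by (intro psim) simp
    show ?thesis unfolding W_def[abs_def] using False by simp
  qed (simp add: W_def[abs_def])
  have WD: "W n w = 0" if "w \<notin> D n" for n w
  proof (cases "n \<noteq> 0 \<and> w \<in> Om (real n)")
    case True
    then have "fst w \<notin> cball (0::'x) (sqrt (2 * real n powr e)) \<times> cball (0::'y) (sqrt (2 * real n powr (2*e)))"
      using that by (auto simp: D_def Om_def)
    then have "scaled_cut (real n powr e) (real n powr (2 * e)) (fst w) = 0" using True by (intro scaled_cut_zero) auto
    then show ?thesis using l by (simp add: W_def \<psi>_def)
  qed (auto simp: W_def)
  have Dm: "D n \<in> sets lborel" for n unfolding D_def by (auto intro!: borel_Times)
  have W1: "AE w in lborel. U w \<noteq> 0 \<longrightarrow> (\<lambda>n. W n w) \<longlonglongrightarrow> 1"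
  proof (rule AE_I2, rule impI)
    fix w :: "('x \<times> 'y) \<times> real" assume "U w \<noteq> 0"
    then have t: "snd w > 0" by (auto simp: U_def split: if_splits)
    have "(\<lambda>n. snd w / real n) \<longlonglongrightarrow> 0" by (rule lim_const_over_n)
    then have "(\<lambda>n. (1 - snd w / real n) powr (real q + \<alpha>)) \<longlonglongrightarrow> (1 - 0) powr (real q + \<alpha>)"
      by (intro tendsto_intros) auto
    moreover have "\<forall>\<^sub>F n in sequentially. (1 - snd w / real n) powr (real q + \<alpha>) = W n w"
      using psi1[of "fst w"] eventually_gt_at_top[of "nat \<lceil>snd w\<rceil>"]
    proof eventually_elim
      case (elim n)
      then have "snd w < real n" using t by linarith
      then have "n \<noteq> 0" "w \<in> Om (real n)" using t by (auto simp: Om_def mem_Times_iff)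
      then show ?case using elim by (simp add: W_def)
    qed
    ultimately show "(\<lambda>n. W n w) \<longlonglongrightarrow> 1" by (simp add: Lim_transform_eventually)
  qed
  have u0lim: "(\<lambda>n. LINT z|lborel. u0 z * \<psi> (real n) z) \<longlonglongrightarrow> (LINT z|lborel. u0 z)"
  proof (rule integral_dominated_convergence[where w="\<lambda>z. \<bar>u0 z\<bar>"])
    show "(\<lambda>z. u0 z * \<psi> (real n) z) \<in> borel_measurable lborel" for n
    proof (cases "n = 0")
      case True
      have "\<psi> (real n) = (\<lambda>z. cbase 0 ^ l * cbase 0 ^ l)" using True by (auto simp: \<psi>_def scaled_cut_def power_mult_distrib)
      then show ?thesis using borel_measurable_integrable[OF u0] by simp
    next
      case False
      then have [measurable]: "\<psi> (real n) \<in> borel_measurable borel" by (intro psim) simp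
      show ?thesis using borel_measurable_integrable[OF u0] by measurable
    qed
    show "AE z in lborel. (\<lambda>n. u0 z * \<psi> (real n) z) \<longlonglongrightarrow> u0 z"
    proof (rule AE_I2)
      fix z
      show "(\<lambda>n. u0 z * \<psi> (real n) z) \<longlonglongrightarrow> u0 z"
        by (rule tendsto_eventually) (use psi1[of z] in \<open>auto elim: eventually_mono\<close>)
    qed
    show "AE z in lborel. norm (u0 z * \<psi> (real n) z) \<le> \<bar>u0 z\<bar>" for n
      using psib by (auto simp: abs_mult intro!: AE_I2 mult_left_le)
  qed (use u0 borel_measurable_integrable[OF u0] in auto)
  define K where "K = unit_ball_vol (real DIM('x)) * sqrt 2 ^ DIM('x) * (unit_ball_vol (real DIM('y)) * sqrt 2 ^ DIM('y))"
  have K: "K \<ge> 0" by (simp add: K_def)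
  have XW: "(LINT w|lborel. U w powr p * W n w) = set_lebesgue_integral lborel (Om (real n)) (\<lambda>w. U w powr p * (\<psi> (real n) (fst w) * (1 - snd w / real n) powr (real q + \<alpha>)))"
    and IW: "integrable lborel (\<lambda>w. U w powr p * W n w) \<longleftrightarrow> set_integrable lborel (Om (real n)) (\<lambda>w. U w powr p * (\<psi> (real n) (fst w) * (1 - snd w / real n) powr (real q + \<alpha>)))"
    and YW: "(LINT w|lborel. U w * W n w powr (1 / p)) = set_lebesgue_integral lborel (Om (real n)) (\<lambda>w. U w * (\<psi> (real n) (fst w) * (1 - snd w / real n) powr (real q + \<alpha>)) powr (1 / p))"
    if "n \<ge> 1" for n
  proof -
    have 1: "U w powr p * W n w = indicator (Om (real n)) w *\<^sub>R (U w powr p * (\<psi> (real n) (fst w) * (1 - snd w / real n) powr (real q + \<alpha>)))" for w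
      using that by (simp add: W_def)
    have 2: "U w * W n w powr (1 / p) = indicator (Om (real n)) w *\<^sub>R (U w * (\<psi> (real n) (fst w) * (1 - snd w / real n) powr (real q + \<alpha>)) powr (1 / p))" for w
      using that by (cases "w \<in> Om (real n)") (auto simp: W_def)
    show "(LINT w|lborel. U w powr p * W n w) = set_lebesgue_integral lborel (Om (real n)) (\<lambda>w. U w powr p * (\<psi> (real n) (fst w) * (1 - snd w / real n) powr (real q + \<alpha>)))"
     "integrable lborel (\<lambda>w. U w powr p * W n w) \<longleftrightarrow> set_integrable lborel (Om (real n)) (\<lambda>w. U w powr p * (\<psi> (real n) (fst w) * (1 - snd w / real n) powr (real q + \<alpha>)))"
     "(LINT w|lborel. U w * W n w powr (1 / p)) = set_lebesgue_integral lborel (Om (real n)) (\<lambda>w. U w * (\<psi> (real n) (fst w) * (1 - snd w / real n) powr (real q + \<alpha>)) powr (1 / p))"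
      unfolding 1 2 set_lebesgue_integral_def set_integrable_def by auto
  qed
  have key_n: "integrable lborel (\<lambda>w. U w powr p * W n w)"
    "(LINT z|lborel. u0 z * \<psi> (real n) z) + c * real n powr \<alpha> * (LINT w|lborel. U w powr p * W n w)
       \<le> C1 * real n powr (- e) * (LINT w|lborel. U w * W n w powr (1 / p))" if n: "n \<ge> 1" for n
  proof -
    have n1: "real n \<ge> 1" using n by simp
    note t = ti[OF n1]
    have k: "set_integrable lborel (Om (real n)) (\<lambda>w. U w powr p * (\<psi> (real n) (fst w) * (1 - snd w / real n) powr (real q + \<alpha>))) \<and>
        c * real n powr \<alpha> * set_lebesgue_integral lborel (Om (real n)) (\<lambda>w. U w powr p * (\<psi> (real n) (fst w) * (1 - snd w / real n) powr (real q + \<alpha>)))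
        \<le> set_lebesgue_integral lborel (Om (real n)) (\<lambda>w. M w * (\<psi> (real n) (fst w) * (1 - snd w / real n) ^ q)) +
          set_lebesgue_integral lborel (Om (real n)) (\<lambda>w. V w * (\<psi> (real n) (fst w) * (1 - snd w / real n) ^ q))"
      by (rule ck[OF n1]) (use t n psib psim in auto)
    show "integrable lborel (\<lambda>w. U w powr p * W n w)" using k IW[OF n] by blast
    show "(LINT z|lborel. u0 z * \<psi> (real n) z) + c * real n powr \<alpha> * (LINT w|lborel. U w powr p * W n w)
       \<le> C1 * real n powr (- e) * (LINT w|lborel. U w * W n w powr (1 / p))"
      unfolding XW[OF n] YW[OF n] using k t by linarith
  qed
  have "AE w in lborel. U w = 0"
  proof (rule AE_zero_of_test_inequality[OF _ U_nonneg Wm W0 WD Dm K _ p _ _ W1, where C="C1 / c" and a="\<alpha> + e"])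
    show "U \<in> borel_measurable lborel" by simp
    show "0 \<le> C1 / c" using C1 c by simp
    show "0 < \<alpha> + e" using \<alpha> e by simp
    show "emeasure lborel (D n) \<le> ennreal (K * real n powr ((\<alpha> + e) * (p / (p - 1))))" if n: "n \<ge> 1" for n
    proof -
      have n0: "real n > 0" using n by simp
      have "sqrt (2 * real n powr e) ^ DIM('x) = sqrt 2 ^ DIM('x) * real n powr (e / 2 * real DIM('x))"
        using n0 by (simp add: real_sqrt_mult power_mult_distrib powr_half_sqrt[symmetric] powr_powr powr_realpow[symmetric])
      moreover have "sqrt (2 * real n powr (2 * e)) ^ DIM('y) = sqrt 2 ^ DIM('y) * real n powr (e * real DIM('y))"
        using n0 by (simp add: real_sqrt_mult power_mult_distrib powr_half_sqrt[symmetric] powr_powr powr_realpow[symmetric])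
      ultimately have "emeasure lborel (D n) = ennreal (K * (real n powr (e / 2 * real DIM('x)) * real n powr (e * real DIM('y)) * real n powr 1))"
        unfolding D_def using n0 by (subst emeasure_parabolic_box) (auto simp: K_def mult_ac)
      also have "real n powr (e / 2 * real DIM('x)) * real n powr (e * real DIM('y)) * real n powr 1 = real n powr (1 + e * (real DIM('x) / 2 + real DIM('y)))"
        unfolding powr_add[symmetric] by (simp add: algebra_simps)
      also have "ennreal (K * \<dots>) \<le> ennreal (K * real n powr ((\<alpha> + e) * (p / (p - 1))))"
        using expo n K by (intro ennreal_leI mult_left_mono powr_mono) auto
      finally show ?thesis .
    qed
    show "\<forall>\<^sub>F n in sequentially. integrable lborel (\<lambda>x. U x powr p * W n x)"
      using eventually_ge_at_top[of 1] by eventually_elim (rule key_n)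
    show "\<forall>\<^sub>F n in sequentially. (LINT x|lborel. U x powr p * W n x) \<le> C1 / c * real n powr - (\<alpha> + e) * (LINT x|lborel. U x * W n x powr (1 / p))"
      using eventually_ge_at_top[of 1] order_tendstoD(1)[OF u0lim u0pos]
    proof eventually_elim
      case (elim n)
      have n0: "real n > 0" using elim by simp
      \<comment> \<open>The integral of \<open>u0\<close> against the cutoff tends to a positive
        limit, so it is eventually positive and may be dropped.\<close>
      have "c * real n powr \<alpha> * (LINT w|lborel. U w powr p * W n w) \<le> C1 * real n powr (- e) * (LINT w|lborel. U w * W n w powr (1 / p))"
        using key_n(2)[OF elim(1)] elim(2) by linarith
      then have "(LINT w|lborel. U w powr p * W n w) \<le> C1 * real n powr (- e) * (LINT w|lborel. U w * W n w powr (1 / p)) / (c * real n powr \<alpha>)"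
        using c n0 by (simp add: pos_le_divide_eq mult.commute)
      also have "\<dots> = C1 / c * (real n powr (- e) / real n powr \<alpha>) * (LINT w|lborel. U w * W n w powr (1 / p))" by simp
      also have "real n powr (- e) / real n powr \<alpha> = real n powr - (\<alpha> + e)"
        unfolding powr_diff[symmetric] by (rule arg_cong[where f="\<lambda>x. real n powr x"]) simp
      finally show ?case .
    qed
  qed
  \<comment> \<open>With \<open>U = 0\<close> almost everywhere the right side of the test
    inequality vanishes, which makes the integrals of \<open>u0\<close> against the cutoffs
    nonpositive, against their positive limit.\<close>
  then have Y0: "(LINT w|lborel. U w * W n w powr (1 / p)) = 0" for n
    by (intro integral_eq_zero_AE) auto
  have "\<forall>\<^sub>F n in sequentially. (LINT z|lborel. u0 z * \<psi> (real n) z) \<le> 0"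
    using eventually_ge_at_top[of 1]
  proof eventually_elim
    case (elim n)
    have "0 \<le> c * real n powr \<alpha> * (LINT w|lborel. U w powr p * W n w)"
      using c W0 by (intro mult_nonneg_nonneg integral_nonneg_AE AE_I2) auto
    then show ?case using key_n(2)[OF elim] unfolding Y0 by simp
  qed
  then have "(LINT z|lborel. u0 z) \<le> 0" by (rule tendsto_upperbound[OF u0lim]) simp
  then show False using u0pos by simp
qed

text \<open>With \<open>e = 1\<close> and \<open>Q = N + 2 k\<close> the exponent condition reads
  \<open>1 + Q / 2 \<le> p2 / (p2 - 1)\<close>, that is, \<open>(p2 - 1) * Q \<le> 2\<close>. The
  memory term is discarded by its sign.\<close>

lemma nonexistence_power:
  assumes u0pos: "(LINT z|lborel. u0 z) > 0" and le: "p2 \<le> 1 + 2 / (real DIM('x) + 2 * real DIM('y))"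
  shows False
proof (rule nonexistence_from_lower_bound[OF p2, of 0 1])
  define Q where "Q = real DIM('x) + 2 * real DIM('y)"
  have Q: "Q > 0" unfolding Q_def by (simp add: add_pos_pos)
  have "p2 - 1 \<le> 2 / Q" using le by (simp add: Q_def)
  then have "(p2 - 1) * Q \<le> 2" using Q by (simp add: pos_le_divide_eq)
  then have "1 + Q / 2 \<le> p2 / (p2 - 1)" using p2 by (simp add: field_simps)
  then show "1 + 1 * (real DIM('x) / 2 + real DIM('y)) \<le> (0 + 1) * (p2 / (p2 - 1))" by (simp add: Q_def field_simps)
  fix q
  show "\<exists>c>0. \<forall>T\<ge>1. \<forall>\<psi>. \<psi> \<in> borel_measurable borel \<and> (\<forall>z. 0 \<le> \<psi> z) \<and>
        set_integrable lborel (Om T) (\<lambda>w. M w * (\<psi> (fst w) * (1 - snd w / T) ^ q)) \<and>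
        set_integrable lborel (Om T) (\<lambda>w. V w * (\<psi> (fst w) * (1 - snd w / T) ^ q)) \<longrightarrow>
        set_integrable lborel (Om T) (\<lambda>w. U w powr p2 * (\<psi> (fst w) * (1 - snd w / T) powr (real q + 0))) \<and>
        c * T powr 0 * set_lebesgue_integral lborel (Om T) (\<lambda>w. U w powr p2 * (\<psi> (fst w) * (1 - snd w / T) powr (real q + 0)))
        \<le> set_lebesgue_integral lborel (Om T) (\<lambda>w. M w * (\<psi> (fst w) * (1 - snd w / T) ^ q)) +
          set_lebesgue_integral lborel (Om T) (\<lambda>w. V w * (\<psi> (fst w) * (1 - snd w / T) ^ q))"
  proof (intro exI[of _ 1] conjI allI impI, simp)
    fix T :: real and \<psi> assume T: "T \<ge> 1" and H: "\<psi> \<in> borel_measurable borel \<and> (\<forall>z. 0 \<le> \<psi> z) \<and>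
        set_integrable lborel (Om T) (\<lambda>w. M w * (\<psi> (fst w) * (1 - snd w / T) ^ q)) \<and>
        set_integrable lborel (Om T) (\<lambda>w. V w * (\<psi> (fst w) * (1 - snd w / T) ^ q))"
    have eq: "indicator (Om T) w *\<^sub>R (U w powr p2 * (\<psi> (fst w) * (1 - snd w / T) powr (real q + 0))) = indicator (Om T) w *\<^sub>R (V w * (\<psi> (fst w) * (1 - snd w / T) ^ q))" for w
    proof (cases "w \<in> Om T")
      case True
      then have "1 - snd w / T > 0" using T by (auto simp: Om_def)
      then show ?thesis by (simp add: V_eq powr_realpow)
    qed simp
    show "set_integrable lborel (Om T) (\<lambda>w. U w powr p2 * (\<psi> (fst w) * (1 - snd w / T) powr (real q + 0)))"
      using H unfolding set_integrable_def eq by blast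
    have "0 \<le> indicator (Om T) w *\<^sub>R (M w * (\<psi> (fst w) * (1 - snd w / T) ^ q))" for w
      using H M_nonneg[of w] T by (cases "w \<in> Om T") (auto simp: Om_def divide_le_eq_1 intro!: mult_nonneg_nonneg)
    then have "0 \<le> set_lebesgue_integral lborel (Om T) (\<lambda>w. M w * (\<psi> (fst w) * (1 - snd w / T) ^ q))"
      unfolding set_lebesgue_integral_def by (intro integral_nonneg_AE AE_I2)
    then show "1 * T powr 0 * set_lebesgue_integral lborel (Om T) (\<lambda>w. U w powr p2 * (\<psi> (fst w) * (1 - snd w / T) powr (real q + 0)))
        \<le> set_lebesgue_integral lborel (Om T) (\<lambda>w. M w * (\<psi> (fst w) * (1 - snd w / T) ^ q)) +
          set_lebesgue_integral lborel (Om T) (\<lambda>w. V w * (\<psi> (fst w) * (1 - snd w / T) ^ q))"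
      using T unfolding set_lebesgue_integral_def eq by simp
  qed
qed (use u0pos in auto)

text \<open>Where the memory integral diverges, \<open>memterm\<close> has the junk value \<open>0\<close>; assumption \<open>fin\<close> excludes this
  almost everywhere.\<close>

lemma nonexistence_memory:
  assumes u0pos: "(LINT z|lborel. u0 z) > 0"
    and fin: "\<And>T. T > 0 \<Longrightarrow> AE z in lborel. (\<integral>\<^sup>+s. ennreal (U (z,s) powr p1) * indicator {0<..<T} s \<partial>lborel) < \<infinity>"
    and le: "p1 \<le> 1 + 2 * (2 - \<gamma>) / (real DIM('x) + 2 * real DIM('y) - 2 + 2 * \<gamma>) \<or> p1 < 1 / \<gamma>"
  shows False
proof -
  define Q where "Q = real DIM('x) + 2 * real DIM('y)"
  have "real DIM('x) \<ge> 1" "real DIM('y) \<ge> 1" by (simp_all add: Suc_le_eq)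
  then have Q: "Q \<ge> 3" unfolding Q_def by linarith
  define b where "b = p1 / (p1 - 1)"
  have b: "b > 1" using p1 by (simp add: b_def)
  \<comment> \<open>In the first alternative \<open>e = 1\<close> works, with equality allowed. For
    \<open>p1 < 1 / \<gamma>\<close> the condition is strict at \<open>e = 0\<close>, with slack
    \<open>(1 - \<gamma>) * b - 1\<close>, and a small \<open>e\<close> uses up at most this
    slack.\<close>
  have "\<exists>e>0. e \<le> 1 \<and> 1 + e * (Q / 2) \<le> (1 - \<gamma> + e) * b"
    using le
  proof
    assume h: "p1 \<le> 1 + 2 * (2 - \<gamma>) / (real DIM('x) + 2 * real DIM('y) - 2 + 2 * \<gamma>)"
    have d: "Q - 2 + 2 * \<gamma> > 0" using Q gam by simp
    have "p1 - 1 \<le> 2 * (2 - \<gamma>) / (Q - 2 + 2 * \<gamma>)" using h by (simp add: Q_def)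
    then have "(p1 - 1) * (Q - 2 + 2 * \<gamma>) \<le> 2 * (2 - \<gamma>)" using d by (simp add: pos_le_divide_eq)
    then have "(1 + Q / 2) * (p1 - 1) \<le> (2 - \<gamma>) * p1" by (simp add: algebra_simps diff_divide_distrib)
    then have "1 + Q / 2 \<le> (2 - \<gamma>) * b" using p1 by (simp add: b_def pos_le_divide_eq)
    then show ?thesis by (intro exI[of _ 1]) simp
  next
    assume h: "p1 < 1 / \<gamma>"
    then have "\<gamma> * p1 < 1" using gam by (simp add: field_simps)
    then have "p1 - 1 < (1 - \<gamma>) * p1" by (simp add: algebra_simps)
    then have d: "(1 - \<gamma>) * b - 1 > 0" using p1 by (simp add: b_def pos_less_divide_eq)
    define \<delta> where "\<delta> = (1 - \<gamma>) * b - 1"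
    define e where "e = min 1 (\<delta> / (Q / 2))"
    have "e > 0" "e \<le> 1" using d Q by (auto simp: e_def \<delta>_def)
    moreover have "e * (Q / 2) \<le> \<delta>"
    proof -
      have "e * (Q / 2) \<le> \<delta> / (Q / 2) * (Q / 2)" unfolding e_def using Q by (intro mult_right_mono) auto
      then show ?thesis using Q by simp
    qed
    moreover have "0 \<le> e * b" using b \<open>e > 0\<close> by simp
    ultimately have "e > 0 \<and> e \<le> 1 \<and> 1 + e * (Q / 2) \<le> (1 - \<gamma> + e) * b" by (simp add: \<delta>_def algebra_simps)
    then show ?thesis by blast
  qed
  then obtain e where e: "0 < e" "e \<le> 1" "1 + e * (Q / 2) \<le> (1 - \<gamma> + e) * b" by blast
  show False
  proof (rule nonexistence_from_lower_bound[OF p1, of "1 - \<gamma>" e])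
    show "1 + e * (real DIM('x) / 2 + real DIM('y)) \<le> (1 - \<gamma> + e) * (p1 / (p1 - 1))"
      using e(3) by (simp add: Q_def b_def field_simps)
    fix q
    show "\<exists>c>0. \<forall>T\<ge>1. \<forall>\<psi>. \<psi> \<in> borel_measurable borel \<and> (\<forall>z. 0 \<le> \<psi> z) \<and>
        set_integrable lborel (Om T) (\<lambda>w. M w * (\<psi> (fst w) * (1 - snd w / T) ^ q)) \<and>
        set_integrable lborel (Om T) (\<lambda>w. V w * (\<psi> (fst w) * (1 - snd w / T) ^ q)) \<longrightarrow>
        set_integrable lborel (Om T) (\<lambda>w. U w powr p1 * (\<psi> (fst w) * (1 - snd w / T) powr (real q + (1 - \<gamma>)))) \<and>
        c * T powr (1 - \<gamma>) * set_lebesgue_integral lborel (Om T) (\<lambda>w. U w powr p1 * (\<psi> (fst w) * (1 - snd w / T) powr (real q + (1 - \<gamma>))))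
        \<le> set_lebesgue_integral lborel (Om T) (\<lambda>w. M w * (\<psi> (fst w) * (1 - snd w / T) ^ q)) +
          set_lebesgue_integral lborel (Om T) (\<lambda>w. V w * (\<psi> (fst w) * (1 - snd w / T) ^ q))"
    proof (intro exI[of _ "2 powr (\<gamma> - 1 - real q)"] conjI allI impI, simp)
      fix T :: real and \<psi> assume T1: "T \<ge> 1" and H: "\<psi> \<in> borel_measurable borel \<and> (\<forall>z. 0 \<le> \<psi> z) \<and>
        set_integrable lborel (Om T) (\<lambda>w. M w * (\<psi> (fst w) * (1 - snd w / T) ^ q)) \<and>
        set_integrable lborel (Om T) (\<lambda>w. V w * (\<psi> (fst w) * (1 - snd w / T) ^ q))"
      then have [measurable]: "\<psi> \<in> borel_measurable borel" by blast
      have T: "T > 0" using T1 by simp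
      define cT where "cT = 2 powr (\<gamma> - 1 - real q) * T powr (1 - \<gamma>)"
      have cT: "cT > 0" using T by (simp add: cT_def)
      define F where "F w = indicator (Om T) w *\<^sub>R (U w powr p1 * (\<psi> (fst w) * (1 - snd w / T) powr (real q + (1 - \<gamma>))))" for w
      define G where "G w = indicator (Om T) w *\<^sub>R (M w * (\<psi> (fst w) * (1 - snd w / T) ^ q))" for w
      have Fm: "F \<in> borel_measurable lborel" unfolding F_def[abs_def] by measurable
      have nn: "0 \<le> F w" "0 \<le> G w" "0 \<le> indicator (Om T) w *\<^sub>R (V w * (\<psi> (fst w) * (1 - snd w / T) ^ q))" for w
        using H M_nonneg[of w] V_nonneg[of w] T by (cases "w \<in> Om T"; auto simp: F_def G_def Om_def divide_le_eq_1 intro!: mult_nonneg_nonneg)+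
      have Gi: "integrable lborel G" using H unfolding set_integrable_def G_def[abs_def] by blast
      have "ennreal cT * (\<integral>\<^sup>+w. ennreal (F w) \<partial>lborel) \<le> (\<integral>\<^sup>+w. ennreal (G w) \<partial>lborel)"
      proof -
        have "(\<integral>\<^sup>+w. ennreal (F w) \<partial>lborel) = (\<integral>\<^sup>+w. ennreal (U w powr p1 * (\<psi> (fst w) * (1 - snd w / T) powr (real q + (1 - \<gamma>)))) * indicator (Om T) w \<partial>lborel)"
          by (intro nn_integral_cong) (auto simp: F_def indicator_def)
        moreover have "(\<integral>\<^sup>+w. ennreal (G w) \<partial>lborel) = (\<integral>\<^sup>+w. ennreal (M w * (\<psi> (fst w) * (1 - snd w / T) ^ q)) * indicator (Om T) w \<partial>lborel)"
          by (intro nn_integral_cong) (auto simp: G_def indicator_def)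
        ultimately show ?thesis using memory_lower[OF T fin[OF T], of \<psi> q] H by (simp add: cT_def)
      qed
      also have "(\<integral>\<^sup>+w. ennreal (G w) \<partial>lborel) = ennreal (LINT w|lborel. G w)"
        by (rule nn_integral_eq_integral[OF Gi]) (use nn in auto)
      finally have le: "ennreal cT * (\<integral>\<^sup>+w. ennreal (F w) \<partial>lborel) \<le> ennreal (LINT w|lborel. G w)" .
      have "(\<integral>\<^sup>+w. ennreal (F w) \<partial>lborel) < \<infinity>"
      proof (rule ccontr)
        assume "\<not> ?thesis"
        then have "(\<integral>\<^sup>+w. ennreal (F w) \<partial>lborel) = \<infinity>" by (simp add: not_less top_unique)
        then show False using le cT by (simp add: ennreal_mult_top top_unique)
      qed
      then have Fi: "integrable lborel F"
        by (intro integrableI_bounded[OF Fm]) (simp add: nn)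
      then show "set_integrable lborel (Om T) (\<lambda>w. U w powr p1 * (\<psi> (fst w) * (1 - snd w / T) powr (real q + (1 - \<gamma>))))"
        unfolding set_integrable_def F_def[abs_def] .
      have "(\<integral>\<^sup>+w. ennreal (F w) \<partial>lborel) = ennreal (LINT w|lborel. F w)"
        by (rule nn_integral_eq_integral[OF Fi]) (use nn in auto)
      then have "ennreal (cT * (LINT w|lborel. F w)) \<le> ennreal (LINT w|lborel. G w)"
        using le cT nn by (simp add: ennreal_mult)
      moreover have "0 \<le> (LINT w|lborel. G w)" using nn by (intro integral_nonneg_AE AE_I2)
      ultimately have "cT * (LINT w|lborel. F w) \<le> (LINT w|lborel. G w)" by simp
      moreover have "0 \<le> (LINT w|lborel. indicator (Om T) w *\<^sub>R (V w * (\<psi> (fst w) * (1 - snd w / T) ^ q)))"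
        using nn by (intro integral_nonneg_AE AE_I2)
      ultimately show "2 powr (\<gamma> - 1 - real q) * T powr (1 - \<gamma>) * set_lebesgue_integral lborel (Om T) (\<lambda>w. U w powr p1 * (\<psi> (fst w) * (1 - snd w / T) powr (real q + (1 - \<gamma>))))
        \<le> set_lebesgue_integral lborel (Om T) (\<lambda>w. M w * (\<psi> (fst w) * (1 - snd w / T) ^ q)) +
          set_lebesgue_integral lborel (Om T) (\<lambda>w. V w * (\<psi> (fst w) * (1 - snd w / T) ^ q))"
        unfolding set_lebesgue_integral_def F_def[symmetric] G_def[symmetric] cT_def[symmetric] by simp
    qed
  qed (use e gam u0pos in auto)
qed

end

section \<open>A Gaussian supersolution away from the degenerate set\<close>

lemma profile_exp:
  assumes b: "\<And>t. t \<in> {0..T} \<Longrightarrow> (\<beta> has_real_derivative \<beta>' t) (at t within {0..T})" and c: "continuous_on {0..T} \<beta>'"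
  shows "profile T (\<lambda>r t. exp (- r * \<beta> t)) (\<lambda>r t. - \<beta> t * exp (- r * \<beta> t)) (\<lambda>r t. \<beta> t * \<beta> t * exp (- r * \<beta> t))
    (\<lambda>r t. - r * \<beta>' t * exp (- r * \<beta> t))"
proof -
  have cb: "continuous_on {0..T} \<beta>" using DERIV_continuous[OF b] by (auto simp: continuous_on_eq_continuous_within)
  have "continuous_on (UNIV \<times> {0..T}) (\<lambda>w::real \<times> real. \<beta> (snd w))" "continuous_on (UNIV \<times> {0..T}) (\<lambda>w::real \<times> real. \<beta>' (snd w))"
    using cb c by (auto intro: continuous_on_compose2[OF _ continuous_on_snd[OF continuous_on_id]])
  moreover have "((\<lambda>r. exp (- r * \<beta> t)) has_real_derivative - \<beta> t * exp (- r * \<beta> t)) (at r)" for r t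
    by (auto intro!: derivative_eq_intros)
  moreover have "((\<lambda>r. - \<beta> t * exp (- r * \<beta> t)) has_real_derivative \<beta> t * \<beta> t * exp (- r * \<beta> t)) (at r)" for r t
    by (auto intro!: derivative_eq_intros)
  moreover have "((\<lambda>t. exp (- r * \<beta> t)) has_real_derivative - r * \<beta>' t * exp (- r * \<beta> t)) (at t within {0..T})" if "t \<in> {0..T}" for r t
    using DERIV_chain2[OF DERIV_exp DERIV_cmult[OF b[OF that], of "- r"]] by (simp add: mult_ac)
  ultimately show ?thesis unfolding profile_def
    by (auto intro!: continuous_on_mult continuous_on_minus continuous_on_exp continuous_on_fst continuous_on_id)
qed

text \<open>From \<open>x \<le> exp x\<close> at \<open>x = y / r\<close>. It converts Gaussian
  decay into decay of any prescribed power.\<close>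

lemma exp_neg_le_powr:
  fixes y r :: real
  assumes "y > 0" "r > 0"
  shows "exp (- y) \<le> (r / y) powr r"
proof -
  have "exp (- y) = exp (y / r) powr (- r)" using assms by (simp add: powr_def)
  also have "\<dots> \<le> (y / r) powr (- r)"
  proof (rule powr_mono2')
    show "y / r \<le> exp (y / r)" using exp_ge_add_one_self[of "y / r"] by linarith
  qed (use assms in auto)
  also have "\<dots> = (r / y) powr r" using assms by (simp add: powr_minus powr_divide)
  finally show ?thesis .
qed

text \<open>\<open>N\<close> and \<open>k\<close> are the two dimensions as reals. \<open>A0\<close>
  keeps the poles away from the degenerate set, \<open>D\<close> bounds the norms in
  \<open>x\<close> met at the poles and on the support, \<open>d\<close> is the cutoff radius and
  \<open>T1\<close> the largest time lag. All estimates in this setting are inequalities between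
  real numbers, free of the geometry.\<close>

locale frozen_kernel =
  fixes N k A0 D d T1 :: real
  assumes N: "N \<ge> 1" and k: "k \<ge> 1" and A0: "0 < A0" "A0 \<le> D" and d: "d > 0" and T1: "T1 > 0"
begin

text \<open>Gaussian kernel with the coefficient of the \<open>y\<close>-Laplacian frozen at \<open>A\<^sup>2\<close>, where \<open>A\<close> is
  the norm of the first component of the pole, \<open>P\<close> and \<open>Q\<close> are the squared distances to the pole in \<open>x\<close> and \<open>y\<close>,
  and \<open>X\<close> stands for the actual coefficient. Enlarging the variance to \<open>mu\<close> makes it grow faster
  than \<open>X\<close> when \<open>P \<le> sqrt \<tau>\<close>, and \<open>bb\<close> is chosen so that the factor \<open>exp (bb * \<tau> powr (1/4))\<close>
  absorbs the remaining singular term; for larger \<open>P\<close> the Gaussian decay beats every power of \<open>\<tau>\<close>.\<close>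

definition bb where "bb = 8 * k * D / A0\<^sup>2"
definition sg where "sg \<tau> = \<tau> powr (- (N + k) / 2) * exp (bb * \<tau> powr (1/4))"
definition sg' where "sg' \<tau> = sg \<tau> * (- (N + k) / (2 * \<tau>) + bb / 4 * \<tau> powr (- 3/4))"
definition mu where "mu A \<tau> = \<tau> * (A\<^sup>2 + 2 * D * \<tau> powr (1/4))"
definition mu' where "mu' A \<tau> = A\<^sup>2 + 5/2 * D * \<tau> powr (1/4)"

lemma D: "D > 0" using A0 by simp
lemma bb: "bb > 0" using k D A0 by (simp add: bb_def)

lemma sg_deriv: "\<tau> > 0 \<Longrightarrow> (sg has_real_derivative sg' \<tau>) (at \<tau>)"
proof -
  assume t: "\<tau> > 0"
  have "((\<lambda>\<tau>. \<tau> powr (- (N + k) / 2) * exp (bb * \<tau> powr (1/4))) has_real_derivative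
     ((- (N + k) / 2) * \<tau> powr (- (N + k) / 2 - 1)) * exp (bb * \<tau> powr (1/4)) +
     (exp (bb * \<tau> powr (1/4)) * (bb * ((1/4) * \<tau> powr (1/4 - 1)))) * \<tau> powr (- (N + k) / 2)) (at \<tau>)"
    using t by (intro DERIV_mult DERIV_fun_exp DERIV_cmult has_real_derivative_powr)
  moreover have "((- (N + k) / 2) * \<tau> powr (- (N + k) / 2 - 1)) * exp (bb * \<tau> powr (1/4)) +
     (exp (bb * \<tau> powr (1/4)) * (bb * ((1/4) * \<tau> powr (1/4 - 1)))) * \<tau> powr (- (N + k) / 2) = sg' \<tau>"
  proof -
    have "\<tau> powr (- (N + k) / 2 - 1) = \<tau> powr (- (N + k) / 2) / \<tau>" using t by (simp add: powr_diff)
    then show ?thesis unfolding sg'_def sg_def by (simp add: algebra_simps)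
  qed
  ultimately show ?thesis unfolding sg_def[abs_def] by simp
qed

lemma mu_deriv: "\<tau> > 0 \<Longrightarrow> (mu A has_real_derivative mu' A \<tau>) (at \<tau>)"
proof -
  assume t: "\<tau> > 0"
  have "((\<lambda>\<tau>. \<tau> * (A\<^sup>2 + 2 * D * \<tau> powr (1/4))) has_real_derivative
     1 * (A\<^sup>2 + 2 * D * \<tau> powr (1/4)) + (0 + 2 * D * ((1/4) * \<tau> powr (1/4 - 1))) * \<tau>) (at \<tau>)"
    using t by (intro DERIV_mult DERIV_add DERIV_const DERIV_cmult has_real_derivative_powr DERIV_ident)
  moreover have "\<tau> powr (1/4 - 1) * \<tau> = \<tau> powr (1/4)" using powr_add[of \<tau> "1/4 - 1" 1] t by simp
  then have "1 * (A\<^sup>2 + 2 * D * \<tau> powr (1/4)) + (0 + 2 * D * ((1/4) * \<tau> powr (1/4 - 1))) * \<tau> = mu' A \<tau>"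
    by (simp add: mu'_def algebra_simps)
  ultimately show ?thesis unfolding mu_def[abs_def] by simp
qed

text \<open>The variance is comparable to \<open>\<tau>\<close>, uniformly over the poles. The lower
  constant is \<open>A0^2\<close>, so it degenerates as poles approach \<open>x = 0\<close>.\<close>

lemma mu_bounds:
  assumes "0 < \<tau>" "\<tau> \<le> T1" "A0 \<le> A" "A \<le> D"
  shows "A0\<^sup>2 * \<tau> \<le> mu A \<tau>" "0 < mu A \<tau>" "mu A \<tau> \<le> (D\<^sup>2 + 2 * D * T1 powr (1/4)) * \<tau>"
proof -
  have "A0\<^sup>2 \<le> A\<^sup>2" "A\<^sup>2 \<le> D\<^sup>2" using assms A0 by (auto intro!: power_mono)
  moreover have "0 \<le> 2 * D * \<tau> powr (1/4)" "2 * D * \<tau> powr (1/4) \<le> 2 * D * T1 powr (1/4)"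
    using D assms by (auto intro!: powr_mono2)
  ultimately have "A0\<^sup>2 \<le> A\<^sup>2 + 2 * D * \<tau> powr (1/4)" "A\<^sup>2 + 2 * D * \<tau> powr (1/4) \<le> D\<^sup>2 + 2 * D * T1 powr (1/4)" by linarith+
  then show "A0\<^sup>2 * \<tau> \<le> mu A \<tau>" "mu A \<tau> \<le> (D\<^sup>2 + 2 * D * T1 powr (1/4)) * \<tau>"
    unfolding mu_def using assms by (simp_all add: mult.commute mult_left_mono)
  moreover have "0 < A0\<^sup>2 * \<tau>" using A0 assms by simp
  ultimately show "0 < mu A \<tau>" by linarith
qed

text \<open>Rate at which the kernel fails to solve the adjoint equation: apart from the cutoffs,
  the operator plus the time derivative turns the kernel into \<open>- J\<close> times itself, see
  \<open>kernel_identity\<close>. Hence \<open>J \<ge> 0\<close> is the sign of a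
  supersolution.\<close>

definition J where "J A P Q X \<tau> = bb / 4 * \<tau> powr (- 3/4) + Q * (mu' A \<tau> - X) / (4 * (mu A \<tau>)\<^sup>2) + k / 2 * (X / mu A \<tau> - 1 / \<tau>)"

text \<open>With \<open>\<theta> = \<tau> powr (1/4)\<close> one has
  \<open>sqrt P \<le> \<theta>\<close>, so \<open>X\<close> differs from \<open>A^2\<close> by at
  most \<open>2 * D * \<theta>\<close>. Then \<open>mu'\<close>, which exceeds \<open>A^2\<close> by
  \<open>5/2 * D * \<theta>\<close>, dominates \<open>X\<close>, and the last term of
  \<open>J\<close> loses at most \<open>2 * k * D * \<theta> / (A0^2 * \<tau>)\<close>, which is
  exactly \<open>bb / 4 * \<tau> powr (- 3/4)\<close>.\<close>

lemma J_near:
  assumes t: "0 < \<tau>" "\<tau> \<le> T1" and A: "A0 \<le> A" "A \<le> D" and P: "0 \<le> P" "P \<le> \<tau> powr (1/2)" and Q: "0 \<le> Q"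
    and X: "X \<le> A\<^sup>2 + 2 * D * sqrt P" "A\<^sup>2 - 2 * D * sqrt P \<le> X"
  shows "J A P Q X \<tau> \<ge> 0"
proof -
  define \<theta> where "\<theta> = \<tau> powr (1/4)"
  have th: "\<theta> \<ge> 0" by (simp add: \<theta>_def)
  have "\<theta> * \<theta> = \<tau> powr (1/2)" by (simp add: \<theta>_def powr_add[symmetric])
  then have sP: "sqrt P \<le> \<theta>" using P th by (intro real_le_lsqrt) (auto simp: power2_eq_square)
  note m = mu_bounds[OF t A]
  have DsP: "2 * D * sqrt P \<le> 2 * D * \<theta>" using sP D by simp
  have "0 \<le> D * \<theta>" using D th by simp
  then have "mu' A \<tau> - X \<ge> 0" using X(1) DsP by (simp add: mu'_def \<theta>_def[symmetric])
  then have 1: "0 \<le> Q * (mu' A \<tau> - X) / (4 * (mu A \<tau>)\<^sup>2)" using Q by simp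
  have "X / mu A \<tau> - 1 / \<tau> = (X - mu A \<tau> / \<tau>) / mu A \<tau>" using m t by (simp add: field_simps)
  also have "mu A \<tau> / \<tau> = A\<^sup>2 + 2 * D * \<theta>" using t by (simp add: mu_def \<theta>_def)
  finally have e: "X / mu A \<tau> - 1 / \<tau> = (X - (A\<^sup>2 + 2 * D * \<theta>)) / mu A \<tau>" .
  have "- (4 * D * \<theta>) \<le> X - (A\<^sup>2 + 2 * D * \<theta>)" using X(2) DsP by linarith
  then have "- (4 * D * \<theta>) / mu A \<tau> \<le> (X - (A\<^sup>2 + 2 * D * \<theta>)) / mu A \<tau>" using m by (intro divide_right_mono) auto
  moreover have "4 * D * \<theta> / mu A \<tau> \<le> 4 * D * \<theta> / (A0\<^sup>2 * \<tau>)"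
    using m D th A0 t by (intro divide_left_mono) (auto intro!: mult_pos_pos)
  ultimately have "- (4 * D * \<theta> / (A0\<^sup>2 * \<tau>)) \<le> X / mu A \<tau> - 1 / \<tau>" unfolding e by simp
  then have L: "k / 2 * - (4 * D * \<theta> / (A0\<^sup>2 * \<tau>)) \<le> k / 2 * (X / mu A \<tau> - 1 / \<tau>)" using k by (intro mult_left_mono) auto
  have "\<theta> / \<tau> = \<tau> powr (- 3/4)"
  proof -
    have "\<tau> powr (1/4) / \<tau> powr 1 = \<tau> powr (1/4 - 1)" by (rule powr_diff[symmetric])
    then show ?thesis using t by (simp add: \<theta>_def)
  qed
  moreover have "4 * D * \<theta> / (A0\<^sup>2 * \<tau>) = 4 * D / A0\<^sup>2 * (\<theta> / \<tau>)" by simp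
  ultimately have "k / 2 * - (4 * D * \<theta> / (A0\<^sup>2 * \<tau>)) = - (bb / 4 * \<tau> powr (- 3/4))"
    by (simp add: bb_def)
  with L show ?thesis using 1 unfolding J_def by linarith
qed

text \<open>No sign is available here. The order \<open>1 / \<tau>^2\<close> stems from the square
  of \<open>mu\<close> in the denominator, and the bounds on \<open>Q\<close> and \<open>X\<close>
  are those valid on the support of the cutoffs.\<close>

lemma J_far:
  assumes t: "0 < \<tau>" "\<tau> \<le> T1" and A: "A0 \<le> A" "A \<le> D" and Q: "0 \<le> Q" "Q \<le> 2 * d\<^sup>2"
    and X: "0 \<le> X" "X \<le> D\<^sup>2"
  shows "- J A P Q X \<tau> \<le> (d\<^sup>2 * D\<^sup>2 / (2 * A0 ^ 4) + k / 2 * T1) / \<tau>\<^sup>2"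
proof -
  note m = mu_bounds[OF t A]
  have "(A0\<^sup>2 * \<tau>)\<^sup>2 \<le> (mu A \<tau>)\<^sup>2" using m A0 t by (intro power_mono) auto
  then have m2: "A0 ^ 4 * \<tau>\<^sup>2 \<le> (mu A \<tau>)\<^sup>2" by (simp add: power_mult_distrib)
  have mp: "mu' A \<tau> \<ge> 0" using D by (simp add: mu'_def)
  have "Q * (X - mu' A \<tau>) \<le> 2 * d\<^sup>2 * D\<^sup>2"
  proof (cases "X - mu' A \<tau> \<ge> 0")
    case True
    then show ?thesis using Q X mp by (intro mult_mono) auto
  next
    case False
    then have "Q * (X - mu' A \<tau>) \<le> 0" using Q by (simp add: mult_nonneg_nonpos)
    also have "0 \<le> 2 * d\<^sup>2 * D\<^sup>2" by simp
    finally show ?thesis .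
  qed
  then have "Q * (X - mu' A \<tau>) / (4 * (mu A \<tau>)\<^sup>2) \<le> 2 * d\<^sup>2 * D\<^sup>2 / (4 * (mu A \<tau>)\<^sup>2)"
    by (intro divide_right_mono) auto
  also have "\<dots> \<le> 2 * d\<^sup>2 * D\<^sup>2 / (4 * (A0 ^ 4 * \<tau>\<^sup>2))"
    using m2 A0 t m by (intro divide_left_mono) (auto intro!: mult_pos_pos)
  finally have 1: "- (Q * (mu' A \<tau> - X) / (4 * (mu A \<tau>)\<^sup>2)) \<le> (d\<^sup>2 * D\<^sup>2 / (2 * A0 ^ 4)) / \<tau>\<^sup>2"
    by (simp add: minus_divide_left algebra_simps)
  have "1 / \<tau> = \<tau> / \<tau>\<^sup>2" using t by (simp add: power2_eq_square)
  also have "\<dots> \<le> T1 / \<tau>\<^sup>2" using t by (intro divide_right_mono) auto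
  finally have "k / 2 * (1 / \<tau>) \<le> k / 2 * (T1 / \<tau>\<^sup>2)" using k by (intro mult_left_mono) auto
  moreover have "0 \<le> k / 2 * (X / mu A \<tau>)" using k X m by simp
  moreover have "0 \<le> bb / 4 * \<tau> powr (- 3/4)" using bb by simp
  ultimately show ?thesis using 1 unfolding J_def by (simp add: algebra_simps add_divide_distrib)
qed

text \<open>\<open>m1\<close> bounds \<open>mu / \<tau>\<close>, and \<open>c0\<close> is a Gaussian
  rate valid in both blocks of variables. \<open>cc\<close> makes the exponent at least
  \<open>cc * \<tau> powr (- 1/2)\<close> in two situations: for \<open>P \<ge> sqrt \<tau>\<close>,
  whence the value \<open>1/4\<close>, and at squared distance \<open>d^2\<close> or more, where
  \<open>1 / \<tau> \<ge> 1 / sqrt (T1 * \<tau>)\<close> gives the second value.\<close>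

definition m1 where "m1 = D\<^sup>2 + 2 * D * T1 powr (1/4)"
definition c0 where "c0 = min (1/4) (1 / (4 * m1))"
definition cc where "cc = min (1/4) (d\<^sup>2 * c0 / sqrt T1)"

lemma m1: "m1 > 0" using D by (simp add: m1_def add_pos_nonneg)
lemma c0: "c0 > 0" using m1 by (simp add: c0_def)
lemma cc: "cc > 0" using c0 d T1 by (simp add: cc_def)

lemma sg_pos: "\<tau> > 0 \<Longrightarrow> sg \<tau> > 0" by (simp add: sg_def)

lemma sg_le: "0 < \<tau> \<Longrightarrow> \<tau> \<le> T1 \<Longrightarrow> sg \<tau> \<le> exp (bb * T1 powr (1/4)) * \<tau> powr (- (N + k) / 2)"
  unfolding sg_def using bb by (subst mult.commute) (intro mult_mono, auto intro!: powr_mono2)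

lemma sg_ge: "0 < \<tau> \<Longrightarrow> \<tau> powr (- (N + k) / 2) \<le> sg \<tau>"
  unfolding sg_def using bb by (simp add: mult_le_cancel_left1)

definition Cs where "Cs = exp (bb * T1 powr (1/4)) * ((N + k + 4) / cc) powr (N + k + 4)"

lemma Cs: "Cs > 0" using cc N k by (simp add: Cs_def)

text \<open>The exponent \<open>r = N + k + 4\<close> makes the gain
  \<open>\<tau> powr (r / 2)\<close> cancel both \<open>\<tau> powr (- (N + k) / 2)\<close> and
  \<open>1 / \<tau>^2\<close> exactly.\<close>

lemma far_bound:
  assumes t: "0 < \<tau>" "\<tau> \<le> T1" and y: "y \<ge> cc * \<tau> powr (- 1/2)"
  shows "sg \<tau> / \<tau>\<^sup>2 * exp (- y) \<le> Cs"
proof -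
  define r where "r = N + k + 4"
  have r: "r > 0" using N k by (simp add: r_def)
  have c: "cc * \<tau> powr (- 1/2) > 0" using cc t by simp
  have "exp (- y) \<le> exp (- (cc * \<tau> powr (- 1/2)))" using y by simp
  also have "\<dots> \<le> (r / (cc * \<tau> powr (- 1/2))) powr r" by (rule exp_neg_le_powr[OF c r])
  also have "r / (cc * \<tau> powr (- 1/2)) = (r / cc) * \<tau> powr (1/2)" using t by (simp add: powr_minus field_simps)
  also have "((r / cc) * \<tau> powr (1/2)) powr r = (r / cc) powr r * \<tau> powr (r / 2)"
    using r cc t by (subst powr_mult) (simp_all add: powr_powr)
  finally have "sg \<tau> / \<tau>\<^sup>2 * exp (- y) \<le> (exp (bb * T1 powr (1/4)) * \<tau> powr (- (N + k) / 2)) / \<tau>\<^sup>2 * ((r / cc) powr r * \<tau> powr (r / 2))"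
    using sg_le[OF t] sg_pos[OF t(1)] t by (intro mult_mono divide_right_mono) auto
  also have "\<dots> = exp (bb * T1 powr (1/4)) * (r / cc) powr r * (\<tau> powr (- (N + k) / 2) / \<tau> powr 2 * \<tau> powr (r / 2))"
    using t by simp
  also have "\<tau> powr (- (N + k) / 2) / \<tau> powr 2 * \<tau> powr (r / 2) = \<tau> powr 0"
    unfolding powr_diff[symmetric] powr_add[symmetric] r_def by (rule arg_cong[where f="\<lambda>x. \<tau> powr x"]) (simp add: field_simps)
  finally show ?thesis using t by (simp add: Cs_def r_def)
qed

lemma cc_le:
  assumes t: "0 < \<tau>" "\<tau> \<le> T1"
  shows "P \<ge> \<tau> powr (1/2) \<Longrightarrow> P / (4 * \<tau>) \<ge> cc * \<tau> powr (- 1/2)"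
    "P \<ge> d\<^sup>2 \<Longrightarrow> P / (4 * \<tau>) \<ge> cc * \<tau> powr (- 1/2)"
    "A0 \<le> A \<Longrightarrow> A \<le> D \<Longrightarrow> P \<ge> d\<^sup>2 \<Longrightarrow> P / (4 * mu A \<tau>) \<ge> cc * \<tau> powr (- 1/2)"
    "A0 \<le> A \<Longrightarrow> A \<le> D \<Longrightarrow> 0 \<le> P \<Longrightarrow> c0 * P / \<tau> \<le> P / (4 * mu A \<tau>)"
    "0 \<le> P \<Longrightarrow> c0 * P / \<tau> \<le> P / (4 * \<tau>)"
proof -
  have ccl: "cc \<le> 1/4" "cc \<le> d\<^sup>2 * c0 / sqrt T1" "c0 \<le> 1/4" "c0 \<le> 1 / (4 * m1)"
    by (simp_all only: cc_def c0_def min.cobounded1 min.cobounded2)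
  have h: "\<tau> powr (- 1/2) = 1 / sqrt \<tau>" "\<tau> powr (1/2) = sqrt \<tau>" using t by (simp_all add: powr_half_sqrt powr_minus_divide)
  have s: "sqrt \<tau> * sqrt \<tau> = \<tau>" "sqrt \<tau> > 0" "sqrt \<tau> \<le> sqrt T1" using t by auto
  show "P \<ge> \<tau> powr (1/2) \<Longrightarrow> P / (4 * \<tau>) \<ge> cc * \<tau> powr (- 1/2)"
  proof -
    assume "P \<ge> \<tau> powr (1/2)"
    then have "sqrt \<tau> / (4 * \<tau>) \<le> P / (4 * \<tau>)" using t h by (intro divide_right_mono) auto
    moreover have "sqrt \<tau> / (4 * \<tau>) = 1/4 * (1 / sqrt \<tau>)"
    proof -
      have "sqrt \<tau> / (4 * (sqrt \<tau> * sqrt \<tau>)) = 1/4 * (1 / sqrt \<tau>)" using s(2) by (simp del: real_sqrt_mult_self)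
      then show ?thesis unfolding s(1) .
    qed
    moreover have "cc * (1 / sqrt \<tau>) \<le> 1/4 * (1 / sqrt \<tau>)" using s by (intro mult_right_mono) (use ccl in auto)
    ultimately show ?thesis unfolding h by linarith
  qed
  have main: "c0 * P / \<tau> \<ge> cc * \<tau> powr (- 1/2)" if "P \<ge> d\<^sup>2" for P
  proof -
    have "cc * (1 / sqrt \<tau>) \<le> (d\<^sup>2 * c0 / sqrt T1) * (1 / sqrt \<tau>)" using s by (intro mult_right_mono) (use ccl in auto)
    also have "\<dots> \<le> (d\<^sup>2 * c0 / sqrt \<tau>) * (1 / sqrt \<tau>)" using s c0 T1 by (intro mult_right_mono divide_left_mono) auto
    also have "\<dots> = c0 * d\<^sup>2 / \<tau>" using s by (simp add: mult.commute)
    also have "\<dots> \<le> c0 * P / \<tau>" using that c0 t by (intro divide_right_mono mult_left_mono) auto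
    finally show ?thesis unfolding h .
  qed
  show 4: "c0 * P / \<tau> \<le> P / (4 * mu A \<tau>)" if A: "A0 \<le> A" "A \<le> D" and P: "0 \<le> P" for A P
  proof -
    note m = mu_bounds[OF t A]
    have "c0 * P / \<tau> \<le> 1 / (4 * m1) * P / \<tau>" using P t by (intro divide_right_mono mult_right_mono) (use ccl in auto)
    also have "\<dots> = P / (4 * (m1 * \<tau>))" by simp
    also have "\<dots> \<le> P / (4 * mu A \<tau>)" using m m1 t P by (intro divide_left_mono) (auto simp: m1_def)
    finally show ?thesis .
  qed
  show 5: "c0 * P / \<tau> \<le> P / (4 * \<tau>)" if P: "0 \<le> P" for P
  proof -
    have "c0 * P / \<tau> \<le> 1 / 4 * P / \<tau>" using P t by (intro divide_right_mono mult_right_mono) (use ccl in auto)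
    then show ?thesis by simp
  qed
  have dd: "0 \<le> P" if "P \<ge> d\<^sup>2" for P using that by (meson order_trans zero_le_power2)
  show "P \<ge> d\<^sup>2 \<Longrightarrow> P / (4 * \<tau>) \<ge> cc * \<tau> powr (- 1/2)" using main[of P] 5[of P] dd[of P] by linarith
  show "A0 \<le> A \<Longrightarrow> A \<le> D \<Longrightarrow> P \<ge> d\<^sup>2 \<Longrightarrow> P / (4 * mu A \<tau>) \<ge> cc * \<tau> powr (- 1/2)" using main[of P] 4[of A P] dd[of P] by linarith
qed

text \<open>Common form of the three error terms of the kernel: \<open>w\<close> gathers the factors
  between 0 and 1, and \<open>B\<close> is the error itself, of order
  \<open>1 / \<tau>^2\<close>.\<close>

lemma weighted_far_bound:
  assumes t: "0 < \<tau>" "\<tau> \<le> T1" and y: "y \<ge> cc * \<tau> powr (- 1/2)" and B: "\<bar>B\<bar> \<le> b / \<tau>\<^sup>2" and w: "0 \<le> w" "w \<le> 1"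
  shows "w * sg \<tau> * exp (- y) * B \<le> Cs * b"
proof -
  have b: "b \<ge> 0"
  proof -
    have "0 \<le> b / \<tau>\<^sup>2" using B by linarith
    then show ?thesis using t by (simp add: zero_le_divide_iff)
  qed
  have "w * sg \<tau> * exp (- y) * B \<le> w * (sg \<tau> * exp (- y)) * (b / \<tau>\<^sup>2)"
    using B w sg_pos[OF t(1)] unfolding mult.assoc by (intro mult_left_mono) auto
  also have "\<dots> \<le> 1 * (sg \<tau> * exp (- y)) * (b / \<tau>\<^sup>2)"
    using w sg_pos[OF t(1)] b by (intro mult_right_mono) auto
  also have "\<dots> = (sg \<tau> / \<tau>\<^sup>2 * exp (- y)) * b" by simp
  also have "\<dots> \<le> Cs * b" using far_bound[OF t y] b by (rule mult_right_mono)
  finally show ?thesis .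
qed

text \<open>One summand for each source of error: the region where \<open>J\<close> may be negative,
  the derivatives of the cutoff in \<open>x\<close>, and those of the cutoff in \<open>y\<close>,
  the last multiplied by the bound \<open>D^2\<close> of the coefficient.\<close>

definition Cerr where "Cerr = Cs * (d\<^sup>2 * D\<^sup>2 / (2 * A0 ^ 4) + k / 2 * T1) + Cs * (135 * (4 * T1 + (8 + 2 * N) * T1\<^sup>2 / d\<^sup>2))
   + Cs * (D\<^sup>2 * (135 * (4 * T1 / A0\<^sup>2 + (8 + 2 * k) * T1\<^sup>2 / d\<^sup>2)))"

lemma Cerr: "Cerr \<ge> 0"
  unfolding Cerr_def using Cs N k T1 by (intro add_nonneg_nonneg mult_nonneg_nonneg divide_nonneg_nonneg) auto

text \<open>Here \<open>135 = 15 * 3^2\<close> is the constant of \<open>cut_bounds\<close> at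
  \<open>l = 3\<close>.\<close>

lemma cut3_bounds:
  "\<bar>cut1 3 (P / d\<^sup>2) / d\<^sup>2\<bar> \<le> 135 / d\<^sup>2" "\<bar>cut2 3 (P / d\<^sup>2) / (d\<^sup>2)\<^sup>2\<bar> \<le> 135 / (d\<^sup>2)\<^sup>2"
proof -
  have c: "\<bar>cut1 3 r\<bar> \<le> 135" "\<bar>cut2 3 r\<bar> \<le> 135" for r
    using cut_bounds(5,6)[of 3 r] cbase_bounds[of r] by auto
  show "\<bar>cut1 3 (P / d\<^sup>2) / d\<^sup>2\<bar> \<le> 135 / d\<^sup>2" "\<bar>cut2 3 (P / d\<^sup>2) / (d\<^sup>2)\<^sup>2\<bar> \<le> 135 / (d\<^sup>2)\<^sup>2"
    using c(1)[of "P / d\<^sup>2"] c(2)[of "P / d\<^sup>2"] d by (auto simp: abs_divide intro: divide_right_mono)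
qed

text \<open>Used with \<open>e = 1/4\<close> in \<open>x\<close> and
  \<open>e = 1 / (4 * A0^2)\<close> in \<open>y\<close>, the respective bounds for
  \<open>\<beta> * \<tau>\<close>. All terms are weakened to order \<open>1 / \<tau>^2\<close>, at
  the price of powers of \<open>T1\<close>, to fit \<open>weighted_far_bound\<close>.\<close>

lemma cut_error_bound:
  assumes t: "0 < \<tau>" "\<tau> \<le> T1" and be: "0 \<le> \<beta>" "\<beta> \<le> e / \<tau>" and n: "n \<ge> 0" and P: "0 \<le> P" "P \<le> 2 * d\<^sup>2"
  shows "\<bar>4 * P * (2 * (- \<beta>) * (cut1 3 (P / d\<^sup>2) / d\<^sup>2) + cut2 3 (P / d\<^sup>2) / (d\<^sup>2)\<^sup>2) + 2 * n * (cut1 3 (P / d\<^sup>2) / d\<^sup>2)\<bar>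
    \<le> (135 * (16 * e * T1 + (8 + 2 * n) * T1\<^sup>2 / d\<^sup>2)) / \<tau>\<^sup>2"
proof -
  define h where "h = cut1 3 (P / d\<^sup>2) / d\<^sup>2"
  define h2 where "h2 = cut2 3 (P / d\<^sup>2) / (d\<^sup>2)\<^sup>2"
  have hb: "\<bar>h\<bar> \<le> 135 / d\<^sup>2" "\<bar>h2\<bar> \<le> 135 / (d\<^sup>2)\<^sup>2" unfolding h_def h2_def by (rule cut3_bounds)+
  have d2: "d\<^sup>2 > 0" using d by simp
  have e: "0 \<le> e / \<tau>" using be by linarith
  have "\<bar>8 * P * \<beta> * h\<bar> \<le> 8 * (2 * d\<^sup>2) * (e / \<tau>) * (135 / d\<^sup>2)"
  proof -
    have "0 \<le> 8 * (2 * d\<^sup>2) * (e / \<tau>)" using e by (intro mult_nonneg_nonneg) auto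
    then show ?thesis unfolding abs_mult using P be hb by (intro mult_mono) auto
  qed
  also have "\<dots> = 135 * 16 * (e / \<tau>)" using d2 by simp
  finally have 1: "\<bar>8 * P * \<beta> * h\<bar> \<le> 135 * 16 * (e / \<tau>)" .
  have "\<bar>4 * P * h2\<bar> \<le> 4 * (2 * d\<^sup>2) * (135 / (d\<^sup>2)\<^sup>2)"
    unfolding abs_mult using P hb by (intro mult_mono) auto
  also have "\<dots> = 135 * 8 / d\<^sup>2" using d2 by (simp add: power2_eq_square)
  finally have 2: "\<bar>4 * P * h2\<bar> \<le> 135 * 8 / d\<^sup>2" .
  have 3: "\<bar>2 * n * h\<bar> \<le> 2 * n * (135 / d\<^sup>2)"
    unfolding abs_mult using n hb by (intro mult_mono) auto
  have "4 * P * (2 * (- \<beta>) * h + h2) + 2 * n * h = - (8 * P * \<beta> * h) + 4 * P * h2 + 2 * n * h" by (simp add: algebra_simps)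
  then have "\<bar>4 * P * (2 * (- \<beta>) * h + h2) + 2 * n * h\<bar> \<le> 135 * 16 * (e / \<tau>) + 135 * 8 / d\<^sup>2 + 2 * n * (135 / d\<^sup>2)"
    using 1 2 3 by linarith
  also have "\<dots> = 135 * (16 * e * (1 / \<tau>) + (8 + 2 * n) / d\<^sup>2 * 1)" by (simp add: algebra_simps add_divide_distrib)
  also have "\<dots> \<le> 135 * (16 * e * (T1 / \<tau>\<^sup>2) + (8 + 2 * n) / d\<^sup>2 * (T1\<^sup>2 / \<tau>\<^sup>2))"
  proof -
    have e0: "e \<ge> 0" using e t by (simp add: zero_le_divide_iff)
    have "1 / \<tau> \<le> T1 / \<tau>\<^sup>2" using t by (simp add: power2_eq_square field_simps)
    moreover have "1 \<le> T1\<^sup>2 / \<tau>\<^sup>2" using t by (simp add: power_mono)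
    ultimately show ?thesis using e0 n by (intro mult_left_mono add_mono) auto
  qed
  also have "\<dots> = (135 * (16 * e * T1 + (8 + 2 * n) * T1\<^sup>2 / d\<^sup>2)) / \<tau>\<^sup>2" by (simp add: add_divide_distrib algebra_simps)
  finally show ?thesis unfolding h_def h2_def .
qed

text \<open>The Gaussian in \<open>x\<close> solves its heat equation exactly, so the terms with
  \<open>P\<close> and \<open>N\<close> that do not differentiate a cutoff cancel. In
  \<open>y\<close> the true coefficient \<open>X\<close> meets the variance \<open>mu\<close>, and
  the remainder is \<open>J\<close>. Time runs backwards from the pole, hence the minus sign in
  front of \<open>sg'\<close>.\<close>

lemma kernel_identity:
  fixes P Q X E1 E2 H Hp Hpp G Gp Gpp th th' \<tau> A :: real
  assumes t: "0 < \<tau>" and m: "0 < mu A \<tau>"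
  defines "S \<equiv> sg \<tau>" and "\<zeta> \<equiv> sg \<tau> * th" and "\<zeta>' \<equiv> - sg' \<tau> * th + sg \<tau> * th'"
    and "\<beta> \<equiv> 1 / (4 * \<tau>)" and "\<beta>' \<equiv> 1 / (4 * \<tau>\<^sup>2)" and "b \<equiv> 1 / (4 * mu A \<tau>)" and "b' \<equiv> mu' A \<tau> / (4 * (mu A \<tau>)\<^sup>2)"
  shows "(4 * P * ((\<zeta> * (\<beta> * \<beta> * E1)) * H + 2 * (\<zeta> * (- \<beta> * E1)) * Hp + (\<zeta> * E1) * Hpp) + 2 * N * ((\<zeta> * (- \<beta> * E1)) * H + (\<zeta> * E1) * Hp)) * (E2 * G)
    + X * ((\<zeta> * E1) * H * (4 * Q * (b * b * E2 * G + 2 * (- b * E2) * Gp + E2 * Gpp) + 2 * k * (- b * E2 * G + E2 * Gp)))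
    + ((\<zeta>' * E1 + \<zeta> * (- P * \<beta>' * E1)) * H * (E2 * G) + (\<zeta> * E1) * H * (- Q * b' * E2 * G))
    = th' * S * E1 * E2 * H * G - th * S * E1 * E2 * H * G * J A P Q X \<tau>
      + th * S * E1 * E2 * G * (4 * P * (2 * (- \<beta>) * Hp + Hpp) + 2 * N * Hp)
      + X * (th * S * E1 * E2 * H * (4 * Q * (2 * (- b) * Gp + Gpp) + 2 * k * Gp))"
proof -
  \<comment> \<open>With the reciprocals of \<open>\<tau>\<close> and \<open>mu\<close> as variables
    the identity becomes polynomial.\<close>
  define i where "i = 1 / \<tau>"
  define j where "j = 1 / mu A \<tau>"
  define w where "w = bb / 4 * \<tau> powr (- 3/4)"
  define n where "n = mu' A \<tau>"
  have "\<beta> = i / 4" "\<beta>' = i * i / 4" "b = j / 4" "b' = n * j * j / 4"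
    by (simp_all add: \<beta>_def \<beta>'_def b_def b'_def i_def j_def n_def power2_eq_square)
  moreover have "sg' \<tau> = S * (- (N + k) / 2 * i + w)" by (simp add: sg'_def S_def i_def w_def)
  moreover have "J A P Q X \<tau> = w + Q * (n - X) * j * j / 4 + k / 2 * (X * j - i)"
    by (simp add: J_def w_def n_def i_def j_def power2_eq_square)
  ultimately show ?thesis unfolding \<zeta>_def \<zeta>'_def S_def[symmetric]
    by (simp only:) (simp add: field_simps)
qed

text \<open>Each error term either has the right sign or lives where a Gaussian factor is at most
  \<open>exp (- cc * \<tau> powr (- 1/2))\<close>: the derivatives of the cutoffs vanish within
  distance \<open>d\<close>, and on the support \<open>J < 0\<close> forces
  \<open>P \<ge> sqrt \<tau>\<close>.\<close>

lemma kernel_inequality: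
  fixes P Q X th th' \<tau> A :: real
  assumes t: "0 < \<tau>" "\<tau> \<le> T1" and A: "A0 \<le> A" "A \<le> D" and th: "0 \<le> th" "th \<le> 1" and P: "0 \<le> P" and Q: "0 \<le> Q" and X0: "0 \<le> X"
    and X: "P \<le> 2 * d\<^sup>2 \<Longrightarrow> X \<le> D\<^sup>2 \<and> X \<le> A\<^sup>2 + 2 * D * sqrt P \<and> A\<^sup>2 - 2 * D * sqrt P \<le> X"
  defines "S \<equiv> sg \<tau>" and "\<beta> \<equiv> 1 / (4 * \<tau>)" and "b \<equiv> 1 / (4 * mu A \<tau>)"
  defines "E1 \<equiv> exp (- P * \<beta>)" and "E2 \<equiv> exp (- Q * b)" and "H \<equiv> cut0 3 (P / d\<^sup>2)" and "Hp \<equiv> cut1 3 (P / d\<^sup>2) / d\<^sup>2" and "Hpp \<equiv> cut2 3 (P / d\<^sup>2) / (d\<^sup>2)\<^sup>2"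
    and "G \<equiv> cut0 3 (Q / d\<^sup>2)" and "Gp \<equiv> cut1 3 (Q / d\<^sup>2) / d\<^sup>2" and "Gpp \<equiv> cut2 3 (Q / d\<^sup>2) / (d\<^sup>2)\<^sup>2"
  shows "th' * S * E1 * E2 * H * G - th * S * E1 * E2 * H * G * J A P Q X \<tau>
      + th * S * E1 * E2 * G * (4 * P * (2 * (- \<beta>) * Hp + Hpp) + 2 * N * Hp)
      + X * (th * S * E1 * E2 * H * (4 * Q * (2 * (- b) * Gp + Gpp) + 2 * k * Gp))
    \<le> th' * S * E1 * E2 * H * G + Cerr"
proof -
  note m = mu_bounds[OF t A]
  have S: "S > 0" unfolding S_def by (rule sg_pos[OF t(1)])
  have be: "0 \<le> \<beta>" "\<beta> \<le> (1/4) / \<tau>" using t by (auto simp: \<beta>_def)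
  have b: "0 \<le> b" "b \<le> (1 / (4 * A0\<^sup>2)) / \<tau>"
  proof -
    show "0 \<le> b" using m by (simp add: b_def)
    have "1 / (4 * mu A \<tau>) \<le> 1 / (4 * (A0\<^sup>2 * \<tau>))" using m t A0 by (intro divide_left_mono) auto
    then show "b \<le> (1 / (4 * A0\<^sup>2)) / \<tau>" by (simp add: b_def)
  qed
  have E: "0 < E1" "E1 \<le> 1" "0 < E2" "E2 \<le> 1" using be b P Q by (auto simp: E1_def E2_def)
  have HG: "0 \<le> H" "H \<le> 1" "0 \<le> G" "G \<le> 1" by (auto simp: H_def G_def cut_bounds)
  have Pz: "H = 0" "Hp = 0" "Hpp = 0" if "\<not> P \<le> 2 * d\<^sup>2"
  proof -
    have "P / d\<^sup>2 \<ge> 2" using that d by (simp add: pos_le_divide_eq)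
    then show "H = 0" "Hp = 0" "Hpp = 0" unfolding H_def Hp_def Hpp_def by (simp_all add: cut_bounds)
  qed
  have Qz: "G = 0" "Gp = 0" "Gpp = 0" if "\<not> Q \<le> 2 * d\<^sup>2"
  proof -
    have "Q / d\<^sup>2 \<ge> 2" using that d by (simp add: pos_le_divide_eq)
    then show "G = 0" "Gp = 0" "Gpp = 0" unfolding G_def Gp_def Gpp_def by (simp_all add: cut_bounds)
  qed
  have Pn: "Hp = 0" "Hpp = 0" if "\<not> P \<ge> d\<^sup>2"
  proof -
    have "P / d\<^sup>2 \<le> 1" using that d by simp
    then show "Hp = 0" "Hpp = 0" unfolding Hp_def Hpp_def by (simp_all add: cut_bounds)
  qed
  have Qn: "Gp = 0" "Gpp = 0" if "\<not> Q \<ge> d\<^sup>2"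
  proof -
    have "Q / d\<^sup>2 \<le> 1" using that d by simp
    then show "Gp = 0" "Gpp = 0" unfolding Gp_def Gpp_def by (simp_all add: cut_bounds)
  qed
  have e1: "E1 = exp (- (P / (4 * \<tau>)))" and e2: "E2 = exp (- (Q / (4 * mu A \<tau>)))"
    by (simp_all add: E1_def E2_def \<beta>_def b_def)
  have c1: "0 \<le> Cs * (d\<^sup>2 * D\<^sup>2 / (2 * A0 ^ 4) + k / 2 * T1)" (is "0 \<le> ?c1")
    using Cs k T1 by (intro mult_nonneg_nonneg add_nonneg_nonneg) auto
  have c2: "0 \<le> Cs * (135 * (4 * T1 + (8 + 2 * N) * T1\<^sup>2 / d\<^sup>2))" (is "0 \<le> ?c2")
    using Cs N T1 by (intro mult_nonneg_nonneg add_nonneg_nonneg divide_nonneg_nonneg) auto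
  have c3: "0 \<le> Cs * (D\<^sup>2 * (135 * (4 * T1 / A0\<^sup>2 + (8 + 2 * k) * T1\<^sup>2 / d\<^sup>2)))" (is "0 \<le> ?c3")
    using Cs k T1 by (intro mult_nonneg_nonneg add_nonneg_nonneg divide_nonneg_nonneg) auto
  have 1: "- (th * S * E1 * E2 * H * G * J A P Q X \<tau>) \<le> ?c1"
  proof (cases "J A P Q X \<tau> \<ge> 0 \<or> H = 0 \<or> G = 0")
    case True
    have "0 \<le> th * S * E1 * E2 * H * G" using th S E HG by simp
    with True have "0 \<le> th * S * E1 * E2 * H * G * J A P Q X \<tau>" by auto
    then show ?thesis using c1 by linarith
  next
    case False
    then have PQ: "P \<le> 2 * d\<^sup>2" "Q \<le> 2 * d\<^sup>2" using Pz Qz by auto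
    note X = X[OF PQ(1)]
    have far: "P \<ge> \<tau> powr (1/2)"
      using J_near[OF t A P _ Q] X False by (metis linear)
    have "\<bar>min (J A P Q X \<tau>) 0\<bar> \<le> (d\<^sup>2 * D\<^sup>2 / (2 * A0 ^ 4) + k / 2 * T1) / \<tau>\<^sup>2"
      using J_far[OF t A Q PQ(2) X0, of P] X False by auto
    then have "\<bar>- J A P Q X \<tau>\<bar> \<le> (d\<^sup>2 * D\<^sup>2 / (2 * A0 ^ 4) + k / 2 * T1) / \<tau>\<^sup>2" using False by auto
    from weighted_far_bound[OF t cc_le(1)[OF t far] this, of "th * E2 * H * G"]
    have "th * E2 * H * G * sg \<tau> * exp (- (P / (4 * \<tau>))) * - J A P Q X \<tau> \<le> ?c1"
      using th E HG by (simp add: mult_le_one)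
    then show ?thesis unfolding e1 S_def by (simp add: mult_ac)
  qed
  have 2: "th * S * E1 * E2 * G * (4 * P * (2 * (- \<beta>) * Hp + Hpp) + 2 * N * Hp) \<le> ?c2"
  proof (cases "P \<ge> d\<^sup>2 \<and> P \<le> 2 * d\<^sup>2")
    case False
    then have "Hp = 0" "Hpp = 0" using Pz Pn by auto
    then show ?thesis using c2 by simp
  next
    case True
    have N0: "N \<ge> 0" using N by simp
    from cut_error_bound[OF t be N0 P] True
    have "\<bar>4 * P * (2 * (- \<beta>) * Hp + Hpp) + 2 * N * Hp\<bar> \<le> (135 * (4 * T1 + (8 + 2 * N) * T1\<^sup>2 / d\<^sup>2)) / \<tau>\<^sup>2"
      unfolding Hp_def Hpp_def by simp
    from weighted_far_bound[OF t cc_le(2)[OF t] this, of P "th * E2 * G"] True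
    have "th * E2 * G * sg \<tau> * exp (- (P / (4 * \<tau>))) * (4 * P * (2 * (- \<beta>) * Hp + Hpp) + 2 * N * Hp) \<le> ?c2"
      using th E HG by (simp add: mult_le_one)
    then show ?thesis unfolding e1 S_def by (simp add: mult_ac)
  qed
  have 3: "X * (th * S * E1 * E2 * H * (4 * Q * (2 * (- b) * Gp + Gpp) + 2 * k * Gp)) \<le> ?c3"
  proof (cases "Q \<ge> d\<^sup>2 \<and> Q \<le> 2 * d\<^sup>2 \<and> P \<le> 2 * d\<^sup>2")
    case False
    then have "Gp = 0 \<and> Gpp = 0 \<or> H = 0" using Qz Qn Pz by auto
    then show ?thesis using c3 by auto
  next
    case True
    have k0: "k \<ge> 0" using k by simp
    from cut_error_bound[OF t b k0 Q] True
    have B: "\<bar>4 * Q * (2 * (- b) * Gp + Gpp) + 2 * k * Gp\<bar> \<le> (135 * (4 * T1 / A0\<^sup>2 + (8 + 2 * k) * T1\<^sup>2 / d\<^sup>2)) / \<tau>\<^sup>2"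
      unfolding Gp_def Gpp_def by simp
    have "\<bar>X * (4 * Q * (2 * (- b) * Gp + Gpp) + 2 * k * Gp)\<bar> \<le> D\<^sup>2 * ((135 * (4 * T1 / A0\<^sup>2 + (8 + 2 * k) * T1\<^sup>2 / d\<^sup>2)) / \<tau>\<^sup>2)"
      unfolding abs_mult[of X] using X X0 True B by (intro mult_mono) auto
    then have "\<bar>X * (4 * Q * (2 * (- b) * Gp + Gpp) + 2 * k * Gp)\<bar> \<le> (D\<^sup>2 * (135 * (4 * T1 / A0\<^sup>2 + (8 + 2 * k) * T1\<^sup>2 / d\<^sup>2))) / \<tau>\<^sup>2"
      by simp
    from weighted_far_bound[OF t cc_le(3)[OF t A] this, of Q "th * E1 * H"] True
    have "th * E1 * H * sg \<tau> * exp (- (Q / (4 * mu A \<tau>))) * (X * (4 * Q * (2 * (- b) * Gp + Gpp) + 2 * k * Gp)) \<le> ?c3"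
      using th E HG by (simp add: mult_le_one)
    then show ?thesis unfolding e2 S_def by (simp add: mult_ac)
  qed
  from 1 2 3 show ?thesis unfolding Cerr_def by linarith
qed

end

section \<open>Comparison of integrals on open sets, and integrals of negative powers of the
  distance\<close>

lemma AE_lborel_fst:
  assumes "AE z in lborel. P z"
  shows "AE w in (lborel :: ('a::euclidean_space \<times> 'b::euclidean_space) measure). P (fst w)"
proof -
  from AE_E2[OF assms] obtain N where N: "{z. \<not> P z} \<subseteq> N" "N \<in> sets lborel" "emeasure lborel N = 0"
    using assms by (elim AE_E) auto
  have "emeasure (lborel \<Otimes>\<^sub>M lborel) (N \<times> (UNIV :: 'b set)) = emeasure lborel N * emeasure lborel (UNIV :: 'b set)"
    using N by (intro lborel.emeasure_pair_measure_Times) auto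
  then have "emeasure lborel (N \<times> (UNIV :: 'b set)) = 0" using N by (simp add: lborel_prod)
  then have "N \<times> UNIV \<in> null_sets (lborel :: ('a \<times> 'b) measure)"
    using N by (intro null_setsI) (auto intro!: borel_Times)
  then show ?thesis by (rule AE_I') (use N(1) in auto)
qed

text \<open>Let \<open>B\<close> be the part of \<open>W\<close> where \<open>g < f\<close>. By
  outer regularity of the finite measure with density \<open>g\<close> on \<open>W\<close>, the
  inequality passes from open sets to \<open>B\<close>; since the integral of \<open>g\<close> over
  \<open>B\<close> is finite and \<open>f > g\<close> there, \<open>B\<close> must be null.\<close>

lemma nn_integral_open_le_imp_AE:
  fixes f g :: "'a::euclidean_space \<Rightarrow> ennreal"
  assumes f [measurable]: "f \<in> borel_measurable borel" and g [measurable]: "g \<in> borel_measurable borel"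
    and W: "open W" and fin: "(\<integral>\<^sup>+x. g x * indicator W x \<partial>lborel) < \<infinity>"
    and le: "\<And>G. open G \<Longrightarrow> G \<subseteq> W \<Longrightarrow> (\<integral>\<^sup>+x. f x * indicator G x \<partial>lborel) \<le> (\<integral>\<^sup>+x. g x * indicator G x \<partial>lborel)"
  shows "AE x in lborel. x \<in> W \<longrightarrow> f x \<le> g x"
proof -
  have [measurable]: "W \<in> sets borel" using W by simp
  define \<nu> where "\<nu> = density lborel (\<lambda>x. g x * indicator W x)"
  have \<nu>: "emeasure \<nu> A = (\<integral>\<^sup>+x. g x * indicator (A \<inter> W) x \<partial>lborel)" if "A \<in> sets borel" for A
    using that unfolding \<nu>_def by (subst emeasure_density) (auto intro!: nn_integral_cong simp: indicator_def)
  have sb: "sets \<nu> = sets borel" by (simp add: \<nu>_def)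
  have fin': "emeasure \<nu> (space \<nu>) \<noteq> \<infinity>"
    using \<nu>[of UNIV] fin by (simp add: \<nu>_def)
  define B where "B = {x \<in> W. g x < f x}"
  have B [measurable]: "B \<in> sets borel" unfolding B_def by measurable
  have "(\<integral>\<^sup>+x. f x * indicator B x \<partial>lborel) \<le> (INF U \<in> {U. B \<subseteq> U \<and> open U}. emeasure \<nu> U)"
  proof (rule INF_greatest)
    fix U assume U: "U \<in> {U. B \<subseteq> U \<and> open U}"
    have "(\<integral>\<^sup>+x. f x * indicator B x \<partial>lborel) \<le> (\<integral>\<^sup>+x. f x * indicator (U \<inter> W) x \<partial>lborel)"
      using U by (intro nn_integral_mono mult_left_mono) (auto simp: indicator_def B_def)
    also have "\<dots> \<le> (\<integral>\<^sup>+x. g x * indicator (U \<inter> W) x \<partial>lborel)"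
      using U W by (intro le) auto
    also have "\<dots> = emeasure \<nu> U" using U by (intro \<nu>[symmetric]) auto
    finally show "(\<integral>\<^sup>+x. f x * indicator B x \<partial>lborel) \<le> emeasure \<nu> U" .
  qed
  also have "\<dots> = emeasure \<nu> B" by (rule outer_regular[OF sb fin' B, symmetric])
  also have "\<dots> = (\<integral>\<^sup>+x. g x * indicator B x \<partial>lborel)"
    by (subst \<nu>[OF B]) (auto simp: B_def intro!: nn_integral_cong arg_cong2[where f="(*)"] arg_cong2[where f=indicator])
  finally have l: "(\<integral>\<^sup>+x. f x * indicator B x \<partial>lborel) \<le> (\<integral>\<^sup>+x. g x * indicator B x \<partial>lborel)" .
  have gfin: "(\<integral>\<^sup>+x. g x * indicator B x \<partial>lborel) \<noteq> \<infinity>"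
  proof -
    have "(\<integral>\<^sup>+x. g x * indicator B x \<partial>lborel) \<le> (\<integral>\<^sup>+x. g x * indicator W x \<partial>lborel)"
      by (intro nn_integral_mono mult_left_mono) (auto simp: indicator_def B_def)
    then show ?thesis using fin by auto
  qed
  have "AE x in lborel. f x * indicator B x \<le> g x * indicator B x"
  proof (rule ccontr)
    assume n: "\<not> (AE x in lborel. f x * indicator B x \<le> g x * indicator B x)"
    have "AE x in lborel. g x * indicator B x \<le> f x * indicator B x"
      by (intro AE_I2) (auto simp: indicator_def B_def)
    from nn_integral_less[OF _ _ gfin this n] l show False by simp
  qed
  then show ?thesis by (rule AE_mp) (auto simp: B_def indicator_def not_less[symmetric] intro!: AE_I2)
qed

text \<open>Dyadic decomposition: a point of the shell between radii \<open>\<rho> (Suc j)\<close>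
  and \<open>\<rho> j\<close> is charged to the whole ball of radius \<open>\<rho> j\<close>. The
  resulting series is geometric with ratio \<open>2 powr (b - DIM('a))\<close>, and nothing in it
  depends on the centre.\<close>

lemma nn_integral_norm_powr_ball:
  fixes c :: "'a::euclidean_space"
  assumes b: "0 < b" "b < real DIM('a)" and R: "R > 0"
  shows "\<exists>C<\<infinity>. \<forall>c::'a. (\<integral>\<^sup>+z. ennreal (norm (z - c) powr - b) * indicator (ball c R) z \<partial>lborel) \<le> C"
proof -
  define \<rho> where "\<rho> j = R / 2 ^ j" for j :: nat
  have \<rho>: "\<rho> j > 0" for j using R by (simp add: \<rho>_def)
  define q where "q = (1/2::real) powr (real DIM('a) - b)"
  have q: "0 < q" "q < 1" using b powr_less_mono2[of "real DIM('a) - b" "1/2" 1] by (auto simp: q_def)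
  define K where "K = 2 powr b * unit_ball_vol (real DIM('a)) * R powr (real DIM('a) - b)"
  have K: "K \<ge> 0" by (simp add: K_def)
  have "(\<integral>\<^sup>+z. ennreal (norm (z - c) powr - b) * indicator (ball c R) z \<partial>lborel) \<le> ennreal (K * (1 / (1 - q)))" for c :: 'a
  proof -
    have "(\<integral>\<^sup>+z. ennreal (norm (z - c) powr - b) * indicator (ball c R) z \<partial>lborel) \<le>
      (\<integral>\<^sup>+z. (\<Sum>j. ennreal ((\<rho> (Suc j)) powr - b) * indicator (cball c (\<rho> j)) z) \<partial>lborel)"
    proof (rule nn_integral_mono)
      fix z :: 'a
      show "ennreal (norm (z - c) powr - b) * indicator (ball c R) z \<le> (\<Sum>j. ennreal ((\<rho> (Suc j)) powr - b) * indicator (cball c (\<rho> j)) z)"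
      proof (cases "z \<in> ball c R \<and> z \<noteq> c")
        case True
        define y where "y = norm (z - c)"
        have y: "0 < y" "y < R" using True by (auto simp: y_def dist_norm norm_minus_commute)
        have "\<exists>j. \<rho> (Suc j) \<le> y"
        proof -
          obtain j where "(1/2) ^ j < y / R" using real_arch_pow_inv[of "y / R" "1/2"] y R by auto
          then have "\<rho> j < y" using R by (simp add: \<rho>_def field_simps power_divide)
          moreover have "\<rho> (Suc j) \<le> \<rho> j" using R by (simp add: \<rho>_def field_simps)
          ultimately show ?thesis by (intro exI[of _ j]) linarith
        qed
        then obtain j where j: "\<rho> (Suc j) \<le> y" "\<And>i. i < j \<Longrightarrow> \<not> \<rho> (Suc i) \<le> y"
          using LeastI_ex[of "\<lambda>j. \<rho> (Suc j) \<le> y"] not_less_Least[of _ "\<lambda>j. \<rho> (Suc j) \<le> y"] by blast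
        have "y \<le> \<rho> j"
        proof (cases j)
          case 0
          then show ?thesis using y by (simp add: \<rho>_def)
        next
          case (Suc i)
          then show ?thesis using j(2)[of i] by simp
        qed
        then have m: "z \<in> cball c (\<rho> j)" by (simp add: y_def dist_norm norm_minus_commute)
        have "y powr - b \<le> \<rho> (Suc j) powr - b" using j(1) \<rho> b by (intro powr_mono2') auto
        then have "ennreal (norm (z - c) powr - b) * indicator (ball c R) z \<le> ennreal ((\<rho> (Suc j)) powr - b) * indicator (cball c (\<rho> j)) z"
          using m True by (simp add: y_def ennreal_leI)
        also have "\<dots> = (\<Sum>i\<in>{j}. ennreal ((\<rho> (Suc i)) powr - b) * indicator (cball c (\<rho> i)) z)"
            by (simp only: sum.empty add_0_right finite.emptyI empty_iff not_False_eq_True sum.insert)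
        also have "\<dots> \<le> (\<Sum>i. ennreal ((\<rho> (Suc i)) powr - b) * indicator (cball c (\<rho> i)) z)"
          by (rule sum_le_suminf) auto
        finally show ?thesis .
      qed (auto simp: indicator_def)
    qed
    also have "\<dots> = (\<Sum>j. \<integral>\<^sup>+z. ennreal ((\<rho> (Suc j)) powr - b) * indicator (cball c (\<rho> j)) z \<partial>lborel)"
    proof (rule nn_integral_suminf[of "\<lambda>j z. ennreal ((\<rho> (Suc j)) powr - b) * indicator (cball c (\<rho> j)) z"])
      show "(\<lambda>z. ennreal ((\<rho> (Suc j)) powr - b) * indicator (cball c (\<rho> j)) z) \<in> borel_measurable lborel" for j
      proof (rule measurable_compose[of "indicator (cball c (\<rho> j)) :: 'a \<Rightarrow> ennreal" lborel borel])
        have "cball c (\<rho> j) \<in> sets lborel" unfolding sets_lborel by (rule borel_closed) (rule closed_cball)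
        then show "(indicator (cball c (\<rho> j)) :: 'a \<Rightarrow> ennreal) \<in> borel_measurable lborel" by (rule borel_measurable_indicator)
        show "(\<lambda>x. ennreal ((\<rho> (Suc j)) powr - b) * x) \<in> borel_measurable borel" by measurable
      qed
    qed
    also have "\<dots> = (\<Sum>j. ennreal (K * q ^ j))"
    proof (rule suminf_cong)
      fix j
      have "(\<integral>\<^sup>+z. ennreal ((\<rho> (Suc j)) powr - b) * indicator (cball c (\<rho> j)) z \<partial>lborel) = ennreal ((\<rho> (Suc j)) powr - b) * ennreal (unit_ball_vol (real DIM('a)) * \<rho> j ^ DIM('a))"
        using \<rho>[of j] by (simp add: nn_integral_cmult_indicator emeasure_cball less_imp_le)
      also have "\<dots> = ennreal ((\<rho> (Suc j)) powr - b * (unit_ball_vol (real DIM('a)) * \<rho> j ^ DIM('a)))"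
        by (rule ennreal_mult[symmetric]) (use \<rho>[of j] in auto)
      also have "(\<rho> (Suc j)) powr - b * (unit_ball_vol (real DIM('a)) * \<rho> j ^ DIM('a)) = K * q ^ j"
      proof -
        have "\<rho> (Suc j) = \<rho> j * (1/2)" by (simp add: \<rho>_def)
        then have "\<rho> (Suc j) powr - b = (\<rho> j * (1/2)) powr - b" by (simp only:)
        also have "\<dots> = \<rho> j powr - b * (1/2) powr - b" by (rule powr_mult)
        also have "(1/2::real) powr - b = 2 powr b" by (simp add: powr_minus powr_divide)
        finally have "\<rho> (Suc j) powr - b = \<rho> j powr - b * 2 powr b" .
        moreover have "\<rho> j ^ DIM('a) = \<rho> j powr real DIM('a)" using \<rho>[of j] by (simp add: powr_realpow)
        moreover have "\<rho> j powr - b * \<rho> j powr real DIM('a) = \<rho> j powr (real DIM('a) - b)" unfolding powr_add[symmetric] by simp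
        moreover have "\<rho> j powr (real DIM('a) - b) = R powr (real DIM('a) - b) * q ^ j"
        proof -
          have "\<rho> j = R * (1/2) ^ j" by (simp add: \<rho>_def power_divide)
          then have "\<rho> j powr (real DIM('a) - b) = R powr (real DIM('a) - b) * ((1/2) ^ j) powr (real DIM('a) - b)"
            using R by (simp add: powr_mult)
          also have "((1/2::real) ^ j) powr (real DIM('a) - b) = q ^ j"
            unfolding q_def by (simp add: powr_realpow[symmetric] powr_powr mult.commute)
          finally show ?thesis .
        qed
        ultimately show ?thesis by (simp add: K_def)
      qed
      finally show "(\<integral>\<^sup>+z. ennreal ((\<rho> (Suc j)) powr - b) * indicator (cball c (\<rho> j)) z \<partial>lborel) = ennreal (K * q ^ j)" .
    qed
    also have "\<dots> = ennreal (K * (1 / (1 - q)))"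
      using q K by (intro suminf_ennreal_eq sums_mult geometric_sums) auto
    finally show ?thesis .
  qed
  then show ?thesis by (intro exI[of _ "ennreal (K * (1 / (1 - q)))"]) auto
qed

section \<open>Upper and lower bounds for the kernel as a test function\<close>

context frozen_kernel
begin

text \<open>Kernel with pole at time \<open>s\<close>, delayed by \<open>\<eta>\<close>, so that for
  \<open>t \<le> s\<close> the lag never falls below \<open>\<eta>\<close> and the function is
  regular. \<open>P\<close> and \<open>Q\<close> are the squared distances to the pole in
  \<open>x\<close> and \<open>y\<close>.\<close>

definition prof where
  "prof s \<eta> A P Q t = sg (s - t + \<eta>) * exp (- P * (1 / (4 * (s - t + \<eta>)))) * exp (- Q * (1 / (4 * mu A (s - t + \<eta>))))
     * cut0 3 (P / d\<^sup>2) * cut0 3 (Q / d\<^sup>2)"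
text \<open>Equal to 1 until \<open>s - \<eta>\<close> and to 0 at \<open>s\<close>, as a test
  function on \<open>[0, s]\<close> must be. Its derivative has size \<open>1 / \<eta>\<close> just
  before \<open>s\<close> and is what extracts the size of \<open>U\<close> near the pole.\<close>

definition th where "th s \<eta> t = 1 - pos (1 - (s - t) / \<eta>) ^ 2"
definition th' where "th' s \<eta> t = - (2 * pos (1 - (s - t) / \<eta>) / \<eta>)"

lemma prof_nonneg: "s - t + \<eta> > 0 \<Longrightarrow> 0 \<le> prof s \<eta> A P Q t"
  unfolding prof_def using sg_pos[of "s - t + \<eta>"] by (simp add: cut_bounds)

lemma th_bounds:
  assumes "\<eta> > 0" "t \<le> s"
  shows "0 \<le> th s \<eta> t" "th s \<eta> t \<le> 1" "th' s \<eta> t \<le> 0"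
proof -
  have "pos (1 - (s - t) / \<eta>) \<le> 1" using assms by (simp add: pos_def)
  then have "pos (1 - (s - t) / \<eta>) ^ 2 \<le> 1" by (simp add: power_le_one)
  then show "0 \<le> th s \<eta> t" "th s \<eta> t \<le> 1" by (simp_all add: th_def)
  show "th' s \<eta> t \<le> 0" using assms by (simp add: th'_def)
qed

text \<open>Gaussian decay is spent as the power \<open>r = (N + k) / 2 - a\<close> of
  \<open>\<tau> / (P + Q)\<close>, which leaves \<open>\<tau> powr (- a)\<close> of the time
  singularity. The parabolic singularity is thus split into a time power times a space power, each
  integrable on its own for suitable \<open>a\<close>. Since \<open>s - t \<le> \<tau>\<close>, the
  bound is uniform in \<open>\<eta>\<close>.\<close>

lemma prof_upper:
  assumes t: "t < s" "0 < \<eta>" "s - t + \<eta> \<le> T1" and A: "A0 \<le> A" "A \<le> D" and PQ: "0 \<le> P" "0 \<le> Q" "P + Q > 0"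
    and a: "0 < a" "a < (N + k) / 2"
  shows "prof s \<eta> A P Q t \<le> exp (bb * T1 powr (1/4)) * (((N + k) / 2 - a) / c0) powr ((N + k) / 2 - a)
      * (s - t) powr (- a) * (P + Q) powr (- ((N + k) / 2 - a))"
proof -
  define \<tau> where "\<tau> = s - t + \<eta>"
  define r where "r = (N + k) / 2 - a"
  have r: "r > 0" using a by (simp add: r_def)
  have tau: "0 < \<tau>" "\<tau> \<le> T1" "s - t \<le> \<tau>" using t by (auto simp: \<tau>_def)
  define y where "y = c0 * (P + Q) / \<tau>"
  have y: "y > 0" using c0 PQ tau by (simp add: y_def)
  have S: "sg \<tau> > 0" by (rule sg_pos[OF tau(1)])
  have yle: "y \<le> P / (4 * \<tau>) + Q / (4 * mu A \<tau>)"
    using cc_le(5)[OF tau(1,2) PQ(1)] cc_le(4)[OF tau(1,2) A PQ(2)] by (simp add: y_def add_divide_distrib algebra_simps)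
  have "prof s \<eta> A P Q t \<le> sg \<tau> * exp (- P * (1 / (4 * \<tau>))) * exp (- Q * (1 / (4 * mu A \<tau>))) * 1 * 1"
    unfolding prof_def \<tau>_def[symmetric] using S by (intro mult_mono mult_nonneg_nonneg) (auto simp: cut_bounds)
  also have "\<dots> = sg \<tau> * exp (- (P / (4 * \<tau>) + Q / (4 * mu A \<tau>)))" by (simp add: exp_add[symmetric] mult.assoc)
  also have "\<dots> \<le> sg \<tau> * exp (- y)" using yle S by simp
  also have "\<dots> \<le> (exp (bb * T1 powr (1/4)) * \<tau> powr (- (N + k) / 2)) * (r / y) powr r"
    using sg_le[OF tau(1,2)] exp_neg_le_powr[OF y r] S by (intro mult_mono) auto
  also have "(r / y) powr r = (r / c0) powr r * \<tau> powr r * (P + Q) powr (- r)"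
  proof -
    have "r / y = (r / c0) * (\<tau> * inverse (P + Q))" by (simp add: y_def divide_inverse mult_ac)
    then show ?thesis using r c0 tau PQ by (simp add: powr_mult powr_divide powr_minus inverse_powr mult.assoc)
  qed
  also have "exp (bb * T1 powr (1/4)) * \<tau> powr (- (N + k) / 2) * ((r / c0) powr r * \<tau> powr r * (P + Q) powr (- r))
      = exp (bb * T1 powr (1/4)) * (r / c0) powr r * (\<tau> powr (- (N + k) / 2) * \<tau> powr r) * (P + Q) powr (- r)" by simp
  also have "\<tau> powr (- (N + k) / 2) * \<tau> powr r = \<tau> powr (- a)" unfolding powr_add[symmetric] by (simp add: r_def field_simps)
  also have "exp (bb * T1 powr (1/4)) * (r / c0) powr r * \<tau> powr (- a) * (P + Q) powr (- r)
     \<le> exp (bb * T1 powr (1/4)) * (r / c0) powr r * (s - t) powr (- a) * (P + Q) powr (- r)"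
    using a t tau by (intro mult_right_mono mult_left_mono powr_mono2') auto
  finally show ?thesis by (simp add: r_def)
qed

text \<open>The three factors come from \<open>\<tau> \<le> 2 * \<eta>\<close>, from
  \<open>P / (4 * \<tau>) \<le> 1/4\<close> and from \<open>mu \<ge> A0^2 * \<eta>\<close>.\<close>

definition clow where "clow = 2 powr (- (N + k) / 2) * (exp (- (1/4)) * exp (- (1 / (4 * A0\<^sup>2))))"

lemma clow: "clow > 0" by (simp add: clow_def)

text \<open>Within parabolic distance \<open>\<eta>\<close> of the pole both exponentials are
  bounded below and the cutoffs equal 1. The product then has the height of a normalized bump on a
  box of volume of order \<open>\<eta> powr ((N + k) / 2 + 1)\<close>.\<close>

lemma prof_lower:
  assumes t: "t < s" "s < t + \<eta> / 2" "s - t + \<eta> \<le> T1" and A: "A0 \<le> A" "A \<le> D" and PQ: "0 \<le> P" "0 \<le> Q" "P + Q \<le> \<eta>" and e: "0 < \<eta>" "\<eta> \<le> d\<^sup>2"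
  shows "- th' s \<eta> t * prof s \<eta> A P Q t \<ge> (1 / \<eta>) * (clow * \<eta> powr (- (N + k) / 2))"
proof -
  define \<tau> where "\<tau> = s - t + \<eta>"
  have tau: "0 < \<tau>" "\<tau> \<le> T1" "\<eta> \<le> \<tau>" "\<tau> \<le> 2 * \<eta>" using t e by (auto simp: \<tau>_def)
  note m = mu_bounds[OF tau(1,2) A]
  have "(s - t) / \<eta> \<le> 1/2" using t e by (simp add: field_simps)
  then have "1 - (s - t) / \<eta> \<ge> 1/2" by linarith
  then have p: "pos (1 - (s - t) / \<eta>) \<ge> 1/2" unfolding pos_def by (rule max.coboundedI2)
  have 1: "- th' s \<eta> t \<ge> 1 / \<eta>"
  proof -
    have "1 / \<eta> \<le> 2 * pos (1 - (s - t) / \<eta>) / \<eta>" using p e by (intro divide_right_mono) auto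
    then show ?thesis by (simp add: th'_def)
  qed
  have "P / d\<^sup>2 \<le> 1" "Q / d\<^sup>2 \<le> 1" using PQ e d by (auto simp: divide_le_eq_1)
  then have c: "cut0 3 (P / d\<^sup>2) = 1" "cut0 3 (Q / d\<^sup>2) = 1" by (auto simp: cut_bounds)
  have "P / (4 * \<tau>) \<le> \<eta> / (4 * \<eta>)" using PQ tau e by (intro frac_le) auto
  then have P: "- (1/4) \<le> - P * (1 / (4 * \<tau>))" using e by simp
  have "Q / (4 * mu A \<tau>) \<le> \<eta> / (4 * (A0\<^sup>2 * \<eta>))"
  proof (rule frac_le)
    have "A0\<^sup>2 * \<eta> \<le> A0\<^sup>2 * \<tau>" using tau by (intro mult_left_mono) auto
    then show "4 * (A0\<^sup>2 * \<eta>) \<le> 4 * mu A \<tau>" using m by linarith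
  qed (use PQ e A0 in auto)
  then have Q: "- (1 / (4 * A0\<^sup>2)) \<le> - Q * (1 / (4 * mu A \<tau>))" using e by simp
  have "2 powr (- (N + k) / 2) * \<eta> powr (- (N + k) / 2) = (2 * \<eta>) powr (- (N + k) / 2)" using e by (simp add: powr_mult)
  also have "\<dots> \<le> \<tau> powr (- (N + k) / 2)" using tau e N k by (intro powr_mono2') auto
  also have "\<dots> \<le> sg \<tau>" by (rule sg_ge[OF tau(1)])
  finally have "2 powr (- (N + k) / 2) * \<eta> powr (- (N + k) / 2) * (exp (- (1/4)) * exp (- (1 / (4 * A0\<^sup>2)))) \<le> sg \<tau> * (exp (- P * (1 / (4 * \<tau>))) * exp (- Q * (1 / (4 * mu A \<tau>))))"
    using P Q sg_pos[OF tau(1)] by (intro mult_mono) auto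
  then have 2: "clow * \<eta> powr (- (N + k) / 2) \<le> prof s \<eta> A P Q t" unfolding prof_def \<tau>_def[symmetric] c clow_def by (simp add: mult_ac)
  have "0 < 1 / \<eta>" using e by simp
  then have "0 \<le> - th' s \<eta> t" using 1 by linarith
  then show ?thesis using 1 2 clow e by (intro mult_mono) auto
qed

lemma sg'_continuous: "continuous_on {0<..} sg'"
  unfolding sg'_def[abs_def] sg_def by (intro continuous_intros) auto

lemma mu'_continuous: "continuous_on {0<..} (mu' A)" "continuous_on {0<..} (mu A)"
  unfolding mu'_def[abs_def] mu_def[abs_def] by (intro continuous_intros; auto)+

lemma kernel_profiles:
  assumes s: "s > 0" "\<eta> > 0" "s + \<eta> \<le> T1" and A: "A0 \<le> A" "A \<le> D"
  shows "profile s (\<lambda>r t. sg (s - t + \<eta>) * th s \<eta> t) (\<lambda>r t. 0) (\<lambda>r t. 0) (\<lambda>r t. - sg' (s - t + \<eta>) * th s \<eta> t + sg (s - t + \<eta>) * th' s \<eta> t)"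
    "profile s (\<lambda>r t. exp (- r * (1 / (4 * (s - t + \<eta>))))) (\<lambda>r t. - (1 / (4 * (s - t + \<eta>))) * exp (- r * (1 / (4 * (s - t + \<eta>)))))
      (\<lambda>r t. (1 / (4 * (s - t + \<eta>))) * (1 / (4 * (s - t + \<eta>))) * exp (- r * (1 / (4 * (s - t + \<eta>)))))
      (\<lambda>r t. - r * (1 / (4 * (s - t + \<eta>)\<^sup>2)) * exp (- r * (1 / (4 * (s - t + \<eta>)))))"
    "profile s (\<lambda>r t. exp (- r * (1 / (4 * mu A (s - t + \<eta>))))) (\<lambda>r t. - (1 / (4 * mu A (s - t + \<eta>))) * exp (- r * (1 / (4 * mu A (s - t + \<eta>)))))
      (\<lambda>r t. (1 / (4 * mu A (s - t + \<eta>))) * (1 / (4 * mu A (s - t + \<eta>))) * exp (- r * (1 / (4 * mu A (s - t + \<eta>)))))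
      (\<lambda>r t. - r * (mu' A (s - t + \<eta>) / (4 * (mu A (s - t + \<eta>))\<^sup>2)) * exp (- r * (1 / (4 * mu A (s - t + \<eta>)))))"
proof -
  have tau: "0 < s - t + \<eta>" "s - t + \<eta> \<le> T1" if "t \<in> {0..s}" for t using that s by auto
  have dt: "((\<lambda>t. s - t + \<eta>) has_real_derivative - 1) (at t within {0..s})" for t by (auto intro!: derivative_eq_intros)
  have ct: "continuous_on {0..s} (\<lambda>t. s - t + \<eta>)" by (intro continuous_intros)
  have img: "(\<lambda>t. s - t + \<eta>) ` {0..s} \<subseteq> {0<..}" using s by auto
  have dsg: "((\<lambda>t. sg (s - t + \<eta>)) has_real_derivative - sg' (s - t + \<eta>)) (at t within {0..s})" if "t \<in> {0..s}" for t
    using DERIV_chain2[OF sg_deriv[OF tau(1)[OF that]] dt] by simp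
  have dmu: "((\<lambda>t. mu A (s - t + \<eta>)) has_real_derivative - mu' A (s - t + \<eta>)) (at t within {0..s})" if "t \<in> {0..s}" for t
    using DERIV_chain2[OF mu_deriv[OF tau(1)[OF that]] dt] by simp
  have dth: "(th s \<eta> has_real_derivative th' s \<eta> t) (at t within {0..s})" for t
  proof -
    have "((\<lambda>t. 1 - (s - t) / \<eta>) has_real_derivative 0 - (0 - 1) / \<eta>) (at t within {0..s})"
      by (intro DERIV_diff DERIV_const DERIV_cdivide DERIV_ident)
    from DERIV_diff[OF DERIV_const pos_pow_deriv[OF _ this, of 2], of 1] show ?thesis
      by (simp add: th_def[abs_def] th'_def)
  qed
  have csg: "continuous_on {0..s} (\<lambda>t. sg (s - t + \<eta>))" using DERIV_continuous[OF dsg] by (auto simp: continuous_on_eq_continuous_within)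
  have cth: "continuous_on {0..s} (th s \<eta>)" using DERIV_continuous[OF dth] by (auto simp: continuous_on_eq_continuous_within)
  have cth': "continuous_on {0..s} (th' s \<eta>)" unfolding th'_def[abs_def] using s by (intro continuous_intros) auto
  have csg': "continuous_on {0..s} (\<lambda>t. sg' (s - t + \<eta>))" by (rule continuous_on_compose2[OF sg'_continuous ct img])
  have cmu: "continuous_on {0..s} (\<lambda>t. mu A (s - t + \<eta>))" "continuous_on {0..s} (\<lambda>t. mu' A (s - t + \<eta>))"
    by (rule continuous_on_compose2[OF mu'_continuous(2) ct img] continuous_on_compose2[OF mu'_continuous(1) ct img])+
  show "profile s (\<lambda>r t. sg (s - t + \<eta>) * th s \<eta> t) (\<lambda>r t. 0) (\<lambda>r t. 0) (\<lambda>r t. - sg' (s - t + \<eta>) * th s \<eta> t + sg (s - t + \<eta>) * th' s \<eta> t)"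
  proof (rule profile_time)
    show "continuous_on {0..s} (\<lambda>t. - sg' (s - t + \<eta>) * th s \<eta> t + sg (s - t + \<eta>) * th' s \<eta> t)"
      by (intro continuous_intros csg csg' cth cth')
    show "((\<lambda>t. sg (s - t + \<eta>) * th s \<eta> t) has_real_derivative - sg' (s - t + \<eta>) * th s \<eta> t + sg (s - t + \<eta>) * th' s \<eta> t) (at t within {0..s})" if "t \<in> {0..s}" for t
      using DERIV_mult[OF dsg[OF that] dth] by (simp add: mult.commute)
  qed
  have e: "(0 * (4 * x) - 1 * (4 * - y)) / ((4 * x) * (4 * x)) = y / (4 * x\<^sup>2)" if "x \<noteq> 0" for x y :: real
    using that by (simp add: power2_eq_square)
  have nz: "s - t + \<eta> \<noteq> 0" "mu A (s - t + \<eta>) \<noteq> 0" if "t \<in> {0..s}" for t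
    using tau[OF that] mu_bounds(2)[OF tau[OF that] A] by auto
  show "profile s (\<lambda>r t. exp (- r * (1 / (4 * (s - t + \<eta>))))) (\<lambda>r t. - (1 / (4 * (s - t + \<eta>))) * exp (- r * (1 / (4 * (s - t + \<eta>)))))
      (\<lambda>r t. (1 / (4 * (s - t + \<eta>))) * (1 / (4 * (s - t + \<eta>))) * exp (- r * (1 / (4 * (s - t + \<eta>)))))
      (\<lambda>r t. - r * (1 / (4 * (s - t + \<eta>)\<^sup>2)) * exp (- r * (1 / (4 * (s - t + \<eta>)))))"
  proof (rule profile_exp)
    show "((\<lambda>t. 1 / (4 * (s - t + \<eta>))) has_real_derivative 1 / (4 * (s - t + \<eta>)\<^sup>2)) (at t within {0..s})" if "t \<in> {0..s}" for t
    proof -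
      have "4 * (s - t + \<eta>) \<noteq> 0" using nz(1)[OF that] by simp
      from DERIV_divide[OF DERIV_const DERIV_cmult[OF dt] this, of 1] show ?thesis
        by (rule DERIV_cong) (rule e[OF nz(1)[OF that]])
    qed
    show "continuous_on {0..s} (\<lambda>t. 1 / (4 * (s - t + \<eta>)\<^sup>2))" using nz(1) by (intro continuous_intros) auto
  qed
  show "profile s (\<lambda>r t. exp (- r * (1 / (4 * mu A (s - t + \<eta>))))) (\<lambda>r t. - (1 / (4 * mu A (s - t + \<eta>))) * exp (- r * (1 / (4 * mu A (s - t + \<eta>)))))
      (\<lambda>r t. (1 / (4 * mu A (s - t + \<eta>))) * (1 / (4 * mu A (s - t + \<eta>))) * exp (- r * (1 / (4 * mu A (s - t + \<eta>)))))
      (\<lambda>r t. - r * (mu' A (s - t + \<eta>) / (4 * (mu A (s - t + \<eta>))\<^sup>2)) * exp (- r * (1 / (4 * mu A (s - t + \<eta>)))))"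
  proof (rule profile_exp)
    show "((\<lambda>t. 1 / (4 * mu A (s - t + \<eta>))) has_real_derivative mu' A (s - t + \<eta>) / (4 * (mu A (s - t + \<eta>))\<^sup>2)) (at t within {0..s})" if "t \<in> {0..s}" for t
    proof -
      have "4 * mu A (s - t + \<eta>) \<noteq> 0" using nz(2)[OF that] by simp
      from DERIV_divide[OF DERIV_const DERIV_cmult[OF dmu[OF that]] this, of 1] show ?thesis
        by (rule DERIV_cong) (rule e[OF nz(2)[OF that]])
    qed
    show "continuous_on {0..s} (\<lambda>t. mu' A (s - t + \<eta>) / (4 * (mu A (s - t + \<eta>))\<^sup>2))" using nz(2) by (intro continuous_intros cmu) auto
  qed
qed

end

lemma norm_sq_diff_le:
  fixes x a :: "'a::real_normed_vector"
  shows "\<bar>(norm x)\<^sup>2 - (norm a)\<^sup>2\<bar> \<le> norm (x - a) * (norm x + norm a)"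
proof -
  have "\<bar>(norm x)\<^sup>2 - (norm a)\<^sup>2\<bar> = \<bar>norm x - norm a\<bar> * (norm x + norm a)"
    by (simp add: power2_eq_square square_diff_square_factored abs_mult mult.commute)
  also have "\<dots> \<le> norm (x - a) * (norm x + norm a)"
    by (intro mult_right_mono norm_triangle_ineq3) auto
  finally show ?thesis .
qed

text \<open>The factor 5: with \<open>d = norm x0 / 2\<close>, poles in the box around
  \<open>x0\<close> have norm at most \<open>3 * d\<close> in \<open>x\<close>, and the cutoff
  reaches \<open>sqrt 2 * d \<le> 3/2 * d\<close> further.\<close>

lemma frozen_kernel_intro:
  assumes "x0 \<noteq> (0::'x::euclidean_space)" "S > 0"
  shows "frozen_kernel (real DIM('x)) (real DIM('y::euclidean_space)) (norm x0 / 2) (5 * (norm x0 / 2)) (norm x0 / 2) (S + 1)"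
  using assms by unfold_locales (simp_all add: Suc_le_eq)

definition near :: "'x::euclidean_space \<Rightarrow> 'y::euclidean_space \<Rightarrow> ('x \<times> 'y) set" where
  "near x0 y0 = ball x0 (norm x0 / 2) \<times> ball y0 (norm x0 / 2)"

lemma near_geometry:
  fixes x0 :: "'x::euclidean_space"
  assumes z': "z' \<in> near x0 y0" and x0: "x0 \<noteq> 0"
  defines "d \<equiv> norm x0 / 2" and "A \<equiv> norm (fst z')"
  shows "d \<le> A" "A \<le> 5 * d"
    "(norm (fst z - fst z'))\<^sup>2 \<le> 2 * d\<^sup>2 \<Longrightarrow> (norm (fst z))\<^sup>2 \<le> (5 * d)\<^sup>2 \<and> (norm (fst z))\<^sup>2 \<le> A\<^sup>2 + 2 * (5 * d) * sqrt ((norm (fst z - fst z'))\<^sup>2)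
       \<and> A\<^sup>2 - 2 * (5 * d) * sqrt ((norm (fst z - fst z'))\<^sup>2) \<le> (norm (fst z))\<^sup>2"
    "z \<in> Kb (fst z') (snd z') (2 * d\<^sup>2) \<Longrightarrow> z \<in> Kb x0 y0 (9 * d\<^sup>2)"
proof -
  have d: "d > 0" using x0 by (simp add: d_def)
  have x0d: "norm x0 = 2 * d" by (simp add: d_def)
  have n: "norm (fst z' - x0) < d" "norm (snd z' - y0) < d"
    using z' by (auto simp: near_def mem_Times_iff dist_norm norm_minus_commute d_def)
  have "norm x0 \<le> norm (fst z') + norm (fst z' - x0)" using norm_triangle_sub[of x0 "fst z'"] by (simp add: norm_minus_commute)
  then show A1: "d \<le> A" using n x0d by (simp add: A_def)
  have "norm (fst z') \<le> norm x0 + norm (fst z' - x0)" by (rule norm_triangle_sub)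
  then have A3: "A \<le> 3 * d" using n x0d by (simp add: A_def)
  then show "A \<le> 5 * d" using d by simp
  have sq: "r \<le> 3/2 * d" if "r\<^sup>2 \<le> 2 * d\<^sup>2" "r \<ge> 0" for r
  proof (rule power2_le_imp_le)
    have "2 * d\<^sup>2 \<le> (3/2 * d)\<^sup>2" using d by (simp add: power2_eq_square)
    then show "r\<^sup>2 \<le> (3/2 * d)\<^sup>2" using that by linarith
  qed (use d in auto)
  \<comment> \<open>At most \<open>3/2 * d\<close> from the cutoff plus \<open>d\<close> from the
    position of the pole stays below \<open>3 * d\<close>, so a single box serves all poles in
    \<open>near x0 y0\<close>.\<close>
  show "z \<in> Kb x0 y0 (9 * d\<^sup>2)" if "z \<in> Kb (fst z') (snd z') (2 * d\<^sup>2)"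
  proof -
    have "norm (fst z - fst z') \<le> 3/2 * d" "norm (snd z - snd z') \<le> 3/2 * d" using that sq by (auto simp: mem_Kb)
    then have "norm (fst z - x0) \<le> 3 * d" "norm (snd z - y0) \<le> 3 * d"
      using norm_triangle_ineq[of "fst z - fst z'" "fst z' - x0"] norm_triangle_ineq[of "snd z - snd z'" "snd z' - y0"] n d by simp_all
    then have "(norm (fst z - x0))\<^sup>2 \<le> (3 * d)\<^sup>2" "(norm (snd z - y0))\<^sup>2 \<le> (3 * d)\<^sup>2" by (intro power_mono; simp)+
    then show ?thesis by (simp add: mem_Kb power_mult_distrib)
  qed
  assume P: "(norm (fst z - fst z'))\<^sup>2 \<le> 2 * d\<^sup>2"
  have "norm (fst z - fst z') \<le> 3/2 * d" using sq[OF P] by simp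
  then have x: "norm (fst z) \<le> 5 * d" using norm_triangle_sub[of "fst z" "fst z'"] A3 d by (simp add: A_def)
  then have 1: "(norm (fst z))\<^sup>2 \<le> (5 * d)\<^sup>2" by (intro power_mono) auto
  have "norm (fst z - fst z') * (norm (fst z) + norm (fst z')) \<le> norm (fst z - fst z') * (2 * (5 * d))"
    using x A3 d by (intro mult_left_mono) (auto simp: A_def)
  with norm_sq_diff_le[of "fst z" "fst z'"] have "\<bar>(norm (fst z))\<^sup>2 - A\<^sup>2\<bar> \<le> 2 * (5 * d) * norm (fst z - fst z')" by (simp add: A_def mult_ac)
  then show "(norm (fst z))\<^sup>2 \<le> (5 * d)\<^sup>2 \<and> (norm (fst z))\<^sup>2 \<le> A\<^sup>2 + 2 * (5 * d) * sqrt ((norm (fst z - fst z'))\<^sup>2)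
       \<and> A\<^sup>2 - 2 * (5 * d) * sqrt ((norm (fst z - fst z'))\<^sup>2) \<le> (norm (fst z))\<^sup>2"
    using 1 by (simp add: abs_le_iff)
qed

section \<open>Potential bounds and finiteness of the memory integral\<close>

lemma ennreal_add_le: "ennreal (x + y) \<le> ennreal x + ennreal y"
proof -
  have "ennreal (x + y) \<le> ennreal (max 0 x + max 0 y)" by (intro ennreal_leI) auto
  also have "\<dots> = ennreal (max 0 x) + ennreal (max 0 y)" by simp
  also have "\<dots> = ennreal x + ennreal y" by (simp add: max_def ennreal_neg)
  finally show ?thesis .
qed

context nonneg_solution
begin

text \<open>The test function on \<open>[0, s]\<close> is the kernel times \<open>th\<close>. The
  term in \<open>th'\<close> is isolated on the left, the supersolution property replaces the rest
  of the adjoint operator by the bounded error \<open>Cerr\<close>, and all data are taken on one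
  box that does not depend on the pole.\<close>

lemma kernel_test:
  fixes x0 :: 'x and y0 :: 'y
  assumes x0: "x0 \<noteq> 0" and S: "S > 0" and z': "z' \<in> near x0 y0" and s: "0 < s" "s < S" and e: "0 < \<eta>" "\<eta> \<le> 1"
  defines "d \<equiv> norm x0 / 2" and "N \<equiv> real DIM('x)" and "k \<equiv> real DIM('y)"
  defines "ph \<equiv> \<lambda>z. frozen_kernel.prof N k d (5 * d) d s \<eta> (norm (fst z')) ((norm (fst z - fst z'))\<^sup>2) ((norm (snd z - snd z'))\<^sup>2)"
  shows "(\<integral>\<^sup>+w. ennreal (U w * (- frozen_kernel.th' s \<eta> (snd w) * ph (fst w) (snd w))) * indicator (Om s) w \<partial>lborel)
    \<le> (\<integral>\<^sup>+w. ennreal ((M w + V w) * ph (fst w) (snd w)) * indicator (Kb x0 y0 (9 * d\<^sup>2) \<times> {0<..<s}) w \<partial>lborel)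
     + (\<integral>\<^sup>+z. ennreal (\<bar>u0 z\<bar> * ph z 0) * indicator (Kb x0 y0 (9 * d\<^sup>2)) z \<partial>lborel)
     + ennreal (frozen_kernel.Cerr N k d (5 * d) d (S + 1)) * (\<integral>\<^sup>+w. ennreal (U w) * indicator (Kb x0 y0 (9 * d\<^sup>2) \<times> {0<..<S}) w \<partial>lborel)"
proof -
  interpret frozen_kernel N k d "5 * d" d "S + 1" unfolding N_def k_def d_def by (rule frozen_kernel_intro[OF x0 S])
  define A where "A = norm (fst z')"
  note geo = near_geometry[OF z' x0, folded d_def A_def]
  note A = geo(1,2)
  have sT: "s + \<eta> \<le> S + 1" using s e by simp
  note kp = kernel_profiles[OF s(1) e(1) sT A]
  define K0 where "K0 = Kb x0 y0 (9 * d\<^sup>2)"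
  define K1 where "K1 = Kb (fst z') (snd z') (2 * d\<^sup>2)"
  have K10: "z \<in> K0" if "z \<in> K1" for z using geo(4) that unfolding K0_def K1_def .
  define P where "P z = (norm (fst z - fst z'))\<^sup>2" for z :: "'x \<times> 'y"
  define Q where "Q z = (norm (snd z - snd z'))\<^sup>2" for z :: "'x \<times> 'y"
  define \<tau> where "\<tau> t = s - t + \<eta>" for t
  have tau: "0 < \<tau> t" "\<tau> t \<le> S + 1" if "0 \<le> t" "t \<le> s" for t using that s e by (auto simp: \<tau>_def)
  define f where "f = (\<lambda>r t. sg (s - t + \<eta>) * th s \<eta> t * exp (- r * (1 / (4 * (s - t + \<eta>)))) * cut0 3 (r / d\<^sup>2))"
  define g where "g = (\<lambda>r t. exp (- r * (1 / (4 * mu A (s - t + \<eta>)))) * cut0 3 (r / d\<^sup>2))"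
  define f1 where "f1 = (\<lambda>r t. (0 * exp (- r * (1 / (4 * (s - t + \<eta>)))) + sg (s - t + \<eta>) * th s \<eta> t * (- (1 / (4 * (s - t + \<eta>))) * exp (- r * (1 / (4 * (s - t + \<eta>)))))) * cut0 3 (r / d\<^sup>2)
        + sg (s - t + \<eta>) * th s \<eta> t * exp (- r * (1 / (4 * (s - t + \<eta>)))) * (cut1 3 (r / d\<^sup>2) / d\<^sup>2))"
  define f2 where "f2 = (\<lambda>r t. (0 * exp (- r * (1 / (4 * (s - t + \<eta>)))) + 2 * 0 * (- (1 / (4 * (s - t + \<eta>))) * exp (- r * (1 / (4 * (s - t + \<eta>))))) + sg (s - t + \<eta>) * th s \<eta> t * ((1 / (4 * (s - t + \<eta>))) * (1 / (4 * (s - t + \<eta>))) * exp (- r * (1 / (4 * (s - t + \<eta>)))))) * cut0 3 (r / d\<^sup>2)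
        + 2 * (0 * exp (- r * (1 / (4 * (s - t + \<eta>)))) + sg (s - t + \<eta>) * th s \<eta> t * (- (1 / (4 * (s - t + \<eta>))) * exp (- r * (1 / (4 * (s - t + \<eta>)))))) * (cut1 3 (r / d\<^sup>2) / d\<^sup>2)
        + sg (s - t + \<eta>) * th s \<eta> t * exp (- r * (1 / (4 * (s - t + \<eta>)))) * (cut2 3 (r / d\<^sup>2) / (d\<^sup>2)\<^sup>2))"
  define g1 where "g1 = (\<lambda>r t. - (1 / (4 * mu A (s - t + \<eta>))) * exp (- r * (1 / (4 * mu A (s - t + \<eta>)))) * cut0 3 (r / d\<^sup>2)
        + exp (- r * (1 / (4 * mu A (s - t + \<eta>)))) * (cut1 3 (r / d\<^sup>2) / d\<^sup>2))"
  define g2 where "g2 = (\<lambda>r t. 1 / (4 * mu A (s - t + \<eta>)) * (1 / (4 * mu A (s - t + \<eta>))) * exp (- r * (1 / (4 * mu A (s - t + \<eta>)))) * cut0 3 (r / d\<^sup>2)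
        + 2 * (- (1 / (4 * mu A (s - t + \<eta>))) * exp (- r * (1 / (4 * mu A (s - t + \<eta>))))) * (cut1 3 (r / d\<^sup>2) / d\<^sup>2)
        + exp (- r * (1 / (4 * mu A (s - t + \<eta>)))) * (cut2 3 (r / d\<^sup>2) / (d\<^sup>2)\<^sup>2))"
  define f' where "f' = (\<lambda>r t. ((- sg' (s - t + \<eta>) * th s \<eta> t + sg (s - t + \<eta>) * th' s \<eta> t) * exp (- r * (1 / (4 * (s - t + \<eta>)))) + sg (s - t + \<eta>) * th s \<eta> t * (- r * (1 / (4 * (s - t + \<eta>)\<^sup>2)) * exp (- r * (1 / (4 * (s - t + \<eta>)))))) * cut0 3 (r / d\<^sup>2)
        + sg (s - t + \<eta>) * th s \<eta> t * exp (- r * (1 / (4 * (s - t + \<eta>)))) * 0)"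
  define g' where "g' = (\<lambda>r t. - r * (mu' A (s - t + \<eta>) / (4 * (mu A (s - t + \<eta>))\<^sup>2)) * exp (- r * (1 / (4 * mu A (s - t + \<eta>)))) * cut0 3 (r / d\<^sup>2)
        + exp (- r * (1 / (4 * mu A (s - t + \<eta>)))) * 0)"
  have F: "profile s f f1 f2 f'"
    unfolding f_def f1_def f2_def f'_def
    by (rule profile_mult[OF profile_mult[OF kp(1) kp(2)] profile_cut[OF order_refl]])
  have G: "profile s g g1 g2 g'"
    unfolding g_def g1_def g2_def g'_def
    by (rule profile_mult[OF kp(3) profile_cut[OF order_refl]])
  have ds: "d > 0" using d .
  have c0z: "cut0 3 (r / d\<^sup>2) = 0" if "r > 2 * d\<^sup>2" for r
  proof -
    have "r / d\<^sup>2 \<ge> 2" using that ds by (simp add: pos_le_divide_eq)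
    then show ?thesis by (intro cut_bounds) auto
  qed
  have supp: "f r t = 0" "g r t = 0" if "r > 2 * d\<^sup>2" for r t using c0z[OF that] by (simp_all add: f_def g_def)
  have fT: "f r s = 0" for r using e by (simp add: f_def th_def pos_def)
  note wt = weak_up_to_zero[OF F G s(1) supp fT, where a="fst z'" and c="snd z'" and \<rho>="2 * d\<^sup>2"]
  have ph: "ph z t = prof s \<eta> A (P z) (Q z) t" for z t by (simp add: ph_def A_def P_def Q_def)
  have rad: "radial2 (fst z') (snd z') f g z t = th s \<eta> t * ph z t" for z t
    by (simp add: f_def g_def radial2_def ph prof_def P_def Q_def)
  have phz: "ph z t = 0" if "z \<notin> K1" for z t
  proof -
    have "P z > 2 * d\<^sup>2 \<or> Q z > 2 * d\<^sup>2" using that by (auto simp: K1_def mem_Kb P_def Q_def)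
    then show ?thesis unfolding ph prof_def using c0z by auto
  qed
  have phn: "0 \<le> ph z t" if "0 \<le> t" "t \<le> s" for z t
    unfolding ph using tau(1)[OF that] by (intro prof_nonneg) (simp add: \<tau>_def)
  define E where "E w = Lrad (fst z') (snd z') f f1 f2 g g1 g2 (fst w) (snd w) + Trad (fst z') (snd z') f f' g g' (fst w) (snd w)" for w :: "('x \<times> 'y) \<times> real"
  note wt = wt[unfolded rad, folded E_def]
  \<comment> \<open>\<open>E\<close> is the adjoint operator applied to the test function; after the
    exact identity only the \<open>th'\<close> term and the bounded error survive.\<close>
  have Eb: "E w \<le> th' s \<eta> (snd w) * ph (fst w) (snd w) + Cerr" if w: "w \<in> Om s" for w
  proof -
    define t where "t = snd w"
    define z where "z = fst w"
    have t: "0 \<le> t" "t \<le> s" using w by (auto simp: Om_def t_def)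
    note tt = tau[OF t]
    note m = mu_bounds(2)[OF tt A]
    have X: "P z \<le> 2 * d\<^sup>2 \<Longrightarrow> (norm (fst z))\<^sup>2 \<le> (5 * d)\<^sup>2 \<and> (norm (fst z))\<^sup>2 \<le> A\<^sup>2 + 2 * (5 * d) * sqrt (P z) \<and> A\<^sup>2 - 2 * (5 * d) * sqrt (P z) \<le> (norm (fst z))\<^sup>2"
      using geo(3)[of z] unfolding P_def .
    have P0: "0 \<le> P z" "0 \<le> Q z" "0 \<le> (norm (fst z))\<^sup>2" by (auto simp: P_def Q_def)
    have "E w = (4 * P z * ((sg (\<tau> t) * th s \<eta> t * (1 / (4 * \<tau> t) * (1 / (4 * \<tau> t)) * exp (- P z * (1 / (4 * \<tau> t))))) * cut0 3 (P z / d\<^sup>2) + 2 * (sg (\<tau> t) * th s \<eta> t * (- (1 / (4 * \<tau> t)) * exp (- P z * (1 / (4 * \<tau> t))))) * (cut1 3 (P z / d\<^sup>2) / d\<^sup>2) + (sg (\<tau> t) * th s \<eta> t * exp (- P z * (1 / (4 * \<tau> t)))) * (cut2 3 (P z / d\<^sup>2) / (d\<^sup>2)\<^sup>2))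
       + 2 * N * ((sg (\<tau> t) * th s \<eta> t * (- (1 / (4 * \<tau> t)) * exp (- P z * (1 / (4 * \<tau> t))))) * cut0 3 (P z / d\<^sup>2) + (sg (\<tau> t) * th s \<eta> t * exp (- P z * (1 / (4 * \<tau> t)))) * (cut1 3 (P z / d\<^sup>2) / d\<^sup>2))) * (exp (- Q z * (1 / (4 * mu A (\<tau> t)))) * cut0 3 (Q z / d\<^sup>2))
      + (norm (fst z))\<^sup>2 * ((sg (\<tau> t) * th s \<eta> t * exp (- P z * (1 / (4 * \<tau> t)))) * cut0 3 (P z / d\<^sup>2) * (4 * Q z * (1 / (4 * mu A (\<tau> t)) * (1 / (4 * mu A (\<tau> t))) * exp (- Q z * (1 / (4 * mu A (\<tau> t)))) * cut0 3 (Q z / d\<^sup>2) + 2 * (- (1 / (4 * mu A (\<tau> t))) * exp (- Q z * (1 / (4 * mu A (\<tau> t))))) * (cut1 3 (Q z / d\<^sup>2) / d\<^sup>2) + exp (- Q z * (1 / (4 * mu A (\<tau> t)))) * (cut2 3 (Q z / d\<^sup>2) / (d\<^sup>2)\<^sup>2))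
         + 2 * k * (- (1 / (4 * mu A (\<tau> t))) * exp (- Q z * (1 / (4 * mu A (\<tau> t)))) * cut0 3 (Q z / d\<^sup>2) + exp (- Q z * (1 / (4 * mu A (\<tau> t)))) * (cut1 3 (Q z / d\<^sup>2) / d\<^sup>2))))
      + (((- sg' (\<tau> t) * th s \<eta> t + sg (\<tau> t) * th' s \<eta> t) * exp (- P z * (1 / (4 * \<tau> t))) + sg (\<tau> t) * th s \<eta> t * (- P z * (1 / (4 * (\<tau> t)\<^sup>2)) * exp (- P z * (1 / (4 * \<tau> t))))) * cut0 3 (P z / d\<^sup>2) * (exp (- Q z * (1 / (4 * mu A (\<tau> t)))) * cut0 3 (Q z / d\<^sup>2))
         + (sg (\<tau> t) * th s \<eta> t * exp (- P z * (1 / (4 * \<tau> t)))) * cut0 3 (P z / d\<^sup>2) * (- Q z * (mu' A (\<tau> t) / (4 * (mu A (\<tau> t))\<^sup>2)) * exp (- Q z * (1 / (4 * mu A (\<tau> t)))) * cut0 3 (Q z / d\<^sup>2)))"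
      unfolding E_def Lrad_def Trad_def radial2_def f_def f1_def f2_def f'_def g_def g1_def g2_def g'_def z_def[symmetric] t_def[symmetric] P_def[symmetric] Q_def[symmetric] \<tau>_def[symmetric] N_def[symmetric] k_def[symmetric]
      by (simp only: mult_zero_left mult_zero_right add_0_left add_0_right)
    also have "\<dots> \<le> th' s \<eta> t * sg (\<tau> t) * exp (- P z * (1 / (4 * \<tau> t))) * exp (- Q z * (1 / (4 * mu A (\<tau> t)))) * cut0 3 (P z / d\<^sup>2) * cut0 3 (Q z / d\<^sup>2) + Cerr"
      unfolding kernel_identity[OF tt(1) m]
      by (rule kernel_inequality[OF tt A th_bounds(1,2)[OF e(1) t(2)] P0 X])
    also have "\<dots> = th' s \<eta> t * ph z t + Cerr" by (simp add: ph prof_def \<tau>_def)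
    finally show ?thesis by (simp add: t_def z_def)
  qed
  have Ez: "E w = 0" if "fst w \<notin> K1" "w \<in> Om s" for w
    unfolding E_def using supp_rad(2,3)[OF F G s(1) supp, where z="fst w" and a="fst z'" and c="snd z'" and \<rho>="2 * d\<^sup>2"] that
    by (auto simp: K1_def Om_def)
  have [measurable]: "K0 \<times> {0<..<s} \<in> sets borel" "K0 \<in> sets borel" unfolding K0_def by measurable
  have bK: "bounded K0" unfolding K0_def by (simp add: compact_imp_bounded)
  have IU: "set_integrable lborel (K0 \<times> {0<..<s}) U"
    unfolding K0_def by (rule integrable_Om_iff_loc0[OF U_meas U_nonneg loc0_bounded(1)[OF bK[unfolded K0_def] s(1)] compact_Kb])
  \<comment> \<open>\<open>U * E\<close> has no sign. Adding the error on the box produces a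
    nonnegative majorant of the \<open>th'\<close> term, for which real and extended integrals
    agree.\<close>
  define H where "H w = - (indicator (Om s) w * (U w * E w)) + Cerr * (indicator (K0 \<times> {0<..<s}) w * U w)" for w
  have Hi: "integrable lborel H"
    unfolding H_def[abs_def] using wt(3) IU unfolding set_integrable_def by auto
  have kH: "indicator (Om s) w * (U w * (- th' s \<eta> (snd w) * ph (fst w) (snd w))) \<le> H w" for w
  proof (cases "w \<in> Om s")
    case True
    show ?thesis
    proof (cases "fst w \<in> K1")
      case k: True
      then have "w \<in> K0 \<times> {0<..<s}" using True K10 by (auto simp: Om_def mem_Times_iff)
      moreover have "U w * E w \<le> U w * (th' s \<eta> (snd w) * ph (fst w) (snd w) + Cerr)" by (intro mult_left_mono Eb True U_nonneg)
      ultimately show ?thesis using True by (simp add: H_def algebra_simps)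
    next
      case False
      then show ?thesis using True Ez[of w] phz Cerr U_nonneg[of w] by (simp add: H_def indicator_def)
    qed
  qed (use Cerr U_nonneg[of w] in \<open>simp add: H_def indicator_def\<close>)
  have kn: "0 \<le> indicator (Om s) w * (U w * (- th' s \<eta> (snd w) * ph (fst w) (snd w)))" for w
  proof (cases "w \<in> Om s")
    case True
    then have "0 \<le> snd w" "snd w \<le> s" by (auto simp: Om_def)
    then have "0 \<le> - th' s \<eta> (snd w)" "0 \<le> ph (fst w) (snd w)"
      using phn[of "snd w" "fst w"] th_bounds(3)[OF e(1), of "snd w" s] by simp_all
    then show ?thesis using U_nonneg[of w] by (intro mult_nonneg_nonneg) auto
  qed simp
  have Hn: "0 \<le> H w" for w using kH[of w] kn[of w] by linarith
  have "(\<integral>\<^sup>+w. ennreal (U w * (- th' s \<eta> (snd w) * ph (fst w) (snd w))) * indicator (Om s) w \<partial>lborel) \<le> (\<integral>\<^sup>+w. ennreal (H w) \<partial>lborel)"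
  proof (rule nn_integral_mono)
    fix w
    show "ennreal (U w * (- th' s \<eta> (snd w) * ph (fst w) (snd w))) * indicator (Om s) w \<le> ennreal (H w)"
      using kH[of w] by (cases "w \<in> Om s") (auto intro: ennreal_leI)
  qed
  also have "\<dots> = ennreal (LINT w|lborel. H w)" by (rule nn_integral_eq_integral[OF Hi]) (use Hn in auto)
  also have "(LINT w|lborel. H w) = - set_lebesgue_integral lborel (Om s) (\<lambda>w. U w * E w) + Cerr * set_lebesgue_integral lborel (K0 \<times> {0<..<s}) U"
    unfolding H_def set_lebesgue_integral_def using wt(3) IU unfolding set_integrable_def by simp
  also have "\<dots> = (LINT z|lborel. u0 z * (th s \<eta> 0 * ph z 0)) + set_lebesgue_integral lborel (Om s) (\<lambda>w. M w * (th s \<eta> (snd w) * ph (fst w) (snd w)))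
     + set_lebesgue_integral lborel (Om s) (\<lambda>w. V w * (th s \<eta> (snd w) * ph (fst w) (snd w))) + Cerr * set_lebesgue_integral lborel (K0 \<times> {0<..<s}) U"
    using wt(4) by simp
  also have "ennreal \<dots> \<le> ennreal (LINT z|lborel. u0 z * (th s \<eta> 0 * ph z 0)) + ennreal (set_lebesgue_integral lborel (Om s) (\<lambda>w. (M w + V w) * (th s \<eta> (snd w) * ph (fst w) (snd w))))
     + ennreal (Cerr * set_lebesgue_integral lborel (K0 \<times> {0<..<s}) U)"
  proof -
    have "set_lebesgue_integral lborel (Om s) (\<lambda>w. (M w + V w) * (th s \<eta> (snd w) * ph (fst w) (snd w))) = set_lebesgue_integral lborel (Om s) (\<lambda>w. M w * (th s \<eta> (snd w) * ph (fst w) (snd w)))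
     + set_lebesgue_integral lborel (Om s) (\<lambda>w. V w * (th s \<eta> (snd w) * ph (fst w) (snd w)))"
      using set_integral_add(2)[OF wt(1,2)] by (simp add: distrib_right)
    then have eq: "(LINT z|lborel. u0 z * (th s \<eta> 0 * ph z 0)) + set_lebesgue_integral lborel (Om s) (\<lambda>w. M w * (th s \<eta> (snd w) * ph (fst w) (snd w)))
     + set_lebesgue_integral lborel (Om s) (\<lambda>w. V w * (th s \<eta> (snd w) * ph (fst w) (snd w))) + Cerr * set_lebesgue_integral lborel (K0 \<times> {0<..<s}) U
     = ((LINT z|lborel. u0 z * (th s \<eta> 0 * ph z 0)) + set_lebesgue_integral lborel (Om s) (\<lambda>w. (M w + V w) * (th s \<eta> (snd w) * ph (fst w) (snd w))))
        + Cerr * set_lebesgue_integral lborel (K0 \<times> {0<..<s}) U" by simp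
    show ?thesis unfolding eq by (rule order_trans[OF ennreal_add_le add_right_mono[OF ennreal_add_le]])
  qed
  finally have main: "(\<integral>\<^sup>+w. ennreal (U w * (- th' s \<eta> (snd w) * ph (fst w) (snd w))) * indicator (Om s) w \<partial>lborel) \<le>
     ennreal (LINT z|lborel. u0 z * (th s \<eta> 0 * ph z 0)) + ennreal (set_lebesgue_integral lborel (Om s) (\<lambda>w. (M w + V w) * (th s \<eta> (snd w) * ph (fst w) (snd w))))
     + ennreal (Cerr * set_lebesgue_integral lborel (K0 \<times> {0<..<s}) U)" .
  \<comment> \<open>This covers nonintegrable functions as well, for which the left side is the
    default value 0.\<close>
  have LI: "ennreal (LINT w|lborel. F w) \<le> (\<integral>\<^sup>+w. ennreal \<bar>F w\<bar> \<partial>lborel)" for F :: "'c::euclidean_space \<Rightarrow> real"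
  proof (cases "integrable lborel F")
    case True
    have "ennreal (LINT w|lborel. F w) \<le> ennreal (LINT w|lborel. \<bar>F w\<bar>)" by (intro ennreal_leI integral_mono True integrable_abs) auto
    also have "\<dots> = (\<integral>\<^sup>+w. ennreal \<bar>F w\<bar> \<partial>lborel)" by (rule nn_integral_eq_integral[symmetric]) (use True in auto)
    finally show ?thesis .
  qed (simp add: not_integrable_integral_eq)
  have thb: "0 \<le> th s \<eta> t" "th s \<eta> t \<le> 1" if "t \<le> s" for t using th_bounds[OF e(1) that] by auto
  have t1: "ennreal (LINT z|lborel. u0 z * (th s \<eta> 0 * ph z 0)) \<le> (\<integral>\<^sup>+z. ennreal (\<bar>u0 z\<bar> * ph z 0) * indicator K0 z \<partial>lborel)"
  proof (rule order_trans[OF LI nn_integral_mono])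
    fix z
    show "ennreal \<bar>u0 z * (th s \<eta> 0 * ph z 0)\<bar> \<le> ennreal (\<bar>u0 z\<bar> * ph z 0) * indicator K0 z"
    proof (cases "z \<in> K1")
      case True
      have "th s \<eta> 0 * ph z 0 \<le> 1 * ph z 0" using thb[of 0] phn[of 0 z] s by (intro mult_right_mono) auto
      then have "\<bar>u0 z * (th s \<eta> 0 * ph z 0)\<bar> \<le> \<bar>u0 z\<bar> * ph z 0"
        using thb[of 0] phn[of 0 z] s by (simp add: abs_mult mult_left_mono)
      then show ?thesis using K10[OF True] by (simp add: ennreal_leI)
    qed (simp add: phz)
  qed
  have t2: "ennreal (set_lebesgue_integral lborel (Om s) (\<lambda>w. (M w + V w) * (th s \<eta> (snd w) * ph (fst w) (snd w)))) \<le>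
     (\<integral>\<^sup>+w. ennreal ((M w + V w) * ph (fst w) (snd w)) * indicator (K0 \<times> {0<..<s}) w \<partial>lborel)"
    unfolding set_lebesgue_integral_def
  proof (rule order_trans[OF LI nn_integral_mono])
    fix w :: "('x \<times> 'y) \<times> real"
    show "ennreal \<bar>indicator (Om s) w *\<^sub>R ((M w + V w) * (th s \<eta> (snd w) * ph (fst w) (snd w)))\<bar> \<le> ennreal ((M w + V w) * ph (fst w) (snd w)) * indicator (K0 \<times> {0<..<s}) w"
    proof (cases "w \<in> Om s \<and> fst w \<in> K1")
      case True
      then have t: "0 \<le> snd w" "snd w \<le> s" by (auto simp: Om_def)
      have k: "w \<in> K0 \<times> {0<..<s}" using True K10 by (auto simp: Om_def mem_Times_iff)
      have mv: "0 \<le> M w + V w" using M_nonneg[of w] V_nonneg[of w] by simp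
      have "th s \<eta> (snd w) * ph (fst w) (snd w) \<le> 1 * ph (fst w) (snd w)" using thb[OF t(2)] phn[OF t] by (intro mult_right_mono) auto
      then have "(M w + V w) * (th s \<eta> (snd w) * ph (fst w) (snd w)) \<le> (M w + V w) * ph (fst w) (snd w)" using mv by (intro mult_left_mono) auto
      moreover have "0 \<le> (M w + V w) * (th s \<eta> (snd w) * ph (fst w) (snd w))" using mv thb[OF t(2)] phn[OF t] by (intro mult_nonneg_nonneg) auto
      ultimately show ?thesis using True k by (simp add: ennreal_leI)
    next
      case False
      then have z: "indicator (Om s) w *\<^sub>R ((M w + V w) * (th s \<eta> (snd w) * ph (fst w) (snd w))) = 0" using phz[of "fst w" "snd w"] by auto
      show ?thesis unfolding z by simp
    qed
  qed
  have t3: "ennreal (Cerr * set_lebesgue_integral lborel (K0 \<times> {0<..<s}) U) \<le> ennreal Cerr * (\<integral>\<^sup>+w. ennreal (U w) * indicator (K0 \<times> {0<..<S}) w \<partial>lborel)"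
  proof -
    have "ennreal (Cerr * set_lebesgue_integral lborel (K0 \<times> {0<..<s}) U) = ennreal Cerr * ennreal (set_lebesgue_integral lborel (K0 \<times> {0<..<s}) U)"
      using Cerr by (simp add: ennreal_mult')
    also have "\<dots> \<le> ennreal Cerr * (\<integral>\<^sup>+w. ennreal (U w) * indicator (K0 \<times> {0<..<S}) w \<partial>lborel)"
      unfolding set_lebesgue_integral_def
      by (rule mult_left_mono[OF order_trans[OF LI nn_integral_mono]])
         (use s U_nonneg in \<open>auto simp: indicator_def\<close>)
    finally show ?thesis .
  qed
  show ?thesis using order_trans[OF main add_mono[OF add_mono[OF t1 t2] t3]]
    by (simp add: K0_def add.commute)
qed

end

lemma Fubini_lborel:
  fixes f :: "'a::euclidean_space \<Rightarrow> 'b::euclidean_space \<Rightarrow> ennreal"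
  assumes "(\<lambda>w. f (fst w) (snd w)) \<in> borel_measurable (borel \<Otimes>\<^sub>M borel)"
  shows "(\<integral>\<^sup>+x. \<integral>\<^sup>+y. f x y \<partial>lborel \<partial>lborel) = (\<integral>\<^sup>+y. \<integral>\<^sup>+x. f x y \<partial>lborel \<partial>lborel)"
proof -
  have "sets (lborel \<Otimes>\<^sub>M lborel) = sets (borel \<Otimes>\<^sub>M (borel :: 'b measure))" by (intro sets_pair_measure_cong) auto
  then have "case_prod f \<in> borel_measurable (lborel \<Otimes>\<^sub>M lborel)"
    using assms by (simp add: case_prod_beta' cong: measurable_cong_sets)
  from lborel_pair.Fubini'[OF this] show ?thesis by simp
qed

text \<open>After exchanging the integrals, the inner integral over \<open>B\<close> of the power of
  the distance is bounded uniformly in the centre \<open>\<pi> w\<close>, because \<open>b\<close>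
  is below the dimension.\<close>

lemma potential_integrable:
  fixes h :: "'w::euclidean_space \<Rightarrow> ennreal" and \<pi> :: "'w \<Rightarrow> 'z::euclidean_space"
  assumes h [measurable]: "h \<in> borel_measurable borel" and pi [measurable]: "\<pi> \<in> borel_measurable borel"
    and b: "0 < b" "b < real DIM('z)" and fin: "(\<integral>\<^sup>+w. h w \<partial>lborel) < \<infinity>"
    and B [measurable]: "B \<in> sets borel" and R: "R > 0" "\<And>w. h w \<noteq> 0 \<Longrightarrow> B \<subseteq> ball (\<pi> w) R"
  shows "(\<integral>\<^sup>+z'. (\<integral>\<^sup>+w. h w * ennreal (norm (\<pi> w - z') powr - b) \<partial>lborel) * indicator B z' \<partial>lborel) < \<infinity>"
proof -
  obtain C where C: "C < \<infinity>" "\<And>c::'z. (\<integral>\<^sup>+z. ennreal (norm (z - c) powr - b) * indicator (ball c R) z \<partial>lborel) \<le> C"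
    using nn_integral_norm_powr_ball[OF b R(1)] by blast
  have "(\<integral>\<^sup>+z'. (\<integral>\<^sup>+w. h w * ennreal (norm (\<pi> w - z') powr - b) \<partial>lborel) * indicator B z' \<partial>lborel)
     = (\<integral>\<^sup>+z'. (\<integral>\<^sup>+w. h w * ennreal (norm (\<pi> w - z') powr - b) * indicator B z' \<partial>lborel) \<partial>lborel)"
    by (intro nn_integral_cong nn_integral_multc[symmetric]) measurable
  also have "\<dots> = (\<integral>\<^sup>+w. (\<integral>\<^sup>+z'. h w * ennreal (norm (\<pi> w - z') powr - b) * indicator B z' \<partial>lborel) \<partial>lborel)"
    by (rule Fubini_lborel) measurable
  also have "\<dots> \<le> (\<integral>\<^sup>+w. C * h w \<partial>lborel)"
  proof (rule nn_integral_mono)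
    fix w
    have "(\<integral>\<^sup>+z'. h w * ennreal (norm (\<pi> w - z') powr - b) * indicator B z' \<partial>lborel) \<le>
      (\<integral>\<^sup>+z'. h w * (ennreal (norm (z' - \<pi> w) powr - b) * indicator (ball (\<pi> w) R) z') \<partial>lborel)"
    proof (rule nn_integral_mono)
      fix z'
      show "h w * ennreal (norm (\<pi> w - z') powr - b) * indicator B z' \<le> h w * (ennreal (norm (z' - \<pi> w) powr - b) * indicator (ball (\<pi> w) R) z')"
      proof (cases "h w = 0 \<or> z' \<notin> B")
        case False
        then have "z' \<in> ball (\<pi> w) R" "z' \<in> B" using R(2)[of w] by auto
        then show ?thesis by (simp only: indicator_simps mult_1_right norm_minus_commute[of "\<pi> w"] order_refl)
      qed auto
    qed
    also have "\<dots> = h w * (\<integral>\<^sup>+z'. ennreal (norm (z' - \<pi> w) powr - b) * indicator (ball (\<pi> w) R) z' \<partial>lborel)"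
    proof (rule nn_integral_cmult)
      have "ball (\<pi> w) R \<in> sets lborel" unfolding sets_lborel by (rule borel_open) (rule open_ball)
      then have "(indicator (ball (\<pi> w) R) :: 'z \<Rightarrow> ennreal) \<in> borel_measurable lborel" by (rule borel_measurable_indicator)
      moreover have "(\<lambda>z'. ennreal (norm (z' - \<pi> w) powr - b)) \<in> borel_measurable lborel" by measurable
      ultimately show "(\<lambda>z'. ennreal (norm (z' - \<pi> w) powr - b) * indicator (ball (\<pi> w) R) z') \<in> borel_measurable lborel"
        by (rule borel_measurable_times_ennreal[rotated])
    qed
    also have "\<dots> \<le> h w * C" by (intro mult_left_mono C) auto
    finally show "(\<integral>\<^sup>+z'. h w * ennreal (norm (\<pi> w - z') powr - b) * indicator B z' \<partial>lborel) \<le> C * h w" by (simp add: mult.commute)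
  qed
  also have "\<dots> = C * (\<integral>\<^sup>+w. h w \<partial>lborel)" by (rule nn_integral_cmult) measurable
  also have "\<dots> < \<infinity>" using C(1) fin by (simp add: ennreal_mult_less_top)
  finally show ?thesis .
qed

lemma time_potential:
  fixes h :: "'w::euclidean_space \<Rightarrow> ennreal" and \<tau> :: "'w \<Rightarrow> real"
  assumes h [measurable]: "h \<in> borel_measurable borel" and tau [measurable]: "\<tau> \<in> borel_measurable borel"
    and a: "0 \<le> a" "a < 1" and S: "S > 0" and t0: "\<And>w. h w \<noteq> 0 \<Longrightarrow> 0 \<le> \<tau> w"
  shows "(\<integral>\<^sup>+s. (\<integral>\<^sup>+w. h w * (ennreal ((s - \<tau> w) powr - a) * indicator {\<tau> w<..<S} s) \<partial>lborel) \<partial>lborel)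
    \<le> ennreal (S powr (1 - a) / (1 - a)) * (\<integral>\<^sup>+w. h w \<partial>lborel)"
proof -
  have "(\<integral>\<^sup>+s. (\<integral>\<^sup>+w. h w * (ennreal ((s - \<tau> w) powr - a) * indicator {\<tau> w<..<S} s) \<partial>lborel) \<partial>lborel) =
     (\<integral>\<^sup>+w. (\<integral>\<^sup>+s. h w * (ennreal ((s - \<tau> w) powr - a) * indicator {\<tau> w<..<S} s) \<partial>lborel) \<partial>lborel)"
    by (rule Fubini_lborel) measurable
  also have "\<dots> = (\<integral>\<^sup>+w. h w * (\<integral>\<^sup>+s. ennreal ((s - \<tau> w) powr - a) * indicator {\<tau> w<..<S} s \<partial>lborel) \<partial>lborel)"
    by (intro nn_integral_cong nn_integral_cmult) measurable
  also have "\<dots> \<le> (\<integral>\<^sup>+w. ennreal (S powr (1 - a) / (1 - a)) * h w \<partial>lborel)"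
  proof (rule nn_integral_mono)
    fix w
    show "h w * (\<integral>\<^sup>+s. ennreal ((s - \<tau> w) powr - a) * indicator {\<tau> w<..<S} s \<partial>lborel) \<le> ennreal (S powr (1 - a) / (1 - a)) * h w"
    proof (cases "h w = 0 \<or> S \<le> \<tau> w")
      case True
      moreover have "{\<tau> w<..<S} = {}" if "S \<le> \<tau> w" using that by auto
      ultimately show ?thesis by auto
    next
      case False
      then have t: "0 \<le> \<tau> w" "\<tau> w < S" using t0 by auto
      have "(S - \<tau> w) powr (1 - a) / (1 - a) \<le> S powr (1 - a) / (1 - a)"
        using t a by (intro divide_right_mono powr_mono2) auto
      then have "(\<integral>\<^sup>+s. ennreal ((s - \<tau> w) powr - a) * indicator {\<tau> w<..<S} s \<partial>lborel) \<le> ennreal (S powr (1 - a) / (1 - a))"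
        unfolding nn_integral_powr_Ioo[OF a t(2)] by (rule ennreal_leI)
      then show ?thesis by (subst (2) mult.commute) (rule mult_left_mono, auto)
    qed
  qed
  also have "\<dots> = ennreal (S powr (1 - a) / (1 - a)) * (\<integral>\<^sup>+w. h w \<partial>lborel)" by (rule nn_integral_cmult) measurable
  finally show ?thesis .
qed

text \<open>Either \<open>x \<le> \<kappa>\<close> or
  \<open>(x / \<kappa>) powr (p - 1) \<ge> 1\<close>. With a free threshold \<open>\<kappa>\<close>
  this plays the part of Jensen's inequality for a measure that is not normalized.\<close>

lemma le_const_plus_powr:
  fixes x \<kappa> p :: real
  assumes "x \<ge> 0" "\<kappa> > 0" "p > 1"
  shows "x \<le> \<kappa> + \<kappa> powr (1 - p) * x powr p"
proof (cases "x \<le> \<kappa>")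
  case True
  then show ?thesis by (simp add: add_increasing2)
next
  case False
  then have x: "x > 0" "x > \<kappa>" using assms by auto
  have "1 = (\<kappa> / \<kappa>) powr (p - 1)" using assms by simp
  also have "\<dots> \<le> (x / \<kappa>) powr (p - 1)" using x assms by (intro powr_mono2 divide_right_mono) auto
  also have "\<dots> = \<kappa> powr (1 - p) * x powr (p - 1)" using x assms by (simp add: powr_divide powr_diff field_simps)
  finally have "1 * x \<le> \<kappa> powr (1 - p) * x powr (p - 1) * x" using x by (intro mult_right_mono) auto
  also have "\<dots> = \<kappa> powr (1 - p) * x powr p" using x by (simp add: powr_diff)
  finally show ?thesis using assms by simp
qed

text \<open>The threshold \<open>v / (4 * L * m)\<close> depends on the unknown itself: it turns one
  term of the bound into \<open>v / 4\<close>, so one of the other three must be at least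
  \<open>v / 4\<close>. These three cases are the three summands of the conclusion.\<close>

lemma powr_bound_aux:
  fixes v L m q c p :: real
  assumes v: "v \<ge> 0" and L: "L > 0" and m: "m > 0" and q: "q \<ge> 0" and c: "c \<ge> 0" and p: "p > 1" and I: "I \<ge> 0"
    and le: "v > 0 \<Longrightarrow> v \<le> L * ((v / (4 * L * m)) * m + (v / (4 * L * m)) powr (1 - p) * I) + q + c"
  shows "v powr p \<le> 4 * L * (4 * L * m) powr (p - 1) * I + (4 * q) powr p + (4 * c) powr p"
proof (cases "v = 0")
  case False
  then have v0: "v > 0" using v by simp
  define \<kappa> where "\<kappa> = v / (4 * L * m)"
  have k: "\<kappa> > 0" using v0 L m by (simp add: \<kappa>_def)
  have "L * (\<kappa> * m) = v / 4" using L m by (simp add: \<kappa>_def)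
  then have le': "v \<le> v / 4 + L * (\<kappa> powr (1 - p) * I) + q + c" using le[OF v0] by (simp add: \<kappa>_def[symmetric] distrib_left)
  have n: "0 \<le> 4 * L * (4 * L * m) powr (p - 1) * I" "0 \<le> (4 * q) powr p" "0 \<le> (4 * c) powr p" using L I by auto
  consider "v / 4 \<le> L * (\<kappa> powr (1 - p) * I)" | "v \<le> 4 * q" | "v \<le> 4 * c" using le' by linarith
  then show ?thesis
  proof cases
    case 1
    have "v * \<kappa> powr (p - 1) \<le> 4 * (L * (\<kappa> powr (1 - p) * I)) * \<kappa> powr (p - 1)" using 1 by (intro mult_right_mono) auto
    also have "\<dots> = 4 * L * I * (\<kappa> powr (1 - p) * \<kappa> powr (p - 1))" by simp
    also have "\<kappa> powr (1 - p) * \<kappa> powr (p - 1) = 1" using k unfolding powr_add[symmetric] by simp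
    finally have "v * \<kappa> powr (p - 1) * (4 * L * m) powr (p - 1) \<le> 4 * L * I * 1 * (4 * L * m) powr (p - 1)" by (intro mult_right_mono) auto
    moreover have "\<kappa> powr (p - 1) * (4 * L * m) powr (p - 1) = v powr (p - 1)"
    proof -
      have "\<kappa> * (4 * L * m) = v" using L m by (simp add: \<kappa>_def)
      then show ?thesis by (metis powr_mult)
    qed
    moreover have "v * v powr (p - 1) = v powr p" using v0 by (simp add: powr_diff)
    ultimately have "v powr p \<le> 4 * L * (4 * L * m) powr (p - 1) * I" by (simp add: mult_ac)
    then show ?thesis using n by linarith
  next
    case 2
    then have "v powr p \<le> (4 * q) powr p" using v p by (intro powr_mono2) auto
    then show ?thesis using n by linarith
  next
    case 3
    then have "v powr p \<le> (4 * c) powr p" using v p by (intro powr_mono2) auto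
    then show ?thesis using n by linarith
  qed
qed (use assms in auto)

text \<open>Since \<open>h\<close> has finite mass, the power \<open>p\<close> can be moved inside
  the potential, where it replaces the exponent \<open>a\<close> by \<open>a * p < 1\<close>. The
  kernel stays integrable in time, and with it the \<open>p\<close>-th power of
  \<open>v\<close>.\<close>

lemma section_powr_integrable:
  fixes h :: "'w::euclidean_space \<Rightarrow> ennreal" and \<tau> :: "'w \<Rightarrow> real" and v :: "real \<Rightarrow> real"
  assumes h [measurable]: "h \<in> borel_measurable borel" and tau [measurable]: "\<tau> \<in> borel_measurable borel"
    and v0: "\<And>s. v s \<ge> 0"
    and p: "p > 1" and a: "0 < a" "a * p < 1" and S: "S > 0" and t0: "\<And>w. h w \<noteq> 0 \<Longrightarrow> 0 \<le> \<tau> w"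
    and fin: "(\<integral>\<^sup>+w. h w \<partial>lborel) < \<infinity>" and L: "L > 0" and q: "q \<ge> 0" and c: "c \<ge> 0"
    and le: "AE s in lborel. s \<in> {0<..<S} \<longrightarrow> ennreal (v s) \<le> ennreal L * (\<integral>\<^sup>+w. h w * (ennreal ((s - \<tau> w) powr - a) * indicator {\<tau> w<..<S} s) \<partial>lborel)
        + ennreal (q * s powr - a) + ennreal c"
  shows "(\<integral>\<^sup>+s. ennreal (v s powr p) * indicator {0<..<S} s \<partial>lborel) < \<infinity>"
proof -
  \<comment> \<open>Adding 1 keeps \<open>m\<close> positive when \<open>h\<close> vanishes.\<close>
  define m where "m = enn2real (\<integral>\<^sup>+w. h w \<partial>lborel) + 1"
  have m: "m > 0" by (simp add: m_def add_nonneg_pos)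
  have hm: "(\<integral>\<^sup>+w. h w \<partial>lborel) \<le> ennreal m"
    using fin by (simp add: m_def ennreal_plus)
  have ap: "0 \<le> a * p" using a p by simp
  define I where "I s = (\<integral>\<^sup>+w. h w * (ennreal ((s - \<tau> w) powr - (a * p)) * indicator {\<tau> w<..<S} s) \<partial>lborel)" for s
  define K1 where "K1 = 4 * L * (4 * L * m) powr (p - 1)"
  define K2 where "K2 = (4 * q) powr p"
  define K3 where "K3 = (4 * c) powr p"
  have K: "K1 \<ge> 0" "K2 \<ge> 0" "K3 \<ge> 0" using L by (auto simp: K1_def K2_def K3_def)
  have Im [measurable]: "I \<in> borel_measurable borel" unfolding I_def by measurable
  have "(\<integral>\<^sup>+s. ennreal (v s powr p) * indicator {0<..<S} s \<partial>lborel) \<le>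
     (\<integral>\<^sup>+s. ennreal K1 * I s + ennreal K2 * (ennreal ((s - 0) powr - (a * p)) * indicator {0<..<S} s) + ennreal K3 * indicator {0<..<S} s \<partial>lborel)"
  proof (rule nn_integral_mono_AE, use le in eventually_elim)
    fix s assume le: "s \<in> {0<..<S} \<longrightarrow> ennreal (v s) \<le> ennreal L * (\<integral>\<^sup>+w. h w * (ennreal ((s - \<tau> w) powr - a) * indicator {\<tau> w<..<S} s) \<partial>lborel)
        + ennreal (q * s powr - a) + ennreal c"
    show "ennreal (v s powr p) * indicator {0<..<S} s \<le> ennreal K1 * I s + ennreal K2 * (ennreal ((s - 0) powr - (a * p)) * indicator {0<..<S} s) + ennreal K3 * indicator {0<..<S} s"
    \<comment> \<open>Where \<open>I s\<close> is infinite the right side is infinite as well,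
      because \<open>K1 > 0\<close>.\<close>
    proof (cases "s \<in> {0<..<S} \<and> (I s < \<infinity> \<or> K1 = 0)")
      case False
      have K1: "K1 > 0" unfolding K1_def using L m by simp
      show ?thesis
      proof (cases "s \<in> {0<..<S}")
        case True
        then have "I s = \<infinity>" using False by (auto simp: not_less top_unique)
        then show ?thesis using K1 by (simp add: ennreal_mult_top)
      qed simp
    next
      case True
      then have s: "s \<in> {0<..<S}" by simp
      have K1: "K1 > 0" unfolding K1_def using L m by simp
      with True have If: "I s < \<infinity>" by auto
      define i where "i = enn2real (I s)"
      have i: "I s = ennreal i" "i \<ge> 0" using If by (auto simp: i_def)
      have "v s powr p \<le> 4 * L * (4 * L * m) powr (p - 1) * i + (4 * (q * s powr - a)) powr p + (4 * c) powr p"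
      proof (rule powr_bound_aux[OF v0 L m _ c p i(2)])
        show "0 \<le> q * s powr - a" using q by simp
        assume vs: "v s > 0"
        define \<kappa> where "\<kappa> = v s / (4 * L * m)"
        have k: "\<kappa> > 0" using vs L m by (simp add: \<kappa>_def)
        have "(\<integral>\<^sup>+w. h w * (ennreal ((s - \<tau> w) powr - a) * indicator {\<tau> w<..<S} s) \<partial>lborel) \<le>
          (\<integral>\<^sup>+w. ennreal \<kappa> * h w + ennreal (\<kappa> powr (1 - p)) * (h w * (ennreal ((s - \<tau> w) powr - (a * p)) * indicator {\<tau> w<..<S} s)) \<partial>lborel)"
        proof (rule nn_integral_mono)
          fix w
          show "h w * (ennreal ((s - \<tau> w) powr - a) * indicator {\<tau> w<..<S} s) \<le> ennreal \<kappa> * h w + ennreal (\<kappa> powr (1 - p)) * (h w * (ennreal ((s - \<tau> w) powr - (a * p)) * indicator {\<tau> w<..<S} s))"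
          proof (cases "s \<in> {\<tau> w<..<S}")
            case True
            have "(s - \<tau> w) powr - a \<le> \<kappa> + \<kappa> powr (1 - p) * ((s - \<tau> w) powr - a) powr p"
              by (rule le_const_plus_powr[OF _ k p]) simp
            also have "((s - \<tau> w) powr - a) powr p = (s - \<tau> w) powr - (a * p)" by (simp add: powr_powr)
            finally have "ennreal ((s - \<tau> w) powr - a) \<le> ennreal (\<kappa> + \<kappa> powr (1 - p) * (s - \<tau> w) powr - (a * p))" by (rule ennreal_leI)
            also have "\<dots> = ennreal \<kappa> + ennreal (\<kappa> powr (1 - p)) * ennreal ((s - \<tau> w) powr - (a * p))"
              using k by (simp add: ennreal_mult ennreal_plus)
            finally have "h w * ennreal ((s - \<tau> w) powr - a) \<le> h w * (ennreal \<kappa> + ennreal (\<kappa> powr (1 - p)) * ennreal ((s - \<tau> w) powr - (a * p)))"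
              by (intro mult_left_mono) auto
            then show ?thesis using True by (simp add: distrib_left mult_ac)
          qed simp
        qed
        also have "\<dots> = ennreal \<kappa> * (\<integral>\<^sup>+w. h w \<partial>lborel) + ennreal (\<kappa> powr (1 - p)) * I s"
          unfolding I_def by (subst nn_integral_add) (auto simp: nn_integral_cmult)
        also have "\<dots> \<le> ennreal \<kappa> * ennreal m + ennreal (\<kappa> powr (1 - p)) * ennreal i"
          unfolding i(1) by (intro add_mono mult_left_mono hm) auto
        also have "\<dots> = ennreal (\<kappa> * m + \<kappa> powr (1 - p) * i)"
          using k m i by (simp add: ennreal_mult ennreal_plus)
        finally have "ennreal (v s) \<le> ennreal L * ennreal (\<kappa> * m + \<kappa> powr (1 - p) * i) + ennreal (q * s powr - a) + ennreal c"
          using le s by (meson add_right_mono mult_left_mono order_trans zero_le)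
        also have "\<dots> = ennreal (L * (\<kappa> * m + \<kappa> powr (1 - p) * i) + q * s powr - a + c)"
          using L k m i q c by (simp add: ennreal_mult[symmetric] ennreal_plus[symmetric] del: ennreal_plus)
        finally show "v s \<le> L * (v s / (4 * L * m) * m + (v s / (4 * L * m)) powr (1 - p) * i) + q * s powr - a + c"
          unfolding \<kappa>_def[symmetric] using L k m i q c by (subst (asm) ennreal_le_iff) auto
      qed
      also have "(4 * (q * s powr - a)) powr p = K2 * s powr - (a * p)"
        using q by (simp add: K2_def powr_mult powr_powr mult.assoc[symmetric])
      finally have "ennreal (v s powr p) \<le> ennreal (K1 * i + K2 * s powr - (a * p) + K3)"
        by (intro ennreal_leI) (simp add: K1_def K3_def)
      then show ?thesis using s K i by (simp add: ennreal_mult ennreal_plus)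
    qed
  qed
  also have "\<dots> = ennreal K1 * (\<integral>\<^sup>+s. I s \<partial>lborel) + ennreal K2 * (\<integral>\<^sup>+s. ennreal ((s - 0) powr - (a * p)) * indicator {0<..<S} s \<partial>lborel) + ennreal K3 * emeasure lborel {0<..<S}"
    by (subst nn_integral_add, measurable)+ (simp add: nn_integral_cmult)
  also have "\<dots> < \<infinity>"
  proof -
    have "(\<integral>\<^sup>+s. I s \<partial>lborel) \<le> ennreal (S powr (1 - a * p) / (1 - a * p)) * (\<integral>\<^sup>+w. h w \<partial>lborel)"
      unfolding I_def by (rule time_potential[OF h tau ap a(2) S t0])
    also have "\<dots> < \<infinity>" using fin by (simp add: ennreal_mult_less_top)
    finally have "(\<integral>\<^sup>+s. I s \<partial>lborel) < \<infinity>" .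
    then show ?thesis unfolding nn_integral_powr_Ioo[OF ap a(2) S] using S by (simp add: ennreal_mult_less_top)
  qed
  finally show ?thesis .
qed

lemma cut0_measurable [measurable]: "cut0 3 \<in> borel_measurable borel"
  by (intro borel_measurable_continuous_onI cut_deriv) simp

lemma pos_measurable [measurable]: "pos \<in> borel_measurable borel"
  unfolding pos_def[abs_def] by measurable

lemma norm_prod_sq: "(norm (fst z - fst z'))\<^sup>2 + (norm (snd z - snd z'))\<^sup>2 = (norm (z - z'))\<^sup>2"
  for z z' :: "'a::real_normed_vector \<times> 'b::real_normed_vector"
  by (simp add: norm_prod_def)

context nonneg_solution
begin

text \<open>Potential of \<open>M + V\<close> over the past of \<open>w'\<close>, plus that of the
  initial data, with the product kernel of \<open>prof_upper\<close>. The domain of integration is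
  the box containing the supports of all kernels with pole in \<open>near x0 y0\<close>.\<close>

definition pot where
  "pot a b x0 y0 S w' =
     (\<integral>\<^sup>+w. ennreal ((M w + V w) * norm (fst w - fst w') powr - b) * indicator (Kb x0 y0 (9 * (norm x0 / 2)\<^sup>2) \<times> {0<..<S}) w
        * (ennreal ((snd w' - snd w) powr - a) * indicator {snd w<..<S} (snd w')) \<partial>lborel)
   + ennreal (snd w' powr - a) * (\<integral>\<^sup>+z. ennreal (\<bar>u0 z\<bar> * norm (z - fst w') powr - b) * indicator (Kb x0 y0 (9 * (norm x0 / 2)\<^sup>2)) z \<partial>lborel)"

text \<open>The exponent \<open>b\<close> is \<open>2 * ((N + k) / 2 - a)\<close>, since
  \<open>prof_upper\<close> is stated in squared distances. The constant is uniform in the pole and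
  in \<open>\<eta>\<close>, which permits averaging over poles and letting \<open>\<eta>\<close>
  tend to 0.\<close>

lemma kernel_potential:
  fixes x0 :: 'x and y0 :: 'y
  assumes x0: "x0 \<noteq> 0" and S: "S > 0" and a: "0 < a" "a < 1/2"
  defines "d \<equiv> norm x0 / 2" and "N \<equiv> real DIM('x)" and "k \<equiv> real DIM('y)" and "b \<equiv> real DIM('x \<times> 'y) - 2 * a"
  shows "\<exists>C>0. \<forall>z'\<in>near x0 y0. \<forall>s\<in>{0<..<S}. \<forall>\<eta>\<in>{0<..1}.
    (\<integral>\<^sup>+w. ennreal (U w * (- frozen_kernel.th' s \<eta> (snd w) * frozen_kernel.prof N k d (5 * d) d s \<eta> (norm (fst z')) ((norm (fst (fst w) - fst z'))\<^sup>2) ((norm (snd (fst w) - snd z'))\<^sup>2) (snd w))) * indicator (Om s) w \<partial>lborel)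
    \<le> ennreal C * pot a b x0 y0 S (z', s) + ennreal C"
proof -
  interpret frozen_kernel N k d "5 * d" d "S + 1" unfolding N_def k_def d_def by (rule frozen_kernel_intro[OF x0 S])
  define r where "r = (N + k) / 2 - a"
  have br: "b = 2 * r" by (simp add: b_def N_def k_def r_def field_simps)
  have a2: "a < (N + k) / 2" using a N k by simp
  define C0 where "C0 = exp (bb * (S + 1) powr (1/4)) * (r / c0) powr r"
  have C0: "C0 \<ge> 0" by (simp add: C0_def)
  define K0 where "K0 = Kb x0 y0 (9 * d\<^sup>2)"
  have [measurable]: "K0 \<times> {0<..<t::real} \<in> sets borel" for t unfolding K0_def by (rule Kb_Ioo_sets)
  have [measurable]: "K0 \<in> sets borel" unfolding K0_def by (rule Kb_sets)
  define c3 where "c3 = ennreal Cerr * (\<integral>\<^sup>+w. ennreal (U w) * indicator (K0 \<times> {0<..<S}) w \<partial>lborel)"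
  have "loc0 K0 S U" unfolding K0_def by (intro loc0_bounded S compact_imp_bounded compact_Kb)
  then have c3f: "c3 < \<infinity>" by (simp add: c3_def loc0_def ennreal_mult_less_top)
  define C where "C = C0 + enn2real c3 + 1"
  have C: "C > 0" "C0 \<le> C" using C0 by (auto simp: C_def add_nonneg_pos)
  have c3C: "c3 \<le> ennreal C"
  proof -
    have "c3 = ennreal (enn2real c3)" using c3f by simp
    also have "\<dots> \<le> ennreal C" by (intro ennreal_leI) (use C0 in \<open>simp add: C_def\<close>)
    finally show ?thesis .
  qed
  have ub: "prof s \<eta> (norm (fst z')) ((norm (fst z - fst z'))\<^sup>2) ((norm (snd z - snd z'))\<^sup>2) t \<le> C0 * (s - t) powr (- a) * norm (z - z') powr - b"
    if z': "z' \<in> near x0 y0" and t: "0 \<le> t" "t < s" "s < S" and e: "0 < \<eta>" "\<eta> \<le> 1" and ne: "z \<noteq> z'" for z z' s \<eta> t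
  proof -
    have A: "d \<le> norm (fst z')" "norm (fst z') \<le> 5 * d" using near_geometry(1,2)[OF z' x0] by (simp_all add: d_def)
    have "norm (z - z') > 0" using ne by simp
    then have n: "(norm (z - z'))\<^sup>2 > 0" by simp
    have "prof s \<eta> (norm (fst z')) ((norm (fst z - fst z'))\<^sup>2) ((norm (snd z - snd z'))\<^sup>2) t
       \<le> exp (bb * (S + 1) powr (1/4)) * (((N + k) / 2 - a) / c0) powr ((N + k) / 2 - a) * (s - t) powr (- a)
         * ((norm (fst z - fst z'))\<^sup>2 + (norm (snd z - snd z'))\<^sup>2) powr (- ((N + k) / 2 - a))"
      by (rule prof_upper[OF t(2) e(1) _ A _ _ _ a(1) a2]) (use t e n in \<open>auto simp: norm_prod_sq\<close>)
    also have "((norm (fst z - fst z'))\<^sup>2 + (norm (snd z - snd z'))\<^sup>2) powr (- ((N + k) / 2 - a)) = norm (z - z') powr - b"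
    proof -
      have "(norm (z - z'))\<^sup>2 = norm (z - z') powr 2" using ne by simp
      then show ?thesis unfolding norm_prod_sq br r_def[symmetric] by (simp only: powr_powr mult_minus_right)
    qed
    finally show ?thesis by (simp add: C0_def r_def)
  qed
  show ?thesis
  proof (intro exI[of _ C] conjI ballI C(1))
    fix z' and s \<eta> :: real assume z': "z' \<in> near x0 y0" and s: "s \<in> {0<..<S}" and e: "\<eta> \<in> {0<..1}"
    have s': "0 < s" "s < S" and e': "0 < \<eta>" "\<eta> \<le> 1" using s e by auto
    let ?ph = "\<lambda>z t. prof s \<eta> (norm (fst z')) ((norm (fst z - fst z'))\<^sup>2) ((norm (snd z - snd z'))\<^sup>2) t"
    have "(\<integral>\<^sup>+w. ennreal (U w * (- th' s \<eta> (snd w) * ?ph (fst w) (snd w))) * indicator (Om s) w \<partial>lborel)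
      \<le> (\<integral>\<^sup>+w. ennreal ((M w + V w) * ?ph (fst w) (snd w)) * indicator (K0 \<times> {0<..<s}) w \<partial>lborel)
       + (\<integral>\<^sup>+z. ennreal (\<bar>u0 z\<bar> * ?ph z 0) * indicator K0 z \<partial>lborel) + c3"
      using kernel_test[OF x0 S z' s' e'] unfolding N_def k_def d_def c3_def K0_def by simp
    also have "\<dots> \<le> ennreal C0 * (\<integral>\<^sup>+w. ennreal ((M w + V w) * norm (fst w - z') powr - b) * indicator (K0 \<times> {0<..<S}) w
        * (ennreal ((s - snd w) powr - a) * indicator {snd w<..<S} s) \<partial>lborel)
      + ennreal C0 * (ennreal (s powr - a) * (\<integral>\<^sup>+z. ennreal (\<bar>u0 z\<bar> * norm (z - z') powr - b) * indicator K0 z \<partial>lborel)) + ennreal C"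
    proof (intro add_mono c3C)
      have "(\<integral>\<^sup>+w. ennreal ((M w + V w) * ?ph (fst w) (snd w)) * indicator (K0 \<times> {0<..<s}) w \<partial>lborel) \<le>
        (\<integral>\<^sup>+w. ennreal C0 * (ennreal ((M w + V w) * norm (fst w - z') powr - b) * indicator (K0 \<times> {0<..<S}) w
        * (ennreal ((s - snd w) powr - a) * indicator {snd w<..<S} s)) \<partial>lborel)"
      \<comment> \<open>The pole has to be excluded: \<open>0 powr - b\<close> is 0, so the kernel
        bound would fail at \<open>z'\<close> itself.\<close>
      proof (rule nn_integral_mono_AE)
        have "AE w in (lborel :: (('x \<times> 'y) \<times> real) measure). fst w \<noteq> z'" by (rule AE_lborel_fst[OF AE_lborel_singleton])
        then show "AE w in lborel. ennreal ((M w + V w) * ?ph (fst w) (snd w)) * indicator (K0 \<times> {0<..<s}) w \<le>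
          ennreal C0 * (ennreal ((M w + V w) * norm (fst w - z') powr - b) * indicator (K0 \<times> {0<..<S}) w
        * (ennreal ((s - snd w) powr - a) * indicator {snd w<..<S} s))"
        proof eventually_elim
          case (elim w)
          show ?case
          proof (cases "w \<in> K0 \<times> {0<..<s}")
            case True
            then have t: "0 \<le> snd w" "snd w < s" and w: "w \<in> K0 \<times> {0<..<S}" "s \<in> {snd w<..<S}" using s' by (auto simp: mem_Times_iff)
            have mv: "0 \<le> M w + V w" using M_nonneg[of w] V_nonneg[of w] by simp
            have "(M w + V w) * ?ph (fst w) (snd w) \<le> (M w + V w) * (C0 * (s - snd w) powr (- a) * norm (fst w - z') powr - b)"
              by (intro mult_left_mono mv ub[OF z' t s'(2) e' elim])
            also have "\<dots> = C0 * (((M w + V w) * norm (fst w - z') powr - b) * (s - snd w) powr - a)" by simp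
            finally have "ennreal ((M w + V w) * ?ph (fst w) (snd w)) \<le> ennreal (C0 * (((M w + V w) * norm (fst w - z') powr - b) * (s - snd w) powr - a))" by (rule ennreal_leI)
            also have "\<dots> = ennreal C0 * (ennreal ((M w + V w) * norm (fst w - z') powr - b) * ennreal ((s - snd w) powr - a))"
              using C0 mv by (simp add: ennreal_mult)
            finally show ?thesis using True w by simp
          qed simp
        qed
      qed
      also have "\<dots> = ennreal C0 * (\<integral>\<^sup>+w. ennreal ((M w + V w) * norm (fst w - z') powr - b) * indicator (K0 \<times> {0<..<S}) w
        * (ennreal ((s - snd w) powr - a) * indicator {snd w<..<S} s) \<partial>lborel)"
        by (rule nn_integral_cmult) measurable
      finally show "(\<integral>\<^sup>+w. ennreal ((M w + V w) * ?ph (fst w) (snd w)) * indicator (K0 \<times> {0<..<s}) w \<partial>lborel) \<le> ennreal C0 * (\<integral>\<^sup>+w. ennreal ((M w + V w) * norm (fst w - z') powr - b) * indicator (K0 \<times> {0<..<S}) w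
        * (ennreal ((s - snd w) powr - a) * indicator {snd w<..<S} s) \<partial>lborel)" .
      have u0m [measurable]: "u0 \<in> borel_measurable borel" using borel_measurable_integrable[OF u0] by simp
      have "(\<integral>\<^sup>+z. ennreal (\<bar>u0 z\<bar> * ?ph z 0) * indicator K0 z \<partial>lborel) \<le>
        (\<integral>\<^sup>+z. ennreal (C0 * s powr - a) * (ennreal (\<bar>u0 z\<bar> * norm (z - z') powr - b) * indicator K0 z) \<partial>lborel)"
      proof (rule nn_integral_mono_AE)
        have "AE z in (lborel :: ('x \<times> 'y) measure). z \<noteq> z'" by (rule AE_lborel_singleton)
        then show "AE z in lborel. ennreal (\<bar>u0 z\<bar> * ?ph z 0) * indicator K0 z \<le> ennreal (C0 * s powr - a) * (ennreal (\<bar>u0 z\<bar> * norm (z - z') powr - b) * indicator K0 z)"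
        proof eventually_elim
          case (elim z)
          have "\<bar>u0 z\<bar> * ?ph z 0 \<le> \<bar>u0 z\<bar> * (C0 * (s - 0) powr (- a) * norm (z - z') powr - b)"
            by (intro mult_left_mono ub[OF z' order_refl s' e' elim]) auto
          also have "\<dots> = (C0 * s powr - a) * (\<bar>u0 z\<bar> * norm (z - z') powr - b)" by simp
          finally have "ennreal (\<bar>u0 z\<bar> * ?ph z 0) \<le> ennreal ((C0 * s powr - a) * (\<bar>u0 z\<bar> * norm (z - z') powr - b))" by (rule ennreal_leI)
          also have "\<dots> = ennreal (C0 * s powr - a) * ennreal (\<bar>u0 z\<bar> * norm (z - z') powr - b)"
            by (rule ennreal_mult) (use C0 in auto)
          finally show ?case by (simp add: indicator_def)
        qed
      qed
      also have "\<dots> = ennreal (C0 * s powr - a) * (\<integral>\<^sup>+z. (ennreal (\<bar>u0 z\<bar> * norm (z - z') powr - b) * indicator K0 z) \<partial>lborel)"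
        by (rule nn_integral_cmult) measurable
      also have "\<dots> = ennreal C0 * (ennreal (s powr - a) * (\<integral>\<^sup>+z. ennreal (\<bar>u0 z\<bar> * norm (z - z') powr - b) * indicator K0 z \<partial>lborel))"
        using C0 by (simp add: ennreal_mult mult.assoc)
      finally show "(\<integral>\<^sup>+z. ennreal (\<bar>u0 z\<bar> * ?ph z 0) * indicator K0 z \<partial>lborel) \<le> ennreal C0 * (ennreal (s powr - a) * (\<integral>\<^sup>+z. ennreal (\<bar>u0 z\<bar> * norm (z - z') powr - b) * indicator K0 z \<partial>lborel))" .
    qed
    also have "\<dots> = ennreal C0 * pot a b x0 y0 S (z', s) + ennreal C"
      unfolding pot_def K0_def d_def by (simp add: distrib_left)
    also have "\<dots> \<le> ennreal C * pot a b x0 y0 S (z', s) + ennreal C"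
      by (intro add_right_mono mult_right_mono ennreal_leI C) auto
    finally show "(\<integral>\<^sup>+w. ennreal (U w * (- th' s \<eta> (snd w) * ?ph (fst w) (snd w))) * indicator (Om s) w \<partial>lborel) \<le> ennreal C * pot a b x0 y0 S (z', s) + ennreal C" .
  qed
qed

lemma pot_measurable [measurable]: "pot a b x0 y0 S \<in> borel_measurable borel"
proof -
  have [measurable]: "u0 \<in> borel_measurable borel" using borel_measurable_integrable[OF u0] by simp
  have "(\<lambda>w'. pot a b x0 y0 S w') \<in> borel_measurable borel"
    unfolding pot_def by measurable
  then show ?thesis .
qed

text \<open>Integrated over the poles, the power of the distance is bounded uniformly, so
  integrability of \<open>M + V\<close> and of \<open>u0\<close> on the box is all that
  enters.\<close>

lemma pot_parts_finite:
  fixes x0 :: 'x and y0 :: 'y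
  assumes x0: "x0 \<noteq> 0" and S: "S > 0" and b: "0 < b" "b < real DIM('x \<times> 'y)"
  shows "(\<integral>\<^sup>+z'. (\<integral>\<^sup>+w. ennreal ((M w + V w) * norm (fst w - z') powr - b) * indicator (Kb x0 y0 (9 * (norm x0 / 2)\<^sup>2) \<times> {0<..<S}) w \<partial>lborel) * indicator (near x0 y0) z' \<partial>lborel) < \<infinity>"
    "(\<integral>\<^sup>+z'. (\<integral>\<^sup>+z. ennreal (\<bar>u0 z\<bar> * norm (z - z') powr - b) * indicator (Kb x0 y0 (9 * (norm x0 / 2)\<^sup>2)) z \<partial>lborel) * indicator (near x0 y0) z' \<partial>lborel) < \<infinity>"
proof -
  define K0 where "K0 = Kb x0 y0 (9 * (norm x0 / 2)\<^sup>2)"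
  have [measurable]: "K0 \<times> {0<..<t::real} \<in> sets borel" for t unfolding K0_def by (rule Kb_Ioo_sets)
  have [measurable]: "K0 \<in> sets borel" unfolding K0_def by (rule Kb_sets)
  have [measurable]: "u0 \<in> borel_measurable borel" using borel_measurable_integrable[OF u0] by simp
  have "open (near x0 y0)" unfolding near_def by (intro open_Times open_ball)
  then have nm: "near x0 y0 \<in> sets borel" by (rule borel_open)
  have "bounded (K0 \<union> near x0 y0)"
    unfolding K0_def near_def by (intro bounded_Un[THEN iffD2] conjI compact_imp_bounded compact_Kb bounded_Times bounded_ball)
  then obtain B where B: "\<And>z. z \<in> K0 \<union> near x0 y0 \<Longrightarrow> norm z \<le> B" unfolding bounded_iff by blast
  define R where "R = 2 * \<bar>B\<bar> + 1"
  have R: "R > 0" by (simp add: R_def)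
  have nb: "near x0 y0 \<subseteq> ball z R" if "z \<in> K0" for z
  proof
    fix z' assume "z' \<in> near x0 y0"
    then have "norm z \<le> B" "norm z' \<le> B" using B that by auto
    then show "z' \<in> ball z R" using norm_triangle_ineq4[of z z'] by (simp add: R_def dist_norm)
  qed
  have "loc0 K0 S (\<lambda>w. M w + V w)" unfolding K0_def by (intro loc0_bounded S compact_imp_bounded compact_Kb)
  then have f1: "(\<integral>\<^sup>+w. ennreal (M w + V w) * indicator (K0 \<times> {0<..<S}) w \<partial>lborel) < \<infinity>" by (simp add: loc0_def)
  have "(\<integral>\<^sup>+z'. (\<integral>\<^sup>+w. (ennreal (M w + V w) * indicator (K0 \<times> {0<..<S}) w) * ennreal (norm (fst w - z') powr - b) \<partial>lborel) * indicator (near x0 y0) z' \<partial>lborel) < \<infinity>"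
  proof (rule potential_integrable[OF _ _ b f1 nm R])
    show "near x0 y0 \<subseteq> ball (fst w) R" if "ennreal (M w + V w) * indicator (K0 \<times> {0<..<S}) w \<noteq> 0" for w
    proof (rule nb)
      have "w \<in> K0 \<times> {0<..<S}" using that by (metis indicator_simps(2) mult_zero_right)
      then show "fst w \<in> K0" by (simp add: mem_Times_iff)
    qed
  qed measurable
  moreover have "(ennreal (M w + V w) * indicator (K0 \<times> {0<..<S}) w) * ennreal (norm (fst w - z') powr - b) = ennreal ((M w + V w) * norm (fst w - z') powr - b) * indicator (K0 \<times> {0<..<S}) w" for w z'
    using M_nonneg[of w] V_nonneg[of w] by (simp add: ennreal_mult mult_ac)
  ultimately show "(\<integral>\<^sup>+z'. (\<integral>\<^sup>+w. ennreal ((M w + V w) * norm (fst w - z') powr - b) * indicator (Kb x0 y0 (9 * (norm x0 / 2)\<^sup>2) \<times> {0<..<S}) w \<partial>lborel) * indicator (near x0 y0) z' \<partial>lborel) < \<infinity>"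
    unfolding K0_def[symmetric] by simp
  have "integrable lborel (\<lambda>z. \<bar>u0 z\<bar>)" using u0 by simp
  then have "(\<integral>\<^sup>+z. ennreal \<bar>u0 z\<bar> \<partial>lborel) < \<infinity>" unfolding integrable_iff_bounded by simp
  moreover have "(\<integral>\<^sup>+z. ennreal \<bar>u0 z\<bar> * indicator K0 z \<partial>lborel) \<le> (\<integral>\<^sup>+z. ennreal \<bar>u0 z\<bar> \<partial>lborel)"
    by (intro nn_integral_mono) (auto simp: indicator_def)
  ultimately have f2: "(\<integral>\<^sup>+z. ennreal \<bar>u0 z\<bar> * indicator K0 z \<partial>lborel) < \<infinity>" by (rule le_less_trans[rotated])
  have "(\<integral>\<^sup>+z'. (\<integral>\<^sup>+z. (ennreal \<bar>u0 z\<bar> * indicator K0 z) * ennreal (norm (z - z') powr - b) \<partial>lborel) * indicator (near x0 y0) z' \<partial>lborel) < \<infinity>"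
  proof (rule potential_integrable[OF _ _ b f2 nm R])
    show "near x0 y0 \<subseteq> ball z R" if "ennreal \<bar>u0 z\<bar> * indicator K0 z \<noteq> 0" for z
      using that by (intro nb) (metis indicator_simps(2) mult_zero_right)
  qed measurable
  moreover have "(ennreal \<bar>u0 z\<bar> * indicator K0 z) * ennreal (norm (z - z') powr - b) = ennreal (\<bar>u0 z\<bar> * norm (z - z') powr - b) * indicator K0 z" for z z'
    by (simp add: ennreal_mult mult_ac)
  ultimately show "(\<integral>\<^sup>+z'. (\<integral>\<^sup>+z. ennreal (\<bar>u0 z\<bar> * norm (z - z') powr - b) * indicator (Kb x0 y0 (9 * (norm x0 / 2)\<^sup>2)) z \<partial>lborel) * indicator (near x0 y0) z' \<partial>lborel) < \<infinity>"
    unfolding K0_def[symmetric] by simp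
qed

end

lemma nn_integral_liminf_le:
  assumes "\<And>n::nat. f n \<in> borel_measurable M" "\<And>x. \<forall>\<^sub>F n in sequentially. g x \<le> f n x"
    and "\<forall>\<^sub>F n in sequentially. (\<integral>\<^sup>+x. f n x \<partial>M) \<le> (C::ennreal)"
  shows "(\<integral>\<^sup>+x. g x \<partial>M) \<le> C"
proof -
  have "(\<integral>\<^sup>+x. g x \<partial>M) \<le> (\<integral>\<^sup>+x. liminf (\<lambda>n. f n x) \<partial>M)"
    by (intro nn_integral_mono Liminf_bounded assms(2))
  also have "\<dots> \<le> liminf (\<lambda>n. \<integral>\<^sup>+x. f n x \<partial>M)" by (rule nn_integral_liminf[OF assms(1)])
  also have "\<dots> \<le> limsup (\<lambda>n. \<integral>\<^sup>+x. f n x \<partial>M)" by (rule Liminf_le_Limsup) simp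
  also have "\<dots> \<le> C" by (rule Limsup_bounded[OF assms(3)])
  finally show ?thesis .
qed

section \<open>Averaging over the pole and the resulting almost everywhere bounds\<close>

context nonneg_solution
begin

lemma open_near: "open (near x0 y0)"
  unfolding near_def by (intro open_Times open_ball)

text \<open>Smearing the kernel over its pole turns it into an approximate identity with mass bounded below.\<close>

lemma smeared_kernel_lower:
  fixes x0 :: 'x and y0 :: 'y
  assumes x0: "x0 \<noteq> 0" and S: "S > 0" and G: "open G" "G \<subseteq> near x0 y0 \<times> {0<..<S}" and w: "w \<in> G"
  defines "d \<equiv> norm x0 / 2" and "N \<equiv> real DIM('x)" and "k \<equiv> real DIM('y)"
  shows "\<forall>\<^sub>F n in sequentially. ennreal (frozen_kernel.clow N k d * unit_ball_vol (real DIM('x \<times> 'y)) / 2) \<le>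
    (\<integral>\<^sup>+w'. ennreal (- frozen_kernel.th' (snd w') (1 / real (Suc n)) (snd w) * frozen_kernel.prof N k d (5 * d) d (snd w') (1 / real (Suc n)) (norm (fst (fst w'))) ((norm (fst (fst w) - fst (fst w')))\<^sup>2) ((norm (snd (fst w) - snd (fst w')))\<^sup>2) (snd w))
      * indicator {0<..<snd w'} (snd w) * indicator G w' \<partial>lborel)"
proof -
  interpret frozen_kernel N k d "5 * d" d "S + 1" unfolding N_def k_def d_def by (rule frozen_kernel_intro[OF x0 S])
  have dim: "real DIM('x \<times> 'y) = N + k" by (simp add: N_def k_def)
  obtain e where e: "e > 0" "ball w e \<subseteq> G" using G(1) w unfolding open_contains_ball by blast
  define \<eta> where "\<eta> n = 1 / real (Suc n)" for n
  have l0: "\<eta> \<longlonglongrightarrow> 0" unfolding \<eta>_def[abs_def] using LIMSEQ_inverse_real_of_nat by (simp add: inverse_eq_divide)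
  have "(\<lambda>n. sqrt (\<eta> n) + \<eta> n) \<longlonglongrightarrow> sqrt 0 + 0" by (intro tendsto_intros l0)
  then have ev1: "\<forall>\<^sub>F n in sequentially. sqrt (\<eta> n) + \<eta> n < e" using e(1) by (auto dest: order_tendstoD(2))
  have ev2: "\<forall>\<^sub>F n in sequentially. \<eta> n < d\<^sup>2" using order_tendstoD(2)[OF l0, of "d\<^sup>2"] d by simp
  have ev3: "\<forall>\<^sub>F n in sequentially. \<eta> n < 1/2" using order_tendstoD(2)[OF l0, of "1/2"] by simp
  show ?thesis using ev1 ev2 ev3 unfolding \<eta>_def[symmetric]
  proof eventually_elim
    case (elim n)
    define h where "h = \<eta> n"
    have h: "h > 0" "sqrt h + h < e" "h < d\<^sup>2" "h < 1/2" using elim by (auto simp: h_def \<eta>_def)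
    define z where "z = fst w"
    define t where "t = snd w"
    have t: "0 < t" "t < S" using w G(2) by (auto simp: t_def)
    define c where "c = (1 / h) * (clow * h powr (- (N + k) / 2))"
    have c: "c \<ge> 0" using h clow by (simp add: c_def)
    \<comment> \<open>Poles slightly later than \<open>w\<close>, in a parabolic box whose volume,
      of order \<open>h powr ((N + k) / 2 + 1)\<close>, is up to a constant the reciprocal of the
      lower bound \<open>c\<close> of the kernel.\<close>
    define Bx where "Bx = ball z (sqrt h) \<times> {t<..<t + h / 2}"
    have Bm: "Bx \<in> sets lborel" unfolding Bx_def sets_lborel by (intro borel_Times borel_open open_ball) auto
    have eB: "emeasure lborel Bx = ennreal (unit_ball_vol (N + k) * sqrt h ^ DIM('x \<times> 'y) * (h / 2))"
    proof -
      have "emeasure lborel Bx = emeasure lborel (ball z (sqrt h)) * emeasure lborel {t<..<t + h / 2}"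
        unfolding Bx_def using lborel.emeasure_pair_measure_Times[of "ball z (sqrt h)" lborel "{t<..<t + h/2}"] by (simp add: lborel_prod)
      also have "emeasure lborel (ball z (sqrt h)) = ennreal (unit_ball_vol (N + k) * sqrt h ^ DIM('x \<times> 'y))"
        using h emeasure_ball[of "sqrt h" z] unfolding dim by simp
      also have "emeasure lborel {t<..<t + h / 2} = ennreal (h / 2)" using h by simp
      also have "ennreal (unit_ball_vol (N + k) * sqrt h ^ DIM('x \<times> 'y)) * ennreal (h / 2) = ennreal (unit_ball_vol (N + k) * sqrt h ^ DIM('x \<times> 'y) * (h / 2))"
        by (rule ennreal_mult[symmetric]) (use h N k in auto)
      finally show ?thesis .
    qed
    have "ennreal (clow * unit_ball_vol (real DIM('x \<times> 'y)) / 2) = ennreal c * emeasure lborel Bx"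
    proof -
      have eq: "c * (unit_ball_vol (N + k) * sqrt h ^ DIM('x \<times> 'y) * (h / 2)) = clow * unit_ball_vol (N + k) / 2"
      proof -
        have "sqrt h ^ DIM('x \<times> 'y) = h powr ((N + k) / 2)"
          using h unfolding dim[symmetric] by (simp add: powr_half_sqrt[symmetric] powr_powr powr_realpow[symmetric])
        moreover have "h powr (- (N + k) / 2) * h powr ((N + k) / 2) = 1"
          using h unfolding powr_add[symmetric] add_divide_distrib[symmetric] by simp
        ultimately show ?thesis using h by (simp add: c_def)
      qed
      have "ennreal c * ennreal (unit_ball_vol (N + k) * sqrt h ^ DIM('x \<times> 'y) * (h / 2)) = ennreal (c * (unit_ball_vol (N + k) * sqrt h ^ DIM('x \<times> 'y) * (h / 2)))"
        by (rule ennreal_mult[symmetric]) (use c h N k in auto)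
      then show ?thesis unfolding eB dim eq by (rule sym)
    qed
    also have "\<dots> = (\<integral>\<^sup>+w'. ennreal c * indicator Bx w' \<partial>lborel)" by (rule nn_integral_cmult_indicator[OF Bm, symmetric])
    also have "\<dots> \<le> (\<integral>\<^sup>+w'. ennreal (- th' (snd w') h (snd w) * prof (snd w') h (norm (fst (fst w'))) ((norm (fst (fst w) - fst (fst w')))\<^sup>2) ((norm (snd (fst w) - snd (fst w')))\<^sup>2) (snd w))
      * indicator {0<..<snd w'} (snd w) * indicator G w' \<partial>lborel)"
    proof (rule nn_integral_mono)
      fix w' :: "('x \<times> 'y) \<times> real"
      show "ennreal c * indicator Bx w' \<le> ennreal (- th' (snd w') h (snd w) * prof (snd w') h (norm (fst (fst w'))) ((norm (fst (fst w) - fst (fst w')))\<^sup>2) ((norm (snd (fst w) - snd (fst w')))\<^sup>2) (snd w))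
      * indicator {0<..<snd w'} (snd w) * indicator G w'"
      proof (cases "w' \<in> Bx")
        case True
        then have zd: "dist z (fst w') < sqrt h" and sd: "t < snd w'" "snd w' < t + h / 2" by (auto simp: Bx_def mem_Times_iff)
        have "dist w w' \<le> dist z (fst w') + dist t (snd w')"
          unfolding dist_prod_def z_def t_def by (rule sqrt_sum_squares_le_sum) auto
        also have "\<dots> < e" using zd sd h by (auto simp: dist_real_def)
        finally have wG: "w' \<in> G" using e(2) by auto
        then have nr: "fst w' \<in> near x0 y0" using G(2) by auto
        have A: "d \<le> norm (fst (fst w'))" "norm (fst (fst w')) \<le> 5 * d" using near_geometry(1,2)[OF nr x0] by (simp_all add: d_def)
        have "(dist z (fst w'))\<^sup>2 \<le> (sqrt h)\<^sup>2" using zd by (intro power_mono) auto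
        then have n: "(norm (fst (fst w) - fst (fst w')))\<^sup>2 + (norm (snd (fst w) - snd (fst w')))\<^sup>2 \<le> h"
          unfolding norm_prod_sq using h by (simp add: dist_norm z_def)
        have "c \<le> - th' (snd w') h (snd w) * prof (snd w') h (norm (fst (fst w'))) ((norm (fst (fst w) - fst (fst w')))\<^sup>2) ((norm (snd (fst w) - snd (fst w')))\<^sup>2) (snd w)"
          unfolding c_def by (rule prof_lower[OF _ _ _ A _ _ n]) (use sd h t S in \<open>auto simp: t_def\<close>)
        moreover have "snd w \<in> {0<..<snd w'}" using t sd by (auto simp: t_def)
        ultimately show ?thesis using True wG by (simp add: ennreal_leI)
      qed simp
    qed
    finally show "ennreal (clow * unit_ball_vol (real DIM('x \<times> 'y)) / 2) \<le> (\<integral>\<^sup>+w'. ennreal (- th' (snd w') (\<eta> n) (snd w) * prof (snd w') (\<eta> n) (norm (fst (fst w'))) ((norm (fst (fst w) - fst (fst w')))\<^sup>2) ((norm (snd (fst w) - snd (fst w')))\<^sup>2) (snd w))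
      * indicator {0<..<snd w'} (snd w) * indicator G w' \<partial>lborel)" unfolding h_def .
  qed
qed

text \<open>Integrate the estimate of \<open>kernel_potential\<close> over the poles in
  \<open>G\<close> and exchange the integrals. The smeared kernel is eventually at least
  \<open>c\<close> at each point of \<open>G\<close>, so by Fatou the left side dominates
  \<open>c\<close> times the integral of \<open>U\<close> over \<open>G\<close>.\<close>

lemma open_set_comparison:
  fixes x0 :: 'x and y0 :: 'y
  assumes x0: "x0 \<noteq> 0" and S: "S > 0" and a: "0 < a" "a < 1/2"
  defines "b \<equiv> real DIM('x \<times> 'y) - 2 * a"
  shows "\<exists>C>0. \<forall>G. open G \<and> G \<subseteq> near x0 y0 \<times> {0<..<S} \<longrightarrow>
    (\<integral>\<^sup>+w. ennreal (U w) * indicator G w \<partial>lborel) \<le> (\<integral>\<^sup>+w. (ennreal C * pot a b x0 y0 S w + ennreal C) * indicator G w \<partial>lborel)"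
proof -
  define d where "d = norm x0 / 2"
  define N where "N = real DIM('x)"
  define k where "k = real DIM('y)"
  interpret frozen_kernel N k d "5 * d" d "S + 1" unfolding N_def k_def d_def by (rule frozen_kernel_intro[OF x0 S])
  obtain C where C: "C > 0" and kp: "\<And>z' s \<eta>. z' \<in> near x0 y0 \<Longrightarrow> s \<in> {0<..<S} \<Longrightarrow> \<eta> \<in> {0<..1} \<Longrightarrow>
    (\<integral>\<^sup>+w. ennreal (U w * (- th' s \<eta> (snd w) * prof s \<eta> (norm (fst z')) ((norm (fst (fst w) - fst z'))\<^sup>2) ((norm (snd (fst w) - snd z'))\<^sup>2) (snd w))) * indicator (Om s) w \<partial>lborel)
    \<le> ennreal C * pot a b x0 y0 S (z', s) + ennreal C"
    using kernel_potential[OF x0 S a, of y0] unfolding d_def[symmetric] N_def[symmetric] k_def[symmetric] b_def[symmetric] by blast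
  define c where "c = clow * unit_ball_vol (real DIM('x \<times> 'y)) / 2"
  have c: "c > 0" using clow by (simp add: c_def)
  define kap where "kap n w' w = - th' (snd w') (1 / real (Suc n)) (snd w) * prof (snd w') (1 / real (Suc n)) (norm (fst (fst w'))) ((norm (fst (fst w) - fst (fst w')))\<^sup>2) ((norm (snd (fst w) - snd (fst w')))\<^sup>2) (snd w)"
    for n and w' w :: "('x \<times> 'y) \<times> real"
  have kapm [measurable (raw)]: "(\<lambda>v. kap n (f v) (g v)) \<in> borel_measurable R"
    if [measurable]: "f \<in> measurable R borel" "g \<in> measurable R borel"
    for n and f g :: "(('x \<times> 'y) \<times> real) \<times> (('x \<times> 'y) \<times> real) \<Rightarrow> ('x \<times> 'y) \<times> real" and R
    unfolding kap_def prof_def th'_def sg_def mu_def by measurable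
  have kapm1 [measurable]: "(\<lambda>w. kap n w' w) \<in> borel_measurable borel" "(\<lambda>w'. kap n w' w) \<in> borel_measurable borel" for n w w'
    unfolding kap_def prof_def th'_def sg_def mu_def by measurable
  have kap0: "0 \<le> kap n w' w" if "snd w < snd w'" for n w' w
  proof -
    have "0 \<le> - th' (snd w') (1 / real (Suc n)) (snd w)" using th_bounds(3)[of "1 / real (Suc n)" "snd w" "snd w'"] that by simp
    moreover have "0 < snd w' - snd w + 1 / real (Suc n)" using that by (simp add: add_pos_pos)
    ultimately show ?thesis unfolding kap_def by (intro mult_nonneg_nonneg prof_nonneg)
  qed
  show ?thesis
  proof (intro exI[of _ "C / c"] conjI allI impI)
    show "0 < C / c" using C c by simp
    fix G :: "(('x \<times> 'y) \<times> real) set" assume "open G \<and> G \<subseteq> near x0 y0 \<times> {0<..<S}"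
    then have G: "open G" "G \<subseteq> near x0 y0 \<times> {0<..<S}" by auto
    have Gm [measurable]: "G \<in> sets borel" using G by simp
    define An where "An n w = (\<integral>\<^sup>+w'. ennreal (kap n w' w) * indicator {0<..<snd w'} (snd w) * indicator G w' \<partial>lborel)" for n w
    have "(\<integral>\<^sup>+w. ennreal (U w) * (ennreal c * indicator G w) \<partial>lborel) \<le> (\<integral>\<^sup>+w'. (ennreal C * pot a b x0 y0 S w' + ennreal C) * indicator G w' \<partial>lborel)"
    proof (rule nn_integral_liminf_le)
      have Am [measurable]: "An n \<in> borel_measurable borel" for n
        unfolding An_def by measurable
      show "(\<lambda>w. ennreal (U w) * An n w) \<in> borel_measurable lborel" for n by measurable
      show "\<forall>\<^sub>F n in sequentially. ennreal (U w) * (ennreal c * indicator G w) \<le> ennreal (U w) * An n w" for w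
      proof (cases "w \<in> G")
        case True
        have "\<forall>\<^sub>F n in sequentially. ennreal c \<le> An n w"
          using smeared_kernel_lower[OF x0 S G True]
          unfolding An_def kap_def c_def d_def[symmetric] N_def[symmetric] k_def[symmetric] .
        then show ?thesis by eventually_elim (use True in \<open>auto intro: mult_left_mono\<close>)
      qed simp
      show "\<forall>\<^sub>F n in sequentially. (\<integral>\<^sup>+w. ennreal (U w) * An n w \<partial>lborel) \<le> (\<integral>\<^sup>+w'. (ennreal C * pot a b x0 y0 S w' + ennreal C) * indicator G w' \<partial>lborel)"
      proof (rule always_eventually, rule allI)
        fix n
        have "(\<integral>\<^sup>+w. ennreal (U w) * An n w \<partial>lborel) = (\<integral>\<^sup>+w. (\<integral>\<^sup>+w'. ennreal (U w) * (ennreal (kap n w' w) * indicator {0<..<snd w'} (snd w) * indicator G w') \<partial>lborel) \<partial>lborel)"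
          unfolding An_def by (intro nn_integral_cong nn_integral_cmult[symmetric]) measurable
        also have "\<dots> = (\<integral>\<^sup>+w'. (\<integral>\<^sup>+w. ennreal (U w) * (ennreal (kap n w' w) * indicator {0<..<snd w'} (snd w) * indicator G w') \<partial>lborel) \<partial>lborel)"
          by (rule Fubini_lborel) measurable
        also have "\<dots> \<le> (\<integral>\<^sup>+w'. (ennreal C * pot a b x0 y0 S w' + ennreal C) * indicator G w' \<partial>lborel)"
        proof (rule nn_integral_mono)
          fix w' :: "('x \<times> 'y) \<times> real"
          show "(\<integral>\<^sup>+w. ennreal (U w) * (ennreal (kap n w' w) * indicator {0<..<snd w'} (snd w) * indicator G w') \<partial>lborel) \<le> (ennreal C * pot a b x0 y0 S w' + ennreal C) * indicator G w'"
          proof (cases "w' \<in> G")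
            case True
            then have w': "fst w' \<in> near x0 y0" "snd w' \<in> {0<..<S}" using G(2) by auto
            have "(\<integral>\<^sup>+w. ennreal (U w) * (ennreal (kap n w' w) * indicator {0<..<snd w'} (snd w) * indicator G w') \<partial>lborel) =
              (\<integral>\<^sup>+w. ennreal (U w * kap n w' w) * indicator (Om (snd w')) w \<partial>lborel)"
            proof (rule nn_integral_cong)
              fix w :: "('x \<times> 'y) \<times> real"
              show "ennreal (U w) * (ennreal (kap n w' w) * indicator {0<..<snd w'} (snd w) * indicator G w') = ennreal (U w * kap n w' w) * indicator (Om (snd w')) w"
                using True U_nonneg[of w] kap0[of w w' n] by (cases "w \<in> Om (snd w')") (auto simp: Om_def mem_Times_iff ennreal_mult indicator_def)
            qed
            also have "\<dots> \<le> ennreal C * pot a b x0 y0 S (fst w', snd w') + ennreal C"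
              unfolding kap_def by (rule kp[OF w']) auto
            finally show ?thesis using True by simp
          qed simp
        qed
        finally show "(\<integral>\<^sup>+w. ennreal (U w) * An n w \<partial>lborel) \<le> (\<integral>\<^sup>+w'. (ennreal C * pot a b x0 y0 S w' + ennreal C) * indicator G w' \<partial>lborel)" .
      qed
    qed
    then have le: "ennreal (1 / c) * (\<integral>\<^sup>+w. ennreal (U w) * (ennreal c * indicator G w) \<partial>lborel) \<le> ennreal (1 / c) * (\<integral>\<^sup>+w'. (ennreal C * pot a b x0 y0 S w' + ennreal C) * indicator G w' \<partial>lborel)"
      by (rule mult_left_mono) simp
    have cc1: "ennreal (1 / c) * ennreal c = 1" using c by (simp add: ennreal_mult[symmetric])
    have "ennreal (1 / c) * (\<integral>\<^sup>+w. ennreal (U w) * (ennreal c * indicator G w) \<partial>lborel) = (\<integral>\<^sup>+w. ennreal (1 / c) * (ennreal (U w) * (ennreal c * indicator G w)) \<partial>lborel)"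
      by (rule nn_integral_cmult[symmetric]) measurable
    also have "\<dots> = (\<integral>\<^sup>+w. ennreal (U w) * indicator G w \<partial>lborel)"
    proof (rule nn_integral_cong)
      fix w
      have "ennreal (1 / c) * (ennreal (U w) * (ennreal c * indicator G w)) = (ennreal (1 / c) * ennreal c) * (ennreal (U w) * indicator G w)" by (simp only: mult_ac)
      then show "ennreal (1 / c) * (ennreal (U w) * (ennreal c * indicator G w)) = ennreal (U w) * indicator G w" by (simp only: cc1 mult_1_left)
    qed
    finally have l: "ennreal (1 / c) * (\<integral>\<^sup>+w. ennreal (U w) * (ennreal c * indicator G w) \<partial>lborel) = (\<integral>\<^sup>+w. ennreal (U w) * indicator G w \<partial>lborel)" .
    have "ennreal (1 / c) * (\<integral>\<^sup>+w'. (ennreal C * pot a b x0 y0 S w' + ennreal C) * indicator G w' \<partial>lborel) = (\<integral>\<^sup>+w'. ennreal (1 / c) * ((ennreal C * pot a b x0 y0 S w' + ennreal C) * indicator G w') \<partial>lborel)"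
      by (rule nn_integral_cmult[symmetric]) measurable
    also have "\<dots> = (\<integral>\<^sup>+w. (ennreal (C / c) * pot a b x0 y0 S w + ennreal (C / c)) * indicator G w \<partial>lborel)"
    proof (rule nn_integral_cong)
      fix w
      have "ennreal (1 / c) * ennreal C = ennreal (C / c)" using c C by (simp add: ennreal_mult[symmetric])
      then show "ennreal (1 / c) * ((ennreal C * pot a b x0 y0 S w + ennreal C) * indicator G w) = (ennreal (C / c) * pot a b x0 y0 S w + ennreal (C / c)) * indicator G w"
        by (simp only: distrib_left mult.assoc[symmetric])
    qed
    finally show "(\<integral>\<^sup>+w. ennreal (U w) * indicator G w \<partial>lborel) \<le> (\<integral>\<^sup>+w. (ennreal (C / c) * pot a b x0 y0 S w + ennreal (C / c)) * indicator G w \<partial>lborel)"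
      using le unfolding l by simp
  qed
qed

text \<open>Supplies the finiteness that the comparison on open sets requires. The variables
  separate: first the time of the pole, by \<open>a < 1\<close>, then its position, by
  \<open>b\<close> below the dimension.\<close>

lemma pot_locally_integrable:
  fixes x0 :: 'x and y0 :: 'y
  assumes x0: "x0 \<noteq> 0" and S: "S > 0" and a: "0 < a" "a < 1" and b: "0 < b" "b < real DIM('x \<times> 'y)"
  shows "(\<integral>\<^sup>+w. pot a b x0 y0 S w * indicator (near x0 y0 \<times> {0<..<S}) w \<partial>lborel) < \<infinity>"
proof -
  define K0 where "K0 = Kb x0 y0 (9 * (norm x0 / 2)\<^sup>2)"
  have [measurable]: "K0 \<times> {0<..<t::real} \<in> sets borel" for t unfolding K0_def by (rule Kb_Ioo_sets)
  have [measurable]: "K0 \<in> sets borel" unfolding K0_def by (rule Kb_sets)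
  have u0m [measurable]: "u0 \<in> borel_measurable borel" using borel_measurable_integrable[OF u0] by simp
  have nm [measurable]: "near x0 y0 \<in> sets borel" using open_near by (rule borel_open)
  have nSm [measurable]: "near x0 y0 \<times> {0<..<S} \<in> sets borel" using open_near by (intro borel_open open_Times) auto
  define h where "h z' w = ennreal ((M w + V w) * norm (fst w - z') powr - b) * indicator (K0 \<times> {0<..<S}) w" for z' and w :: "('x \<times> 'y) \<times> real"
  define m2 where "m2 z' = (\<integral>\<^sup>+z. ennreal (\<bar>u0 z\<bar> * norm (z - z') powr - b) * indicator K0 z \<partial>lborel)" for z'
  have m2m [measurable]: "m2 \<in> borel_measurable borel" unfolding m2_def by measurable
  have hm: "(\<lambda>w. h z' w) \<in> borel_measurable borel" for z' unfolding h_def by measurable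
  have m1m: "(\<lambda>z'. \<integral>\<^sup>+w. h z' w \<partial>lborel) \<in> borel_measurable borel" unfolding h_def by measurable
  have "(\<integral>\<^sup>+w. pot a b x0 y0 S w * indicator (near x0 y0 \<times> {0<..<S}) w \<partial>lborel) =
     (\<integral>\<^sup>+z'. \<integral>\<^sup>+s. pot a b x0 y0 S (z', s) * indicator (near x0 y0 \<times> {0<..<S}) (z', s) \<partial>lborel \<partial>lborel)"
    by (rule nn_integral_lborel_Pair) measurable
  also have "\<dots> \<le> (\<integral>\<^sup>+z'. ennreal (S powr (1 - a) / (1 - a)) * ((\<integral>\<^sup>+w. h z' w \<partial>lborel) * indicator (near x0 y0) z' + m2 z' * indicator (near x0 y0) z') \<partial>lborel)"
  proof (rule nn_integral_mono)
    fix z'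
    show "(\<integral>\<^sup>+s. pot a b x0 y0 S (z', s) * indicator (near x0 y0 \<times> {0<..<S}) (z', s) \<partial>lborel) \<le> ennreal (S powr (1 - a) / (1 - a)) * ((\<integral>\<^sup>+w. h z' w \<partial>lborel) * indicator (near x0 y0) z' + m2 z' * indicator (near x0 y0) z')"
    proof (cases "z' \<in> near x0 y0")
      case True
      note hmz [measurable] = hm[of z']
      have "(\<integral>\<^sup>+s. pot a b x0 y0 S (z', s) * indicator (near x0 y0 \<times> {0<..<S}) (z', s) \<partial>lborel) \<le>
        (\<integral>\<^sup>+s. (\<integral>\<^sup>+w. h z' w * (ennreal ((s - snd w) powr - a) * indicator {snd w<..<S} s) \<partial>lborel) + m2 z' * (ennreal ((s - 0) powr - a) * indicator {0<..<S} s) \<partial>lborel)"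
      proof (rule nn_integral_mono)
        fix s
        have e: "pot a b x0 y0 S (z', s) = (\<integral>\<^sup>+w. h z' w * (ennreal ((s - snd w) powr - a) * indicator {snd w<..<S} s) \<partial>lborel) + m2 z' * ennreal (s powr - a)"
          unfolding pot_def h_def m2_def K0_def by (simp add: mult.commute)
        show "pot a b x0 y0 S (z', s) * indicator (near x0 y0 \<times> {0<..<S}) (z', s) \<le> (\<integral>\<^sup>+w. h z' w * (ennreal ((s - snd w) powr - a) * indicator {snd w<..<S} s) \<partial>lborel) + m2 z' * (ennreal ((s - 0) powr - a) * indicator {0<..<S} s)"
          unfolding e using True by (cases "s \<in> {0<..<S}") (simp_all add: indicator_def)
      qed
      also have "\<dots> = (\<integral>\<^sup>+s. (\<integral>\<^sup>+w. h z' w * (ennreal ((s - snd w) powr - a) * indicator {snd w<..<S} s) \<partial>lborel) \<partial>lborel) + (\<integral>\<^sup>+s. m2 z' * (ennreal ((s - 0) powr - a) * indicator {0<..<S} s) \<partial>lborel)"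
        by (rule nn_integral_add) measurable
      also have "\<dots> \<le> ennreal (S powr (1 - a) / (1 - a)) * (\<integral>\<^sup>+w. h z' w \<partial>lborel) + m2 z' * ennreal ((S - 0) powr (1 - a) / (1 - a))"
      proof (intro add_mono)
        show "(\<integral>\<^sup>+s. (\<integral>\<^sup>+w. h z' w * (ennreal ((s - snd w) powr - a) * indicator {snd w<..<S} s) \<partial>lborel) \<partial>lborel) \<le> ennreal (S powr (1 - a) / (1 - a)) * (\<integral>\<^sup>+w. h z' w \<partial>lborel)"
        proof (rule time_potential[OF hmz _ _ a(2) S])
          show "0 \<le> snd w" if "h z' w \<noteq> 0" for w
            using that by (cases "w \<in> K0 \<times> {0<..<S}") (auto simp: h_def)
        qed (use a in auto)
        have "(\<integral>\<^sup>+s. m2 z' * (ennreal ((s - 0) powr - a) * indicator {0<..<S} s) \<partial>lborel) = m2 z' * (\<integral>\<^sup>+s. ennreal ((s - 0) powr - a) * indicator {0<..<S} s \<partial>lborel)"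
          by (rule nn_integral_cmult) measurable
        also have "\<dots> = m2 z' * ennreal ((S - 0) powr (1 - a) / (1 - a))" using nn_integral_powr_Ioo[of a 0 S] a S by simp
        finally show "(\<integral>\<^sup>+s. m2 z' * (ennreal ((s - 0) powr - a) * indicator {0<..<S} s) \<partial>lborel) \<le> m2 z' * ennreal ((S - 0) powr (1 - a) / (1 - a))" by simp
      qed
      also have "\<dots> = ennreal (S powr (1 - a) / (1 - a)) * ((\<integral>\<^sup>+w. h z' w \<partial>lborel) * indicator (near x0 y0) z' + m2 z' * indicator (near x0 y0) z')"
        using True by (simp add: distrib_left distrib_right mult.commute)
      finally show ?thesis .
    qed simp
  qed
  also have "\<dots> = ennreal (S powr (1 - a) / (1 - a)) * ((\<integral>\<^sup>+z'. (\<integral>\<^sup>+w. h z' w \<partial>lborel) * indicator (near x0 y0) z' \<partial>lborel) + (\<integral>\<^sup>+z'. m2 z' * indicator (near x0 y0) z' \<partial>lborel))"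
  proof -
    define m1 where "m1 = (\<lambda>z'. \<integral>\<^sup>+w. h z' w \<partial>lborel)"
    have [measurable]: "m1 \<in> borel_measurable borel" unfolding m1_def by (rule m1m)
    have "(\<integral>\<^sup>+z'. ennreal (S powr (1 - a) / (1 - a)) * (m1 z' * indicator (near x0 y0) z' + m2 z' * indicator (near x0 y0) z') \<partial>lborel)
      = ennreal (S powr (1 - a) / (1 - a)) * (\<integral>\<^sup>+z'. m1 z' * indicator (near x0 y0) z' + m2 z' * indicator (near x0 y0) z' \<partial>lborel)"
      by (rule nn_integral_cmult) measurable
    also have "(\<integral>\<^sup>+z'. m1 z' * indicator (near x0 y0) z' + m2 z' * indicator (near x0 y0) z' \<partial>lborel)
      = (\<integral>\<^sup>+z'. m1 z' * indicator (near x0 y0) z' \<partial>lborel) + (\<integral>\<^sup>+z'. m2 z' * indicator (near x0 y0) z' \<partial>lborel)"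
      by (rule nn_integral_add) measurable
    finally show ?thesis unfolding m1_def .
  qed
  also have "\<dots> < \<infinity>"
    using pot_parts_finite[OF x0 S b, of y0] unfolding h_def m2_def K0_def by (simp add: ennreal_mult_less_top)
  finally show ?thesis .
qed

text \<open>For almost every \<open>z\<close> the bound by the potential holds at almost every time
  and both spatial potentials are finite at \<open>z\<close>. What is left is an estimate in the
  time variable alone.\<close>

lemma time_section_finite_near:
  fixes x0 :: 'x and y0 :: 'y
  assumes x0: "x0 \<noteq> 0" and S: "S > 0"
  shows "AE z in lborel. z \<in> near x0 y0 \<longrightarrow> (\<integral>\<^sup>+s. ennreal (U (z, s) powr p1) * indicator {0<..<S} s \<partial>lborel) < \<infinity>"
proof -
  \<comment> \<open>This gives \<open>a * p1 = 1/2 < 1\<close>, and \<open>a < 1/2\<close> because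
    \<open>p1 > 1\<close>.\<close>
  define a where "a = 1 / (2 * p1)"
  have a: "0 < a" "a < 1/2" "a < 1" "a * p1 < 1" using p1 by (auto simp: a_def field_simps)
  define b where "b = real DIM('x \<times> 'y) - 2 * a"
  have "real DIM('x \<times> 'y) \<ge> 2" using DIM_positive[where 'a='x] DIM_positive[where 'a='y] by (simp del: DIM_positive)
  then have b: "0 < b" "b < real DIM('x \<times> 'y)" using a unfolding b_def by linarith+
  obtain C where C: "C > 0" and cmp: "\<And>G. open G \<Longrightarrow> G \<subseteq> near x0 y0 \<times> {0<..<S} \<Longrightarrow>
    (\<integral>\<^sup>+w. ennreal (U w) * indicator G w \<partial>lborel) \<le> (\<integral>\<^sup>+w. (ennreal C * pot a b x0 y0 S w + ennreal C) * indicator G w \<partial>lborel)"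
    using open_set_comparison[OF x0 S a(1,2), of y0] unfolding b_def[symmetric] by blast
  define K0 where "K0 = Kb x0 y0 (9 * (norm x0 / 2)\<^sup>2)"
  have [measurable]: "K0 \<times> {0<..<t::real} \<in> sets borel" for t unfolding K0_def by (rule Kb_Ioo_sets)
  have [measurable]: "K0 \<in> sets borel" unfolding K0_def by (rule Kb_sets)
  have u0m [measurable]: "u0 \<in> borel_measurable borel" using borel_measurable_integrable[OF u0] by simp
  have nm [measurable]: "near x0 y0 \<in> sets borel" using open_near by (rule borel_open)
  define W where "W = near x0 y0 \<times> {0<..<S}"
  have oW: "open W" unfolding W_def by (intro open_Times open_near) auto
  have Wm [measurable]: "W \<in> sets borel" using oW by (rule borel_open)
  have "bounded W" unfolding W_def near_def by (intro bounded_Times bounded_ball) simp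
  then have eW: "emeasure lborel W < \<infinity>" by (rule emeasure_bounded_finite)
  have "AE w in lborel. w \<in> W \<longrightarrow> ennreal (U w) \<le> ennreal C * pot a b x0 y0 S w + ennreal C"
  proof (rule nn_integral_open_le_imp_AE[OF _ _ oW])
    have "(\<integral>\<^sup>+w. (ennreal C * pot a b x0 y0 S w + ennreal C) * indicator W w \<partial>lborel) =
      (\<integral>\<^sup>+w. ennreal C * (pot a b x0 y0 S w * indicator W w) + ennreal C * indicator W w \<partial>lborel)"
      by (simp add: distrib_right mult.assoc)
    also have "\<dots> = (\<integral>\<^sup>+w. ennreal C * (pot a b x0 y0 S w * indicator W w) \<partial>lborel) + (\<integral>\<^sup>+w. ennreal C * indicator W w \<partial>lborel)"
      by (rule nn_integral_add) measurable
    also have "(\<integral>\<^sup>+w. ennreal C * (pot a b x0 y0 S w * indicator W w) \<partial>lborel) = ennreal C * (\<integral>\<^sup>+w. pot a b x0 y0 S w * indicator W w \<partial>lborel)"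
      by (rule nn_integral_cmult) measurable
    also have "(\<integral>\<^sup>+w. ennreal C * indicator W w \<partial>lborel) = ennreal C * emeasure lborel W"
      by (rule nn_integral_cmult_indicator) simp
    also have "ennreal C * (\<integral>\<^sup>+w. pot a b x0 y0 S w * indicator W w \<partial>lborel) + ennreal C * emeasure lborel W < \<infinity>"
      using pot_locally_integrable[OF x0 S a(1,3) b, of y0] eW by (simp add: W_def ennreal_mult_less_top)
    finally show "(\<integral>\<^sup>+w. (ennreal C * pot a b x0 y0 S w + ennreal C) * indicator W w \<partial>lborel) < \<infinity>" .
  qed (measurable, rule cmp, auto simp: W_def)
  then have "AE w in lborel \<Otimes>\<^sub>M lborel. w \<in> W \<longrightarrow> ennreal (U w) \<le> ennreal C * pot a b x0 y0 S w + ennreal C"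
    unfolding lborel_prod .
  \<comment> \<open>Fubini for null sets: an exceptional set in space-time has null time sections at
    almost every \<open>z\<close>.\<close>
  then have AEzs: "AE z in lborel. AE s in lborel. (z, s) \<in> W \<longrightarrow> ennreal (U (z, s)) \<le> ennreal C * pot a b x0 y0 S (z, s) + ennreal C"
    by (rule lborel_pair.AE_pair)
  define h where "h z' w = ennreal ((M w + V w) * norm (fst w - z') powr - b) * indicator (K0 \<times> {0<..<S}) w" for z' and w :: "('x \<times> 'y) \<times> real"
  define m2 where "m2 z' = (\<integral>\<^sup>+z. ennreal (\<bar>u0 z\<bar> * norm (z - z') powr - b) * indicator K0 z \<partial>lborel)" for z'
  have hm: "(\<lambda>w. h z' w) \<in> borel_measurable borel" for z' unfolding h_def by measurable
  define m1 where "m1 z' = (\<integral>\<^sup>+w. h z' w \<partial>lborel)" for z'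
  have [measurable]: "m1 \<in> borel_measurable borel" unfolding m1_def h_def by measurable
  have [measurable]: "m2 \<in> borel_measurable borel" unfolding m2_def by measurable
  have AE1: "AE z' in lborel. m1 z' * indicator (near x0 y0) z' \<noteq> \<infinity>"
    by (rule nn_integral_PInf_AE) (measurable, use pot_parts_finite(1)[OF x0 S b, of y0] in \<open>simp add: m1_def h_def K0_def\<close>)
  have AE2: "AE z' in lborel. m2 z' * indicator (near x0 y0) z' \<noteq> \<infinity>"
    by (rule nn_integral_PInf_AE) (measurable, use pot_parts_finite(2)[OF x0 S b, of y0] in \<open>simp add: m2_def K0_def\<close>)
  show ?thesis using AEzs AE1 AE2
  proof eventually_elim
    case (elim z)
    show ?case
    proof
      assume z: "z \<in> near x0 y0"
      then have f1: "m1 z < \<infinity>" and f2: "m2 z < \<infinity>" using elim by (auto simp: less_top)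
      show "(\<integral>\<^sup>+s. ennreal (U (z, s) powr p1) * indicator {0<..<S} s \<partial>lborel) < \<infinity>"
      proof (rule section_powr_integrable[where h = "h z" and \<tau> = snd and L = C and q = "C * enn2real (m2 z)" and c = C])
        show "h z \<in> borel_measurable borel" using hm[of z] by simp
        show "0 \<le> snd w" if "h z w \<noteq> 0" for w
          using that by (cases "w \<in> K0 \<times> {0<..<S}") (auto simp: h_def)
        show "(\<integral>\<^sup>+w. h z w \<partial>lborel) < \<infinity>" using f1 by (simp add: m1_def)
        show "AE s in lborel. s \<in> {0<..<S} \<longrightarrow> ennreal (U (z, s)) \<le> ennreal C * (\<integral>\<^sup>+w. h z w * (ennreal ((s - snd w) powr - a) * indicator {snd w<..<S} s) \<partial>lborel)
          + ennreal (C * enn2real (m2 z) * s powr - a) + ennreal C"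
          using elim(1)
        proof eventually_elim
          case (elim s)
          show ?case
          proof
            assume "s \<in> {0<..<S}"
            then have "ennreal (U (z, s)) \<le> ennreal C * pot a b x0 y0 S (z, s) + ennreal C" using elim z by (auto simp: W_def)
            also have "pot a b x0 y0 S (z, s) = (\<integral>\<^sup>+w. h z w * (ennreal ((s - snd w) powr - a) * indicator {snd w<..<S} s) \<partial>lborel) + ennreal (s powr - a) * m2 z"
              unfolding pot_def h_def m2_def K0_def by simp
            also have "m2 z = ennreal (enn2real (m2 z))" using f2 by simp
            also have "ennreal C * ((\<integral>\<^sup>+w. h z w * (ennreal ((s - snd w) powr - a) * indicator {snd w<..<S} s) \<partial>lborel) + ennreal (s powr - a) * ennreal (enn2real (m2 z))) + ennreal C
              = ennreal C * (\<integral>\<^sup>+w. h z w * (ennreal ((s - snd w) powr - a) * indicator {snd w<..<S} s) \<partial>lborel)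
          + ennreal (C * enn2real (m2 z) * s powr - a) + ennreal C"
              using C by (simp add: distrib_left ennreal_mult mult_ac)
            finally show "ennreal (U (z, s)) \<le> ennreal C * (\<integral>\<^sup>+w. h z w * (ennreal ((s - snd w) powr - a) * indicator {snd w<..<S} s) \<partial>lborel)
          + ennreal (C * enn2real (m2 z) * s powr - a) + ennreal C" .
          qed
        qed
      qed (use C a p1 S U_nonneg in auto)
    qed
  qed
qed

text \<open>The boxes \<open>near\<close> cover the set \<open>x \<noteq> 0\<close>, and by Lindelof
  countably many of them suffice, so the exceptional sets still form a null set. The remaining set
  \<open>x = 0\<close> is null itself.\<close>

lemma time_section_finite:
  assumes S: "S > 0"
  shows "AE z in lborel. (\<integral>\<^sup>+s. ennreal (U (z, s) powr p1) * indicator {0<..<S} s \<partial>lborel) < \<infinity>"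
proof -
  define F where "F = (\<lambda>z. near (fst z) (snd z)) ` {z :: 'x \<times> 'y. fst z \<noteq> 0}"
  have "\<And>X. X \<in> F \<Longrightarrow> open X" unfolding F_def using open_near by auto
  then obtain F' where F': "F' \<subseteq> F" "countable F'" "\<Union>F' = \<Union>F" using Lindelof[of F] by blast
  have "AE z in lborel. \<forall>X\<in>F'. z \<in> X \<longrightarrow> (\<integral>\<^sup>+s. ennreal (U (z, s) powr p1) * indicator {0<..<S} s \<partial>lborel) < \<infinity>"
  proof (rule AE_ball_countable[THEN iffD2, OF F'(2)], rule ballI)
    fix X assume "X \<in> F'"
    then obtain z0 where "X = near (fst z0) (snd z0)" "fst z0 \<noteq> 0" using F' by (auto simp: F_def)
    then show "AE z in lborel. z \<in> X \<longrightarrow> (\<integral>\<^sup>+s. ennreal (U (z, s) powr p1) * indicator {0<..<S} s \<partial>lborel) < \<infinity>"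
      using time_section_finite_near[OF _ S] by simp
  qed
  moreover have "AE z in (lborel :: ('x \<times> 'y) measure). fst z \<noteq> 0" by (rule AE_lborel_fst[OF AE_lborel_singleton])
  ultimately show ?thesis
  proof eventually_elim
    case (elim z)
    have "z \<in> near (fst z) (snd z)" using elim(2) by (simp add: near_def mem_Times_iff)
    then have "z \<in> \<Union>F" using elim(2) by (auto simp: F_def)
    then show ?case using elim(1) F'(3) by blast
  qed
qed

end

theorem theorem4:
  fixes u0 :: "('x::euclidean_space \<times> 'y::euclidean_space) \<Rightarrow> real"
    and \<gamma> p1 p2 :: real
  assumes "0 < \<gamma>" "\<gamma> < 1" "p1 > 1" "p2 > 1"
    and "integrable lborel u0" "(LINT z|lborel. u0 z) > 0"
    and "p1 \<le> 1 + 2 * (2 - \<gamma>) / (real DIM('x) + 2 * real DIM('y) - 2 + 2 * \<gamma>)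
         \<or> p2 \<le> 1 + 2 / (real DIM('x) + 2 * real DIM('y))
         \<or> p1 < 1 / \<gamma>"
  shows "\<not> (\<exists>u :: ('x \<times> 'y) \<Rightarrow> real \<Rightarrow> real.
             (\<forall>z t. t > 0 \<longrightarrow> u z t \<ge> 0) \<and> global_weak_solution \<gamma> p1 p2 u0 u)"
proof
  assume "\<exists>u :: ('x \<times> 'y) \<Rightarrow> real \<Rightarrow> real. (\<forall>z t. t > 0 \<longrightarrow> u z t \<ge> 0) \<and> global_weak_solution \<gamma> p1 p2 u0 u"
  then obtain u :: "('x \<times> 'y) \<Rightarrow> real \<Rightarrow> real"
    where u: "\<forall>z t. t > 0 \<longrightarrow> u z t \<ge> 0" "global_weak_solution \<gamma> p1 p2 u0 u" by blast
  interpret nonneg_solution \<gamma> p1 p2 u0 u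
    by unfold_locales (use assms u in \<open>auto simp: global_weak_solution_def\<close>)
  \<comment> \<open>The condition on \<open>p2\<close> is settled by the power nonlinearity alone;
    both conditions on \<open>p1\<close> go through the memory term and its almost everywhere
    finiteness.\<close>
  show False using assms(7) nonexistence_power[OF assms(6)] nonexistence_memory[OF assms(6) time_section_finite] by blast
qed

end
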